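(* Assume $V$ satisfies (V) and $f$ satisfies (f1)–(f5). Then there exists a ground state solution $\mathfrak u_\varepsilon$ of problem $(P_\varepsilon)$ (i.e. a solution whose energy equals the minimum of the associated energy functional on its Nehari manifold): 1. for every $\varepsilon>0$, if $V_\infty=+\infty$; 2. for every $\varepsilon\in(0,\bar\varepsilon]$, for some $\bar\varepsilon>0$, if $V_\infty<+\infty$.
   Context: Let $s\in(0,1)$, $N>2s$, $2^*_s:=2N/(N-2s)$. $(-\Delta)^s$ is the fractional Laplacian, defined via the Fourier transform by $\mathcal F((-\Delta)^s u)=|\xi|^{2s}\mathcal F u$, and $H^s(\mathbb R^N)=\{u\in L^2(\mathbb R^N):(-\Delta)^{s/2}u\in L^2(\mathbb R^N)\}$ with norm $\|u\|^2=|(-\Delta)^{s/2}u|_2^2+|u|_2^2$. Problem $(P_\varepsilon)$ is: $\varepsilon^{2s}(-\Delta)^s u+V(z)u=f(u)$ in $\mathbb R^N$, $u\in H^s(\mathbb R^N)$, $u>0$; a solution is a positive $u\in H^s(\mathbb R^N)$ with $\int V u^2<\infty$ satisfying $\varepsilon^{2s}\int(-\Delta)^{s/2}u(-\Delta)^{s/2}v+\int V(z)uv=\int f(u)v$ for all such $v$. Equivalently (via $u(x)\mapsto u(\varepsilon x)$) one studies $(-\Delta)^s u+V(\varepsilon x)u=f(u)$, whose solutions are critical points of $I_\varepsilon(u)=\frac12\int|(-\Delta)^{s/2}u|^2+\frac12\int V(\varepsilon x)u^2-\int F(u)$ on $W_\varepsilon=\{u\in H^s(\mathbb R^N):\int V(\varepsilon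 x)u^2<\infty\}$; the ground state is a critical point achieving $\inf_{\mathcal N_\varepsilon}I_\varepsilon$, where $\mathcal N_\varepsilon=\{u\in W_\varepsilon\setminus\{0\}: \int|(-\Delta)^{s/2}u|^2+\int V(\varepsilon x)u^2=\int f(u)u\}$. Hypotheses: (V) $V:\mathbb R^N\to\mathbb R$ is continuous and $0<V_0:=\min_{\mathbb R^N}V<V_\infty:=\liminf_{|x|\to\infty}V(x)\in(0,+\infty]$. (f1) $f\in C^1(\mathbb R)$, $f(u)=0$ for $u\le0$; (f2) $\lim_{u\to0}f'(u)=0$; (f3) there is $q\in(2,2^*_s-1)$ with $\lim_{u\to\infty}f'(u)/u^{q-1}=0$; (f4) there is $\theta>2$ with $0<\theta F(u)\le uf(u)$ for all $u>0$, where $F(u)=\int_0^u f(t)\,dt$; (f5) $u\mapsto f(u)/u$ is strictly increasing on $(0,\infty)$. *)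

theory Defs
  imports "HOL-Analysis.Analysis" "HOL-Library.Extended_Real"
begin

definition fourier_L1 :: "('a::euclidean_space \<Rightarrow> complex) \<Rightarrow> 'a \<Rightarrow> complex" where
  "fourier_L1 \<phi> \<xi> = complex_of_real ((2 * pi) powr (- real DIM('a) / 2)) *
      (LINT x|lborel. cis (- (x \<bullet> \<xi>)) * \<phi> x)"

definition L2 :: "('a::euclidean_space \<Rightarrow> real) set" where
  "L2 = {u. u \<in> borel_measurable lborel \<and> integrable lborel (\<lambda>x. (u x)^2)}"

text \<open>w is (a representative of) the L^2 Fourier transform (Plancherel) of u:
  it is the unique L^2 function with <w, F phi> = <u, phi> for all phi in L^1 \<inter> L^2.\<close>
definition is_L2_fourier :: "('a::euclidean_space \<Rightarrow> real) \<Rightarrow> ('a \<Rightarrow> complex) \<Rightarrow> bool" where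
  "is_L2_fourier u w \<longleftrightarrow>
     w \<in> borel_measurable lborel \<and> integrable lborel (\<lambda>\<xi>. (cmod (w \<xi>))^2) \<and>
     (\<forall>\<phi>. \<phi> \<in> borel_measurable lborel \<and> integrable lborel \<phi> \<and>
           integrable lborel (\<lambda>x. (cmod (\<phi> x))^2) \<longrightarrow>
        (LINT \<xi>|lborel. w \<xi> * cnj (fourier_L1 \<phi> \<xi>)) =
        (LINT x|lborel. complex_of_real (u x) * cnj (\<phi> x)))"

definition L2_fourier :: "('a::euclidean_space \<Rightarrow> real) \<Rightarrow> 'a \<Rightarrow> complex" where
  "L2_fourier u = (SOME w. is_L2_fourier u w)"

text \<open>H^s(R^N) = {u in L^2 : (-\<Delta>)^(s/2) u in L^2}, i.e. |xi|^s F u in L^2.\<close>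
definition Hs :: "real \<Rightarrow> ('a::euclidean_space \<Rightarrow> real) set" where
  "Hs s = {u. u \<in> L2 \<and> (\<exists>w. is_L2_fourier u w \<and>
              integrable lborel (\<lambda>\<xi>. norm \<xi> powr (2 * s) * (cmod (w \<xi>))^2))}"

text \<open>|(-\<Delta>)^(s/2) u|_2^2 = int |xi|^(2s) |F u(xi)|^2 d xi\<close>
definition frac_sq :: "real \<Rightarrow> ('a::euclidean_space \<Rightarrow> real) \<Rightarrow> real" where
  "frac_sq s u = (LINT \<xi>|lborel. norm \<xi> powr (2 * s) * (cmod (L2_fourier u \<xi>))^2)"

text \<open>int (-\<Delta>)^(s/2) u (-\<Delta>)^(s/2) v, by polarization.\<close>
definition frac_form :: "real \<Rightarrow> ('a::euclidean_space \<Rightarrow> real) \<Rightarrow> ('a \<Rightarrow> real) \<Rightarrow> real" where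
  "frac_form s u v = (frac_sq s (\<lambda>x. u x + v x) - frac_sq s (\<lambda>x. u x - v x)) / 4"

definition Wsp :: "real \<Rightarrow> ('a::euclidean_space \<Rightarrow> real) \<Rightarrow> ('a \<Rightarrow> real) set" where
  "Wsp s V = {u. u \<in> Hs s \<and> integrable lborel (\<lambda>z. V z * (u z)^2)}"

text \<open>Solution of (P_eps): eps^(2s) (-\<Delta>)^s u + V(z) u = f(u), u > 0 (weak sense).\<close>
definition is_solution_P :: "real \<Rightarrow> ('a::euclidean_space \<Rightarrow> real) \<Rightarrow> (real \<Rightarrow> real) \<Rightarrow> real
     \<Rightarrow> ('a \<Rightarrow> real) \<Rightarrow> bool" where
  "is_solution_P s V f \<epsilon> u \<longleftrightarrow>
     u \<in> Wsp s V \<and> (AE z in lborel. u z > 0) \<and>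
     (\<forall>v \<in> Wsp s V.
        \<epsilon> powr (2 * s) * frac_form s u v + (LINT z|lborel. V z * u z * v z)
          = (LINT z|lborel. f (u z) * v z))"

definition prim :: "(real \<Rightarrow> real) \<Rightarrow> real \<Rightarrow> real" where
  "prim f t = integral {0..t} f"

definition energy_P :: "real \<Rightarrow> ('a::euclidean_space \<Rightarrow> real) \<Rightarrow> (real \<Rightarrow> real) \<Rightarrow> real
     \<Rightarrow> ('a \<Rightarrow> real) \<Rightarrow> real" where
  "energy_P s V f \<epsilon> u =
     \<epsilon> powr (2 * s) / 2 * frac_sq s u + 1 / 2 * (LINT z|lborel. V z * (u z)^2)
       - (LINT z|lborel. prim f (u z))"

definition nehari_P :: "real \<Rightarrow> ('a::euclidean_space \<Rightarrow> real) \<Rightarrow> (real \<Rightarrow> real) \<Rightarrow> real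
     \<Rightarrow> ('a \<Rightarrow> real) set" where
  "nehari_P s V f \<epsilon> = {u. u \<in> Wsp s V \<and> \<not> (AE z in lborel. u z = 0) \<and>
       \<epsilon> powr (2 * s) * frac_sq s u + (LINT z|lborel. V z * (u z)^2)
         = (LINT z|lborel. f (u z) * u z)}"

definition ground_state_P :: "real \<Rightarrow> ('a::euclidean_space \<Rightarrow> real) \<Rightarrow> (real \<Rightarrow> real) \<Rightarrow> real
     \<Rightarrow> ('a \<Rightarrow> real) \<Rightarrow> bool" where
  "ground_state_P s V f \<epsilon> u \<longleftrightarrow>
     is_solution_P s V f \<epsilon> u \<and> u \<in> nehari_P s V f \<epsilon> \<and>
     (\<forall>w \<in> nehari_P s V f \<epsilon>. energy_P s V f \<epsilon> u \<le> energy_P s V f \<epsilon> w)"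

end

theory Submission
  imports Defs "HOL-Probability.Probability" "HOL-Library.Diagonal_Subsequence"
begin

text \<open>Writing \<open>|x|\<^sup>-\<^sup>N\<^sup>-\<^sup>2\<^sup>s\<close> as a superposition of heat kernels and using Plancherel, one sees that \<open>frac_sq s u\<close> is a
  Gagliardo double integral; from there on everything happens in physical space. Comparison of \<open>u\<close> with its
  averages over small balls gives the subcritical Sobolev inequality and local compactness.

  After the change of variables \<open>z = z\<^sub>0 + \<epsilon> x\<close> the energy is minimised over the Nehari manifold. On it the energy
  equals \<open>J u = \<integral> (f u \<cdot> u / 2 - F u)\<close>, whose integrand is nonnegative and nondecreasing in \<open>u\<close> by (f5), and a
  function \<open>w\<close> with \<open>Q w \<le> \<integral> f w \<cdot> w\<close> is carried into the manifold by a factor \<open>t \<le> 1\<close>, which does not increase \<open>J\<close>.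
  With Brezis-Lieb splitting, a nonzero a.e. limit of a minimising sequence is therefore itself, up to such a factor,
  a minimiser. The limit can only vanish if the mass escapes to infinity. If \<open>V\<close> is coercive this is impossible; if
  \<open>V\<^sub>\<infinity>\<close> is finite it would force the level of \<open>V\<close> to be at least that of a constant potential \<open>A' < V\<^sub>\<infinity>\<close>,
  whereas for small \<open>\<epsilon>\<close> a compactly supported competitor concentrated at \<open>z\<^sub>0\<close> has smaller energy.\<close>

section \<open>Square integrable functions and the Brezis--Lieb lemma\<close>

text \<open>Two features of the Gagliardo form shape the argument: truncations of \<open>u\<close>
  lower it pointwise, and almost everywhere convergence passes from points to pairs of points.
  Fatou's lemma and Brezis-Lieb splitting along a.e. limits therefore do the work of weak
  convergence and of Palais-Smale sequences. If the limit \<open>u\<close> has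
  \<open>G V u > 0\<close>, no factor at most 1 carries it into the manifold. But then the
  remainders have \<open>G < 0\<close> and cost at least the full level, while splitting leaves them
  only the level minus \<open>J u\<close>. For constant potentials translation invariance destroys
  compactness, and no minimiser is constructed: nearly minimal elements suffice, because the gap
  between \<open>V z0\<close> and V_\<infinity> has room for several intermediate constants.
  Criticality comes from one-sided difference quotients at a minimiser, with the intermediate value
  theorem in the place of a smooth structure on the Nehari set. Positivity comes from nonlocality: a
  typical zero of \<open>u\<close> is coupled by the kernel to every other point.\<close>

definition sq_integrable :: "'x measure \<Rightarrow> ('x \<Rightarrow> 'b::{second_countable_topology,banach}) \<Rightarrow> bool" where
  "sq_integrable M f \<longleftrightarrow> f \<in> borel_measurable M \<and> integrable M (\<lambda>x. (norm (f x))^2)"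

lemma sq_integrableD:
  assumes "sq_integrable M f"
  shows "f \<in> borel_measurable M" "integrable M (\<lambda>x. (norm (f x))^2)"
  using assms by (auto simp: sq_integrable_def)

lemma sq_integrable_real:
  fixes f :: "'x \<Rightarrow> real"
  shows "sq_integrable M f \<longleftrightarrow> f \<in> borel_measurable M \<and> integrable M (\<lambda>x. (f x)^2)"
  by (simp add: sq_integrable_def)

lemma norm_add_sq_le: "(norm (a + b))^2 \<le> 2 * (norm a)^2 + 2 * (norm b)^2"
  for a b :: "'a::real_normed_vector"
proof -
  have "(norm (a + b))^2 \<le> (norm a + norm b)^2"
    by (intro power_mono norm_triangle_ineq) auto
  also have "\<dots> \<le> 2 * (norm a)^2 + 2 * (norm b)^2"
    using sum_squares_bound[of "norm a" "norm b"] by (simp add: power2_sum)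
  finally show ?thesis .
qed

lemma norm_diff_sq_le: "(norm (a - b))^2 \<le> 2 * (norm a)^2 + 2 * (norm b)^2"
  for a b :: "'a::real_normed_vector"
  using norm_add_sq_le[of a "-b"] by simp

lemma sq_integrable_bound:
  assumes "integrable M g" "f \<in> borel_measurable M" "AE x in M. (norm (f x))^2 \<le> g x"
  shows "sq_integrable M f"
  unfolding sq_integrable_def
proof
  show "integrable M (\<lambda>x. (norm (f x))^2)"
    by (rule Bochner_Integration.integrable_bound[OF assms(1)]) (use assms in auto)
qed (use assms in auto)

lemma sq_integrable_add:
  assumes "sq_integrable M f" "sq_integrable M g"
  shows "sq_integrable M (\<lambda>x. f x + g x)"
proof (rule sq_integrable_bound)
  show "integrable M (\<lambda>x. 2 * (norm (f x))^2 + 2 * (norm (g x))^2)"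
    using assms by (auto simp: sq_integrable_def)
qed (use assms norm_add_sq_le in \<open>auto simp: sq_integrable_def\<close>)

lemma sq_integrable_diff:
  assumes "sq_integrable M f" "sq_integrable M g"
  shows "sq_integrable M (\<lambda>x. f x - g x)"
proof (rule sq_integrable_bound)
  show "integrable M (\<lambda>x. 2 * (norm (f x))^2 + 2 * (norm (g x))^2)"
    using assms by (auto simp: sq_integrable_def)
qed (use assms norm_diff_sq_le in \<open>auto simp: sq_integrable_def\<close>)

lemma sq_integrable_mult:
  fixes f :: "'x \<Rightarrow> 'b::{real_normed_field,second_countable_topology,banach}"
  assumes "sq_integrable M f"
  shows "sq_integrable M (\<lambda>x. c * f x)"
  using assms by (auto simp: sq_integrable_def norm_mult power_mult_distrib)

lemma norm_mult_le_sq: "norm (a * b) \<le> (norm a)^2 + (norm b)^2"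
  for a b :: "'b::real_normed_algebra"
proof -
  have "norm (a * b) \<le> norm a * norm b" by (rule norm_mult_ineq)
  also have "\<dots> \<le> (norm a)^2 + (norm b)^2"
    using sum_squares_bound[of "norm a" "norm b"]
      mult_nonneg_nonneg[OF norm_ge_zero[of a] norm_ge_zero[of b]] by linarith
  finally show ?thesis .
qed

lemma sq_integrable_prod:
  fixes f :: "'x \<Rightarrow> 'b::{real_normed_algebra,second_countable_topology,banach}"
  assumes "sq_integrable M f" "sq_integrable M g"
  shows "integrable M (\<lambda>x. f x * g x)"
proof (rule Bochner_Integration.integrable_bound)
  show "integrable M (\<lambda>x. (norm (f x))^2 + (norm (g x))^2)"
    using assms by (auto simp: sq_integrable_def)
  show "(\<lambda>x. f x * g x) \<in> borel_measurable M"
    using assms by (auto simp: sq_integrable_def)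
  show "AE x in M. norm (f x * g x) \<le> norm ((norm (f x))^2 + (norm (g x))^2)"
    using norm_mult_le_sq by (auto intro!: AE_I2)
qed

lemma sq_integrable_Cauchy_Schwarz:
  fixes f g :: "'x \<Rightarrow> 'b::{real_normed_field,second_countable_topology,banach}"
  assumes "sq_integrable M f" "sq_integrable M g"
  shows "(norm (LINT x|M. f x * g x))^2 \<le> (LINT x|M. (norm (f x))^2) * (LINT x|M. (norm (g x))^2)"
proof -
  have m: "f \<in> borel_measurable M" "g \<in> borel_measurable M"
    using assms by (auto simp: sq_integrable_def)
  have i: "integrable M (\<lambda>x. norm (f x) * norm (g x))"
    using integrable_norm[OF sq_integrable_prod[OF assms]] by (simp add: norm_mult)
  have "(norm (LINT x|M. f x * g x))^2 \<le> (LINT x|M. norm (f x) * norm (g x))^2"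
    using integral_norm_bound[of M "\<lambda>x. f x * g x"] by (intro power_mono) (auto simp: norm_mult)
  also have "\<dots> \<le> (LINT x|M. (norm (f x))^2) * (LINT x|M. (norm (g x))^2)"
  proof -
    have "(\<integral>\<^sup>+x. ennreal (norm (f x)) * ennreal (norm (g x)) \<partial>M)^2
        \<le> (\<integral>\<^sup>+x. ennreal (norm (f x))^2 \<partial>M) * (\<integral>\<^sup>+x. ennreal (norm (g x))^2 \<partial>M)"
      by (rule Cauchy_Schwarz_nn_integral) (use m in auto)
    moreover have "(\<integral>\<^sup>+x. ennreal (norm (f x)) * ennreal (norm (g x)) \<partial>M) = ennreal (LINT x|M. norm (f x) * norm (g x))"
      using nn_integral_eq_integral[OF i] by (simp add: ennreal_mult)
    moreover have "(\<integral>\<^sup>+x. ennreal (norm (f x))^2 \<partial>M) = ennreal (LINT x|M. (norm (f x))^2)"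
      using nn_integral_eq_integral[OF sq_integrableD(2)[OF assms(1)]] by (simp add: ennreal_power)
    moreover have "(\<integral>\<^sup>+x. ennreal (norm (g x))^2 \<partial>M) = ennreal (LINT x|M. (norm (g x))^2)"
      using nn_integral_eq_integral[OF sq_integrableD(2)[OF assms(2)]] by (simp add: ennreal_power)
    ultimately have "(ennreal (LINT x|M. norm (f x) * norm (g x)))^2 \<le>
       ennreal (LINT x|M. (norm (f x))^2) * ennreal (LINT x|M. (norm (g x))^2)" by simp
    then have "ennreal ((LINT x|M. norm (f x) * norm (g x))^2) \<le>
       ennreal ((LINT x|M. (norm (f x))^2) * (LINT x|M. (norm (g x))^2))"
      by (simp add: ennreal_power ennreal_mult)
    then show ?thesis by (subst (asm) ennreal_le_iff) (auto intro!: mult_nonneg_nonneg)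
  qed
  finally show ?thesis .
qed

text \<open>Fatou's lemma. The bound is asked only from \<open>n0\<close> on, so that it also
  applies to differences \<open>f k - f n\<close> with \<open>n\<close> fixed and turns the Cauchy
  property into closeness to the limit.\<close>

lemma sq_integrable_liminf:
  assumes "\<And>n. sq_integrable M (f n)" "g \<in> borel_measurable M" "AE x in M. (\<lambda>n. f n x) \<longlonglongrightarrow> g x"
    and "\<And>n. n \<ge> n0 \<Longrightarrow> (LINT x|M. (norm (f n x))^2) \<le> B"
  shows "sq_integrable M g" "(LINT x|M. (norm (g x))^2) \<le> B"
proof -
  \<comment> \<open>\<open>ennreal\<close> sends negative numbers to 0, so the final comparison with
    \<open>B\<close> as a real number needs its sign.\<close>
  have "0 \<le> (LINT x|M. (norm (f n0 x))^2)" by simp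
  then have B: "B \<ge> 0" using assms(4)[of n0] by linarith
  have "(\<integral>\<^sup>+x. ennreal ((norm (g x))^2) \<partial>M) \<le> (\<integral>\<^sup>+x. liminf (\<lambda>n. ennreal ((norm (f n x))^2)) \<partial>M)"
  proof (rule nn_integral_mono_AE)
    show "AE x in M. ennreal ((norm (g x))^2) \<le> liminf (\<lambda>n. ennreal ((norm (f n x))^2))"
      using assms(3)
    proof eventually_elim
      case (elim x)
      have "(\<lambda>n. ennreal ((norm (f n x))^2)) \<longlonglongrightarrow> ennreal ((norm (g x))^2)"
        by (intro tendsto_ennrealI tendsto_intros elim)
      from lim_imp_Liminf[OF _ this] show ?case by simp
    qed
  qed
  also have "\<dots> \<le> liminf (\<lambda>n. \<integral>\<^sup>+x. ennreal ((norm (f n x))^2) \<partial>M)"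
    by (rule nn_integral_liminf) (use assms in \<open>auto simp: sq_integrable_def\<close>)
  also have "\<dots> \<le> ennreal B"
  proof (rule Liminf_le)
    show "\<forall>\<^sub>F n in sequentially. (\<integral>\<^sup>+x. ennreal ((norm (f n x))^2) \<partial>M) \<le> ennreal B"
    proof (rule eventually_sequentiallyI)
      fix n assume "n \<ge> n0"
      show "(\<integral>\<^sup>+x. ennreal ((norm (f n x))^2) \<partial>M) \<le> ennreal B"
        using nn_integral_eq_integral[OF sq_integrableD(2)[OF assms(1)[of n]]] assms(4)[OF \<open>n \<ge> n0\<close>]
        by (simp add: ennreal_leI)
    qed
  qed simp
  finally have le: "(\<integral>\<^sup>+x. ennreal ((norm (g x))^2) \<partial>M) \<le> ennreal B" .
  show s: "sq_integrable M g"
    unfolding sq_integrable_def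
    by (intro conjI assms integrableI_nonneg) (use assms le in \<open>auto simp: le_less_trans\<close>)
  show "(LINT x|M. (norm (g x))^2) \<le> B"
    using le nn_integral_eq_integral[OF sq_integrableD(2)[OF s]] B by (simp add: ennreal_le_iff)
qed

text \<open>The Riesz-Fischer argument: along a fast subsequence the increments are absolutely
  summable almost everywhere. Square integrability of the limit is left to Fatou's lemma at the
  places of use.\<close>

lemma sq_integrable_Cauchy_AE_subseq:
  fixes f :: "nat \<Rightarrow> 'x \<Rightarrow> 'b::{second_countable_topology,banach}"
  assumes f: "\<And>n. sq_integrable M (f n)"
    and C: "\<And>e. e > 0 \<Longrightarrow> \<exists>N. \<forall>m\<ge>N. \<forall>n\<ge>N. (LINT x|M. (norm (f m x - f n x))^2) < e"
  obtains r g where "strict_mono r" "g \<in> borel_measurable M" "AE x in M. (\<lambda>n. f (r n) x) \<longlonglongrightarrow> g x"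
proof -
  \<comment> \<open>The rate \<open>(1/8)^k\<close> leaves \<open>(1/4)^k\<close> after
    multiplication by the weight \<open>2^k\<close>; that weight turns square summability into
    summability below.\<close>
  have "\<exists>r :: nat \<Rightarrow> nat. \<forall>k. (\<forall>m\<ge>r k. \<forall>n\<ge>r k. (LINT x|M. (norm (f m x - f n x))^2) < (1/8)^k) \<and> r k < r (Suc k)"
  proof (rule dependent_nat_choice)
    show "\<exists>x. \<forall>m\<ge>x. \<forall>n\<ge>x. (LINT xa|M. (norm (f m xa - f n xa))^2) < (1/8)^0" by (rule C) simp
  next
    fix x k
    obtain N where N: "\<forall>m\<ge>N. \<forall>n\<ge>N. (LINT xa|M. (norm (f m xa - f n xa))^2) < (1/8)^Suc k"
      using C[of "(1/8)^Suc k"] by auto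
    show "\<exists>y. (\<forall>m\<ge>y. \<forall>n\<ge>y. (LINT xa|M. (norm (f m xa - f n xa))^2) < (1 / 8) ^ Suc k) \<and> x < y"
      by (rule exI[of _ "max N (Suc x)"]) (use N in auto)
  qed
  then obtain r :: "nat \<Rightarrow> nat" where
    r: "\<And>k m n. m \<ge> r k \<Longrightarrow> n \<ge> r k \<Longrightarrow> (LINT x|M. (norm (f m x - f n x))^2) < (1/8)^k"
    and mono: "\<And>k. r k < r (Suc k)" by metis
  have sm: "strict_mono r" using mono by (simp add: strict_mono_Suc_iff)
  have fm [measurable]: "f n \<in> borel_measurable M" for n using f by (auto simp: sq_integrable_def)
  define \<Delta> where "\<Delta> k x = norm (f (r (Suc k)) x - f (r k) x)" for k x
  have \<Delta>i: "integrable M (\<lambda>x. 2^k * (\<Delta> k x)^2)" for k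
    using sq_integrable_diff[OF f f, of "r (Suc k)" "r k"] by (auto simp: sq_integrable_def \<Delta>_def)
  have \<Delta>b: "(\<integral>\<^sup>+x. ennreal (2^k * (\<Delta> k x)^2) \<partial>M) \<le> ennreal ((1/4)^k)" for k
  proof -
    have "(LINT x|M. (\<Delta> k x)^2) \<le> (1/8)^k"
      using r[of k "r (Suc k)" "r k"] mono[of k] by (simp add: \<Delta>_def)
    then have "2^k * (LINT x|M. (\<Delta> k x)^2) \<le> 2^k * (1/8)^k" by (intro mult_left_mono) auto
    also have "(2::real)^k * (1/8)^k = (1/4)^k" by (simp add: power_mult_distrib[symmetric])
    finally show ?thesis
      using nn_integral_eq_integral[OF \<Delta>i[of k]] by (simp add: ennreal_leI)
  qed
  have "(\<integral>\<^sup>+x. (\<Sum>k. ennreal (2^k * (\<Delta> k x)^2)) \<partial>M) = (\<Sum>k. \<integral>\<^sup>+x. ennreal (2^k * (\<Delta> k x)^2) \<partial>M)"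
    by (rule nn_integral_suminf) (auto simp: \<Delta>_def)
  also have "\<dots> \<le> (\<Sum>k. ennreal ((1/4)^k))" by (intro suminf_le \<Delta>b) auto
  also have "\<dots> = ennreal (\<Sum>k. (1/4)^k)" by (rule suminf_ennreal2) auto
  also have "\<dots> < \<infinity>" by simp
  finally have "AE x in M. (\<Sum>k. ennreal (2^k * (\<Delta> k x)^2)) \<noteq> \<infinity>"
    by (intro nn_integral_PInf_AE) (auto simp: \<Delta>_def)
  then have ae: "AE x in M. convergent (\<lambda>n. f (r n) x)"
  proof eventually_elim
    case (elim x)
    have sm: "summable (\<lambda>k. 2^k * (\<Delta> k x)^2)"
      by (rule summable_suminf_not_top) (use elim in \<open>auto simp: top_ennreal.rep_eq\<close>)
    have "summable (\<lambda>k. 2^k * (\<Delta> k x)^2 + (1/2)^k)"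
      by (intro summable_add sm summable_geometric) auto
    then have "summable (\<lambda>k. norm (f (r (Suc k)) x - f (r k) x))"
    proof (rule summable_comparison_test')
      fix k
      \<comment> \<open>Young's inequality with weight \<open>2^k\<close>: the increment is at most
        \<open>2^k * (\<Delta> k x)^2 + (1/2)^k\<close>.\<close>
      have "\<Delta> k x = (sqrt (2^k) * \<Delta> k x) * sqrt ((1/2)^k)"
        by (simp add: power_one_over real_sqrt_divide)
      also have "\<dots> \<le> (sqrt (2^k) * \<Delta> k x)^2 + (sqrt ((1/2)^k))^2"
        using norm_mult_le_sq[of "sqrt (2^k) * \<Delta> k x" "sqrt ((1/2)^k)"] by simp
      finally show "norm (norm (f (r (Suc k)) x - f (r k) x)) \<le> 2^k * (\<Delta> k x)^2 + (1/2)^k"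
        by (simp add: power_mult_distrib \<Delta>_def)
    qed
    then have "summable (\<lambda>k. f (r (Suc k)) x - f (r k) x)" by (rule summable_norm_cancel)
    then have "convergent (\<lambda>n. f (r n) x - f (r 0) x)"
      by (simp only: summable_iff_convergent sum_lessThan_telescope[of "\<lambda>k. f (r k) x"])
    then have "convergent (\<lambda>n. (f (r n) x - f (r 0) x) + f (r 0) x)"
      by (intro convergent_add convergent_const)
    then show ?case by simp
  qed
  define g where "g x = lim (\<lambda>n. f (r n) x)" for x
  have "g \<in> borel_measurable M" unfolding g_def by (rule borel_measurable_lim_metric) auto
  moreover have "AE x in M. (\<lambda>n. f (r n) x) \<longlonglongrightarrow> g x"
    using ae unfolding g_def by (auto simp: convergent_LIMSEQ_iff)
  ultimately show thesis using sm that by blast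
qed

text \<open>The error \<open>E n\<close> is at most \<open>\<delta> * \<Phi> (v n)\<close> plus a
  fixed integrable function. Cutting off the first part leaves \<open>W n\<close>, to which
  dominated convergence applies; the part cut off has integral at most \<open>\<delta> * B\<close>.
  The growth of \<open>j\<close> enters only through \<open>split\<close>.\<close>

lemma Brezis_Lieb:
  fixes j \<Phi> :: "real \<Rightarrow> real"
  assumes j: "continuous_on UNIV j" "j 0 = 0" and \<Phi>: "\<Phi> \<in> borel_measurable borel" "\<And>x. \<Phi> x \<ge> 0"
    and split: "\<And>\<delta>. \<delta> > 0 \<Longrightarrow> \<exists>C. \<forall>a b. \<bar>j (a + b) - j a - j b\<bar> \<le> \<delta> * \<Phi> a + C * \<Phi> b"
    and v: "\<And>n. v n \<in> borel_measurable M" and u: "u \<in> borel_measurable M"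
    and lim: "AE x in M. (\<lambda>n. v n x) \<longlonglongrightarrow> 0"
    and iu: "integrable M (\<lambda>x. \<Phi> (u x))" and iv: "\<And>n. integrable M (\<lambda>x. \<Phi> (v n x))"
    and B: "\<And>n. (LINT x|M. \<Phi> (v n x)) \<le> B"
    and iju: "integrable M (\<lambda>x. j (u x))" and ijv: "\<And>n. integrable M (\<lambda>x. j (v n x))"
    and ijs: "\<And>n. integrable M (\<lambda>x. j (v n x + u x))"
  shows "(\<lambda>n. (LINT x|M. j (v n x + u x)) - (LINT x|M. j (v n x))) \<longlonglongrightarrow> (LINT x|M. j (u x))"
proof -
  define E where "E n x = \<bar>j (v n x + u x) - j (v n x) - j (u x)\<bar>" for n x
  have iE: "integrable M (E n)" for n unfolding E_def using iju ijv ijs by auto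
  have jm [measurable]: "j \<in> borel_measurable borel" using j(1) by (rule borel_measurable_continuous_onI)
  note [measurable] = v u \<Phi>(1)
  have B0: "B \<ge> 0" using B[of 0] \<Phi>(2) by (meson Bochner_Integration.integral_nonneg order_trans)
  have E0: "(\<lambda>n. LINT x|M. E n x) \<longlonglongrightarrow> 0"
  proof (rule LIMSEQ_I)
    fix e :: real assume e: "e > 0"
    \<comment> \<open>With \<open>B + 1\<close> in place of \<open>B\<close>, the product
      \<open>\<delta> * (B + 1)\<close> is \<open>e / 2\<close> even when
      \<open>B = 0\<close>.\<close>
    define \<delta> where "\<delta> = e / (2 * (B + 1))"
    have \<delta>: "\<delta> > 0" using e B0 by (simp add: \<delta>_def)
    obtain C where C: "\<And>a b. \<bar>j (a + b) - j a - j b\<bar> \<le> \<delta> * \<Phi> a + C * \<Phi> b" using split[OF \<delta>] by blast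
    define W where "W n x = max 0 (E n x - \<delta> * \<Phi> (v n x))" for n x
    have "(\<lambda>n. LINT x|M. W n x) \<longlonglongrightarrow> (LINT x|M. 0)"
    proof (rule integral_dominated_convergence)
      show "integrable M (\<lambda>x. \<bar>C\<bar> * \<Phi> (u x))" using iu by auto
      show "W n \<in> borel_measurable M" for n unfolding W_def E_def by measurable
      show "AE x in M. norm (W n x) \<le> \<bar>C\<bar> * \<Phi> (u x)" for n
      proof (rule AE_I2)
        fix x
        have "C * \<Phi> (u x) \<le> \<bar>C\<bar> * \<Phi> (u x)" using \<Phi>(2)[of "u x"] by (intro mult_right_mono) auto
        moreover have "0 \<le> \<bar>C\<bar> * \<Phi> (u x)" using \<Phi>(2)[of "u x"] by auto
        ultimately show "norm (W n x) \<le> \<bar>C\<bar> * \<Phi> (u x)"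
          using C[of "v n x" "u x"] by (auto simp: W_def E_def)
      qed
      show "AE x in M. (\<lambda>n. W n x) \<longlonglongrightarrow> 0" using lim
      proof eventually_elim
        case (elim x)
        have c: "isCont j y" for y using j(1) by (simp add: continuous_on_eq_continuous_at)
        have "(\<lambda>n. E n x) \<longlonglongrightarrow> \<bar>j (0 + u x) - j 0 - j (u x)\<bar>" unfolding E_def
          by (intro tendsto_intros isCont_tendsto_compose[OF c] elim)
        then have E0: "(\<lambda>n. E n x) \<longlonglongrightarrow> 0" by (simp add: j)
        show ?case
        proof (rule Lim_null_comparison[OF always_eventually E0], rule allI)
          fix n show "norm (W n x) \<le> E n x"
            using \<Phi>(2)[of "v n x"] \<delta> by (auto simp: W_def E_def)
        qed
      qed
    qed auto
    then have "(\<lambda>n. LINT x|M. W n x) \<longlonglongrightarrow> 0" by simp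
    then obtain N where N0: "\<And>n. n \<ge> N \<Longrightarrow> norm ((LINT x|M. W n x) - 0) < e/2"
      using LIMSEQ_D[of "\<lambda>n. LINT x|M. W n x" 0 "e/2"] e half_gt_zero by blast
    have N: "(LINT x|M. W n x) < e/2" if "n \<ge> N" for n
    proof -
      have "(LINT x|M. W n x) \<le> norm ((LINT x|M. W n x) - 0)" by simp
      also note N0[OF that]
      finally show ?thesis .
    qed
    have "norm ((LINT x|M. E n x) - 0) < e" if "n \<ge> N" for n
    proof -
      have iW: "integrable M (W n)" unfolding W_def using iE[of n] iv[of n] by auto
      have "(LINT x|M. E n x) \<le> (LINT x|M. W n x + \<delta> * \<Phi> (v n x))"
        by (rule integral_mono) (use iE iW iv in \<open>auto simp: W_def\<close>)
      also have "\<dots> = (LINT x|M. W n x) + \<delta> * (LINT x|M. \<Phi> (v n x))"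
        using iW iv by simp
      also have "\<dots> < e/2 + \<delta> * (B + 1)"
        by (intro add_less_le_mono mult_left_mono N[OF that]) (use B[of n] \<delta> in linarith)+
      also have "\<dots> = e" using B0 e unfolding \<delta>_def by (simp add: divide_simps, simp add: algebra_simps)
      finally have "(LINT x|M. E n x) < e" .
      moreover have "(LINT x|M. E n x) \<ge> 0" by (simp add: E_def)
      ultimately show ?thesis unfolding real_norm_def by linarith
    qed
    then show "\<exists>N. \<forall>n\<ge>N. norm ((LINT x|M. E n x) - 0) < e" by blast
  qed
  have nE: "norm ((LINT x|M. j (v n x + u x)) - (LINT x|M. j (v n x)) - (LINT x|M. j (u x))) \<le> (LINT x|M. E n x)" for n
  proof -
    have "(LINT x|M. j (v n x + u x)) - (LINT x|M. j (v n x)) - (LINT x|M. j (u x))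
      = (LINT x|M. j (v n x + u x) - j (v n x) - j (u x))" using iju ijv ijs by simp
    then show ?thesis
      using integral_norm_bound[of M "\<lambda>x. j (v n x + u x) - j (v n x) - j (u x)"] unfolding E_def by simp
  qed
  have "(\<lambda>n. (LINT x|M. j (v n x + u x)) - (LINT x|M. j (v n x)) - (LINT x|M. j (u x))) \<longlonglongrightarrow> 0"
    by (rule Lim_null_comparison[OF _ E0]) (use nE in \<open>intro always_eventually allI\<close>)
  then show ?thesis by (simp add: LIM_zero_iff)
qed

lemma abs_sq_split:
  assumes "\<delta> > 0"
  shows "\<exists>C. \<forall>a b::real. \<bar>(a + b)^2 - a^2 - b^2\<bar> \<le> \<delta> * a^2 + C * b^2"
proof (intro exI allI)
  fix a b :: real
  \<comment> \<open>Expanding this square gives Young's inequality with constant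
    \<open>1 / \<delta>\<close>.\<close>
  have "0 \<le> (sqrt \<delta> * \<bar>a\<bar> - \<bar>b\<bar> / sqrt \<delta>)^2" by simp
  also have "\<dots> = \<delta> * a^2 + (1/\<delta>) * b^2 - 2 * \<bar>a\<bar> * \<bar>b\<bar>"
    using assms by (simp add: power2_diff power_mult_distrib power_divide)
  also have "2 * \<bar>a\<bar> * \<bar>b\<bar> = \<bar>(a + b)^2 - a^2 - b^2\<bar>" by (simp add: power2_sum abs_mult)
  finally show "\<bar>(a + b)^2 - a^2 - b^2\<bar> \<le> \<delta> * a^2 + (1/\<delta>) * b^2" by simp
qed

lemma Brezis_Lieb_sq:
  fixes u :: "'x \<Rightarrow> real"
  assumes "\<And>n. sq_integrable M (v n)" "sq_integrable M u" "AE x in M. (\<lambda>n. v n x) \<longlonglongrightarrow> 0"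
    "\<And>n. (LINT x|M. (v n x)^2) \<le> B"
  shows "(\<lambda>n. (LINT x|M. (v n x + u x)^2) - (LINT x|M. (v n x)^2)) \<longlonglongrightarrow> (LINT x|M. (u x)^2)"
proof (rule Brezis_Lieb[where \<Phi>="\<lambda>x. x^2" and B=B])
  show "integrable M (\<lambda>x. (v n x + u x)^2)" for n
    using sq_integrable_add[OF assms(1,2)] by (simp add: sq_integrable_real)
qed (use assms abs_sq_split in \<open>auto simp: sq_integrable_real intro!: continuous_intros\<close>)

section \<open>The heat kernel and the Plancherel theorem\<close>

text \<open>\<open>lborel\<close> is the image of a product of one-dimensional Lebesgue measures
  under the coordinate map, so Gaussian integrals factor over the coordinates.\<close>

lemma lborel_prod_Basis:
  fixes g :: "'a::euclidean_space \<Rightarrow> real \<Rightarrow> complex"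
  assumes g: "\<And>b. b \<in> Basis \<Longrightarrow> integrable lborel (g b)"
  shows "integrable lborel (\<lambda>x::'a. \<Prod>b\<in>Basis. g b (x \<bullet> b))"
    and "(LINT x|lborel. (\<Prod>b\<in>Basis. g b ((x::'a) \<bullet> b))) = (\<Prod>b\<in>Basis. (LINT y|lborel. g b y))"
proof -
  interpret product_sigma_finite "\<lambda>_::'a. lborel :: real measure" by standard
  have gm [measurable]: "b \<in> Basis \<Longrightarrow> g b \<in> borel_measurable borel" for b
    using borel_measurable_integrable[OF g[of b]] by simp
  have m [measurable]: "(\<lambda>x::'a. \<Prod>b\<in>Basis. g b (x \<bullet> b)) \<in> borel_measurable borel"
  proof (rule borel_measurable_prod)
    fix b :: 'a assume "b \<in> Basis"
    then show "(\<lambda>x. g b (x \<bullet> b)) \<in> borel_measurable borel"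
      using measurable_compose[OF _ gm, of "\<lambda>x. x \<bullet> b" borel b] by simp
  qed
  have e: "(\<Prod>b\<in>Basis. g b ((\<Sum>c\<in>Basis. f c *\<^sub>R c) \<bullet> b)) = (\<Prod>b\<in>Basis. g b (f b))" for f
    by (intro prod.cong) auto
  have mm: "(\<lambda>f. \<Sum>b\<in>Basis. f b *\<^sub>R b) \<in> measurable (\<Pi>\<^sub>M b\<in>Basis. (lborel :: real measure)) (borel :: 'a measure)"
    by measurable
  show "integrable lborel (\<lambda>x::'a. \<Prod>b\<in>Basis. g b (x \<bullet> b))"
    by (subst lborel_eq, subst integrable_distr_eq[OF mm m])
       (unfold e, rule product_integrable_prod, use g in auto)
  show "(LINT x|lborel. (\<Prod>b\<in>Basis. g b ((x::'a) \<bullet> b))) = (\<Prod>b\<in>Basis. (LINT y|lborel. g b y))"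
    by (subst lborel_eq, subst integral_distr[OF mm m])
       (unfold e, rule product_integral_prod, use g in auto)
qed

text \<open>The substitution \<open>\<sigma> * y\<close> reduces the integral to the characteristic
  function of the standard normal distribution.\<close>

lemma normal_density_fourier:
  assumes "\<sigma> > 0"
  shows "integrable lborel (\<lambda>y. cis (y * \<eta>) * complex_of_real (normal_density 0 \<sigma> y))"
    and "(LINT y|lborel. cis (y * \<eta>) * complex_of_real (normal_density 0 \<sigma> y)) = complex_of_real (exp (- (\<sigma>^2 * \<eta>^2) / 2))"
proof -
  have i: "integrable lborel (\<lambda>y. complex_of_real (normal_density 0 \<sigma> y))"
    using integrable_normal_density[OF assms, of 0] by simp
  show "integrable lborel (\<lambda>y. cis (y * \<eta>) * complex_of_real (normal_density 0 \<sigma> y))"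
    by (rule Bochner_Integration.integrable_bound[OF i]) (auto simp: norm_mult cis_conv_exp)
  have "(LINT y|lborel. cis (y * \<eta>) * complex_of_real (normal_density 0 \<sigma> y))
    = \<bar>\<sigma>\<bar> *\<^sub>R (LINT y|lborel. cis ((0 + \<sigma> * y) * \<eta>) * complex_of_real (normal_density 0 \<sigma> (0 + \<sigma> * y)))"
    by (rule lborel_integral_real_affine) (use assms in auto)
  also have "\<dots> = (LINT y|lborel. \<sigma> *\<^sub>R (cis ((0 + \<sigma> * y) * \<eta>) * complex_of_real (normal_density 0 \<sigma> (0 + \<sigma> * y))))"
    using assms by (simp only: integral_scaleR_right abs_of_pos)
  also have "\<dots> = (LINT y|lborel. std_normal_density y *\<^sub>R iexp ((\<sigma> * \<eta>) * y))"
    by (intro Bochner_Integration.integral_cong)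
       (use assms in \<open>auto simp: normal_density_def std_normal_density_def cis_conv_exp scaleR_conv_of_real real_sqrt_mult power_mult_distrib mult_ac\<close>)
  also have "\<dots> = char std_normal_distribution (\<sigma> * \<eta>)"
    unfolding char_def by (subst integral_density) auto
  also have "\<dots> = complex_of_real (exp (- (\<sigma>^2 * \<eta>^2) / 2))"
    by (simp add: char_std_normal_distribution power_mult_distrib)
  finally show "(LINT y|lborel. cis (y * \<eta>) * complex_of_real (normal_density 0 \<sigma> y)) = complex_of_real (exp (- (\<sigma>^2 * \<eta>^2) / 2))" .
qed

text \<open>Centred Gaussian density with variance \<open>t\<close> in each coordinate, the kernel
  of the semigroup generated by half the Laplacian. This normalisation is the source of the factor
  \<open>1/2\<close> in \<open>exp (- t * (norm \<xi>)^2 / 2)\<close>.\<close>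

definition heat :: "real \<Rightarrow> 'a::euclidean_space \<Rightarrow> real" where
  "heat t x = (2 * pi * t) powr (- real DIM('a) / 2) * exp (- (norm x)\<^sup>2 / (2 * t))"

lemma norm_sq_Basis: "(norm x)^2 = (\<Sum>b\<in>Basis. (x \<bullet> b)^2)" for x :: "'a::euclidean_space"
  by (simp only: power2_norm_eq_inner euclidean_inner[of x x]) (simp add: power2_eq_square)

lemma heat_prod:
  assumes "t > 0"
  shows "heat t x = (\<Prod>b\<in>Basis. normal_density 0 (sqrt t) (x \<bullet> b))"
proof -
  have "(\<Prod>b\<in>Basis. normal_density 0 (sqrt t) (x \<bullet> b))
     = (\<Prod>b\<in>(Basis::'a set). 1 / sqrt (2 * pi * t)) * (\<Prod>b\<in>Basis. exp (- (x \<bullet> b)\<^sup>2 / (2 * t)))"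
    using assms by (subst prod.distrib[symmetric]) (auto simp: normal_density_def intro!: prod.cong)
  also have "(\<Prod>b\<in>(Basis::'a set). 1 / sqrt (2 * pi * t)) = ((2 * pi * t) powr (- (1/2))) ^ DIM('a)"
  proof -
    have "(2 * pi * t) powr (- (1/2)) = 1 / sqrt (2 * pi * t)"
      by (subst powr_minus_divide, subst powr_half_sqrt) (use assms in auto)
    then show ?thesis by (simp only: prod_constant)
  qed
  also have "\<dots> = (2 * pi * t) powr (- real DIM('a) / 2)"
    using assms by (subst powr_realpow[symmetric]) (auto simp: powr_powr)
  also have "(\<Prod>b\<in>Basis. exp (- (x \<bullet> b)\<^sup>2 / (2 * t))) = exp (- (norm x)\<^sup>2 / (2 * t))"
    by (simp add: exp_sum[symmetric] norm_sq_Basis sum_divide_distrib sum_negf)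
  finally show ?thesis by (simp add: heat_def)
qed

lemma heat_nonneg [simp]: "heat t x \<ge> 0" by (simp add: heat_def)
lemma heat_measurable [measurable]: "heat t \<in> borel_measurable borel" unfolding heat_def by measurable
lemma heat_fourier:
  fixes \<xi> :: "'a::euclidean_space"
  assumes "t > 0"
  shows "integrable lborel (\<lambda>x. cis (x \<bullet> \<xi>) * complex_of_real (heat t x))"
    and "(LINT x|lborel. cis (x \<bullet> \<xi>) * complex_of_real (heat t x)) = complex_of_real (exp (- t * (norm \<xi>)^2 / 2))"
proof -
  have e: "cis (x \<bullet> \<xi>) * complex_of_real (heat t x) =
     (\<Prod>b\<in>Basis. cis ((x \<bullet> b) * (\<xi> \<bullet> b)) * complex_of_real (normal_density 0 (sqrt t) (x \<bullet> b)))" for x :: 'a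
  proof -
    have "cis (x \<bullet> \<xi>) = (\<Prod>b\<in>Basis. cis ((x \<bullet> b) * (\<xi> \<bullet> b)))"
      by (subst euclidean_inner) (simp add: cis_conv_exp exp_sum[symmetric] sum_distrib_left)
    then show ?thesis by (simp add: heat_prod[OF assms] prod.distrib)
  qed
  show "integrable lborel (\<lambda>x. cis (x \<bullet> \<xi>) * complex_of_real (heat t x))"
    unfolding e by (rule lborel_prod_Basis, rule normal_density_fourier) (use assms in auto)
  have "(LINT x|lborel. cis (x \<bullet> \<xi>) * complex_of_real (heat t x)) =
    (\<Prod>b\<in>Basis. (LINT y|lborel. cis (y * (\<xi> \<bullet> b)) * complex_of_real (normal_density 0 (sqrt t) y)))"
    unfolding e by (rule lborel_prod_Basis, rule normal_density_fourier) (use assms in auto)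
  also have "\<dots> = (\<Prod>b\<in>Basis. complex_of_real (exp (- (t * (\<xi> \<bullet> b)^2) / 2)))"
    using assms by (intro prod.cong refl) (simp add: normal_density_fourier)
  also have "\<dots> = complex_of_real (exp (\<Sum>b\<in>Basis. - (t * (\<xi> \<bullet> b)^2) / 2))"
    by (simp only: of_real_prod[symmetric] exp_sum finite_Basis)
  also have "(\<Sum>b\<in>Basis. - (t * (\<xi> \<bullet> b)^2) / 2) = - t * (norm \<xi>)^2 / 2"
    by (simp add: norm_sq_Basis sum_divide_distrib sum_negf sum_distrib_left)
  finally show "(LINT x|lborel. cis (x \<bullet> \<xi>) * complex_of_real (heat t x)) = complex_of_real (exp (- t * (norm \<xi>)^2 / 2))" .
qed

lemma heat_integral:
  assumes "t > 0"
  shows "integrable lborel (heat t :: 'a::euclidean_space \<Rightarrow> real)" "(LINT x|lborel. heat t (x::'a)) = 1"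
proof -
  show i: "integrable lborel (heat t :: 'a \<Rightarrow> real)"
    using integrable_Re[OF heat_fourier(1)[OF assms, of "0::'a"]] by simp
  have "complex_of_real (LINT x|lborel. heat t (x::'a)) = 1"
    using heat_fourier(2)[OF assms, of "0::'a"] by simp
  then show "(LINT x|lborel. heat t (x::'a)) = 1" by (simp only: of_real_eq_1_iff)
qed

text \<open>\<open>2 * (1 - cos (h \<bullet> \<xi>))\<close> is the Fourier multiplier of a squared
  shift difference, and \<open>1 - exp (- t * (norm \<xi>)^2 / 2)\<close> is the function whose
  superposition over \<open>t\<close> produces the fractional symbol.\<close>

lemma heat_cos:
  fixes \<xi> :: "'a::euclidean_space"
  assumes "t > 0"
  shows "integrable lborel (\<lambda>h. (1 - cos (h \<bullet> \<xi>)) * heat t h)"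
    "(LINT h|lborel. (1 - cos (h \<bullet> \<xi>)) * heat t h) = 1 - exp (- t * (norm \<xi>)^2 / 2)"
proof -
  have ic: "integrable lborel (\<lambda>h. cos (h \<bullet> \<xi>) * heat t h)"
    and ec: "(LINT h|lborel. cos (h \<bullet> \<xi>) * heat t h) = exp (- t * (norm \<xi>)^2 / 2)"
    using integrable_Re[OF heat_fourier(1)[OF assms, of \<xi>]] integral_Re[OF heat_fourier(1)[OF assms, of \<xi>]]
      heat_fourier(2)[OF assms, of \<xi>] by auto
  show "integrable lborel (\<lambda>h. (1 - cos (h \<bullet> \<xi>)) * heat t h)"
    using ic heat_integral(1)[OF assms, where 'a='a] by (simp add: left_diff_distrib)
  show "(LINT h|lborel. (1 - cos (h \<bullet> \<xi>)) * heat t h) = 1 - exp (- t * (norm \<xi>)^2 / 2)"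
    using ic ec heat_integral[OF assms, where 'a='a] by (simp add: left_diff_distrib)
qed

section \<open>Invariance of Lebesgue measure and continuity of translations in L2\<close>

lemma nn_integral_translate:
  fixes f :: "'a::euclidean_space \<Rightarrow> ennreal"
  assumes "f \<in> borel_measurable borel"
  shows "(\<integral>\<^sup>+x. f (h + x) \<partial>lborel) = (\<integral>\<^sup>+x. f x \<partial>lborel)"
proof -
  have "(\<integral>\<^sup>+x. f x \<partial>lborel) = (\<integral>\<^sup>+x. f x \<partial>distr lborel borel ((+) h))"
    by (simp add: lborel_distr_plus)
  also have "\<dots> = (\<integral>\<^sup>+x. f (h + x) \<partial>lborel)"
    by (subst nn_integral_distr) (use assms in auto)
  finally show ?thesis by simp
qed

lemma integrable_translate:
  fixes f :: "'a::euclidean_space \<Rightarrow> 'b::{banach,second_countable_topology}"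
  assumes "integrable lborel f"
  shows "integrable lborel (\<lambda>x. f (h + x))"
proof -
  have "integrable (distr lborel borel ((+) h)) f" using assms by (simp add: lborel_distr_plus)
  then show ?thesis by (subst (asm) integrable_distr_eq) (use assms in auto)
qed

lemma integral_translate:
  fixes f :: "'a::euclidean_space \<Rightarrow> 'b::{banach,second_countable_topology}"
  assumes "f \<in> borel_measurable borel"
  shows "(LINT x|lborel. f (h + x)) = (LINT x|lborel. f x)"
proof -
  have "(LINT x|lborel. f x) = (LINT x|distr lborel borel ((+) h). f x)"
    by (simp add: lborel_distr_plus)
  also have "\<dots> = (LINT x|lborel. f (h + x))"
    by (subst integral_distr) (use assms in auto)
  finally show ?thesis by simp
qed

lemma sq_integrable_translate:
  fixes f :: "'a::euclidean_space \<Rightarrow> 'b::{banach,second_countable_topology}"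
  assumes "sq_integrable lborel f"
  shows "sq_integrable lborel (\<lambda>x. f (h + x))"
  using integrable_translate[of "\<lambda>x. (norm (f x))^2" h] assms by (auto simp: sq_integrable_def)

lemma nn_integral_scale:
  fixes f :: "'a::euclidean_space \<Rightarrow> ennreal"
  assumes c: "c > 0" and f [measurable]: "f \<in> borel_measurable borel"
  shows "(\<integral>\<^sup>+x. f x \<partial>lborel) = ennreal (c ^ DIM('a)) * (\<integral>\<^sup>+x. f (c *\<^sub>R x) \<partial>lborel)"
proof -
  have "(\<integral>\<^sup>+x. f x \<partial>lborel) = (\<integral>\<^sup>+x. f x \<partial>density (distr lborel borel (\<lambda>x. 0 + c *\<^sub>R x)) (\<lambda>_. \<bar>c\<bar> ^ DIM('a)))"
    using lborel_affine[of c "0::'a"] c by simp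
  also have "\<dots> = ennreal (c ^ DIM('a)) * (\<integral>\<^sup>+x. f (c *\<^sub>R x) \<partial>lborel)"
    using c by (subst nn_integral_density) (auto simp: nn_integral_distr nn_integral_cmult)
  finally show ?thesis .
qed

lemma integral_scale:
  fixes f :: "'a::euclidean_space \<Rightarrow> 'b::{banach,second_countable_topology}"
  assumes c: "c > 0" and f [measurable]: "f \<in> borel_measurable borel"
  shows "(LINT x|lborel. f x) = c ^ DIM('a) *\<^sub>R (LINT x|lborel. f (c *\<^sub>R x))"
proof -
  have "(LINT x|lborel. f x) = (LINT x|density (distr lborel borel (\<lambda>x. 0 + c *\<^sub>R x)) (\<lambda>_. \<bar>c\<bar> ^ DIM('a)). f x)"
    using lborel_affine[of c "0::'a"] c by simp
  also have "\<dots> = c ^ DIM('a) *\<^sub>R (LINT x|lborel. f (c *\<^sub>R x))"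
    using c by (subst integral_density) (auto simp: integral_distr)
  finally show ?thesis .
qed

definition shift_dist :: "('a::euclidean_space \<Rightarrow> 'b::{banach,second_countable_topology}) \<Rightarrow> 'a \<Rightarrow> real" where
  "shift_dist f h = (LINT x|lborel. (norm (f (h + x) - f x))^2)"

text \<open>Stated with sequences, the form in which dominated convergence consumes it.\<close>

definition shift_cont :: "('a::euclidean_space \<Rightarrow> 'b::{banach,second_countable_topology}) \<Rightarrow> bool" where
  "shift_cont f \<longleftrightarrow> (\<forall>h. h \<longlonglongrightarrow> 0 \<longrightarrow> (\<lambda>n::nat. shift_dist f (h n)) \<longlonglongrightarrow> 0)"

lemma shift_dist_nonneg [simp]: "shift_dist f h \<ge> 0" by (simp add: shift_dist_def)

lemma sq_integrable_shift_diff: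
  assumes "sq_integrable lborel f"
  shows "sq_integrable lborel (\<lambda>x. f (h + x) - f x)"
  by (intro sq_integrable_diff sq_integrable_translate assms)

lemma integral_sq_translate:
  fixes f :: "'a::euclidean_space \<Rightarrow> 'b::{banach,second_countable_topology}"
  assumes "sq_integrable lborel f"
  shows "(LINT x|lborel. (norm (f (h + x)))^2) = (LINT x|lborel. (norm (f x))^2)"
  by (rule integral_translate[of "\<lambda>x. (norm (f x))^2"]) (use assms in \<open>auto simp: sq_integrable_def\<close>)

lemma shift_dist_le:
  assumes f: "sq_integrable lborel f"
  shows "shift_dist f h \<le> 4 * (LINT x|lborel. (norm (f x))^2)"
proof -
  have "shift_dist f h \<le> (LINT x|lborel. 2 * (norm (f (h + x)))^2 + 2 * (norm (f x))^2)"
    unfolding shift_dist_def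
    by (rule integral_mono)
      (use sq_integrable_shift_diff[OF f] sq_integrable_translate[OF f] f norm_diff_sq_le in \<open>auto simp: sq_integrable_def\<close>)
  also have "\<dots> = 2 * (LINT x|lborel. (norm (f (h + x)))^2) + 2 * (LINT x|lborel. (norm (f x))^2)"
    using sq_integrable_translate[OF f, of h] f by (simp add: sq_integrable_def)
  finally show ?thesis by (simp add: integral_sq_translate[OF f])
qed

lemma shift_dist_add_le:
  assumes f: "sq_integrable lborel f" and g: "sq_integrable lborel g"
  shows "shift_dist (\<lambda>x. f x + g x) h \<le> 2 * shift_dist f h + 2 * shift_dist g h"
proof -
  have "shift_dist (\<lambda>x. f x + g x) h \<le> (LINT x|lborel. 2 * (norm (f (h + x) - f x))^2 + 2 * (norm (g (h + x) - g x))^2)"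
    unfolding shift_dist_def
  proof (rule integral_mono)
    show "integrable lborel (\<lambda>x. (norm (f (h + x) + g (h + x) - (f x + g x)))^2)"
      using sq_integrable_shift_diff[OF sq_integrable_add[OF f g]] by (simp add: sq_integrable_def)
    show "integrable lborel (\<lambda>x. 2 * (norm (f (h + x) - f x))^2 + 2 * (norm (g (h + x) - g x))^2)"
      using sq_integrable_shift_diff[OF f] sq_integrable_shift_diff[OF g] by (simp add: sq_integrable_def)
    show "(norm (f (h + x) + g (h + x) - (f x + g x)))^2 \<le> 2 * (norm (f (h + x) - f x))^2 + 2 * (norm (g (h + x) - g x))^2" for x
      using norm_add_sq_le[of "f (h + x) - f x" "g (h + x) - g x"] by (simp add: algebra_simps)
  qed
  also have "\<dots> = 2 * shift_dist f h + 2 * shift_dist g h"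
    unfolding shift_dist_def using sq_integrable_shift_diff[OF f] sq_integrable_shift_diff[OF g]
    by (simp add: sq_integrable_def)
  finally show ?thesis .
qed

lemma shift_cont_add:
  assumes f: "sq_integrable lborel f" "shift_cont f" and g: "sq_integrable lborel g" "shift_cont g"
  shows "shift_cont (\<lambda>x. f x + g x)"
  unfolding shift_cont_def
proof (intro allI impI)
  fix h :: "nat \<Rightarrow> 'a" assume h: "h \<longlonglongrightarrow> 0"
  have "(\<lambda>n. 2 * shift_dist f (h n) + 2 * shift_dist g (h n)) \<longlonglongrightarrow> 2 * 0 + 2 * 0"
    using f(2) g(2) h unfolding shift_cont_def by (intro tendsto_intros) auto
  then have L: "(\<lambda>n. 2 * shift_dist f (h n) + 2 * shift_dist g (h n)) \<longlonglongrightarrow> 0" by simp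
  show "(\<lambda>n. shift_dist (\<lambda>x. f x + g x) (h n)) \<longlonglongrightarrow> 0"
    by (rule tendsto_sandwich[OF _ _ tendsto_const L])
       (auto simp: shift_dist_add_le[OF f(1) g(1)])
qed

lemma shift_cont_sum:
  assumes "finite I" "\<And>i. i \<in> I \<Longrightarrow> sq_integrable lborel (f i) \<and> shift_cont (f i)"
  shows "sq_integrable lborel (\<lambda>x. \<Sum>i\<in>I. f i x) \<and> shift_cont (\<lambda>x. \<Sum>i\<in>I. f i x)"
  using assms
proof (induction I rule: finite_induct)
  case empty
  then show ?case by (simp add: sq_integrable_def shift_cont_def shift_dist_def)
next
  case (insert i I)
  then show ?case using shift_cont_add[of "f i" "\<lambda>x. \<Sum>i\<in>I. f i x"] sq_integrable_add[of lborel "f i" "\<lambda>x. \<Sum>i\<in>I. f i x"] by simp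
qed

text \<open>By \<open>shift_dist_le\<close> an L2 remainder stays small under every shift, uniformly
  in \<open>h\<close>; so continuity of translations passes to L2 limits.\<close>

lemma shift_cont_approx:
  assumes f: "sq_integrable lborel f"
    and a: "\<And>e. e > 0 \<Longrightarrow> \<exists>g. sq_integrable lborel g \<and> shift_cont g \<and> (LINT x|lborel. (norm (f x - g x))^2) < e"
  shows "shift_cont f"
  unfolding shift_cont_def
proof (intro allI impI)
  fix h :: "nat \<Rightarrow> 'a" assume h: "h \<longlonglongrightarrow> 0"
  show "(\<lambda>n. shift_dist f (h n)) \<longlonglongrightarrow> 0"
  proof (rule LIMSEQ_I)
    fix e :: real assume e: "e > 0"
    \<comment> \<open>The remainder enters with the factor \<open>2 * 4\<close>, so that
      \<open>e / 16\<close> costs \<open>e / 2\<close>; the other half is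
      \<open>2 * shift_dist g (h n)\<close>.\<close>
    obtain g where g: "sq_integrable lborel g" "shift_cont g" "(LINT x|lborel. (norm (f x - g x))^2) < e / 16"
      using a[of "e/16"] e by auto
    have d: "sq_integrable lborel (\<lambda>x. f x - g x)" by (intro sq_integrable_diff f g)
    have "(\<lambda>n. shift_dist g (h n)) \<longlonglongrightarrow> 0" using g(2) h by (simp add: shift_cont_def)
    moreover have "e / 4 > 0" using e by simp
    ultimately obtain N where N: "\<And>n. n \<ge> N \<Longrightarrow> norm (shift_dist g (h n) - 0) < e / 4"
      using LIMSEQ_D by blast
    have "norm (shift_dist f (h n) - 0) < e" if n: "n \<ge> N" for n
    proof -
      have "shift_dist f (h n) \<le> 2 * shift_dist (\<lambda>x. f x - g x) (h n) + 2 * shift_dist g (h n)"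
        using shift_dist_add_le[OF d g(1), of "h n"] by simp
      also have "\<dots> \<le> 2 * (4 * (LINT x|lborel. (norm (f x - g x))^2)) + 2 * shift_dist g (h n)"
        using shift_dist_le[OF d, of "h n"] by simp
      also have "\<dots> < e"
        using N[OF n] g(3) by simp
      finally show ?thesis by simp
    qed
    then show "\<exists>N. \<forall>n\<ge>N. norm (shift_dist f (h n) - 0) < e" by blast
  qed
qed

lemma sq_integrable_indicator:
  fixes c :: "'b::{banach,second_countable_topology}"
  assumes "A \<in> sets M" "emeasure M A < \<infinity>"
  shows "sq_integrable M (\<lambda>x. indicator A x *\<^sub>R c)"
    "(LINT x|M. (norm (indicator A x *\<^sub>R c))^2) = measure M A * (norm c)^2"
proof -
  have e: "(norm (indicator A x *\<^sub>R c))^2 = indicator A x * (norm c)^2" for x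
    by (auto simp: indicator_def)
  have i: "integrable M (\<lambda>x. indicator A x :: real)" using assms by (simp add: integrable_indicator_iff)
  show "sq_integrable M (\<lambda>x. indicator A x *\<^sub>R c)"
    unfolding sq_integrable_def e using assms i by auto
  show "(LINT x|M. (norm (indicator A x *\<^sub>R c))^2) = measure M A * (norm c)^2"
    unfolding e using assms i sets.sets_into_space[OF assms(1)] by (simp add: Int_absorb2)
qed

text \<open>After expanding the square only the overlap of \<open>U\<close> with its shift has to
  converge. Its integrand converges at every point: by openness inside \<open>U\<close>, and because
  the product is 0 outside. So the boundary of \<open>U\<close> causes no trouble.\<close>

lemma shift_cont_indicator_open:
  fixes U :: "'a::euclidean_space set" and c :: "'b::{banach,second_countable_topology}"
  assumes U: "open U" "emeasure lborel U < \<infinity>"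
  shows "shift_cont (\<lambda>x. indicator U x *\<^sub>R c)"
  unfolding shift_cont_def
proof (intro allI impI)
  fix h :: "nat \<Rightarrow> 'a" assume h: "h \<longlonglongrightarrow> 0"
  have [measurable]: "U \<in> sets borel" using U(1) by auto
  let ?i = "\<lambda>x. indicator U x :: real"
  have i: "integrable lborel ?i" using U by (simp add: integrable_indicator_iff)
  have i2: "integrable lborel (\<lambda>x. ?i (h n + x) * ?i x)" for n
    by (rule Bochner_Integration.integrable_bound[OF i]) (auto simp: indicator_def)
  have it: "integrable lborel (\<lambda>x. ?i (h n + x))" for n using integrable_translate[OF i] .
  have e: "(norm (indicator U (h n + x) *\<^sub>R c - indicator U x *\<^sub>R c))^2
     = (norm c)^2 * (?i (h n + x) + ?i x - 2 * (?i (h n + x) * ?i x))" for n x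
    by (auto simp: indicator_def)
  have S: "shift_dist (\<lambda>x. indicator U x *\<^sub>R c) (h n)
     = (norm c)^2 * ((LINT x|lborel. ?i x) + (LINT x|lborel. ?i x) - 2 * (LINT x|lborel. ?i (h n + x) * ?i x))" for n
  proof -
    have "(LINT x|lborel. ?i (h n + x)) = (LINT x|lborel. ?i x)"
      by (rule integral_translate) auto
    moreover have "shift_dist (\<lambda>x. indicator U x *\<^sub>R c) (h n)
     = (norm c)^2 * ((LINT x|lborel. ?i (h n + x)) + (LINT x|lborel. ?i x) - 2 * (LINT x|lborel. ?i (h n + x) * ?i x))"
      unfolding shift_dist_def e using i i2[of n] it[of n] by simp
    ultimately show ?thesis by simp
  qed
  have "(\<lambda>n. LINT x|lborel. ?i (h n + x) * ?i x) \<longlonglongrightarrow> (LINT x|lborel. ?i x)"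
  proof (rule integral_dominated_convergence)
    show "AE x in lborel. (\<lambda>n. ?i (h n + x) * ?i x) \<longlonglongrightarrow> ?i x"
    proof (rule AE_I2)
      fix x :: 'a
      show "(\<lambda>n. ?i (h n + x) * ?i x) \<longlonglongrightarrow> ?i x"
      proof (cases "x \<in> U")
        case True
        have "(\<lambda>n. h n + x) \<longlonglongrightarrow> 0 + x" by (intro tendsto_intros h)
        then have "\<forall>\<^sub>F n in sequentially. h n + x \<in> U"
          using topological_tendstoD[of "\<lambda>n. h n + x" x] U(1) True by auto
        then have "\<forall>\<^sub>F n in sequentially. ?i (h n + x) * ?i x = ?i x"
          by eventually_elim (auto simp: True)
        then show ?thesis by (rule tendsto_eventually)
      qed auto
    qed
    show "integrable lborel ?i" by (rule i)
  qed (auto simp: indicator_def)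
  then have "(\<lambda>n. shift_dist (\<lambda>x. indicator U x *\<^sub>R c) (h n)) \<longlonglongrightarrow>
     (norm c)^2 * ((LINT x|lborel. ?i x) + (LINT x|lborel. ?i x) - 2 * (LINT x|lborel. ?i x))"
    unfolding S by (intro tendsto_intros)
  then show "(\<lambda>n. shift_dist (\<lambda>x. indicator U x *\<^sub>R c) (h n)) \<longlonglongrightarrow> 0" by simp
qed

text \<open>Outer regularity replaces \<open>A\<close> by an open superset that differs little in
  measure, hence little in L2.\<close>

lemma shift_cont_indicator:
  fixes A :: "'a::euclidean_space set" and c :: "'b::{banach,second_countable_topology}"
  assumes A: "A \<in> sets borel" "emeasure lborel A < \<infinity>"
  shows "shift_cont (\<lambda>x. indicator A x *\<^sub>R c)"
proof (rule shift_cont_approx)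
  show "sq_integrable lborel (\<lambda>x. indicator A x *\<^sub>R c)"
    by (rule sq_integrable_indicator) (use A in auto)
  fix e :: real assume e: "e > 0"
  define \<delta> where "\<delta> = e / ((norm c)^2 + 1)"
  have "(norm c)^2 + 1 > 0" using zero_le_power2[of "norm c"] by linarith
  then have \<delta>: "\<delta> > 0" using e by (simp add: \<delta>_def)
  obtain U where U: "open U" "A \<subseteq> U" "emeasure lborel (U - A) < ennreal \<delta>"
    using outer_regular_lborel[OF A(1) \<delta>] by blast
  have [measurable]: "U \<in> sets borel" "A \<in> sets borel" using U(1) A by auto
  have "emeasure lborel U = emeasure lborel (A \<union> (U - A))" using U(2) by (simp add: Un_absorb1)
  also have "\<dots> \<le> emeasure lborel A + emeasure lborel (U - A)" by (rule emeasure_subadditive) auto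
  also have "\<dots> < \<infinity>" using A(2) U(3) by (simp add: less_top[symmetric]) (metis ennreal_less_top less_trans less_irrefl)
  finally have Uf: "emeasure lborel U < \<infinity>" .
  have UAf: "emeasure lborel (U - A) < \<infinity>" using U(3) by (rule less_trans) simp
  have d: "indicator A x *\<^sub>R c - indicator U x *\<^sub>R c = indicator (U - A) x *\<^sub>R (- c)" for x
    using U(2) by (auto simp: indicator_def)
  have "emeasure lborel (U - A) = ennreal (measure lborel (U - A))"
    using UAf by (intro emeasure_eq_ennreal_measure) auto
  then have mU: "measure lborel (U - A) < \<delta>"
    using U(3) by (simp only: ennreal_less_iff[OF measure_nonneg])
  have "(LINT x|lborel. (norm (indicator A x *\<^sub>R c - indicator U x *\<^sub>R c))^2) = measure lborel (U - A) * (norm c)^2"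
    unfolding d using sq_integrable_indicator(2)[of "U - A" lborel "-c"] UAf by simp
  also have "\<dots> \<le> \<delta> * (norm c)^2" using mU by (intro mult_right_mono) auto
  also have "\<dots> < \<delta> * ((norm c)^2 + 1)" using \<delta> by (intro mult_strict_left_mono) auto
  also have "\<dots> = e" using \<open>(norm c)^2 + 1 > 0\<close> by (simp add: \<delta>_def)
  finally have "(LINT x|lborel. (norm (indicator A x *\<^sub>R c - indicator U x *\<^sub>R c))^2) < e" .
  moreover have "sq_integrable lborel (\<lambda>x. indicator U x *\<^sub>R c)"
    by (rule sq_integrable_indicator) (use Uf in auto)
  ultimately show "\<exists>g. sq_integrable lborel g \<and> shift_cont g \<and> (LINT x|lborel. (norm (indicator A x *\<^sub>R c - g x))^2) < e"
    using shift_cont_indicator_open[OF U(1) Uf] by blast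
qed

lemma shift_cont_simple:
  fixes s :: "'a::euclidean_space \<Rightarrow> 'b::{banach,second_countable_topology}"
  assumes s: "simple_function lborel s" "sq_integrable lborel s"
  shows "shift_cont s"
proof -
  have fin: "finite (range s)" using s(1) by (simp add: simple_function_def)
  have m: "s -` {y} \<in> sets borel" for y
    using simple_functionD(2)[OF s(1), of "{y}"] by simp
  have e: "s x = (\<Sum>y\<in>range s - {0}. indicator (s -` {y}) x *\<^sub>R y)" for x
  proof -
    have "(\<Sum>y\<in>range s - {0}. indicator (s -` {y}) x *\<^sub>R y) = (\<Sum>y\<in>range s - {0}. if y = s x then y else 0)"
      by (intro sum.cong) (auto simp: indicator_def)
    also have "\<dots> = s x" using fin by (subst sum.delta) auto
    finally show ?thesis ..
  qed
  have "sq_integrable lborel (\<lambda>x. indicator (s -` {y}) x *\<^sub>R y) \<and> shift_cont (\<lambda>x. indicator (s -` {y}) x *\<^sub>R y)"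
    if y: "y \<in> range s - {0}" for y
  proof -
    have "ennreal ((norm y)^2) * emeasure lborel (s -` {y}) = (\<integral>\<^sup>+x. ennreal ((norm y)^2) * indicator (s -` {y}) x \<partial>lborel)"
      using m by (simp add: nn_integral_cmult_indicator)
    also have "\<dots> \<le> (\<integral>\<^sup>+x. ennreal ((norm (s x))^2) \<partial>lborel)"
      by (rule nn_integral_mono) (auto simp: indicator_def)
    also have "\<dots> < \<infinity>" using s(2) by (auto simp: sq_integrable_def integrable_iff_bounded)
    finally have "emeasure lborel (s -` {y}) < \<infinity>"
      using y by (auto simp: ennreal_mult_less_top)
    then show ?thesis using shift_cont_indicator[OF m] sq_integrable_indicator(1)[of "s -` {y}" lborel y] m by auto
  qed
  then have "shift_cont (\<lambda>x. \<Sum>y\<in>range s - {0}. indicator (s -` {y}) x *\<^sub>R y)"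
    using shift_cont_sum[of "range s - {0}" "\<lambda>y x. indicator (s -` {y}) x *\<^sub>R y"] fin by blast
  moreover have "s = (\<lambda>x. \<Sum>y\<in>range s - {0}. indicator (s -` {y}) x *\<^sub>R y)"
    by (rule ext) (rule e)
  ultimately show ?thesis by (simp only:)
qed

theorem shift_cont:
  fixes f :: "'a::euclidean_space \<Rightarrow> 'b::{banach,second_countable_topology}"
  assumes f: "sq_integrable lborel f"
  shows "shift_cont f"
proof (rule shift_cont_approx[OF f])
  fix e :: real assume e: "e > 0"
  have fm [measurable]: "f \<in> borel_measurable borel" using f by (simp add: sq_integrable_def)
  obtain s where s: "\<And>i. simple_function lborel (s i)" "\<And>x. (\<lambda>i. s i x) \<longlonglongrightarrow> f x"
    "\<And>i x. norm (s i x) \<le> 2 * norm (f x)"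
    using borel_measurable_implies_sequence_metric[of f lborel 0] by auto
  have sm [measurable]: "s i \<in> borel_measurable borel" for i
    using borel_measurable_simple_function[OF s(1)] by simp
  have b: "(norm (s i x))^2 \<le> 4 * (norm (f x))^2" for i x
    using power_mono[OF s(3)[of i x], of 2] by (simp add: power_mult_distrib)
  have ssq: "sq_integrable lborel (s i)" for i
    by (rule sq_integrable_bound[of _ "\<lambda>x. 4 * (norm (f x))^2"]) (use f b in \<open>auto simp: sq_integrable_def\<close>)
  have "(\<lambda>i. LINT x|lborel. (norm (f x - s i x))^2) \<longlonglongrightarrow> (LINT x|(lborel::'a measure). (0::real))"
  proof (rule integral_dominated_convergence)
    \<comment> \<open>\<open>10 = 2 + 2 * 4\<close>, from \<open>norm_diff_sq_le\<close> and the
      bound \<open>norm (s i x) \<le> 2 * norm (f x)\<close>.\<close>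
    show "integrable lborel (\<lambda>x. 10 * (norm (f x))^2)" using f by (simp add: sq_integrable_def)
    show "AE x in lborel. (\<lambda>i. (norm (f x - s i x))^2) \<longlonglongrightarrow> 0"
    proof (rule AE_I2)
      fix x
      have "(\<lambda>i. (norm (f x - s i x))^2) \<longlonglongrightarrow> (norm (f x - f x))^2"
        by (intro tendsto_intros s)
      then show "(\<lambda>i. (norm (f x - s i x))^2) \<longlonglongrightarrow> 0" by simp
    qed
    show "AE x in lborel. norm ((norm (f x - s i x))^2) \<le> 10 * (norm (f x))^2" for i
      using norm_diff_sq_le[of "f _" "s i _"] b[of i] by (intro AE_I2) (smt (verit) real_norm_def abs_of_nonneg zero_le_power2)
  qed auto
  then have "\<forall>\<^sub>F i in sequentially. (LINT x|lborel. (norm (f x - s i x))^2) < e"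
    using e by (intro order_tendstoD(2)) auto
  then obtain i where "(LINT x|lborel. (norm (f x - s i x))^2) < e"
    using eventually_happens' sequentially_bot by blast
  then show "\<exists>g. sq_integrable lborel g \<and> shift_cont g \<and> (LINT x|lborel. (norm (f x - g x))^2) < e"
    using ssq shift_cont_simple[OF s(1) ssq] by blast
qed

lemma shift_dist_measurable [measurable]:
  fixes f :: "'a::euclidean_space \<Rightarrow> 'b::{banach,second_countable_topology}"
  assumes [measurable]: "f \<in> borel_measurable borel"
  shows "shift_dist f \<in> borel_measurable borel"
  unfolding shift_dist_def by measurable

lemma heat_scale:
  fixes x :: "'a::euclidean_space"
  assumes "t > 0"
  shows "sqrt t ^ DIM('a) * heat t (sqrt t *\<^sub>R x) = heat 1 x"
proof -
  have "sqrt t ^ DIM('a) = t powr (real DIM('a) / 2)"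
    using assms by (simp add: powr_half_sqrt[symmetric] powr_realpow[symmetric] powr_powr)
  moreover have "(2 * pi * t) powr (- real DIM('a) / 2) = (2 * pi) powr (- real DIM('a) / 2) * t powr (- (real DIM('a) / 2))"
    using assms by (simp add: powr_mult)
  moreover have "t powr (real DIM('a) / 2) * t powr (- (real DIM('a) / 2)) = 1"
    using assms by (simp add: powr_add[symmetric])
  ultimately show ?thesis using assms by (simp add: heat_def power_mult_distrib)
qed

text \<open>The heat kernel is an approximate identity: substituting
  \<open>sqrt t *\<^sub>R h\<close> freezes the Gaussian at time 1 and moves the smallness of
  \<open>t\<close> into the shift, where continuity of translations applies.\<close>

lemma heat_shift_dist_tendsto:
  fixes f :: "'a::euclidean_space \<Rightarrow> 'b::{banach,second_countable_topology}"
  assumes f: "sq_integrable lborel f" and t: "t \<longlonglongrightarrow> 0" "\<And>n. t n > 0"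
  shows "(\<lambda>n. LINT h|lborel. heat (t n) h * shift_dist f h) \<longlonglongrightarrow> 0"
proof -
  have [measurable]: "f \<in> borel_measurable borel" using f by (simp add: sq_integrable_def)
  define B where "B = 4 * (LINT x|lborel. (norm (f x))^2)"
  have e: "(LINT h|lborel. heat (t n) h * shift_dist f h) = (LINT h|lborel. heat 1 h * shift_dist f (sqrt (t n) *\<^sub>R h))" for n
  proof -
    have "(LINT h|lborel. heat (t n) h * shift_dist f h)
       = sqrt (t n) ^ DIM('a) *\<^sub>R (LINT h|lborel. heat (t n) (sqrt (t n) *\<^sub>R h) * shift_dist f (sqrt (t n) *\<^sub>R h))"
      by (rule integral_scale) (use t(2) in auto)
    also have "\<dots> = (LINT h|lborel. (sqrt (t n) ^ DIM('a) * heat (t n) (sqrt (t n) *\<^sub>R h)) * shift_dist f (sqrt (t n) *\<^sub>R h))"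
      by (simp add: mult.assoc)
    finally show ?thesis by (simp only: heat_scale[OF t(2)])
  qed
  have "(\<lambda>n. LINT h|lborel. heat 1 h * shift_dist f (sqrt (t n) *\<^sub>R h)) \<longlonglongrightarrow> (LINT h|(lborel::'a measure). (0::real))"
  proof (rule integral_dominated_convergence)
    show "integrable lborel (\<lambda>h::'a. B * heat 1 h)" using heat_integral(1)[of 1, where 'a='a] by simp
    show "AE h in lborel. (\<lambda>n. heat 1 h * shift_dist f (sqrt (t n) *\<^sub>R h)) \<longlonglongrightarrow> 0"
    proof (rule AE_I2)
      fix h :: 'a
      have "(\<lambda>n. sqrt (t n) *\<^sub>R h) \<longlonglongrightarrow> sqrt 0 *\<^sub>R h" by (intro tendsto_intros t)
      then have "(\<lambda>n. shift_dist f (sqrt (t n) *\<^sub>R h)) \<longlonglongrightarrow> 0"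
        using shift_cont[OF f] by (simp add: shift_cont_def)
      then show "(\<lambda>n. heat 1 h * shift_dist f (sqrt (t n) *\<^sub>R h)) \<longlonglongrightarrow> 0"
        by (rule tendsto_mult_right_zero)
    qed
    show "AE h in lborel. norm (heat 1 h * shift_dist f (sqrt (t n) *\<^sub>R h)) \<le> B * heat 1 h" for n
      using shift_dist_le[OF f] by (intro AE_I2) (auto simp: abs_mult B_def mult.commute intro!: mult_left_mono)
  qed auto
  then show ?thesis unfolding e by simp
qed

section \<open>The Fourier transform on L1 and the Plancherel identity\<close>

lemma lborel_prod_mult_integrable:
  fixes f :: "'a::euclidean_space \<Rightarrow> 'c::{real_normed_field,banach,second_countable_topology}"
    and g :: "'b::euclidean_space \<Rightarrow> 'c"
  assumes f: "integrable lborel f" and g: "integrable lborel g"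
  shows "integrable (lborel \<Otimes>\<^sub>M lborel) (\<lambda>(x, y). f x * g y)"
proof (rule lborel_pair.Fubini_integrable)
  have [measurable]: "f \<in> borel_measurable borel" "g \<in> borel_measurable borel" using f g by auto
  show "(\<lambda>(x, y). f x * g y) \<in> borel_measurable (lborel \<Otimes>\<^sub>M lborel)" by measurable
  show "integrable lborel (\<lambda>x. LINT y|lborel. norm (case (x, y) of (x, y) \<Rightarrow> f x * g y))"
    using f by (auto simp: norm_mult intro!: integrable_norm)
  show "AE x in lborel. integrable lborel (\<lambda>y. case (x, y) of (x, y) \<Rightarrow> f x * g y)"
    using g by auto
qed

lemma bounded_fourier_swap:
  fixes a b :: "'a::euclidean_space \<Rightarrow> complex"
  assumes a: "integrable lborel a" and b: "integrable lborel b"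
    and k: "(\<lambda>(x, y). k x y) \<in> borel_measurable (borel \<Otimes>\<^sub>M borel)" "\<And>x y. norm (k x y :: complex) \<le> 1"
  shows "(LINT x|lborel. a x * (LINT y|lborel. k x y * b y)) = (LINT y|lborel. (LINT x|lborel. k x y * a x) * b y)"
    and "integrable lborel (\<lambda>y. (LINT x|lborel. k x y * a x) * b y)"
proof -
  have [measurable]: "a \<in> borel_measurable borel" "b \<in> borel_measurable borel" using a b by auto
  note [measurable] = k(1)
  have km: "(\<lambda>z. k (fst z) (snd z)) \<in> borel_measurable (borel \<Otimes>\<^sub>M borel)"
    using k(1) by (simp add: case_prod_beta')
  have i: "integrable (lborel \<Otimes>\<^sub>M lborel) (\<lambda>(x, y). k x y * (a x * b y))"
  proof (rule Bochner_Integration.integrable_bound[OF lborel_prod_mult_integrable[OF a b]])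
    show "(\<lambda>(x, y). k x y * (a x * b y)) \<in> borel_measurable (lborel \<Otimes>\<^sub>M lborel)"
      unfolding case_prod_beta' using km by measurable
    show "AE z in lborel \<Otimes>\<^sub>M lborel. norm (case z of (x, y) \<Rightarrow> k x y * (a x * b y)) \<le> norm (case z of (x, y) \<Rightarrow> a x * b y)"
      using k(2) by (intro AE_I2) (auto simp: norm_mult case_prod_beta' intro!: mult_left_le_one_le)
  qed
  have "(LINT x|lborel. a x * (LINT y|lborel. k x y * b y)) = (LINT x|lborel. LINT y|lborel. k x y * (a x * b y))"
    by (subst integral_mult_right_zero[symmetric]) (simp add: mult_ac)
  also have "\<dots> = (LINT y|lborel. LINT x|lborel. k x y * (a x * b y))"
    using lborel_pair.Fubini_integral[OF i] by simp
  also have "\<dots> = (LINT y|lborel. (LINT x|lborel. k x y * a x) * b y)"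
    by (subst integral_mult_left_zero[symmetric]) (simp add: mult_ac)
  finally show "(LINT x|lborel. a x * (LINT y|lborel. k x y * b y)) = (LINT y|lborel. (LINT x|lborel. k x y * a x) * b y)" .
  have "integrable lborel (\<lambda>y. LINT x|lborel. k x y * (a x * b y))"
    using lborel_pair.integrable_snd[OF i] by simp
  also have "(\<lambda>y. LINT x|lborel. k x y * (a x * b y)) = (\<lambda>y. (LINT x|lborel. k x y * a x) * b y)"
    by (subst integral_mult_left_zero[symmetric]) (simp add: mult_ac)
  finally show "integrable lborel (\<lambda>y. (LINT x|lborel. k x y * a x) * b y)" .
qed

lemma cis_inner_measurable: "(\<lambda>(x, y). cis (- (x \<bullet> y))) \<in> borel_measurable (borel \<Otimes>\<^sub>M (borel :: 'a::euclidean_space measure))"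
proof -
  have "continuous_on UNIV (\<lambda>z::'a \<times> 'a. cis (- (fst z \<bullet> snd z)))"
    unfolding cis_conv_exp by (intro continuous_intros)
  then have "(\<lambda>z::'a \<times> 'a. cis (- (fst z \<bullet> snd z))) \<in> borel_measurable borel"
    by (rule borel_measurable_continuous_onI)
  then show ?thesis by (simp add: case_prod_beta' borel_prod)
qed

lemma cnj_measurable [measurable]: "cnj \<in> borel_measurable borel"
  by (intro borel_measurable_continuous_onI continuous_intros)

lemma fourier_L1_measurable [measurable]:
  fixes \<phi> :: "'a::euclidean_space \<Rightarrow> complex"
  assumes [measurable]: "\<phi> \<in> borel_measurable borel"
  shows "fourier_L1 \<phi> \<in> borel_measurable borel"
proof -
  have "continuous_on UNIV (\<lambda>z::'a \<times> 'a. cis (- (snd z \<bullet> fst z)))"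
    unfolding cis_conv_exp by (intro continuous_intros)
  then have [measurable]: "(\<lambda>z::'a \<times> 'a. cis (- (snd z \<bullet> fst z))) \<in> borel_measurable (borel \<Otimes>\<^sub>M borel)"
    using borel_measurable_continuous_onI by (fastforce simp: borel_prod)
  have "(\<lambda>(\<xi>, x). cis (- (x \<bullet> \<xi>)) * \<phi> x) \<in> borel_measurable (borel \<Otimes>\<^sub>M lborel)"
    unfolding case_prod_beta' by measurable
  then have "(\<lambda>\<xi>. LINT x|lborel. cis (- (x \<bullet> \<xi>)) * \<phi> x) \<in> borel_measurable borel"
    by (rule lborel.borel_measurable_lebesgue_integral)
  then show ?thesis unfolding fourier_L1_def by measurable
qed

lemma fourier_L1_bound:
  fixes \<phi> :: "'a::euclidean_space \<Rightarrow> complex"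
  shows "norm (fourier_L1 \<phi> \<xi>) \<le> (2 * pi) powr (- real DIM('a) / 2) * (LINT x|lborel. norm (\<phi> x))"
proof -
  have "norm (LINT x|lborel. cis (- (x \<bullet> \<xi>)) * \<phi> x) \<le> (LINT x|lborel. norm (cis (- (x \<bullet> \<xi>)) * \<phi> x))"
    by (rule integral_norm_bound)
  then show ?thesis unfolding fourier_L1_def by (simp add: norm_mult mult_left_mono)
qed

lemma fourier_integrand_integrable:
  fixes \<phi> :: "'a::euclidean_space \<Rightarrow> complex"
  assumes "integrable lborel \<phi>"
  shows "integrable lborel (\<lambda>x. cis (- (x \<bullet> \<xi>)) * \<phi> x)"
proof (rule Bochner_Integration.integrable_bound[OF assms])
  have "continuous_on UNIV (\<lambda>x::'a. cis (- (x \<bullet> \<xi>)))"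
    unfolding cis_conv_exp by (intro continuous_intros)
  then have [measurable]: "(\<lambda>x::'a. cis (- (x \<bullet> \<xi>))) \<in> borel_measurable borel"
    by (rule borel_measurable_continuous_onI)
  have [measurable]: "\<phi> \<in> borel_measurable borel" using assms by auto
  show "(\<lambda>x. cis (- (x \<bullet> \<xi>)) * \<phi> x) \<in> borel_measurable lborel" by measurable
qed (auto simp: norm_mult)

lemma fourier_L1_add:
  fixes \<phi> \<psi> :: "'a::euclidean_space \<Rightarrow> complex"
  assumes "integrable lborel \<phi>" "integrable lborel \<psi>"
  shows "fourier_L1 (\<lambda>x. \<phi> x + c * \<psi> x) \<xi> = fourier_L1 \<phi> \<xi> + c * fourier_L1 \<psi> \<xi>"
proof -
  have "(LINT x|lborel. cis (- (x \<bullet> \<xi>)) * (\<phi> x + c * \<psi> x))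
     = (LINT x|lborel. cis (- (x \<bullet> \<xi>)) * \<phi> x + c * (cis (- (x \<bullet> \<xi>)) * \<psi> x))"
    by (simp add: algebra_simps)
  also have "\<dots> = (LINT x|lborel. cis (- (x \<bullet> \<xi>)) * \<phi> x) + c * (LINT x|lborel. cis (- (x \<bullet> \<xi>)) * \<psi> x)"
    using assms[THEN fourier_integrand_integrable] by simp
  finally show ?thesis unfolding fourier_L1_def by (simp add: algebra_simps)
qed

text \<open>The multiplication formula: Fubini for the kernel
  \<open>cis (- (y \<bullet> x))\<close>, which is symmetric in its two arguments.\<close>

lemma fourier_L1_swap:
  fixes a b :: "'a::euclidean_space \<Rightarrow> complex"
  assumes "integrable lborel a" "integrable lborel b"
  shows "(LINT x|lborel. a x * fourier_L1 b x) = (LINT y|lborel. fourier_L1 a y * b y)"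
proof -
  have km: "(\<lambda>(x, y). cis (- (y \<bullet> x))) \<in> borel_measurable (borel \<Otimes>\<^sub>M (borel :: 'a measure))"
    using cis_inner_measurable[where 'a='a] by (simp add: inner_commute)
  have "(LINT x|lborel. a x * (LINT y|lborel. cis (- (y \<bullet> x)) * b y)) = (LINT y|lborel. (LINT x|lborel. cis (- (y \<bullet> x)) * a x) * b y)"
    by (rule bounded_fourier_swap[OF assms km]) simp
  moreover have "(LINT x|lborel. a x * fourier_L1 b x) = complex_of_real ((2 * pi) powr (- real DIM('a) / 2)) *
      (LINT x|lborel. a x * (LINT y|lborel. cis (- (y \<bullet> x)) * b y))"
    by (subst integral_mult_right_zero[symmetric]) (simp add: fourier_L1_def mult.left_commute)
  moreover have "(LINT y|lborel. fourier_L1 a y * b y) = complex_of_real ((2 * pi) powr (- real DIM('a) / 2)) *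
      (LINT y|lborel. (LINT x|lborel. cis (- (y \<bullet> x)) * a x) * b y)"
    by (subst integral_mult_right_zero[symmetric]) (simp add: fourier_L1_def mult.assoc inner_commute)
  ultimately show ?thesis by simp
qed

text \<open>Modulated Gaussians are the test functions of this section: their transforms are
  multiples of heat kernels centred at an arbitrary point \<open>\<eta>\<close>.\<close>

lemma fourier_L1_gauss:
  fixes \<eta> :: "'a::euclidean_space"
  assumes t: "t > 0"
  shows "integrable lborel (\<lambda>x. cis (x \<bullet> \<eta>) * complex_of_real (exp (- t * (norm x)^2 / 2)))"
    and "fourier_L1 (\<lambda>x. cis (x \<bullet> \<eta>) * complex_of_real (exp (- t * (norm x)^2 / 2))) \<xi>
     = complex_of_real ((2 * pi) powr (real DIM('a) / 2) * heat t (\<xi> - \<eta>))"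
proof -
  \<comment> \<open>A Gaussian is a multiple of the heat kernel at the inverse time
    \<open>1/t\<close>, so its transform is already known.\<close>
  have c: "exp (- t * (norm x)^2 / 2) = (2 * pi / t) powr (real DIM('a) / 2) * heat (1/t) x" for x :: 'a
    using t by (simp add: heat_def powr_minus field_simps)
  have i: "integrable lborel (\<lambda>x. cis (x \<bullet> \<zeta>) * complex_of_real (exp (- t * (norm x)^2 / 2)))" for \<zeta> :: 'a
    unfolding c using integrable_mult_right[OF heat_fourier(1)[of "1/t" \<zeta>], of "(2 * pi / t) powr (real DIM('a) / 2)"] t
    by (simp add: mult_ac)
  then show "integrable lborel (\<lambda>x. cis (x \<bullet> \<eta>) * complex_of_real (exp (- t * (norm x)^2 / 2)))" .
  have "(LINT x|lborel. cis (- (x \<bullet> \<xi>)) * (cis (x \<bullet> \<eta>) * complex_of_real (exp (- t * (norm x)^2 / 2))))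
     = (LINT x|lborel. complex_of_real ((2 * pi / t) powr (real DIM('a) / 2)) * (cis (x \<bullet> (\<eta> - \<xi>)) * complex_of_real (heat (1/t) x)))"
  proof (rule Bochner_Integration.integral_cong[OF refl])
    fix x :: 'a
    have "cis (- (x \<bullet> \<xi>)) * cis (x \<bullet> \<eta>) = cis (x \<bullet> (\<eta> - \<xi>))"
      by (simp add: cis_mult inner_diff_right)
    then have "cis (- (x \<bullet> \<xi>)) * (cis (x \<bullet> \<eta>) * complex_of_real (exp (- t * (norm x)^2 / 2)))
      = cis (x \<bullet> (\<eta> - \<xi>)) * complex_of_real (exp (- t * (norm x)^2 / 2))"
      by (simp only: mult.assoc[symmetric])
    then show "cis (- (x \<bullet> \<xi>)) * (cis (x \<bullet> \<eta>) * complex_of_real (exp (- t * (norm x)^2 / 2)))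
      = complex_of_real ((2 * pi / t) powr (real DIM('a) / 2)) * (cis (x \<bullet> (\<eta> - \<xi>)) * complex_of_real (heat (1/t) x))"
      by (simp only: c of_real_mult mult.left_commute)
  qed
  also have "\<dots> = complex_of_real ((2 * pi / t) powr (real DIM('a) / 2)) * complex_of_real (exp (- (1/t) * (norm (\<eta> - \<xi>))^2 / 2))"
    using t by (subst integral_mult_right_zero, subst heat_fourier(2)) auto
  also have "\<dots> = complex_of_real ((2 * pi) powr real DIM('a) * heat t (\<xi> - \<eta>))"
  proof -
    have "(2 * pi / t) powr (real DIM('a) / 2) = (2 * pi) powr real DIM('a) * (2 * pi * t) powr (- real DIM('a) / 2)"
    proof -
      have "(2 * pi * t) powr (- real DIM('a) / 2) = (2 * pi) powr (- real DIM('a) / 2) * t powr (- real DIM('a) / 2)"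
        using t by (simp add: powr_mult)
      moreover have "(2 * pi) powr real DIM('a) * (2 * pi) powr (- real DIM('a) / 2) = (2 * pi) powr (real DIM('a) / 2)"
        by (simp add: powr_add[symmetric])
      moreover have "(2 * pi / t) powr (real DIM('a) / 2) = (2 * pi) powr (real DIM('a) / 2) * t powr (- real DIM('a) / 2)"
        using t by (simp add: powr_divide powr_minus_divide)
      ultimately show ?thesis by (simp add: mult.assoc[symmetric])
    qed
    then show ?thesis using t by (simp add: heat_def norm_minus_commute)
  qed
  finally have "(LINT x|lborel. cis (- (x \<bullet> \<xi>)) * (cis (x \<bullet> \<eta>) * complex_of_real (exp (- t * (norm x)^2 / 2)))) = complex_of_real ((2 * pi) powr real DIM('a) * heat t (\<xi> - \<eta>))" .
  moreover have "(2 * pi) powr (- real DIM('a) / 2) * (2 * pi) powr real DIM('a) = (2 * pi) powr (real DIM('a) / 2)"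
    by (simp add: powr_add[symmetric])
  ultimately show "fourier_L1 (\<lambda>x. cis (x \<bullet> \<eta>) * complex_of_real (exp (- t * (norm x)^2 / 2))) \<xi>
     = complex_of_real ((2 * pi) powr (real DIM('a) / 2) * heat t (\<xi> - \<eta>))"
    unfolding fourier_L1_def by (simp only: of_real_mult[symmetric] mult.assoc[symmetric])
qed

text \<open>By polarisation, the pairing of \<open>\<phi>\<close> with its own heat smoothing is the
  squared norm minus half an average of shift distances. That average vanishes as \<open>t\<close>
  tends to 0, which takes the place of an inversion theorem.\<close>

lemma heat_autocorrelation:
  fixes \<phi> :: "'a::euclidean_space \<Rightarrow> complex"
  assumes \<phi>: "sq_integrable lborel \<phi>" and t: "t > 0"
  shows "(LINT x|lborel. \<phi> x * (LINT y|lborel. complex_of_real (heat t (y - x)) * cnj (\<phi> y)))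
     = (LINT h|lborel. complex_of_real (heat t h) * (LINT x|lborel. \<phi> x * cnj (\<phi> (h + x))))"
    and "Re (LINT h|lborel. complex_of_real (heat t h) * (LINT x|lborel. \<phi> x * cnj (\<phi> (h + x))))
     = (LINT x|lborel. (norm (\<phi> x))^2) - (LINT h|lborel. heat t h * shift_dist \<phi> h) / 2"
proof -
  have [measurable]: "\<phi> \<in> borel_measurable borel" using \<phi> by (simp add: sq_integrable_def)
  let ?B = "LINT x|lborel. (norm (\<phi> x))^2"
  have sc: "sq_integrable lborel (\<lambda>x. cnj (\<phi> (h + x)))" for h
    unfolding sq_integrable_def
  proof
    show "(\<lambda>x. cnj (\<phi> (h + x))) \<in> borel_measurable lborel" by measurable
  qed (use sq_integrable_translate[OF \<phi>, of h] in \<open>simp add: sq_integrable_def\<close>)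
  have pi: "integrable lborel (\<lambda>x. \<phi> x * cnj (\<phi> (h + x)))" for h
    by (rule sq_integrable_prod[OF \<phi> sc])
  have nb: "(LINT x|lborel. norm (\<phi> x) * norm (\<phi> (h + x))) \<le> 2 * ?B" for h
  proof -
    have "(LINT x|lborel. norm (\<phi> x) * norm (\<phi> (h + x))) \<le> (LINT x|lborel. (norm (\<phi> x))^2 + (norm (\<phi> (h + x)))^2)"
    proof (rule integral_mono)
      show "integrable lborel (\<lambda>x. norm (\<phi> x) * norm (\<phi> (h + x)))"
        using integrable_norm[OF pi[of h]] by (simp add: norm_mult)
      show "integrable lborel (\<lambda>x. (norm (\<phi> x))^2 + (norm (\<phi> (h + x)))^2)"
        using \<phi> sq_integrable_translate[OF \<phi>] by (simp add: sq_integrable_def)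
      show "norm (\<phi> x) * norm (\<phi> (h + x)) \<le> (norm (\<phi> x))^2 + (norm (\<phi> (h + x)))^2" for x
        using norm_mult_le_sq[of "\<phi> x" "\<phi> (h + x)"] by (simp add: norm_mult)
    qed
    also have "\<dots> = 2 * ?B"
      using \<phi> sq_integrable_translate[OF \<phi>, of h] integral_sq_translate[OF \<phi>, of h] by (simp add: sq_integrable_def)
    finally show ?thesis .
  qed
  have i: "integrable (lborel \<Otimes>\<^sub>M lborel) (\<lambda>(h, x). complex_of_real (heat t h) * (\<phi> x * cnj (\<phi> (h + x))))"
  proof (rule lborel_pair.Fubini_integrable)
    show "(\<lambda>(h, x). complex_of_real (heat t h) * (\<phi> x * cnj (\<phi> (h + x)))) \<in> borel_measurable (lborel \<Otimes>\<^sub>M lborel)"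
      by measurable
    show "AE h in lborel. integrable lborel (\<lambda>x. case (h, x) of (h, x) \<Rightarrow> complex_of_real (heat t h) * (\<phi> x * cnj (\<phi> (h + x))))"
      using pi by simp
    show "integrable lborel (\<lambda>h. LINT x|lborel. norm (case (h, x) of (h, x) \<Rightarrow> complex_of_real (heat t h) * (\<phi> x * cnj (\<phi> (h + x)))))"
    proof (rule Bochner_Integration.integrable_bound)
      show "integrable lborel (\<lambda>h::'a. heat t h * (2 * ?B))" using heat_integral(1)[OF t, where 'a='a] by simp
      show "(\<lambda>h. LINT x|lborel. norm (case (h, x) of (h, x) \<Rightarrow> complex_of_real (heat t h) * (\<phi> x * cnj (\<phi> (h + x))))) \<in> borel_measurable lborel"
        by measurable
      show "AE h in lborel. norm (LINT x|lborel. norm (case (h, x) of (h, x) \<Rightarrow> complex_of_real (heat t h) * (\<phi> x * cnj (\<phi> (h + x))))) \<le> norm (heat t h * (2 * ?B))"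
      proof (rule AE_I2)
        fix h :: 'a
        have "(LINT x|lborel. norm (case (h, x) of (h, x) \<Rightarrow> complex_of_real (heat t h) * (\<phi> x * cnj (\<phi> (h + x))))) = heat t h * (LINT x|lborel. norm (\<phi> x) * norm (\<phi> (h + x)))"
          by (simp add: norm_mult)
        then show "norm (LINT x|lborel. norm (case (h, x) of (h, x) \<Rightarrow> complex_of_real (heat t h) * (\<phi> x * cnj (\<phi> (h + x))))) \<le> norm (heat t h * (2 * ?B))"
          using mult_left_mono[OF nb[of h] heat_nonneg[of t h]] by (simp add: abs_mult)
      qed
    qed
  qed
  have "(LINT x|lborel. \<phi> x * (LINT y|lborel. complex_of_real (heat t (y - x)) * cnj (\<phi> y)))
    = (LINT x|lborel. LINT h|lborel. complex_of_real (heat t h) * (\<phi> x * cnj (\<phi> (h + x))))"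
  proof (rule Bochner_Integration.integral_cong[OF refl])
    fix x
    have "(LINT y|lborel. complex_of_real (heat t (y - x)) * cnj (\<phi> y)) = (LINT h|lborel. complex_of_real (heat t h) * cnj (\<phi> (h + x)))"
      using integral_translate[of "\<lambda>y. complex_of_real (heat t (y - x)) * cnj (\<phi> y)" x] by (simp add: add.commute)
    then show "\<phi> x * (LINT y|lborel. complex_of_real (heat t (y - x)) * cnj (\<phi> y)) = (LINT h|lborel. complex_of_real (heat t h) * (\<phi> x * cnj (\<phi> (h + x))))"
      by (simp only: integral_mult_right_zero[symmetric] mult.left_commute)
  qed
  also have "\<dots> = (LINT h|lborel. LINT x|lborel. complex_of_real (heat t h) * (\<phi> x * cnj (\<phi> (h + x))))"
    using lborel_pair.Fubini_integral[OF i] by simp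
  also have "\<dots> = (LINT h|lborel. complex_of_real (heat t h) * (LINT x|lborel. \<phi> x * cnj (\<phi> (h + x))))"
    by simp
  finally show "(LINT x|lborel. \<phi> x * (LINT y|lborel. complex_of_real (heat t (y - x)) * cnj (\<phi> y)))
     = (LINT h|lborel. complex_of_real (heat t h) * (LINT x|lborel. \<phi> x * cnj (\<phi> (h + x))))" .
  have re: "Re (LINT x|lborel. \<phi> x * cnj (\<phi> (h + x))) = ?B - shift_dist \<phi> h / 2" for h
  proof -
    have p: "Re (a * cnj b) = ((norm a)^2 + (norm b)^2 - (norm (b - a))^2) / 2" for a b
      unfolding cmod_power2 by (simp add: power2_eq_square algebra_simps)
    have "Re (LINT x|lborel. \<phi> x * cnj (\<phi> (h + x))) = (LINT x|lborel. Re (\<phi> x * cnj (\<phi> (h + x))))"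
      using integral_Re[OF pi] by simp
    also have "\<dots> = (LINT x|lborel. ((norm (\<phi> x))^2 + (norm (\<phi> (h + x)))^2 - (norm (\<phi> (h + x) - \<phi> x))^2) / 2)"
      by (simp only: p)
    also have "\<dots> = (?B + (LINT x|lborel. (norm (\<phi> (h + x)))^2) - shift_dist \<phi> h) / 2"
      unfolding shift_dist_def
      using \<phi> sq_integrable_translate[OF \<phi>, of h] sq_integrable_shift_diff[OF \<phi>, of h] by (simp add: sq_integrable_def)
    finally show ?thesis unfolding integral_sq_translate[OF \<phi>] by simp
  qed
  have ih: "integrable lborel (\<lambda>h. complex_of_real (heat t h) * (LINT x|lborel. \<phi> x * cnj (\<phi> (h + x))))"
    using lborel_pair.integrable_fst[OF i] by simp
  have is': "integrable lborel (\<lambda>h. heat t h * shift_dist \<phi> h)"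
  proof (rule Bochner_Integration.integrable_bound)
    show "integrable lborel (\<lambda>h::'a. heat t h * (4 * ?B))" using heat_integral(1)[OF t, where 'a='a] by simp
    show "AE h in lborel. norm (heat t h * shift_dist \<phi> h) \<le> norm (heat t h * (4 * ?B))"
      using shift_dist_le[OF \<phi>] by (intro AE_I2) (auto simp: abs_mult intro!: mult_left_mono)
  qed auto
  have "Re (LINT h|lborel. complex_of_real (heat t h) * (LINT x|lborel. \<phi> x * cnj (\<phi> (h + x))))
    = (LINT h|lborel. Re (complex_of_real (heat t h) * (LINT x|lborel. \<phi> x * cnj (\<phi> (h + x)))))"
    using integral_Re[OF ih] by simp
  also have "\<dots> = (LINT h|lborel. heat t h * ?B - (heat t h * shift_dist \<phi> h) / 2)"
    by (simp add: re algebra_simps)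
  also have "\<dots> = ?B - (LINT h|lborel. heat t h * shift_dist \<phi> h) / 2"
    using heat_integral[OF t, where 'a='a] is' by simp
  finally show "Re (LINT h|lborel. complex_of_real (heat t h) * (LINT x|lborel. \<phi> x * cnj (\<phi> (h + x))))
     = ?B - (LINT h|lborel. heat t h * shift_dist \<phi> h) / 2" .
qed

text \<open>The Gaussian weight makes the squared transform integrable before anything is known
  about its decay. The multiplication formula then moves one of the two transforms across, where it
  becomes a heat smoothing of \<open>cnj \<phi>\<close>.\<close>

lemma fourier_L1_weighted:
  fixes \<phi> :: "'a::euclidean_space \<Rightarrow> complex"
  assumes \<phi>1: "integrable lborel \<phi>" and \<phi>2: "sq_integrable lborel \<phi>" and t: "t > 0"
  shows "integrable lborel (\<lambda>\<xi>. exp (- t * (norm \<xi>)^2 / 2) * (cmod (fourier_L1 \<phi> \<xi>))^2)"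
    and "(LINT \<xi>|lborel. exp (- t * (norm \<xi>)^2 / 2) * (cmod (fourier_L1 \<phi> \<xi>))^2)
     = (LINT x|lborel. (norm (\<phi> x))^2) - (LINT h|lborel. heat t h * shift_dist \<phi> h) / 2"
proof -
  have [measurable]: "\<phi> \<in> borel_measurable borel" using \<phi>1 by auto
  let ?e = "\<lambda>\<xi>::'a. complex_of_real (exp (- t * (norm \<xi>)^2 / 2))"
  define C where "C = (2 * pi) powr (- real DIM('a) / 2) * (LINT x|lborel. norm (\<phi> x))"
  have Fb: "cmod (fourier_L1 \<phi> \<xi>) \<le> C" for \<xi> unfolding C_def by (rule fourier_L1_bound)
  have C0: "C \<ge> 0" using order_trans[OF norm_ge_zero Fb] .
  have ei: "integrable lborel ?e" using fourier_L1_gauss(1)[OF t, of 0] by simp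
  define a where "a \<xi> = ?e \<xi> * cnj (fourier_L1 \<phi> \<xi>)" for \<xi>
  have [measurable]: "a \<in> borel_measurable borel" unfolding a_def by measurable
  have ai: "integrable lborel a"
  proof (rule Bochner_Integration.integrable_bound)
    show "integrable lborel (\<lambda>\<xi>. C * ?e \<xi>)" using ei by simp
    show "AE \<xi> in lborel. norm (a \<xi>) \<le> norm (C * ?e \<xi>)"
      using Fb C0 by (intro AE_I2) (auto simp: a_def norm_mult intro!: mult_right_mono)
  qed auto
  \<comment> \<open>The multiplication formula with a Gaussian modulated to \<open>y\<close>,
    followed by conjugation; the powers of \<open>2 * pi\<close> from the two transforms
    cancel.\<close>
  have Fa: "fourier_L1 a y = (LINT z|lborel. complex_of_real (heat t (z - y)) * cnj (\<phi> z))" for y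
  proof -
    let ?g = "\<lambda>x. cis (x \<bullet> y) * ?e x"
    have "(LINT \<xi>|lborel. ?g \<xi> * fourier_L1 \<phi> \<xi>) = (LINT z|lborel. fourier_L1 ?g z * \<phi> z)"
      by (rule fourier_L1_swap[OF fourier_L1_gauss(1)[OF t] \<phi>1])
    also have "\<dots> = (LINT z|lborel. complex_of_real ((2 * pi) powr (real DIM('a) / 2)) * (complex_of_real (heat t (z - y)) * \<phi> z))"
      by (simp only: fourier_L1_gauss(2)[OF t] of_real_mult mult.assoc)
    also have "\<dots> = complex_of_real ((2 * pi) powr (real DIM('a) / 2)) * (LINT z|lborel. complex_of_real (heat t (z - y)) * \<phi> z)"
      by (rule integral_mult_right_zero)
    finally have "complex_of_real ((2 * pi) powr (- real DIM('a) / 2)) * (LINT \<xi>|lborel. ?g \<xi> * fourier_L1 \<phi> \<xi>)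
       = complex_of_real ((2 * pi) powr (- real DIM('a) / 2) * (2 * pi) powr (real DIM('a) / 2)) * (LINT z|lborel. complex_of_real (heat t (z - y)) * \<phi> z)"
      by (simp only: of_real_mult mult.assoc)
    also have "(2 * pi) powr (- real DIM('a) / 2) * (2 * pi) powr (real DIM('a) / 2) = 1"
      by (simp add: powr_add[symmetric])
    finally have "complex_of_real ((2 * pi) powr (- real DIM('a) / 2)) * (LINT \<xi>|lborel. ?g \<xi> * fourier_L1 \<phi> \<xi>) = (LINT z|lborel. complex_of_real (heat t (z - y)) * \<phi> z)"
      by simp
    then have "cnj (complex_of_real ((2 * pi) powr (- real DIM('a) / 2)) * (LINT \<xi>|lborel. ?g \<xi> * fourier_L1 \<phi> \<xi>)) = cnj (LINT z|lborel. complex_of_real (heat t (z - y)) * \<phi> z)"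
      by (rule arg_cong)
    then have "complex_of_real ((2 * pi) powr (- real DIM('a) / 2)) * (LINT \<xi>|lborel. cnj (?g \<xi> * fourier_L1 \<phi> \<xi>)) = (LINT z|lborel. cnj (complex_of_real (heat t (z - y)) * \<phi> z))"
      unfolding Bochner_Integration.integral_cnj by (simp only: complex_cnj_mult complex_cnj_complex_of_real)
    moreover have "cnj (?g \<xi> * fourier_L1 \<phi> \<xi>) = cis (- (\<xi> \<bullet> y)) * a \<xi>" for \<xi>
      unfolding a_def by (simp add: cis_cnj)
    ultimately show ?thesis unfolding fourier_L1_def[of a] by simp
  qed
  have e1: "a \<xi> * fourier_L1 \<phi> \<xi> = complex_of_real (exp (- t * (norm \<xi>)^2 / 2) * (cmod (fourier_L1 \<phi> \<xi>))^2)" for \<xi>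
    unfolding a_def of_real_mult complex_norm_square by (simp only: mult_ac)
  show "integrable lborel (\<lambda>\<xi>. exp (- t * (norm \<xi>)^2 / 2) * (cmod (fourier_L1 \<phi> \<xi>))^2)"
  proof (rule Bochner_Integration.integrable_bound)
    show "integrable lborel (\<lambda>\<xi>. C^2 * ?e \<xi>)" using ei by simp
    show "AE \<xi> in lborel. norm (exp (- t * (norm \<xi>)^2 / 2) * (cmod (fourier_L1 \<phi> \<xi>))^2) \<le> norm (C^2 * ?e \<xi>)"
      using power_mono[OF Fb, of _ 2] by (intro AE_I2) (auto simp: norm_mult norm_power mult.commute intro!: mult_left_mono)
  qed auto
  have "complex_of_real (LINT \<xi>|lborel. exp (- t * (norm \<xi>)^2 / 2) * (cmod (fourier_L1 \<phi> \<xi>))^2) = (LINT \<xi>|lborel. a \<xi> * fourier_L1 \<phi> \<xi>)"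
    unfolding e1 by (rule integral_complex_of_real[symmetric])
  also have "\<dots> = (LINT y|lborel. fourier_L1 a y * \<phi> y)"
    by (rule fourier_L1_swap[OF ai \<phi>1])
  also have "\<dots> = (LINT x|lborel. \<phi> x * (LINT y|lborel. complex_of_real (heat t (y - x)) * cnj (\<phi> y)))"
    unfolding Fa by (simp only: mult.commute)
  also have "\<dots> = (LINT h|lborel. complex_of_real (heat t h) * (LINT x|lborel. \<phi> x * cnj (\<phi> (h + x))))"
    by (rule heat_autocorrelation(1)[OF \<phi>2 t])
  finally have "Re (complex_of_real (LINT \<xi>|lborel. exp (- t * (norm \<xi>)^2 / 2) * (cmod (fourier_L1 \<phi> \<xi>))^2))
     = Re (LINT h|lborel. complex_of_real (heat t h) * (LINT x|lborel. \<phi> x * cnj (\<phi> (h + x))))"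
    by (rule arg_cong)
  then show "(LINT \<xi>|lborel. exp (- t * (norm \<xi>)^2 / 2) * (cmod (fourier_L1 \<phi> \<xi>))^2)
     = (LINT x|lborel. (norm (\<phi> x))^2) - (LINT h|lborel. heat t h * shift_dist \<phi> h) / 2"
    unfolding heat_autocorrelation(2)[OF \<phi>2 t] by (simp only: Re_complex_of_real)
qed

lemma heat_shift_dist_inverse_Suc:
  assumes "sq_integrable lborel f"
  shows "(\<lambda>n. B - (LINT h|lborel. heat (1 / Suc n) h * shift_dist f h) / 2) \<longlonglongrightarrow> (B::real)"
proof -
  have "(\<lambda>n. LINT h|lborel. heat (1 / Suc n) h * shift_dist f h) \<longlonglongrightarrow> 0"
    by (rule heat_shift_dist_tendsto[OF assms LIMSEQ_Suc[OF lim_inverse_n']]) simp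
  then have "(\<lambda>n. B - (LINT h|lborel. heat (1 / Suc n) h * shift_dist f h) / 2) \<longlonglongrightarrow> B - 0 / 2"
    by (intro tendsto_intros) simp_all
  then show ?thesis by simp
qed

text \<open>The weights at \<open>t = 1 / Suc n\<close> increase to 1, so monotone convergence
  yields integrability and the value at once.\<close>

theorem fourier_L1_Plancherel:
  fixes \<phi> :: "'a::euclidean_space \<Rightarrow> complex"
  assumes \<phi>1: "integrable lborel \<phi>" and \<phi>2: "sq_integrable lborel \<phi>"
  shows "sq_integrable lborel (fourier_L1 \<phi>)"
    and "(LINT \<xi>|lborel. (cmod (fourier_L1 \<phi> \<xi>))^2) = (LINT x|lborel. (cmod (\<phi> x))^2)"
proof -
  have [measurable]: "\<phi> \<in> borel_measurable borel" using \<phi>1 by auto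
  define F where "F n \<xi> = exp (- (1 / Suc n) * (norm \<xi>)^2 / 2) * (cmod (fourier_L1 \<phi> \<xi>))^2" for n \<xi>
  have i: "integrable lborel (F n)" for n unfolding F_def by (rule fourier_L1_weighted(1)[OF \<phi>1 \<phi>2]) simp
  have mono: "AE \<xi> in lborel. mono (\<lambda>n. F n \<xi>)"
  proof (intro AE_I2 monoI)
    fix \<xi> :: 'a and m n :: nat assume "m \<le> n"
    then have "(1 / real (Suc n)) * (norm \<xi>)^2 \<le> (1 / real (Suc m)) * (norm \<xi>)^2"
      by (intro mult_right_mono) (auto simp: frac_le)
    then have "- (1 / real (Suc m)) * (norm \<xi>)^2 / 2 \<le> - (1 / real (Suc n)) * (norm \<xi>)^2 / 2"
      unfolding mult_minus_left minus_divide_left[symmetric] neg_le_iff_le by (rule divide_right_mono) simp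
    then show "F m \<xi> \<le> F n \<xi>" unfolding F_def by (intro mult_right_mono) (simp_all only: exp_le_cancel_iff zero_le_power2)
  qed
  have lim: "AE \<xi> in lborel. (\<lambda>n. F n \<xi>) \<longlonglongrightarrow> (cmod (fourier_L1 \<phi> \<xi>))^2"
  proof (rule AE_I2)
    fix \<xi> :: 'a
    have "(\<lambda>n. F n \<xi>) \<longlonglongrightarrow> exp (- 0 * (norm \<xi>)^2 / 2) * (cmod (fourier_L1 \<phi> \<xi>))^2"
      unfolding F_def by (intro tendsto_intros LIMSEQ_Suc[OF lim_inverse_n']) simp_all
    then show "(\<lambda>n. F n \<xi>) \<longlonglongrightarrow> (cmod (fourier_L1 \<phi> \<xi>))^2" by simp
  qed
  have "(LINT \<xi>|lborel. F n \<xi>) = (LINT x|lborel. (cmod (\<phi> x))^2) - (LINT h|lborel. heat (1 / Suc n) h * shift_dist \<phi> h) / 2" for n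
    unfolding F_def by (rule fourier_L1_weighted(2)[OF \<phi>1 \<phi>2]) simp
  then have I: "(\<lambda>n. LINT \<xi>|lborel. F n \<xi>) \<longlonglongrightarrow> (LINT x|lborel. (cmod (\<phi> x))^2)"
    using heat_shift_dist_inverse_Suc[OF \<phi>2] by simp
  have m: "(\<lambda>\<xi>. (cmod (fourier_L1 \<phi> \<xi>))^2) \<in> borel_measurable lborel" by measurable
  show "sq_integrable lborel (fourier_L1 \<phi>)"
    unfolding sq_integrable_def using integrable_monotone_convergence[OF i mono lim I m] by simp
  show "(LINT \<xi>|lborel. (cmod (fourier_L1 \<phi> \<xi>))^2) = (LINT x|lborel. (cmod (\<phi> x))^2)"
    by (rule integral_monotone_convergence[OF i mono lim I m])
qed

lemma sq_integrable_cnj: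
  assumes "sq_integrable M f" shows "sq_integrable M (\<lambda>x. cnj (f x))"
proof -
  have [measurable]: "f \<in> borel_measurable M" using assms by (simp add: sq_integrable_def)
  have "(\<lambda>x. cnj (f x)) \<in> borel_measurable M" by measurable
  then show ?thesis using assms by (simp add: sq_integrable_def)
qed

lemma integral_norm_sq_add:
  fixes f g :: "'x \<Rightarrow> complex"
  assumes f: "sq_integrable M f" and g: "sq_integrable M g"
  shows "(LINT x|M. (cmod (f x + c * g x))^2) = (LINT x|M. (cmod (f x))^2) + (cmod c)^2 * (LINT x|M. (cmod (g x))^2)
     + 2 * Re (cnj c * (LINT x|M. f x * cnj (g x)))"
proof -
  have p: "integrable M (\<lambda>x. cnj c * (f x * cnj (g x)))"
    using sq_integrable_prod[OF f sq_integrable_cnj[OF g]] by simp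
  have e: "(cmod (a + c * b))^2 = (cmod a)^2 + (cmod c)^2 * (cmod b)^2 + 2 * Re (cnj c * (a * cnj b))" for a b
    unfolding cmod_power2 by (simp add: power2_eq_square algebra_simps)
  have "(LINT x|M. (cmod (f x + c * g x))^2) = (LINT x|M. (cmod (f x))^2) + (cmod c)^2 * (LINT x|M. (cmod (g x))^2)
     + 2 * (LINT x|M. Re (cnj c * (f x * cnj (g x))))"
  proof -
    define h where "h x = Re (cnj c * (f x * cnj (g x)))" for x
    have "integrable M h" unfolding h_def by (rule integrable_Re[OF p])
    then show ?thesis
      unfolding e h_def[symmetric] using f g by (simp add: sq_integrable_def)
  qed
  also have "(LINT x|M. Re (cnj c * (f x * cnj (g x)))) = Re (cnj c * (LINT x|M. f x * cnj (g x)))"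
    using integral_Re[OF p] by simp
  finally show ?thesis .
qed

lemma fourier_L1_Parseval:
  fixes \<phi> \<psi> :: "'a::euclidean_space \<Rightarrow> complex"
  assumes \<phi>: "integrable lborel \<phi>" "sq_integrable lborel \<phi>"
    and \<psi>: "integrable lborel \<psi>" "sq_integrable lborel \<psi>"
  shows "(LINT \<xi>|lborel. fourier_L1 \<phi> \<xi> * cnj (fourier_L1 \<psi> \<xi>)) = (LINT x|lborel. \<phi> x * cnj (\<psi> x))"
proof -
  have "Re (cnj c * (LINT \<xi>|lborel. fourier_L1 \<phi> \<xi> * cnj (fourier_L1 \<psi> \<xi>))) = Re (cnj c * (LINT x|lborel. \<phi> x * cnj (\<psi> x)))" for c
  proof -
    have "(LINT \<xi>|lborel. (cmod (fourier_L1 (\<lambda>x. \<phi> x + c * \<psi> x) \<xi>))^2) = (LINT x|lborel. (cmod (\<phi> x + c * \<psi> x))^2)"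
      by (rule fourier_L1_Plancherel) (use \<phi> \<psi> in \<open>auto intro!: sq_integrable_add sq_integrable_mult\<close>)
    then show ?thesis
      unfolding fourier_L1_add[OF \<phi>(1) \<psi>(1)]
        integral_norm_sq_add[OF fourier_L1_Plancherel(1)[OF \<phi>] fourier_L1_Plancherel(1)[OF \<psi>]]
        integral_norm_sq_add[OF \<phi>(2) \<psi>(2)]
        fourier_L1_Plancherel(2)[OF \<phi>] fourier_L1_Plancherel(2)[OF \<psi>] by simp
  qed
  \<comment> \<open>\<open>c = 1\<close> gives the real part, \<open>c = \<i>\<close> the imaginary
    part.\<close>
  from this[of 1] this[of \<i>] show ?thesis by (simp add: complex_eq_iff)
qed

lemma sq_integrable_tendsto_prod:
  fixes f :: "nat \<Rightarrow> 'x \<Rightarrow> 'b::{real_normed_field,banach,second_countable_topology}"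
  assumes f: "\<And>n. sq_integrable M (f n)" and g: "sq_integrable M g" and k: "sq_integrable M k"
    and lim: "(\<lambda>n. LINT x|M. (norm (f n x - g x))^2) \<longlonglongrightarrow> 0"
  shows "(\<lambda>n. LINT x|M. f n x * k x) \<longlonglongrightarrow> (LINT x|M. g x * k x)"
proof -
  have "(\<lambda>n. norm ((LINT x|M. f n x * k x) - (LINT x|M. g x * k x))) \<longlonglongrightarrow> 0"
  proof (rule tendsto_sandwich[OF _ _ tendsto_const])
    have "(\<lambda>n. sqrt ((LINT x|M. (norm (f n x - g x))^2) * (LINT x|M. (norm (k x))^2))) \<longlonglongrightarrow> sqrt (0 * (LINT x|M. (norm (k x))^2))"
      by (intro tendsto_intros lim)
    then show "(\<lambda>n. sqrt ((LINT x|M. (norm (f n x - g x))^2) * (LINT x|M. (norm (k x))^2))) \<longlonglongrightarrow> 0" by simp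
    show "\<forall>\<^sub>F n in sequentially. norm ((LINT x|M. f n x * k x) - (LINT x|M. g x * k x)) \<le> sqrt ((LINT x|M. (norm (f n x - g x))^2) * (LINT x|M. (norm (k x))^2))"
    proof (intro always_eventually allI real_le_rsqrt)
      fix n
      have "(LINT x|M. f n x * k x) - (LINT x|M. g x * k x) = (LINT x|M. (f n x - g x) * k x)"
        using sq_integrable_prod[OF f k, of n] sq_integrable_prod[OF g k] by (simp add: left_diff_distrib)
      then show "(norm ((LINT x|M. f n x * k x) - (LINT x|M. g x * k x)))^2 \<le> (LINT x|M. (norm (f n x - g x))^2) * (LINT x|M. (norm (k x))^2)"
        using sq_integrable_Cauchy_Schwarz[OF sq_integrable_diff[OF f g] k, of n] by simp
    qed
  qed auto
  then show ?thesis by (simp add: tendsto_norm_zero_iff LIM_zero_iff)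
qed

lemma integrable_truncate_sq:
  fixes u :: "'a::euclidean_space \<Rightarrow> 'b::{banach,second_countable_topology}"
  assumes u: "sq_integrable lborel u" and B: "B \<in> sets borel" "emeasure lborel B < \<infinity>"
  shows "integrable lborel (\<lambda>x. indicator B x *\<^sub>R u x)" "sq_integrable lborel (\<lambda>x. indicator B x *\<^sub>R u x)"
proof -
  have [measurable]: "u \<in> borel_measurable borel" "B \<in> sets borel" using u B by (auto simp: sq_integrable_def)
  show "integrable lborel (\<lambda>x. indicator B x *\<^sub>R u x)"
  proof (rule Bochner_Integration.integrable_bound)
    show "integrable lborel (\<lambda>x. (norm (u x))^2 + indicator B x)"
      using u B by (auto simp: sq_integrable_def integrable_indicator_iff)
    have "norm y \<le> (norm y)^2 + 1" for y :: 'b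
      using sum_squares_bound[of "norm y" 1] zero_le_power2[of "norm y"] norm_ge_zero[of y] unfolding power_one by linarith
    then show "AE x in lborel. norm (indicator B x *\<^sub>R u x) \<le> norm ((norm (u x))^2 + indicator B x)"
      by (intro AE_I2) (auto simp: indicator_def)
  qed auto
  show "sq_integrable lborel (\<lambda>x. indicator B x *\<^sub>R u x)"
    by (rule sq_integrable_bound[OF sq_integrableD(2)[OF u]]) (auto simp: indicator_def)
qed

lemma integral_ball_complement_tendsto:
  fixes k :: "'a::euclidean_space \<Rightarrow> real"
  assumes k: "integrable lborel k"
  shows "(\<lambda>n. LINT x|lborel. indicator (- ball 0 (real n)) x * k x) \<longlonglongrightarrow> 0"
proof -
  have "(\<lambda>n. LINT x|lborel. indicator (- ball 0 (real n)) x * k x) \<longlonglongrightarrow> (LINT x|(lborel::'a measure). (0::real))"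
  proof (rule integral_dominated_convergence)
    show "AE x in lborel. (\<lambda>n. indicator (- ball 0 (real n)) x * k x) \<longlonglongrightarrow> 0"
    proof (rule AE_I2)
      fix x :: 'a
      obtain m :: nat where m: "norm x < m" using reals_Archimedean2 by blast
      have "\<forall>\<^sub>F n in sequentially. indicator (- ball 0 (real n)) x * k x = 0"
        by (rule eventually_sequentiallyI[of m]) (use m in \<open>auto simp: indicator_def\<close>)
      then show "(\<lambda>n. indicator (- ball 0 (real n)) x * k x) \<longlonglongrightarrow> 0" by (rule tendsto_eventually)
    qed
    show "integrable lborel (\<lambda>x. norm (k x))" using k by (rule integrable_norm)
  qed (use k in \<open>auto simp: indicator_def\<close>)
  then show ?thesis by simp
qed

section \<open>The Fourier transform on L2\<close>

lemma L2_iff: "u \<in> L2 \<longleftrightarrow> sq_integrable lborel u"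
  by (simp add: L2_def sq_integrable_real)

lemma sq_integrable_of_real:
  "sq_integrable M u \<Longrightarrow> sq_integrable M (\<lambda>x. complex_of_real (u x))"
  by (auto simp: sq_integrable_def)

lemma is_L2_fourier_iff:
  "is_L2_fourier u w \<longleftrightarrow> sq_integrable lborel w \<and>
     (\<forall>\<phi>. integrable lborel \<phi> \<and> sq_integrable lborel \<phi> \<longrightarrow>
        (LINT \<xi>|lborel. w \<xi> * cnj (fourier_L1 \<phi> \<xi>)) = (LINT x|lborel. complex_of_real (u x) * cnj (\<phi> x)))"
  unfolding is_L2_fourier_def sq_integrable_def by auto

lemma integral_sq_truncate_le:
  fixes u :: "'a::euclidean_space \<Rightarrow> 'b::{banach,second_countable_topology}"
  assumes u: "sq_integrable lborel u" and B: "A \<in> sets borel" "B \<in> sets borel" "D \<in> sets borel"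
    and D: "\<And>x. x \<in> D \<Longrightarrow> x \<in> A \<and> x \<in> B"
  shows "(LINT x|lborel. (norm (indicator A x *\<^sub>R u x - indicator B x *\<^sub>R u x))^2)
     \<le> (LINT x|lborel. indicator (- D) x * (norm (u x))^2)"
proof (rule integral_mono')
  have [measurable]: "u \<in> borel_measurable borel" "D \<in> sets borel" using u B by (auto simp: sq_integrable_def)
  show "integrable lborel (\<lambda>x. indicator (- D) x * (norm (u x))^2)"
    by (rule Bochner_Integration.integrable_bound[OF sq_integrableD(2)[OF u]]) (auto simp: indicator_def)
  show "0 \<le> indicator (- D) x * (norm (u x))^2" for x by simp
  show "(norm (indicator A x *\<^sub>R u x - indicator B x *\<^sub>R u x))^2 \<le> indicator (- D) x * (norm (u x))^2" for x
    using D[of x] by (auto simp: indicator_def)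
qed

text \<open>Truncations of \<open>u\<close> to balls lie in L1 and in L2, and by Plancherel their
  transforms form a Cauchy sequence. The a.e. limit of a subsequence inherits the duality identity
  that characterises the transform.\<close>

theorem L2_fourier_exists:
  fixes u :: "'a::euclidean_space \<Rightarrow> real"
  assumes u: "sq_integrable lborel u"
  obtains w where "is_L2_fourier u w" "(LINT \<xi>|lborel. (cmod (w \<xi>))^2) = (LINT x|lborel. (u x)^2)"
proof -
  have [measurable]: "u \<in> borel_measurable borel" using u by (simp add: sq_integrable_def)
  define U where "U x = complex_of_real (u x)" for x
  have Us: "sq_integrable lborel U" unfolding U_def by (rule sq_integrable_of_real[OF u])
  define f where "f n x = indicator (ball 0 (real n)) x *\<^sub>R U x" for n :: nat and x
  have fi: "integrable lborel (f n)" "sq_integrable lborel (f n)" for n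
    unfolding f_def using integrable_truncate_sq[OF Us, of "ball 0 (real n)"] emeasure_lborel_ball_finite by auto
  note Fi = fourier_L1_Plancherel(1)[OF fi]
  \<comment> \<open>The mass of \<open>u\<close> outside a ball controls all later differences of
    truncations, hence all differences of their transforms.\<close>
  define T where "T n = (LINT x|lborel. indicator (- ball 0 (real n)) x * (norm (U x))^2)" for n :: nat
  have T0: "T \<longlonglongrightarrow> 0" unfolding T_def
    by (rule integral_ball_complement_tendsto) (use Us in \<open>auto simp: sq_integrable_def\<close>)
  have FT: "(LINT \<xi>|lborel. (norm (fourier_L1 (f m) \<xi> - fourier_L1 (f n) \<xi>))^2) \<le> T k" if "m \<ge> k" "n \<ge> k" for m n k
  proof -
    have "fourier_L1 (f m) \<xi> - fourier_L1 (f n) \<xi> = fourier_L1 (\<lambda>x. f m x + (-1) * f n x) \<xi>" for \<xi>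
      by (subst fourier_L1_add) (use fi in auto)
    then have "(LINT \<xi>|lborel. (norm (fourier_L1 (f m) \<xi> - fourier_L1 (f n) \<xi>))^2) = (LINT x|lborel. (norm (f m x + (-1) * f n x))^2)"
      using fourier_L1_Plancherel(2)[of "\<lambda>x. f m x + (-1) * f n x"] fi sq_integrable_diff[OF fi(2) fi(2), of m n] by simp
    also have "\<dots> = (LINT x|lborel. (norm (indicator (ball 0 (real m)) x *\<^sub>R U x - indicator (ball 0 (real n)) x *\<^sub>R U x))^2)"
      unfolding f_def by simp
    also have "\<dots> \<le> T k" unfolding T_def
      by (rule integral_sq_truncate_le[OF Us]) (use that in auto)
    finally show ?thesis .
  qed
  have small: "\<exists>k. T k < e" if "e > 0" for e
    using order_tendstoD(2)[OF T0 that] eventually_happens' sequentially_bot by blast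
  obtain r w where r: "strict_mono r" and wm: "w \<in> borel_measurable lborel"
    and ae: "AE \<xi> in lborel. (\<lambda>n. fourier_L1 (f (r n)) \<xi>) \<longlonglongrightarrow> w \<xi>"
  proof (rule sq_integrable_Cauchy_AE_subseq[of lborel "\<lambda>n. fourier_L1 (f n)"])
    show "sq_integrable lborel (fourier_L1 (f n))" for n by (rule Fi)
    show "\<exists>N. \<forall>m\<ge>N. \<forall>n\<ge>N. (LINT x|lborel. (norm (fourier_L1 (f m) x - fourier_L1 (f n) x))^2) < e" if "e > 0" for e
      using small[OF that] FT by (meson le_less_trans)
  qed blast
  have rn: "r n \<ge> n" for n using r by (rule strict_mono_imp_increasing)
  have lim1: "sq_integrable lborel (\<lambda>\<xi>. w \<xi> - fourier_L1 (f (r n)) \<xi>) \<and>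
     (LINT \<xi>|lborel. (norm (w \<xi> - fourier_L1 (f (r n)) \<xi>))^2) \<le> T n" for n
  proof
    have m: "(\<lambda>\<xi>. w \<xi> - fourier_L1 (f (r n)) \<xi>) \<in> borel_measurable lborel"
      using wm Fi[of "r n"] by (auto simp: sq_integrable_def)
    have s: "sq_integrable lborel (\<lambda>\<xi>. fourier_L1 (f (r k)) \<xi> - fourier_L1 (f (r n)) \<xi>)" for k
      by (intro sq_integrable_diff Fi)
    have a: "AE \<xi> in lborel. (\<lambda>k. fourier_L1 (f (r k)) \<xi> - fourier_L1 (f (r n)) \<xi>) \<longlonglongrightarrow> w \<xi> - fourier_L1 (f (r n)) \<xi>"
      using ae by eventually_elim (intro tendsto_intros)
    have b: "(LINT \<xi>|lborel. (norm (fourier_L1 (f (r k)) \<xi> - fourier_L1 (f (r n)) \<xi>))^2) \<le> T n" if "k \<ge> n" for k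
      by (rule FT) (use rn[of n] rn[of k] that in auto)
    show "sq_integrable lborel (\<lambda>\<xi>. w \<xi> - fourier_L1 (f (r n)) \<xi>)"
      by (rule sq_integrable_liminf(1)[OF s m a b])
    show "(LINT \<xi>|lborel. (norm (w \<xi> - fourier_L1 (f (r n)) \<xi>))^2) \<le> T n"
      by (rule sq_integrable_liminf(2)[OF s m a b])
  qed
  have ws: "sq_integrable lborel w"
    using sq_integrable_add[OF conjunct1[OF lim1[of 0]] Fi[of "r 0"]] by simp
  have wl: "(\<lambda>n. LINT \<xi>|lborel. (norm (fourier_L1 (f (r n)) \<xi> - w \<xi>))^2) \<longlonglongrightarrow> 0"
  proof (rule tendsto_sandwich[OF _ _ tendsto_const T0])
    show "\<forall>\<^sub>F n in sequentially. (LINT \<xi>|lborel. (norm (fourier_L1 (f (r n)) \<xi> - w \<xi>))^2) \<le> T n"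
      using lim1 by (simp add: norm_minus_commute)
  qed auto
  have fl: "(\<lambda>n. LINT x|lborel. (norm (f (r n) x - U x))^2) \<longlonglongrightarrow> 0"
  proof (rule tendsto_sandwich[OF _ _ tendsto_const T0])
    show "\<forall>\<^sub>F n in sequentially. (LINT x|lborel. (norm (f (r n) x - U x))^2) \<le> T n"
    proof (intro always_eventually allI)
      fix n
      have "(LINT x|lborel. (norm (indicator (ball 0 (real (r n))) x *\<^sub>R U x - indicator UNIV x *\<^sub>R U x))^2) \<le> T n"
        unfolding T_def by (rule integral_sq_truncate_le[OF Us]) (use rn[of n] in auto)
      then show "(LINT x|lborel. (norm (f (r n) x - U x))^2) \<le> T n" by (simp add: f_def)
    qed
  qed auto
  have main: "(LINT \<xi>|lborel. w \<xi> * cnj (fourier_L1 \<phi> \<xi>)) = (LINT x|lborel. U x * cnj (\<phi> x))"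
    if \<phi>: "integrable lborel \<phi>" "sq_integrable lborel \<phi>" for \<phi>
  proof (rule LIMSEQ_unique)
    show "(\<lambda>n. LINT \<xi>|lborel. fourier_L1 (f (r n)) \<xi> * cnj (fourier_L1 \<phi> \<xi>)) \<longlonglongrightarrow> (LINT \<xi>|lborel. w \<xi> * cnj (fourier_L1 \<phi> \<xi>))"
      by (rule sq_integrable_tendsto_prod[OF Fi ws sq_integrable_cnj[OF fourier_L1_Plancherel(1)[OF \<phi>]] wl])
    show "(\<lambda>n. LINT \<xi>|lborel. fourier_L1 (f (r n)) \<xi> * cnj (fourier_L1 \<phi> \<xi>)) \<longlonglongrightarrow> (LINT x|lborel. U x * cnj (\<phi> x))"
      unfolding fourier_L1_Parseval[OF fi \<phi>]
      by (rule sq_integrable_tendsto_prod[OF fi(2) Us sq_integrable_cnj[OF \<phi>(2)] fl])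
  qed
  have "is_L2_fourier u w" unfolding is_L2_fourier_iff using ws main by (auto simp: U_def)
  \<comment> \<open>The identity for \<open>w\<close> is tested with the truncations themselves; the
    two sides then converge to the two squared norms.\<close>
  moreover have "(LINT \<xi>|lborel. (cmod (w \<xi>))^2) = (LINT x|lborel. (u x)^2)"
  proof -
    have c: "(LINT x|M. g x * cnj (g x)) = complex_of_real (LINT x|M. (cmod (g x))^2)" for g and M :: "'a measure"
      unfolding complex_norm_square[symmetric] by (rule integral_complex_of_real)
    have "(\<lambda>n. cnj (LINT \<xi>|lborel. fourier_L1 (f (r n)) \<xi> * cnj (w \<xi>))) \<longlonglongrightarrow> cnj (LINT \<xi>|lborel. w \<xi> * cnj (w \<xi>))"
      by (intro tendsto_cnj sq_integrable_tendsto_prod[OF Fi ws sq_integrable_cnj[OF ws] wl])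
    moreover have "cnj (LINT \<xi>|lborel. fourier_L1 (f (r n)) \<xi> * cnj (w \<xi>)) = (LINT x|lborel. U x * cnj (f (r n) x))" for n
      unfolding main[OF fi, symmetric] Bochner_Integration.integral_cnj[symmetric] by (simp add: mult.commute)
    moreover have "(\<lambda>n. cnj (LINT x|lborel. f (r n) x * cnj (U x))) \<longlonglongrightarrow> cnj (LINT x|lborel. U x * cnj (U x))"
      by (intro tendsto_cnj sq_integrable_tendsto_prod[OF fi(2) Us sq_integrable_cnj[OF Us] fl])
    moreover have "cnj (LINT x|lborel. f (r n) x * cnj (U x)) = (LINT x|lborel. U x * cnj (f (r n) x))" for n
      unfolding Bochner_Integration.integral_cnj[symmetric] by (simp add: mult.commute)
    ultimately have "cnj (LINT \<xi>|lborel. w \<xi> * cnj (w \<xi>)) = cnj (LINT x|lborel. U x * cnj (U x))"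
      using LIMSEQ_unique by (simp only:)
    then show ?thesis unfolding c by (simp add: U_def)
  qed
  ultimately show thesis by (rule that)
qed

lemma sq_integrable_zero_of_heat:
  fixes g :: "'a::euclidean_space \<Rightarrow> complex"
  assumes g: "sq_integrable lborel g"
    and z: "\<And>t x. t > 0 \<Longrightarrow> (LINT y|lborel. complex_of_real (heat t (y - x)) * cnj (g y)) = 0"
  shows "(LINT x|lborel. (cmod (g x))^2) = 0"
proof -
  have "(LINT x|lborel. (cmod (g x))^2) - (LINT h|lborel. heat (1 / Suc n) h * shift_dist g h) / 2 = 0" for n
    using heat_autocorrelation[OF g, of "1 / Suc n"] by (simp add: z)
  then show ?thesis
    using heat_shift_dist_inverse_Suc[OF g, of "LINT x|lborel. (cmod (g x))^2"] LIMSEQ_unique[OF _ tendsto_const] by simp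
qed

text \<open>Modulated Gaussians are enough test functions: if \<open>g\<close> annihilates their
  transforms, every heat smoothing of \<open>cnj g\<close> vanishes, and
  \<open>heat_autocorrelation\<close> forces the norm of \<open>g\<close> to be 0 as
  \<open>t\<close> tends to 0.\<close>

lemma fourier_L1_range_dense:
  fixes g :: "'a::euclidean_space \<Rightarrow> complex"
  assumes g: "sq_integrable lborel g"
    and z: "\<And>\<phi>. integrable lborel \<phi> \<Longrightarrow> sq_integrable lborel \<phi> \<Longrightarrow> (LINT \<xi>|lborel. g \<xi> * cnj (fourier_L1 \<phi> \<xi>)) = 0"
  shows "(LINT x|lborel. (cmod (g x))^2) = 0"
proof (rule sq_integrable_zero_of_heat[OF g])
  fix t :: real and x :: 'a assume t: "t > 0"
  define \<phi> where "\<phi> y = cis (y \<bullet> x) * complex_of_real (exp (- t * (norm y)^2 / 2))" for y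
  have \<phi>i: "integrable lborel \<phi>" unfolding \<phi>_def by (rule fourier_L1_gauss(1)[OF t])
  have "integrable lborel (\<lambda>y::'a. exp (- (2 * t) * (norm y)^2 / 2))"
    using integrable_Re[OF fourier_L1_gauss(1)[of "2 * t" "0::'a"]] t by simp
  then have "sq_integrable lborel \<phi>"
    unfolding sq_integrable_def using \<phi>i by (auto simp: \<phi>_def norm_mult exp_double[symmetric] power2_eq_square mult_exp_exp)
  from z[OF \<phi>i this] have "(LINT \<xi>|lborel. g \<xi> * cnj (complex_of_real ((2 * pi) powr (real DIM('a) / 2) * heat t (\<xi> - x)))) = 0"
    unfolding \<phi>_def fourier_L1_gauss(2)[OF t] .
  then have "cnj (LINT \<xi>|lborel. g \<xi> * cnj (complex_of_real ((2 * pi) powr (real DIM('a) / 2) * heat t (\<xi> - x)))) = 0"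
    by simp
  also have "cnj (LINT \<xi>|lborel. g \<xi> * cnj (complex_of_real ((2 * pi) powr (real DIM('a) / 2) * heat t (\<xi> - x))))
     = (LINT \<xi>|lborel. complex_of_real ((2 * pi) powr (real DIM('a) / 2)) * (complex_of_real (heat t (\<xi> - x)) * cnj (g \<xi>)))"
    unfolding Bochner_Integration.integral_cnj[symmetric]
    by (intro Bochner_Integration.integral_cong refl) (simp add: mult_ac)
  also have "\<dots> = complex_of_real ((2 * pi) powr (real DIM('a) / 2)) * (LINT \<xi>|lborel. complex_of_real (heat t (\<xi> - x)) * cnj (g \<xi>))"
    by (rule integral_mult_right_zero)
  finally show "(LINT y|lborel. complex_of_real (heat t (y - x)) * cnj (g y)) = 0" by simp
qed

text \<open>\<open>L2_fourier\<close> selects a representative by \<open>SOME\<close>, so the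
  isometry has to hold for every admissible \<open>w\<close>. Two admissible functions differ by one
  that annihilates all transforms of L1 and L2 functions, hence by a null function.\<close>

theorem L2_fourier_isometry:
  fixes u :: "'a::euclidean_space \<Rightarrow> real"
  assumes u: "sq_integrable lborel u" and w: "is_L2_fourier u w"
  shows "(LINT \<xi>|lborel. (cmod (w \<xi>))^2) = (LINT x|lborel. (u x)^2)"
proof -
  obtain w0 where w0: "is_L2_fourier u w0" "(LINT \<xi>|lborel. (cmod (w0 \<xi>))^2) = (LINT x|lborel. (u x)^2)"
    using L2_fourier_exists[OF u] .
  have s: "sq_integrable lborel w" "sq_integrable lborel w0" using w w0(1) by (auto simp: is_L2_fourier_iff)
  have d: "sq_integrable lborel (\<lambda>\<xi>. w \<xi> - w0 \<xi>)" by (rule sq_integrable_diff[OF s])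
  have "(LINT x|lborel. (cmod (w x - w0 x))^2) = 0"
  proof (rule fourier_L1_range_dense[OF d])
    fix \<phi> :: "'a \<Rightarrow> complex" assume \<phi>: "integrable lborel \<phi>" "sq_integrable lborel \<phi>"
    have c: "sq_integrable lborel (\<lambda>\<xi>. cnj (fourier_L1 \<phi> \<xi>))"
      by (rule sq_integrable_cnj[OF fourier_L1_Plancherel(1)[OF \<phi>]])
    have "(LINT \<xi>|lborel. (w \<xi> - w0 \<xi>) * cnj (fourier_L1 \<phi> \<xi>)) = (LINT \<xi>|lborel. w \<xi> * cnj (fourier_L1 \<phi> \<xi>)) - (LINT \<xi>|lborel. w0 \<xi> * cnj (fourier_L1 \<phi> \<xi>))"
      using sq_integrable_prod[OF s(1) c] sq_integrable_prod[OF s(2) c] by (simp add: left_diff_distrib)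
    then show "(LINT \<xi>|lborel. (w \<xi> - w0 \<xi>) * cnj (fourier_L1 \<phi> \<xi>)) = 0"
      using w w0(1) \<phi> by (simp add: is_L2_fourier_iff)
  qed
  then have "AE \<xi> in lborel. (cmod (w \<xi> - w0 \<xi>))^2 = 0"
    using integral_nonneg_eq_0_iff_AE[OF sq_integrableD(2)[OF d]] by simp
  then have "AE \<xi> in lborel. (cmod (w \<xi>))^2 = (cmod (w0 \<xi>))^2" by eventually_elim simp
  then have "(LINT \<xi>|lborel. (cmod (w \<xi>))^2) = (LINT \<xi>|lborel. (cmod (w0 \<xi>))^2)"
    using s by (intro integral_cong_AE) (auto simp: sq_integrable_def)
  then show ?thesis using w0(2) by simp
qed

lemma fourier_L1_translate:
  fixes \<phi> :: "'a::euclidean_space \<Rightarrow> complex"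
  assumes "integrable lborel \<phi>"
  shows "fourier_L1 (\<lambda>x. \<phi> (h + x)) \<xi> = cis (h \<bullet> \<xi>) * fourier_L1 \<phi> \<xi>"
proof -
  have [measurable]: "(\<lambda>x. cis (- (x \<bullet> \<xi>)) * \<phi> x) \<in> borel_measurable borel"
    using fourier_integrand_integrable[OF assms] by auto
  have "(LINT x|lborel. cis (- (x \<bullet> \<xi>)) * \<phi> (h + x)) = (LINT x|lborel. cis (h \<bullet> \<xi>) * (cis (- ((h + x) \<bullet> \<xi>)) * \<phi> (h + x)))"
  proof (rule Bochner_Integration.integral_cong[OF refl])
    fix x :: 'a
    have "cis (h \<bullet> \<xi>) * cis (- ((h + x) \<bullet> \<xi>)) = cis (- (x \<bullet> \<xi>))" by (simp add: cis_mult inner_add_left)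
    then show "cis (- (x \<bullet> \<xi>)) * \<phi> (h + x) = cis (h \<bullet> \<xi>) * (cis (- ((h + x) \<bullet> \<xi>)) * \<phi> (h + x))"
      by (simp only: mult.assoc[symmetric])
  qed
  also have "\<dots> = cis (h \<bullet> \<xi>) * (LINT x|lborel. cis (- ((h + x) \<bullet> \<xi>)) * \<phi> (h + x))" by (rule integral_mult_right_zero)
  also have "(LINT x|lborel. cis (- ((h + x) \<bullet> \<xi>)) * \<phi> (h + x)) = (LINT x|lborel. cis (- (x \<bullet> \<xi>)) * \<phi> x)"
    by (rule integral_translate[of "\<lambda>x. cis (- (x \<bullet> \<xi>)) * \<phi> x"]) measurable
  finally show ?thesis unfolding fourier_L1_def by (simp add: mult.left_commute)
qed

lemma is_L2_fourier_shift_diff: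
  fixes u :: "'a::euclidean_space \<Rightarrow> real"
  assumes u: "sq_integrable lborel u" and w: "is_L2_fourier u w"
  shows "is_L2_fourier (\<lambda>x. u (h + x) - u x) (\<lambda>\<xi>. (cis (h \<bullet> \<xi>) - 1) * w \<xi>)"
  unfolding is_L2_fourier_iff
proof (intro conjI allI impI)
  have ws: "sq_integrable lborel w" using w by (simp add: is_L2_fourier_iff)
  have [measurable]: "w \<in> borel_measurable borel" using ws by (simp add: sq_integrable_def)
  have cm: "(\<lambda>\<xi>::'a. cis (h \<bullet> \<xi>)) \<in> borel_measurable borel"
    unfolding cis_conv_exp by (intro borel_measurable_continuous_onI continuous_intros)
  show "sq_integrable lborel (\<lambda>\<xi>. (cis (h \<bullet> \<xi>) - 1) * w \<xi>)"
  proof (rule sq_integrable_bound)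
    show "integrable lborel (\<lambda>\<xi>. 4 * (cmod (w \<xi>))^2)" using ws by (simp add: sq_integrable_def)
    have "cmod (cis a - 1) \<le> 2" for a using norm_triangle_ineq4[of "cis a" 1] by simp
    then have "(cmod (cis a - 1))^2 \<le> 4" for a using power_mono[of "cmod (cis a - 1)" 2 2] by simp
    then show "AE \<xi> in lborel. (cmod ((cis (h \<bullet> \<xi>) - 1) * w \<xi>))^2 \<le> 4 * (cmod (w \<xi>))^2"
      by (intro AE_I2) (simp add: norm_mult power_mult_distrib mult_right_mono)
    show "(\<lambda>\<xi>. (cis (h \<bullet> \<xi>) - 1) * w \<xi>) \<in> borel_measurable lborel" using cm by measurable
  qed
  fix \<phi> :: "'a \<Rightarrow> complex" assume "integrable lborel \<phi> \<and> sq_integrable lborel \<phi>"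
  then have \<phi>: "integrable lborel \<phi>" "sq_integrable lborel \<phi>" by auto
  have [measurable]: "\<phi> \<in> borel_measurable borel" "u \<in> borel_measurable borel" using \<phi> u by (auto simp: sq_integrable_def)
  \<comment> \<open>By duality the shift of \<open>u\<close> by \<open>h\<close> becomes the
    opposite shift of the test function.\<close>
  define \<psi> where "\<psi> x = \<phi> (- h + x) + (-1) * \<phi> x" for x
  have \<phi>t: "integrable lborel (\<lambda>x. \<phi> (- h + x))" "sq_integrable lborel (\<lambda>x. \<phi> (- h + x))"
    by (rule integrable_translate[OF \<phi>(1)], rule sq_integrable_translate[OF \<phi>(2)])
  have \<psi>: "integrable lborel \<psi>" "sq_integrable lborel \<psi>"
    unfolding \<psi>_def using \<phi> \<phi>t sq_integrable_diff[OF \<phi>t(2) \<phi>(2)] by auto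
  have F: "fourier_L1 \<psi> \<xi> = (cis (- (h \<bullet> \<xi>)) - 1) * fourier_L1 \<phi> \<xi>" for \<xi>
    unfolding \<psi>_def fourier_L1_add[OF \<phi>t(1) \<phi>(1)] fourier_L1_translate[OF \<phi>(1)] by (simp add: left_diff_distrib)
  have "(LINT \<xi>|lborel. (cis (h \<bullet> \<xi>) - 1) * w \<xi> * cnj (fourier_L1 \<phi> \<xi>)) = (LINT \<xi>|lborel. w \<xi> * cnj (fourier_L1 \<psi> \<xi>))"
    unfolding F by (intro Bochner_Integration.integral_cong refl) (simp add: cis_cnj)
  also have "\<dots> = (LINT x|lborel. complex_of_real (u x) * cnj (\<psi> x))"
    using w \<psi> by (simp add: is_L2_fourier_iff)
  also have "\<dots> = (LINT x|lborel. complex_of_real (u x) * cnj (\<phi> (- h + x))) - (LINT x|lborel. complex_of_real (u x) * cnj (\<phi> x))"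
    unfolding \<psi>_def
    using sq_integrable_prod[OF sq_integrable_of_real[OF u] sq_integrable_cnj[OF \<phi>t(2)]]
      sq_integrable_prod[OF sq_integrable_of_real[OF u] sq_integrable_cnj[OF \<phi>(2)]] by (simp add: algebra_simps)
  also have "(LINT x|lborel. complex_of_real (u x) * cnj (\<phi> (- h + x))) = (LINT x|lborel. complex_of_real (u (h + x)) * cnj (\<phi> x))"
    using integral_translate[of "\<lambda>x. complex_of_real (u x) * cnj (\<phi> (- h + x))" h] by simp
  also have "\<dots> - (LINT x|lborel. complex_of_real (u x) * cnj (\<phi> x)) = (LINT x|lborel. complex_of_real (u (h + x) - u x) * cnj (\<phi> x))"
    using sq_integrable_prod[OF sq_integrable_of_real[OF sq_integrable_translate[OF u]] sq_integrable_cnj[OF \<phi>(2)], of h]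
      sq_integrable_prod[OF sq_integrable_of_real[OF u] sq_integrable_cnj[OF \<phi>(2)]] by (simp add: left_diff_distrib)
  finally show "(LINT \<xi>|lborel. (cis (h \<bullet> \<xi>) - 1) * w \<xi> * cnj (fourier_L1 \<phi> \<xi>)) = (LINT x|lborel. complex_of_real (u (h + x) - u x) * cnj (\<phi> x))" .
qed

text \<open>The isometry applied to a shift difference; the squared modulus of
  \<open>cis a - 1\<close> is \<open>2 * (1 - cos a)\<close>.\<close>

lemma shift_dist_fourier:
  fixes u :: "'a::euclidean_space \<Rightarrow> real"
  assumes u: "sq_integrable lborel u" and w: "is_L2_fourier u w"
  shows "shift_dist u h = (LINT \<xi>|lborel. 2 * (1 - cos (h \<bullet> \<xi>)) * (cmod (w \<xi>))^2)"
proof -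
  have e: "(cmod (cis a - 1))^2 = 2 * (1 - cos a)" for a
  proof -
    have "(cmod (cis a - 1))^2 = (cos a)^2 + (sin a)^2 + 1 - 2 * cos a"
      unfolding cmod_power2 by (simp add: power2_diff)
    then show ?thesis by simp
  qed
  have "shift_dist u h = (LINT x|lborel. (u (h + x) - u x)^2)" by (simp add: shift_dist_def)
  also have "\<dots> = (LINT \<xi>|lborel. (cmod ((cis (h \<bullet> \<xi>) - 1) * w \<xi>))^2)"
    by (rule L2_fourier_isometry[symmetric, OF sq_integrable_shift_diff[OF u] is_L2_fourier_shift_diff[OF u w]])
  finally show ?thesis by (simp add: norm_mult power_mult_distrib e)
qed

section \<open>The Gagliardo form of the fractional energy\<close>

lemma nn_integral_pos_scale:
  fixes f :: "real \<Rightarrow> ennreal"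
  assumes c: "c > 0" and f [measurable]: "f \<in> borel_measurable borel"
  shows "(\<integral>\<^sup>+t\<in>{0<..}. f t \<partial>lborel) = ennreal c * (\<integral>\<^sup>+t\<in>{0<..}. f (c * t) \<partial>lborel)"
proof -
  have "(\<integral>\<^sup>+t\<in>{0<..}. f t \<partial>lborel) = ennreal \<bar>c\<bar> * (\<integral>\<^sup>+t. f (0 + c * t) * indicator {0<..} (0 + c * t) \<partial>lborel)"
    by (rule nn_integral_real_affine) (use c in auto)
  also have "(\<integral>\<^sup>+t. f (0 + c * t) * indicator {0<..} (0 + c * t) \<partial>lborel) = (\<integral>\<^sup>+t\<in>{0<..}. f (c * t) \<partial>lborel)"
    by (intro nn_integral_cong) (use c in \<open>auto simp: indicator_def zero_less_mult_iff\<close>)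
  finally show ?thesis using c by simp
qed

lemma nn_integral_powr_0_1:
  assumes "a > (-1::real)"
  shows "(\<integral>\<^sup>+t\<in>{0<..1}. ennreal (t powr a) \<partial>lborel) < \<infinity>"
proof -
  have "(\<integral>\<^sup>+t\<in>{0<..1}. ennreal (t powr a) \<partial>lborel) \<le> (\<integral>\<^sup>+t\<in>{0..1}. ennreal (t powr a) \<partial>lborel)"
    by (intro nn_integral_mono) (auto simp: indicator_def)
  also have "\<dots> = ennreal (1 powr (a + 1) / (a + 1))"
    by (rule nn_integral_has_integral_lebesgue') (use has_integral_powr_from_0[OF assms, of 1] in auto)
  finally show ?thesis by (rule le_less_trans) simp
qed

lemma nn_integral_powr_1_inf:
  assumes "a < (-1::real)"
  shows "(\<integral>\<^sup>+t\<in>{1..}. ennreal (t powr a) \<partial>lborel) < \<infinity>"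
proof -
  have "(\<integral>\<^sup>+t\<in>{1..}. ennreal (t powr a) \<partial>lborel) = ennreal (- (1 powr (a + 1)) / (a + 1))"
    by (rule nn_integral_has_integral_lebesgue') (use has_integral_powr_to_inf[OF assms, of 1] in auto)
  then show ?thesis by simp
qed

text \<open>One test for all the \<open>t\<close>-integrals of the subordination formulas: a power
  above -1 near 0 and a power below -1 near infinity.\<close>

lemma nn_integral_pos_finite:
  fixes f :: "real \<Rightarrow> ennreal"
  assumes [measurable]: "f \<in> borel_measurable borel"
    and a: "a > -1" "\<And>t. 0 < t \<Longrightarrow> t \<le> 1 \<Longrightarrow> f t \<le> ennreal (C * t powr a)"
    and b: "b < -1" "\<And>t. t \<ge> 1 \<Longrightarrow> f t \<le> ennreal (C * t powr b)" and C: "C \<ge> 0"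
  shows "(\<integral>\<^sup>+t\<in>{0<..}. f t \<partial>lborel) < \<infinity>"
proof -
  have "(\<integral>\<^sup>+t\<in>{0<..}. f t \<partial>lborel) \<le> (\<integral>\<^sup>+t. ennreal C * (ennreal (t powr a) * indicator {0<..1} t) + ennreal C * (ennreal (t powr b) * indicator {1..} t) \<partial>lborel)"
  proof (rule nn_integral_mono)
    fix t :: real
    show "f t * indicator {0<..} t \<le> ennreal C * (ennreal (t powr a) * indicator {0<..1} t) + ennreal C * (ennreal (t powr b) * indicator {1..} t)"
    proof (cases "0 < t")
      case True
      show ?thesis
      proof (cases "t \<le> 1")
        case le: True
        then have "f t \<le> ennreal C * ennreal (t powr a)" using a(2)[OF True le] C by (simp add: ennreal_mult)
        then show ?thesis using True le by (simp add: indicator_def add_increasing2)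
      next
        case False
        then have "f t \<le> ennreal C * ennreal (t powr b)" using b(2)[of t] C by (simp add: ennreal_mult)
        then show ?thesis using True False by (simp add: indicator_def)
      qed
    qed auto
  qed
  also have "\<dots> = ennreal C * (\<integral>\<^sup>+t\<in>{0<..1}. ennreal (t powr a) \<partial>lborel) + ennreal C * (\<integral>\<^sup>+t\<in>{1..}. ennreal (t powr b) \<partial>lborel)"
    by (subst nn_integral_add) (auto simp: nn_integral_cmult)
  also have "\<dots> < \<infinity>"
    using nn_integral_powr_0_1[OF a(1)] nn_integral_powr_1_inf[OF b(1)] by (simp add: ennreal_mult_less_top)
  finally show ?thesis .
qed

lemma nn_integral_pos_positive:
  fixes f :: "real \<Rightarrow> ennreal"
  assumes [measurable]: "f \<in> borel_measurable borel" and pos: "\<And>t. t > 0 \<Longrightarrow> f t > 0"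
  shows "(\<integral>\<^sup>+t\<in>{0<..}. f t \<partial>lborel) > 0"
proof (rule ccontr)
  assume "\<not> 0 < (\<integral>\<^sup>+t\<in>{0<..}. f t \<partial>lborel)"
  then have "(\<integral>\<^sup>+t\<in>{0<..}. f t \<partial>lborel) = 0" by simp
  then have "AE t in lborel. f t * indicator {0<..} t = 0"
    by (subst (asm) nn_integral_0_iff_AE) auto
  then have "AE t in lborel. t \<notin> {0<..<1::real}"
  proof eventually_elim
    case (elim t)
    then show ?case using pos[of t] by (auto simp: indicator_def split: if_splits)
  qed
  then have "emeasure lborel {0<..<1::real} = 0"
    by (subst (asm) AE_iff_measurable[of "{0<..<1}"]) auto
  then show False by simp
qed

text \<open>This constant and the next are the integrals with weight \<open>t powr (-1 - s)\<close>
  of the symbol \<open>1 - exp (- t / 2)\<close> at unit frequency and of the heat kernel at unit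
  distance; homogeneity supplies all other frequencies and distances.\<close>

definition frac_sym_const :: "real \<Rightarrow> ennreal" where
  "frac_sym_const s = (\<integral>\<^sup>+t\<in>{0<..}. ennreal (t powr (-1 - s) * (1 - exp (- t / 2))) \<partial>lborel)"

definition frac_ker_const :: "real \<Rightarrow> real \<Rightarrow> ennreal" where
  "frac_ker_const s d = (\<integral>\<^sup>+t\<in>{0<..}. ennreal (t powr (-1 - s) * ((2 * pi * t) powr (- d / 2) * exp (- 1 / (2 * t)))) \<partial>lborel)"

lemma frac_sym_const_finite:
  assumes "0 < s" "s < 1"
  shows "frac_sym_const s < \<infinity>" "frac_sym_const s > 0"
proof -
  show "frac_sym_const s < \<infinity>"
    unfolding frac_sym_const_def
  proof (rule nn_integral_pos_finite[where a="-s" and b="-1-s" and C=1])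
    fix t :: real assume t: "0 < t" "t \<le> 1"
    have "1 - exp (- t / 2) \<le> t" using exp_ge_add_one_self[of "- t / 2"] t by simp
    then have "t powr (-1 - s) * (1 - exp (- t / 2)) \<le> t powr (-1 - s) * t powr 1"
      using t by (intro mult_left_mono) auto
    also have "\<dots> = t powr (- s)" by (simp only: powr_add[symmetric]) simp
    finally show "ennreal (t powr (-1 - s) * (1 - exp (- t / 2))) \<le> ennreal (1 * t powr (- s))" by (simp add: ennreal_leI)
  next
    fix t :: real assume "t \<ge> 1"
    then show "ennreal (t powr (-1 - s) * (1 - exp (- t / 2))) \<le> ennreal (1 * t powr (-1 - s))"
      by (intro ennreal_leI) (simp add: mult_left_le)
  qed (use assms in auto)
  show "frac_sym_const s > 0"
    unfolding frac_sym_const_def by (rule nn_integral_pos_positive) auto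
qed

lemma frac_ker_const_finite:
  assumes s: "0 < s" "s < 1" and d: "d > 0"
  shows "frac_ker_const s d < \<infinity>" "frac_ker_const s d > 0"
proof -
  \<comment> \<open>\<open>m\<close> is at least the order \<open>1 + s + d / 2\<close> of the power
    singularity at 0.\<close>
  obtain m :: nat where m: "1 + s + d / 2 \<le> m" "m > 0" using real_arch_simple[of "1 + s + d / 2"] s d
    by (metis (no_types, opaque_lifting) add_pos_pos divide_pos_pos less_le_trans of_nat_0_less_iff zero_less_numeral zero_less_one)
  define C where "C = (2 * pi) powr (- d / 2) * (1 + (2 * real m) ^ m)"
  have C: "(2 * pi) powr (- d / 2) * (2 * real m) ^ m \<le> C" "(2 * pi) powr (- d / 2) \<le> C" "C \<ge> 0"
    by (auto simp: C_def mult_left_mono)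
  have split: "t powr (-1 - s) * ((2 * pi * t) powr (- d / 2) * exp (- 1 / (2 * t)))
     = (2 * pi) powr (- d / 2) * (t powr (- (1 + s + d / 2)) * exp (- 1 / (2 * t)))" if "t > 0" for t
  proof -
    have "(2 * pi * t) powr (- d / 2) = (2 * pi) powr (- d / 2) * t powr (- d / 2)"
      using that by (simp add: powr_mult)
    moreover have "t powr (-1 - s) * t powr (- d / 2) = t powr (- (1 + s + d / 2))"
      by (simp add: powr_add[symmetric])
    ultimately show ?thesis by (simp add: mult_ac)
  qed
  show "frac_ker_const s d < \<infinity>"
    unfolding frac_ker_const_def
  proof (rule nn_integral_pos_finite[where a=0 and b="-1-s" and C=C])
    fix t :: real assume t: "0 < t" "t \<le> 1"
    have "t powr (- (1 + s + d / 2)) = (1/t) powr (1 + s + d / 2)"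
      by (subst powr_minus_divide) (use t in \<open>simp add: powr_divide\<close>)
    also have "\<dots> \<le> (1/t) powr real m" using t m by (intro powr_mono) auto
    also have "\<dots> = (1/t) ^ m" using t by (simp add: powr_realpow)
    finally have 1: "t powr (- (1 + s + d / 2)) \<le> (1/t) ^ m" .
    \<comment> \<open>\<open>(1 + x / m)^m \<le> exp x\<close> with \<open>x = 1 / (2 * t)\<close>:
      the Gaussian factor beats any power of \<open>1 / t\<close>.\<close>
    have "((1/t) / (2 * real m)) ^ m \<le> (1 + (1 / (2 * t)) / real m) ^ m"
      using t by (intro power_mono) (auto simp: field_simps)
    also have "\<dots> \<le> exp (1 / (2 * t))"
      by (rule exp_ge_one_plus_x_over_n_power_n) (use t m in \<open>auto intro: order_trans[of _ 0]\<close>)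
    finally have "(1/t) ^ m / (2 * real m) ^ m \<le> exp (1 / (2 * t))" by (simp only: power_divide)
    then have 2: "(1/t) ^ m \<le> (2 * real m) ^ m * exp (1 / (2 * t))"
      using m by (simp add: divide_le_eq mult.commute)
    have "t powr (- (1 + s + d / 2)) * exp (- 1 / (2 * t)) \<le> ((2 * real m) ^ m * exp (1 / (2 * t))) * exp (- 1 / (2 * t))"
      using 1 2 by (intro mult_right_mono) auto
    also have "\<dots> = (2 * real m) ^ m" by (simp add: mult.assoc exp_minus)
    finally have "(2 * pi) powr (- d / 2) * (t powr (- (1 + s + d / 2)) * exp (- 1 / (2 * t))) \<le> (2 * pi) powr (- d / 2) * (2 * real m) ^ m"
      by (intro mult_left_mono) auto
    also have "\<dots> \<le> C * t powr 0" using C(1) t by simp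
    finally show "ennreal (t powr (-1 - s) * ((2 * pi * t) powr (- d / 2) * exp (- 1 / (2 * t)))) \<le> ennreal (C * t powr 0)"
      unfolding split[OF t(1)] by (rule ennreal_leI)
  next
    fix t :: real assume t: "t \<ge> 1"
    have "t powr (- (1 + s + d / 2)) * exp (- 1 / (2 * t)) \<le> t powr (- 1 - s) * 1"
      using t s d by (intro mult_mono powr_mono) auto
    then have "(2 * pi) powr (- d / 2) * (t powr (- (1 + s + d / 2)) * exp (- 1 / (2 * t))) \<le> C * t powr (-1 - s)"
      using C by (intro mult_mono) auto
    then show "ennreal (t powr (-1 - s) * ((2 * pi * t) powr (- d / 2) * exp (- 1 / (2 * t)))) \<le> ennreal (C * t powr (-1 - s))"
      using t by (subst split) (auto intro: ennreal_leI)
  qed (use s C in auto)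
  show "frac_ker_const s d > 0"
    unfolding frac_ker_const_def by (rule nn_integral_pos_positive) auto
qed

lemma frac_sym_integral:
  fixes \<xi> :: "'a::euclidean_space"
  assumes s: "0 < s"
  shows "(\<integral>\<^sup>+t\<in>{0<..}. ennreal (t powr (-1 - s) * (1 - exp (- t * (norm \<xi>)^2 / 2))) \<partial>lborel) = frac_sym_const s * ennreal (norm \<xi> powr (2 * s))"
proof (cases "\<xi> = 0")
  case True then show ?thesis using s by simp
next
  case False
  define r where "r = (norm \<xi>)^2"
  have r: "r > 0" using False by (simp add: r_def)
  have rp: "norm \<xi> powr (2 * s) = r powr s" using False by (simp add: r_def powr_powr[symmetric] powr_numeral[symmetric] del: powr_numeral)
  have "frac_sym_const s = ennreal r * (\<integral>\<^sup>+t\<in>{0<..}. ennreal ((r * t) powr (-1 - s) * (1 - exp (- (r * t) / 2))) \<partial>lborel)"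
    unfolding frac_sym_const_def by (rule nn_integral_pos_scale[OF r]) auto
  also have "(\<integral>\<^sup>+t\<in>{0<..}. ennreal ((r * t) powr (-1 - s) * (1 - exp (- (r * t) / 2))) \<partial>lborel)
     = (\<integral>\<^sup>+t. ennreal (r powr (-1 - s)) * (ennreal (t powr (-1 - s) * (1 - exp (- t * r / 2))) * indicator {0<..} t) \<partial>lborel)"
  proof (rule nn_integral_cong)
    fix t :: real
    show "ennreal ((r * t) powr (-1 - s) * (1 - exp (- (r * t) / 2))) * indicator {0<..} t
      = ennreal (r powr (-1 - s)) * (ennreal (t powr (-1 - s) * (1 - exp (- t * r / 2))) * indicator {0<..} t)"
      using r by (cases "t > 0") (auto simp: powr_mult ennreal_mult[symmetric] mult_ac)
  qed
  also have "\<dots> = ennreal (r powr (-1 - s)) * (\<integral>\<^sup>+t\<in>{0<..}. ennreal (t powr (-1 - s) * (1 - exp (- t * r / 2))) \<partial>lborel)"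
    by (rule nn_integral_cmult) auto
  finally have "frac_sym_const s * ennreal (r powr s) = (ennreal r * ennreal (r powr (-1 - s)) * ennreal (r powr s)) * (\<integral>\<^sup>+t\<in>{0<..}. ennreal (t powr (-1 - s) * (1 - exp (- t * r / 2))) \<partial>lborel)"
    by (simp only: mult_ac)
  also have "ennreal r * ennreal (r powr (-1 - s)) * ennreal (r powr s) = ennreal (r powr 1 * r powr (-1 - s) * r powr s)"
    using r by (simp add: ennreal_mult)
  also have "r powr 1 * r powr (-1 - s) * r powr s = 1" using r by (simp only: powr_add[symmetric]) simp
  finally show ?thesis unfolding rp r_def[symmetric] by simp
qed

text \<open>The substitution of \<open>(norm h)^2 * t\<close> for \<open>t\<close> brings out the
  homogeneity. The point \<open>h = 0\<close> is excluded: there the left side diverges, while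
  \<open>0 powr a = 0\<close> makes the right side 0.\<close>

lemma frac_ker_integral:
  fixes h :: "'a::euclidean_space"
  assumes h: "h \<noteq> 0"
  shows "(\<integral>\<^sup>+t\<in>{0<..}. ennreal (t powr (-1 - s) * heat t h) \<partial>lborel) = frac_ker_const s (real DIM('a)) * ennreal (norm h powr (- (real DIM('a) + 2 * s)))"
proof -
  define r where "r = (norm h)^2"
  define d where "d = real DIM('a)"
  have r: "r > 0" using h by (simp add: r_def)
  have rp: "norm h powr (- (d + 2 * s)) = r powr (- (d / 2 + s))"
  proof -
    have "r powr (- (d / 2 + s)) = (norm h powr 2) powr (- (d / 2 + s))" using h by (simp add: r_def)
    also have "\<dots> = norm h powr (2 * (- (d / 2 + s)))" by (rule powr_powr)
    also have "2 * (- (d / 2 + s)) = - (d + 2 * s)" by simp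
    finally show ?thesis ..
  qed
  have "(\<integral>\<^sup>+t\<in>{0<..}. ennreal (t powr (-1 - s) * heat t h) \<partial>lborel)
     = ennreal r * (\<integral>\<^sup>+t\<in>{0<..}. ennreal ((r * t) powr (-1 - s) * heat (r * t) h) \<partial>lborel)"
    by (rule nn_integral_pos_scale[OF r]) (unfold heat_def, measurable)
  also have "(\<integral>\<^sup>+t\<in>{0<..}. ennreal ((r * t) powr (-1 - s) * heat (r * t) h) \<partial>lborel)
     = (\<integral>\<^sup>+t. ennreal (r powr (-1 - s) * r powr (- d / 2)) * (ennreal (t powr (-1 - s) * ((2 * pi * t) powr (- d / 2) * exp (- 1 / (2 * t)))) * indicator {0<..} t) \<partial>lborel)"
  proof (rule nn_integral_cong)
    fix t :: real
    show "ennreal ((r * t) powr (-1 - s) * heat (r * t) h) * indicator {0<..} t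
      = ennreal (r powr (-1 - s) * r powr (- d / 2)) * (ennreal (t powr (-1 - s) * ((2 * pi * t) powr (- d / 2) * exp (- 1 / (2 * t)))) * indicator {0<..} t)"
    proof (cases "t > 0")
      case True
      have "- (norm h)\<^sup>2 / (2 * (r * t)) = - 1 / (2 * t)" using r by (simp add: r_def[symmetric])
      moreover have "(2 * pi * (r * t)) powr (- d / 2) = r powr (- d / 2) * (2 * pi * t) powr (- d / 2)"
        using r True by (simp add: powr_mult mult_ac)
      moreover have "(r * t) powr (-1 - s) = r powr (-1 - s) * t powr (-1 - s)" using r True by (simp add: powr_mult)
      ultimately have "(r * t) powr (-1 - s) * heat (r * t) h = (r powr (-1 - s) * r powr (- d / 2)) * (t powr (-1 - s) * ((2 * pi * t) powr (- d / 2) * exp (- 1 / (2 * t))))"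
        unfolding heat_def d_def[symmetric] by (simp only: mult_ac)
      then show ?thesis using True by (simp add: ennreal_mult)
    qed auto
  qed
  also have "\<dots> = ennreal (r powr (-1 - s) * r powr (- d / 2)) * frac_ker_const s d"
    unfolding frac_ker_const_def by (rule nn_integral_cmult) measurable
  also have "ennreal r * (ennreal (r powr (-1 - s) * r powr (- d / 2)) * frac_ker_const s d) = frac_ker_const s d * ennreal (r powr 1 * r powr (-1 - s) * r powr (- d / 2))"
    using r by (simp add: ennreal_mult mult_ac)
  also have "r powr 1 * r powr (-1 - s) * r powr (- d / 2) = r powr (- (d / 2 + s))"
    by (simp only: powr_add[symmetric]) (simp add: algebra_simps)
  finally show ?thesis unfolding rp[unfolded d_def] d_def .
qed

lemma nn_integral_heat_cos:
  fixes \<xi> :: "'a::euclidean_space"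
  assumes t: "t > 0"
  shows "(\<integral>\<^sup>+h. ennreal (heat t h * (2 * (1 - cos (h \<bullet> \<xi>)))) \<partial>lborel) = ennreal (2 * (1 - exp (- t * (norm \<xi>)^2 / 2)))"
proof -
  have "(\<integral>\<^sup>+h. ennreal (2 * ((1 - cos (h \<bullet> \<xi>)) * heat t h)) \<partial>lborel) = ennreal (LINT h|lborel. 2 * ((1 - cos (h \<bullet> \<xi>)) * heat t h))"
    by (rule nn_integral_eq_integral) (use heat_cos(1)[OF t, of \<xi>] in auto)
  also have "(LINT h|lborel. 2 * ((1 - cos (h \<bullet> \<xi>)) * heat t h)) = 2 * (1 - exp (- t * (norm \<xi>)^2 / 2))"
    by (simp only: integral_mult_right_zero heat_cos(2)[OF t])
  finally show ?thesis by (simp only: mult.left_commute mult.commute)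
qed

text \<open>Tonelli's theorem applied to \<open>shift_dist_fourier\<close>; the average over
  \<open>h\<close> acts only on the cosine and is evaluated by \<open>heat_cos\<close>.\<close>

lemma heat_shift_identity:
  fixes u :: "'a::euclidean_space \<Rightarrow> real"
  assumes u: "sq_integrable lborel u" and w: "is_L2_fourier u w" and t: "t > 0"
  shows "(\<integral>\<^sup>+h. ennreal (heat t h * shift_dist u h) \<partial>lborel) = (\<integral>\<^sup>+\<xi>. ennreal (2 * (1 - exp (- t * (norm \<xi>)^2 / 2)) * (cmod (w \<xi>))^2) \<partial>lborel)"
proof -
  have ws: "sq_integrable lborel w" using w by (simp add: is_L2_fourier_iff)
  have [measurable]: "w \<in> borel_measurable borel" using ws by (simp add: sq_integrable_def)
  have i: "integrable lborel (\<lambda>\<xi>. 2 * (1 - cos (h \<bullet> \<xi>)) * (cmod (w \<xi>))^2)" for h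
  proof (rule Bochner_Integration.integrable_bound)
    show "integrable lborel (\<lambda>\<xi>. 4 * (cmod (w \<xi>))^2)" using ws by (simp add: sq_integrable_def)
    have "0 \<le> 2 * (1 - x) \<and> 2 * (1 - x) \<le> 4" if "-1 \<le> x" "x \<le> 1" for x :: real
      using that by auto
    from this[OF cos_ge_minus_one cos_le_one]
    have "0 \<le> 2 * (1 - cos a)" "2 * (1 - cos a) \<le> 4" for a :: real by blast+
    moreover have "norm (k * c) \<le> norm (4 * c)" if "0 \<le> k" "k \<le> 4" "0 \<le> c" for k c :: real
      using mult_right_mono[OF that(2,3)] that by (simp add: abs_mult)
    ultimately show "AE \<xi> in lborel. norm (2 * (1 - cos (h \<bullet> \<xi>)) * (cmod (w \<xi>))^2) \<le> norm (4 * (cmod (w \<xi>))^2)"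
      by (intro AE_I2) (meson zero_le_power2)
  qed measurable
  have "(\<integral>\<^sup>+h. ennreal (heat t h * shift_dist u h) \<partial>lborel) = (\<integral>\<^sup>+h. \<integral>\<^sup>+\<xi>. ennreal (heat t h * (2 * (1 - cos (h \<bullet> \<xi>)))) * ennreal ((cmod (w \<xi>))^2) \<partial>lborel \<partial>lborel)"
  proof (rule nn_integral_cong)
    fix h :: 'a
    have "ennreal (shift_dist u h) = (\<integral>\<^sup>+\<xi>. ennreal (2 * (1 - cos (h \<bullet> \<xi>)) * (cmod (w \<xi>))^2) \<partial>lborel)"
      unfolding shift_dist_fourier[OF u w] by (rule nn_integral_eq_integral[symmetric, OF i]) simp
    then have "ennreal (heat t h * shift_dist u h) = ennreal (heat t h) * (\<integral>\<^sup>+\<xi>. ennreal (2 * (1 - cos (h \<bullet> \<xi>)) * (cmod (w \<xi>))^2) \<partial>lborel)"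
      by (simp add: ennreal_mult)
    also have "\<dots> = (\<integral>\<^sup>+\<xi>. ennreal (heat t h) * ennreal (2 * (1 - cos (h \<bullet> \<xi>)) * (cmod (w \<xi>))^2) \<partial>lborel)"
      by (rule nn_integral_cmult[symmetric]) measurable
    also have "\<dots> = (\<integral>\<^sup>+\<xi>. ennreal (heat t h * (2 * (1 - cos (h \<bullet> \<xi>)))) * ennreal ((cmod (w \<xi>))^2) \<partial>lborel)"
      by (intro nn_integral_cong) (simp add: ennreal_mult[symmetric] mult_ac)
    finally show "ennreal (heat t h * shift_dist u h) = (\<integral>\<^sup>+\<xi>. ennreal (heat t h * (2 * (1 - cos (h \<bullet> \<xi>)))) * ennreal ((cmod (w \<xi>))^2) \<partial>lborel)" .
  qed
  also have "\<dots> = (\<integral>\<^sup>+\<xi>. \<integral>\<^sup>+h. ennreal (heat t h * (2 * (1 - cos (h \<bullet> \<xi>)))) * ennreal ((cmod (w \<xi>))^2) \<partial>lborel \<partial>lborel)"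
    by (rule lborel_pair.Fubini') measurable
  also have "\<dots> = (\<integral>\<^sup>+\<xi>. (\<integral>\<^sup>+h. ennreal (heat t h * (2 * (1 - cos (h \<bullet> \<xi>)))) \<partial>lborel) * ennreal ((cmod (w \<xi>))^2) \<partial>lborel)"
    by (intro nn_integral_cong nn_integral_multc) measurable
  also have "\<dots> = (\<integral>\<^sup>+\<xi>. ennreal (2 * (1 - exp (- t * (norm \<xi>)^2 / 2)) * (cmod (w \<xi>))^2) \<partial>lborel)"
    unfolding nn_integral_heat_cos[OF t] using t by (intro nn_integral_cong) (simp add: ennreal_mult)
  finally show ?thesis .
qed

text \<open>Both sides equal the integral of \<open>t powr (-1 - s)\<close> times the heat average
  of \<open>shift_dist u\<close>, computed once over frequencies and once over shifts. In extended
  values no finiteness has to be assumed, so the identity can decide membership in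
  \<open>Hs\<close>.\<close>

theorem fourier_Gagliardo:
  fixes u :: "'a::euclidean_space \<Rightarrow> real"
  assumes u: "sq_integrable lborel u" and w: "is_L2_fourier u w" and s: "0 < s"
  shows "2 * frac_sym_const s * (\<integral>\<^sup>+\<xi>. ennreal (norm \<xi> powr (2 * s) * (cmod (w \<xi>))^2) \<partial>lborel)
    = frac_ker_const s (real DIM('a)) * (\<integral>\<^sup>+h. ennreal (norm h powr (- (real DIM('a) + 2 * s)) * shift_dist u h) \<partial>lborel)"
proof -
  have ws: "sq_integrable lborel w" using w by (simp add: is_L2_fourier_iff)
  have [measurable]: "w \<in> borel_measurable borel" "u \<in> borel_measurable borel" using ws u by (auto simp: sq_integrable_def)
  have hm [measurable]: "(\<lambda>(t, h). heat t (h::'a)) \<in> borel_measurable (borel \<Otimes>\<^sub>M borel)" unfolding heat_def by measurable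
  have "(\<integral>\<^sup>+t\<in>{0<..}. ennreal (t powr (-1 - s)) * (\<integral>\<^sup>+h. ennreal (heat t h * shift_dist u h) \<partial>lborel) \<partial>lborel)
     = (\<integral>\<^sup>+t. \<integral>\<^sup>+h. ennreal (t powr (-1 - s) * heat t h) * indicator {0<..} t * ennreal (shift_dist u h) \<partial>lborel \<partial>lborel)"
  proof (rule nn_integral_cong)
    fix t :: real
    have "(\<integral>\<^sup>+h. ennreal (t powr (-1 - s) * heat t h) * indicator {0<..} t * ennreal (shift_dist u h) \<partial>lborel)
      = (\<integral>\<^sup>+h. (ennreal (t powr (-1 - s)) * indicator {0<..} t) * ennreal (heat t h * shift_dist u h) \<partial>lborel)"
      by (intro nn_integral_cong) (simp add: ennreal_mult mult_ac)
    also have "\<dots> = (ennreal (t powr (-1 - s)) * indicator {0<..} t) * (\<integral>\<^sup>+h. ennreal (heat t h * shift_dist u h) \<partial>lborel)"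
      by (rule nn_integral_cmult) measurable
    finally show "ennreal (t powr (-1 - s)) * (\<integral>\<^sup>+h. ennreal (heat t h * shift_dist u h) \<partial>lborel) * indicator {0<..} t
       = (\<integral>\<^sup>+h. ennreal (t powr (-1 - s) * heat t h) * indicator {0<..} t * ennreal (shift_dist u h) \<partial>lborel)"
      by (simp add: mult_ac)
  qed
  also have "\<dots> = (\<integral>\<^sup>+h. \<integral>\<^sup>+t. ennreal (t powr (-1 - s) * heat t h) * indicator {0<..} t * ennreal (shift_dist u h) \<partial>lborel \<partial>lborel)"
    by (rule lborel_pair.Fubini') measurable
  also have "\<dots> = (\<integral>\<^sup>+h. (\<integral>\<^sup>+t\<in>{0<..}. ennreal (t powr (-1 - s) * heat t h) \<partial>lborel) * ennreal (shift_dist u h) \<partial>lborel)"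
    by (intro nn_integral_cong nn_integral_multc) measurable
  also have "\<dots> = (\<integral>\<^sup>+h. frac_ker_const s (real DIM('a)) * ennreal (norm h powr (- (real DIM('a) + 2 * s)) * shift_dist u h) \<partial>lborel)"
  proof (rule nn_integral_cong)
    fix h :: 'a
    show "(\<integral>\<^sup>+t\<in>{0<..}. ennreal (t powr (-1 - s) * heat t h) \<partial>lborel) * ennreal (shift_dist u h)
      = frac_ker_const s (real DIM('a)) * ennreal (norm h powr (- (real DIM('a) + 2 * s)) * shift_dist u h)"
    proof (cases "h = 0")
      \<comment> \<open>The divergent \<open>t\<close>-integral meets the factor
        \<open>shift_dist u 0 = 0\<close>, and \<open>\<infinity> * 0 = 0\<close>.\<close>
      case True
      then show ?thesis by (simp add: shift_dist_def)
    next
      case False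
      then show ?thesis unfolding frac_ker_integral[OF False] by (simp add: ennreal_mult mult_ac)
    qed
  qed
  also have "\<dots> = frac_ker_const s (real DIM('a)) * (\<integral>\<^sup>+h. ennreal (norm h powr (- (real DIM('a) + 2 * s)) * shift_dist u h) \<partial>lborel)"
    by (rule nn_integral_cmult) measurable
  finally have R: "(\<integral>\<^sup>+t\<in>{0<..}. ennreal (t powr (-1 - s)) * (\<integral>\<^sup>+h. ennreal (heat t h * shift_dist u h) \<partial>lborel) \<partial>lborel) = \<dots>" .
  have "(\<integral>\<^sup>+t\<in>{0<..}. ennreal (t powr (-1 - s)) * (\<integral>\<^sup>+h. ennreal (heat t h * shift_dist u h) \<partial>lborel) \<partial>lborel)
     = (\<integral>\<^sup>+t. \<integral>\<^sup>+\<xi>. ennreal (t powr (-1 - s) * (1 - exp (- t * (norm \<xi>)^2 / 2))) * indicator {0<..} t * ennreal (2 * (cmod (w \<xi>))^2) \<partial>lborel \<partial>lborel)"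
  proof (rule nn_integral_cong)
    fix t :: real
    show "ennreal (t powr (-1 - s)) * (\<integral>\<^sup>+h. ennreal (heat t h * shift_dist u h) \<partial>lborel) * indicator {0<..} t
       = (\<integral>\<^sup>+\<xi>. ennreal (t powr (-1 - s) * (1 - exp (- t * (norm \<xi>)^2 / 2))) * indicator {0<..} t * ennreal (2 * (cmod (w \<xi>))^2) \<partial>lborel)"
    proof (cases "t > 0")
      case True
      have "ennreal (t powr (-1 - s)) * (\<integral>\<^sup>+h. ennreal (heat t h * shift_dist u h) \<partial>lborel)
        = (\<integral>\<^sup>+\<xi>. ennreal (t powr (-1 - s)) * ennreal (2 * (1 - exp (- t * (norm \<xi>)^2 / 2)) * (cmod (w \<xi>))^2) \<partial>lborel)"
        unfolding heat_shift_identity[OF u w True] by (rule nn_integral_cmult[symmetric]) measurable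
      also have "\<dots> = (\<integral>\<^sup>+\<xi>. ennreal (t powr (-1 - s) * (1 - exp (- t * (norm \<xi>)^2 / 2))) * ennreal (2 * (cmod (w \<xi>))^2) \<partial>lborel)"
        using True by (intro nn_integral_cong) (simp add: ennreal_mult[symmetric] mult_ac)
      finally show ?thesis using True by simp
    qed simp
  qed
  also have "\<dots> = (\<integral>\<^sup>+\<xi>. \<integral>\<^sup>+t. ennreal (t powr (-1 - s) * (1 - exp (- t * (norm \<xi>)^2 / 2))) * indicator {0<..} t * ennreal (2 * (cmod (w \<xi>))^2) \<partial>lborel \<partial>lborel)"
    by (rule lborel_pair.Fubini') measurable
  also have "\<dots> = (\<integral>\<^sup>+\<xi>. (\<integral>\<^sup>+t\<in>{0<..}. ennreal (t powr (-1 - s) * (1 - exp (- t * (norm \<xi>)^2 / 2))) \<partial>lborel) * ennreal (2 * (cmod (w \<xi>))^2) \<partial>lborel)"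
    by (intro nn_integral_cong nn_integral_multc) measurable
  also have "\<dots> = (\<integral>\<^sup>+\<xi>. (2 * frac_sym_const s) * ennreal (norm \<xi> powr (2 * s) * (cmod (w \<xi>))^2) \<partial>lborel)"
    unfolding frac_sym_integral[OF s] by (intro nn_integral_cong) (simp add: ennreal_mult mult_ac)
  also have "\<dots> = 2 * frac_sym_const s * (\<integral>\<^sup>+\<xi>. ennreal (norm \<xi> powr (2 * s) * (cmod (w \<xi>))^2) \<partial>lborel)"
    by (rule nn_integral_cmult) measurable
  finally show ?thesis using R by simp
qed

text \<open>The constant that makes the Gagliardo seminorm agree with \<open>frac_sq\<close>; the Gagliardo
  double integral is then the squared \<open>L\<^sup>2\<close> norm of \<open>pdiff u\<close> for the measure \<open>gag s\<close> on pairs.\<close>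

definition gag_const :: "real \<Rightarrow> real \<Rightarrow> real" where
  "gag_const s d = enn2real (frac_ker_const s d) / (2 * enn2real (frac_sym_const s))"

definition gag_ker :: "real \<Rightarrow> 'a::euclidean_space \<Rightarrow> real" where
  "gag_ker s h = gag_const s (real DIM('a)) * norm h powr (- (real DIM('a) + 2 * s))"

definition gag :: "real \<Rightarrow> ('a::euclidean_space \<times> 'a) measure" where
  "gag s = density lborel (\<lambda>z. ennreal (gag_ker s (fst z - snd z)))"

definition pdiff :: "('a \<Rightarrow> real) \<Rightarrow> 'a \<times> 'a \<Rightarrow> real" where
  "pdiff u z = u (fst z) - u (snd z)"

lemma gag_const_pos:
  assumes "0 < s" "s < 1" "d > 0"
  shows "gag_const s d > 0"
  using frac_sym_const_finite[OF assms(1,2)] frac_ker_const_finite[OF assms]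
  by (auto simp: gag_const_def enn2real_positive_iff)

lemma gag_ker_measurable [measurable]: "gag_ker s \<in> borel_measurable borel"
  unfolding gag_ker_def by measurable

lemma sets_gag [measurable_cong, simp]: "sets (gag s) = sets borel"
  by (simp add: gag_def)

lemma space_gag [simp]: "space (gag s) = UNIV"
  by (simp add: gag_def)

lemma fst_snd_borel [measurable]:
  "fst \<in> borel_measurable (borel :: ('a::euclidean_space \<times> 'a) measure)" "snd \<in> borel_measurable (borel :: ('a::euclidean_space \<times> 'a) measure)"
  by (auto intro!: borel_measurable_continuous_onI continuous_intros)

lemma nn_integral_gag:
  fixes f :: "'a::euclidean_space \<times> 'a \<Rightarrow> ennreal"
  assumes [measurable]: "f \<in> borel_measurable borel"
  shows "(\<integral>\<^sup>+z. f z \<partial>gag s) = (\<integral>\<^sup>+x. \<integral>\<^sup>+y. ennreal (gag_ker s (x - y)) * f (x, y) \<partial>lborel \<partial>lborel)"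
proof -
  have m: "(\<lambda>z. ennreal (gag_ker s (fst z - snd z)) * f z) \<in> borel_measurable borel" by measurable
  have "(\<integral>\<^sup>+z. f z \<partial>gag s) = (\<integral>\<^sup>+z. ennreal (gag_ker s (fst z - snd z)) * f z \<partial>lborel)"
    unfolding gag_def by (rule nn_integral_density) measurable
  also have "\<dots> = (\<integral>\<^sup>+z. ennreal (gag_ker s (fst z - snd z)) * f z \<partial>(lborel \<Otimes>\<^sub>M lborel))"
    by (simp add: lborel_prod)
  also have "\<dots> = (\<integral>\<^sup>+x. \<integral>\<^sup>+y. ennreal (gag_ker s (x - y)) * f (x, y) \<partial>lborel \<partial>lborel)"
    by (subst lborel.nn_integral_fst[symmetric]) (use m in \<open>simp_all add: lborel_prod\<close>)
  finally show ?thesis .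
qed

lemma pdiff_measurable [measurable]:
  fixes u :: "'a::euclidean_space \<Rightarrow> real"
  assumes [measurable]: "u \<in> borel_measurable borel"
  shows "pdiff u \<in> borel_measurable borel"
  unfolding pdiff_def by measurable

lemma nn_integral_pdiff_shift_dist:
  fixes u :: "'a::euclidean_space \<Rightarrow> real"
  assumes u: "sq_integrable lborel u"
  shows "(\<integral>\<^sup>+z. ennreal ((pdiff u z)^2) \<partial>gag s) = (\<integral>\<^sup>+h. ennreal (gag_ker s h) * ennreal (shift_dist u h) \<partial>lborel)"
proof -
  have [measurable]: "u \<in> borel_measurable borel" using u by (auto simp: sq_integrable_def)
  have "(\<integral>\<^sup>+z. ennreal ((pdiff u z)^2) \<partial>gag s) = (\<integral>\<^sup>+x. \<integral>\<^sup>+y. ennreal (gag_ker s (x - y)) * ennreal ((u x - u y)^2) \<partial>lborel \<partial>lborel)"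
    by (subst nn_integral_gag) (auto simp: pdiff_def)
  also have "\<dots> = (\<integral>\<^sup>+y. \<integral>\<^sup>+x. ennreal (gag_ker s (x - y)) * ennreal ((u x - u y)^2) \<partial>lborel \<partial>lborel)"
    by (rule lborel_pair.Fubini'[symmetric]) measurable
  also have "\<dots> = (\<integral>\<^sup>+y. \<integral>\<^sup>+h. ennreal (gag_ker s h) * ennreal ((u (h + y) - u y)^2) \<partial>lborel \<partial>lborel)"
  proof (rule nn_integral_cong)
    fix y :: 'a
    show "(\<integral>\<^sup>+x. ennreal (gag_ker s (x - y)) * ennreal ((u x - u y)^2) \<partial>lborel) = (\<integral>\<^sup>+h. ennreal (gag_ker s h) * ennreal ((u (h + y) - u y)^2) \<partial>lborel)"
      using nn_integral_translate[of "\<lambda>x. ennreal (gag_ker s (x - y)) * ennreal ((u x - u y)^2)" y]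
      by (simp add: add.commute)
  qed
  also have "\<dots> = (\<integral>\<^sup>+h. \<integral>\<^sup>+y. ennreal (gag_ker s h) * ennreal ((u (h + y) - u y)^2) \<partial>lborel \<partial>lborel)"
    by (rule lborel_pair.Fubini'[symmetric]) measurable
  also have "\<dots> = (\<integral>\<^sup>+h. ennreal (gag_ker s h) * ennreal (shift_dist u h) \<partial>lborel)"
  proof (rule nn_integral_cong)
    fix h :: 'a
    have "(\<integral>\<^sup>+y. ennreal ((u (h + y) - u y)^2) \<partial>lborel) = ennreal (shift_dist u h)"
      unfolding shift_dist_def using nn_integral_eq_integral[OF sq_integrableD(2)[OF sq_integrable_shift_diff[OF u, of h]]] by simp
    then show "(\<integral>\<^sup>+y. ennreal (gag_ker s h) * ennreal ((u (h + y) - u y)^2) \<partial>lborel) = ennreal (gag_ker s h) * ennreal (shift_dist u h)"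
      by (subst nn_integral_cmult) auto
  qed
  finally show ?thesis .
qed

theorem frac_sq_Gagliardo:
  fixes u :: "'a::euclidean_space \<Rightarrow> real"
  assumes s: "0 < s" "s < 1" and u: "sq_integrable lborel u" and w: "is_L2_fourier u w"
  shows "(\<integral>\<^sup>+\<xi>. ennreal (norm \<xi> powr (2 * s) * (cmod (w \<xi>))^2) \<partial>lborel) = (\<integral>\<^sup>+z. ennreal ((pdiff u z)^2) \<partial>gag s)"
proof -
  have [measurable]: "u \<in> borel_measurable borel" using u by (auto simp: sq_integrable_def)
  define a where "a = enn2real (frac_sym_const s)"
  define b where "b = enn2real (frac_ker_const s (real DIM('a)))"
  have a: "frac_sym_const s = ennreal a" "a > 0" using frac_sym_const_finite[OF s] by (auto simp: a_def enn2real_positive_iff)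
  have b: "frac_ker_const s (real DIM('a)) = ennreal b" "b > 0"
    using frac_ker_const_finite[OF s, of "real DIM('a)"] by (auto simp: b_def enn2real_positive_iff)
  let ?X = "\<integral>\<^sup>+\<xi>. ennreal (norm \<xi> powr (2 * s) * (cmod (w \<xi>))^2) \<partial>lborel"
  let ?Y = "\<integral>\<^sup>+h. ennreal (norm h powr (- (real DIM('a) + 2 * s)) * shift_dist u h) \<partial>lborel"
  have "ennreal (2 * a) * ?X = ennreal b * ?Y"
    using fourier_Gagliardo[OF u w s(1)] a b by (simp add: ennreal_mult)
  then have "ennreal (1 / (2 * a)) * (ennreal (2 * a) * ?X) = ennreal (1 / (2 * a)) * (ennreal b * ?Y)" by simp
  then have "?X = ennreal (b / (2 * a)) * ?Y"
    using a(2) b(2) by (simp add: mult.assoc[symmetric] ennreal_mult[symmetric])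
  also have "\<dots> = (\<integral>\<^sup>+h. ennreal (b / (2 * a)) * ennreal (norm h powr (- (real DIM('a) + 2 * s)) * shift_dist u h) \<partial>lborel)"
    by (rule nn_integral_cmult[symmetric]) measurable
  also have "\<dots> = (\<integral>\<^sup>+h. ennreal (gag_ker s h) * ennreal (shift_dist u h) \<partial>lborel)"
    using a(2) b(2) by (intro nn_integral_cong) (simp add: gag_ker_def gag_const_def a_def[symmetric] b_def[symmetric] ennreal_mult[symmetric] mult_ac)
  also have "\<dots> = (\<integral>\<^sup>+z. ennreal ((pdiff u z)^2) \<partial>gag s)"
    by (rule nn_integral_pdiff_shift_dist[symmetric, OF u])
  finally show ?thesis .
qed

text \<open>\<open>Hs\<close> asks for some transform with finite weighted integral; by
  \<open>frac_sq_Gagliardo\<close> that integral is the same for all transforms, finite or not, so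
  the choice of \<open>w\<close> is immaterial.\<close>

theorem Hs_iff:
  fixes u :: "'a::euclidean_space \<Rightarrow> real"
  assumes s: "0 < s" "s < 1"
  shows "u \<in> Hs s \<longleftrightarrow> sq_integrable lborel u \<and> sq_integrable (gag s) (pdiff u)"
proof (cases "sq_integrable lborel u")
  case True
  then have [measurable]: "u \<in> borel_measurable borel" by (auto simp: sq_integrable_def)
  have *: "integrable lborel (\<lambda>\<xi>. norm \<xi> powr (2 * s) * (cmod (w \<xi>))^2) \<longleftrightarrow> sq_integrable (gag s) (pdiff u)"
    if w: "is_L2_fourier u w" for w
  proof -
    have [measurable]: "w \<in> borel_measurable borel" using w by (simp add: is_L2_fourier_iff sq_integrable_def)
    show ?thesis
      using frac_sq_Gagliardo[OF s True w] by (simp add: sq_integrable_real integrable_iff_bounded)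
  qed
  obtain w0 where "is_L2_fourier u w0" using L2_fourier_exists[OF True] by blast
  then show ?thesis using True * by (auto simp: Hs_def L2_iff)
qed (simp add: Hs_def L2_iff)

text \<open>Valid also when the seminorm is infinite: both sides are \<open>enn2real\<close> of the
  same extended number, which is 0 at infinity.\<close>

theorem frac_sq_eq:
  fixes u :: "'a::euclidean_space \<Rightarrow> real"
  assumes s: "0 < s" "s < 1" and u: "sq_integrable lborel u"
  shows "frac_sq s u = (LINT z|gag s. (pdiff u z)^2)"
proof -
  have [measurable]: "u \<in> borel_measurable borel" using u by (auto simp: sq_integrable_def)
  obtain w0 where "is_L2_fourier u w0" using L2_fourier_exists[OF u] by blast
  then have w: "is_L2_fourier u (L2_fourier u)" unfolding L2_fourier_def by (rule someI[of "is_L2_fourier u"])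
  have [measurable]: "L2_fourier u \<in> borel_measurable borel" using w by (simp add: is_L2_fourier_iff sq_integrable_def)
  show ?thesis unfolding frac_sq_def
    using frac_sq_Gagliardo[OF s u w] by (subst (1 2) integral_eq_nn_integral) auto
qed

section \<open>Sobolev inequality and local compactness\<close>

lemma lborel_prod_mult_integral:
  fixes f :: "'a::euclidean_space \<Rightarrow> real" and g :: "'b::euclidean_space \<Rightarrow> real"
  assumes f: "integrable lborel f" and g: "integrable lborel g"
  shows "integrable lborel (\<lambda>z. f (fst z) * g (snd z))"
    "(LINT z|lborel. f (fst z) * g (snd z)) = (LINT x|lborel. f x) * (LINT y|lborel. g y)"
proof -
  have i: "integrable (lborel \<Otimes>\<^sub>M lborel) (\<lambda>z. f (fst z) * g (snd z))"
    using lborel_prod_mult_integrable[OF f g] by (simp add: case_prod_beta')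
  then show "integrable lborel (\<lambda>z. f (fst z) * g (snd z))" by (simp add: lborel_prod)
  show "(LINT z|lborel. f (fst z) * g (snd z)) = (LINT x|lborel. f x) * (LINT y|lborel. g y)"
    using lborel_pair.integral_fst'[OF i] by (simp add: lborel_prod)
qed

lemma indicator_Cauchy_Schwarz:
  fixes g :: "'a::euclidean_space \<Rightarrow> real"
  assumes A: "A \<in> sets borel" "emeasure lborel A < \<infinity>" and g: "sq_integrable lborel (\<lambda>x. indicator A x * g x)"
  shows "(LINT x|lborel. indicator A x * g x)^2 \<le> measure lborel A * (LINT x|lborel. indicator A x * (g x)^2)"
proof -
  have a: "sq_integrable lborel (\<lambda>x. indicator A x * (1::real))" "(LINT x|lborel. (indicator A x * (1::real))^2) = measure lborel A"
    using sq_integrable_indicator[of A lborel "1::real"] A by auto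
  have e: "indicator A x * (1::real) * (indicator A x * g x) = indicator A x * g x"
     "(indicator A x * g x)^2 = indicator A x * (g x)^2" for x by (auto simp: indicator_def)
  show ?thesis using sq_integrable_Cauchy_Schwarz[OF a(1) g] unfolding e using a(2) by (simp add: e)
qed

section \<open>Ball averages and the energy near the diagonal\<close>

definition ball_avg :: "real \<Rightarrow> ('a::euclidean_space \<Rightarrow> real) \<Rightarrow> 'a \<Rightarrow> real" where
  "ball_avg r u x = (LINT y|lborel. indicator (ball x r) y * u y) / measure lborel (ball x r)"

lemma measure_ball_scale:
  "r \<ge> 0 \<Longrightarrow> measure lborel (ball (x::'a::euclidean_space) r) = r ^ DIM('a) * measure lborel (ball (0::'a) 1)"
  by (rule content_ball_conv_unit_ball)

lemma ball_facts:
  fixes x :: "'a::euclidean_space"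
  assumes "r > 0"
  shows "ball x r \<in> sets borel" "emeasure lborel (ball x r) < \<infinity>" "measure lborel (ball x r) > 0"
  using assms emeasure_lborel_ball_finite content_ball_pos[OF assms] by auto

lemma sq_integrable_indicator_mult:
  fixes u :: "'a::euclidean_space \<Rightarrow> real"
  assumes "sq_integrable lborel u" "A \<in> sets borel" "emeasure lborel A < \<infinity>"
  shows "sq_integrable lborel (\<lambda>x. indicator A x * u x)" "integrable lborel (\<lambda>x. indicator A x * u x)"
  using integrable_truncate_sq[OF assms] by auto

lemma ball_avg_bound:
  fixes u :: "'a::euclidean_space \<Rightarrow> real"
  assumes u: "sq_integrable lborel u" and r: "r > 0"
  shows "(ball_avg r u x)^2 \<le> (LINT x|lborel. (u x)^2) / measure lborel (ball x r)"
proof -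
  note b = ball_facts[OF r, of x]
  have "(LINT y|lborel. indicator (ball x r) y * u y)^2 \<le> measure lborel (ball x r) * (LINT y|lborel. indicator (ball x r) y * (u y)^2)"
    by (rule indicator_Cauchy_Schwarz[OF b(1,2) sq_integrable_indicator_mult(1)[OF u b(1,2)]])
  also have "(LINT y|lborel. indicator (ball x r) y * (u y)^2) \<le> (LINT y|lborel. (u y)^2)"
    using sq_integrableD(2)[OF u] by (intro integral_mono') (auto simp: indicator_def)
  finally show ?thesis using b(3)
    by (simp add: ball_avg_def power_divide divide_le_eq power2_eq_square mult.commute)
qed

lemma ball_avg_measurable [measurable]:
  fixes u :: "'a::euclidean_space \<Rightarrow> real"
  assumes [measurable]: "u \<in> borel_measurable borel"
  shows "ball_avg r u \<in> borel_measurable borel"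
proof -
  have "(\<lambda>x. LINT y|lborel. indicator {y. dist x y < r} y * u y) \<in> borel_measurable borel" by measurable
  moreover have "measure lborel (ball x r) = measure lborel (ball (0::'a) r)" for x :: 'a
  proof (cases "r \<ge> 0")
    case True
    then show ?thesis using measure_ball_scale[OF True, of x] measure_ball_scale[OF True, of "0::'a"] by simp
  next
    case False
    then have "ball x r = {}" "ball (0::'a) r = {}" by (auto simp: ball_empty)
    then show ?thesis by (simp only:)
  qed
  ultimately show ?thesis unfolding ball_avg_def ball_def by simp
qed

text \<open>The dummy argument \<open>T\<close> fixes the type \<open>'a\<close>, so that real
  constants depending on it only through its dimension can be defined.\<close>

locale frac =
  fixes s :: real and T :: "'a::euclidean_space itself"
  assumes s: "0 < s" "s < 1" and N: "real DIM('a) > 2 * s"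
begin

definition H :: "('a \<Rightarrow> real) \<Rightarrow> bool" where
  "H u \<longleftrightarrow> sq_integrable lborel u \<and> sq_integrable (gag s) (pdiff u)"

definition D :: "('a \<Rightarrow> real) \<Rightarrow> real" where
  "D u = (LINT z|gag s. (pdiff u z)^2)"

definition S :: "('a \<Rightarrow> real) \<Rightarrow> real" where
  "S u = (LINT x|lborel. (u x)^2)"

definition c0 :: real where "c0 = gag_const s (real DIM('a))"
definition v1 :: real where "v1 = measure lborel (ball (0::'a) 1)"

lemma c0: "c0 > 0" unfolding c0_def by (rule gag_const_pos) (use s in auto)
lemma v1: "v1 > 0" unfolding v1_def by (rule content_ball_pos) simp
lemma D_nonneg [simp]: "D u \<ge> 0" by (simp add: D_def)
lemma S_nonneg [simp]: "S u \<ge> 0" by (simp add: S_def)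

lemma H_measurable: "H u \<Longrightarrow> u \<in> borel_measurable borel"
  by (simp add: H_def sq_integrable_def)

lemma measure_ball: "r \<ge> 0 \<Longrightarrow> measure lborel (ball (x::'a) r) = r powr real DIM('a) * v1"
  using measure_ball_scale[of r x] by (cases "r = 0") (auto simp: v1_def powr_realpow)

text \<open>At distance at most \<open>R\<close> the kernel is at least \<open>c0\<close> times the
  power -(N + 2s) of \<open>R\<close>, with N the dimension. On the diagonal this bound fails
  because \<open>0 powr a = 0\<close>, but \<open>pdiff u\<close> vanishes there.\<close>

lemma near_diagonal:
  assumes u: "H u" and E: "E \<in> sets borel" "\<And>z. z \<in> E \<Longrightarrow> norm (fst z - snd z) \<le> R" and R: "R > 0"
  shows "integrable lborel (\<lambda>z. indicator E z * (pdiff u z)^2)"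
    "(\<integral>\<^sup>+z. ennreal (indicator E z * (pdiff u z)^2) \<partial>lborel) \<le> ennreal (R powr (real DIM('a) + 2 * s) / c0 * D u)"
    "(LINT z|lborel. indicator E z * (pdiff u z)^2) \<le> R powr (real DIM('a) + 2 * s) / c0 * D u"
proof -
  have [measurable]: "u \<in> borel_measurable borel" using H_measurable[OF u] .
  note [measurable] = E(1)
  have p: "indicator E z * (pdiff u z)^2 \<le> R powr (real DIM('a) + 2 * s) / c0 * (gag_ker s (fst z - snd z) * (pdiff u z)^2)" for z
  proof (cases "z \<in> E \<and> fst z \<noteq> snd z")
    case True
    then have z: "0 < norm (fst z - snd z)" "norm (fst z - snd z) \<le> R" using E(2) by auto
    have "1 \<le> R powr (real DIM('a) + 2 * s) * norm (fst z - snd z) powr (- (real DIM('a) + 2 * s))"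
    proof -
      have "R powr (- (real DIM('a) + 2 * s)) \<le> norm (fst z - snd z) powr (- (real DIM('a) + 2 * s))"
        by (rule powr_mono2') (use z s in auto)
      then have "R powr (real DIM('a) + 2 * s) * R powr (- (real DIM('a) + 2 * s)) \<le> R powr (real DIM('a) + 2 * s) * norm (fst z - snd z) powr (- (real DIM('a) + 2 * s))"
        by (intro mult_left_mono) auto
      then show ?thesis using R by (simp add: powr_add[symmetric])
    qed
    then have "1 * (pdiff u z)^2 \<le> (R powr (real DIM('a) + 2 * s) * norm (fst z - snd z) powr (- (real DIM('a) + 2 * s))) * (pdiff u z)^2"
      by (rule mult_right_mono) simp
    then show ?thesis using True c0 by (simp add: gag_ker_def c0_def[symmetric] mult_ac)
  next
    case False
    have "0 \<le> R powr (real DIM('a) + 2 * s) / c0 * (gag_ker s (fst z - snd z) * (pdiff u z)^2)"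
      using c0 by (simp add: gag_ker_def c0_def[symmetric])
    then show ?thesis using False by (auto simp: pdiff_def)
  qed
  have "(\<integral>\<^sup>+z. ennreal (indicator E z * (pdiff u z)^2) \<partial>lborel) \<le> (\<integral>\<^sup>+z. ennreal (R powr (real DIM('a) + 2 * s) / c0) * (ennreal (gag_ker s (fst z - snd z)) * ennreal ((pdiff u z)^2)) \<partial>lborel)"
  proof (rule nn_integral_mono)
    fix z :: "'a \<times> 'a"
    have "gag_ker s (fst z - snd z) \<ge> 0" using c0 by (simp add: gag_ker_def c0_def[symmetric])
    then have "ennreal (R powr (real DIM('a) + 2 * s) / c0) * (ennreal (gag_ker s (fst z - snd z)) * ennreal ((pdiff u z)^2))
      = ennreal (R powr (real DIM('a) + 2 * s) / c0 * (gag_ker s (fst z - snd z) * (pdiff u z)^2))"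
      using c0 by (subst ennreal_mult, simp, simp, subst ennreal_mult) auto
    then show "ennreal (indicator E z * (pdiff u z)^2) \<le> ennreal (R powr (real DIM('a) + 2 * s) / c0) * (ennreal (gag_ker s (fst z - snd z)) * ennreal ((pdiff u z)^2))"
      using ennreal_leI[OF p[of z]] by (simp only:)
  qed
  also have "\<dots> = ennreal (R powr (real DIM('a) + 2 * s) / c0) * (\<integral>\<^sup>+z. ennreal ((pdiff u z)^2) \<partial>gag s)"
    unfolding gag_def by (subst nn_integral_cmult) (measurable, simp add: nn_integral_density)
  also have "\<dots> = ennreal (R powr (real DIM('a) + 2 * s) / c0 * D u)"
  proof -
    have "(\<integral>\<^sup>+z. ennreal ((pdiff u z)^2) \<partial>gag s) = ennreal (D u)"
      unfolding D_def by (rule nn_integral_eq_integral) (use u in \<open>auto simp: H_def sq_integrable_real\<close>)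
    then show ?thesis using c0 by (simp only:, subst ennreal_mult) auto
  qed
  finally show le: "(\<integral>\<^sup>+z. ennreal (indicator E z * (pdiff u z)^2) \<partial>lborel) \<le> ennreal (R powr (real DIM('a) + 2 * s) / c0 * D u)" .
  show i: "integrable lborel (\<lambda>z. indicator E z * (pdiff u z)^2)"
    by (rule integrableI_nonneg) (measurable, use le in \<open>auto simp: le_less_trans\<close>)
  show "(LINT z|lborel. indicator E z * (pdiff u z)^2) \<le> R powr (real DIM('a) + 2 * s) / c0 * D u"
    using le c0 nn_integral_eq_integral[OF i] by (simp add: ennreal_le_iff)
qed

text \<open>Cauchy-Schwarz on the ball bounds the error by squared differences over pairs at
  distance below \<open>r\<close>. For these \<open>near_diagonal\<close> gives the power N + 2s of
  \<open>r\<close>, and the volume of the ball takes away N.\<close>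

lemma ball_avg_approx:
  assumes u: "H u" and r: "r > 0"
  shows "sq_integrable lborel (\<lambda>x. u x - ball_avg r u x)"
    "(LINT x|lborel. (u x - ball_avg r u x)^2) \<le> r powr (2 * s) / (v1 * c0) * D u"
proof -
  have us: "sq_integrable lborel u" using u by (simp add: H_def)
  have um [measurable]: "u \<in> borel_measurable borel" using H_measurable[OF u] .
  define E where "E = {z :: 'a \<times> 'a. dist (fst z) (snd z) < r}"
  have E [measurable]: "E \<in> sets borel" unfolding E_def by measurable
  have Er: "norm (fst z - snd z) \<le> r" if "z \<in> E" for z using that by (simp add: E_def dist_norm)
  define v where "v = r powr real DIM('a) * v1"
  have v: "v > 0" using r v1 by (simp add: v_def)
  have vb: "measure lborel (ball x r) = v" for x :: 'a using r by (simp add: measure_ball v_def)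
  have pt: "ennreal ((u x - ball_avg r u x)^2) \<le> ennreal (1 / v) * (\<integral>\<^sup>+y. ennreal (indicator E (x, y) * (pdiff u (x, y))^2) \<partial>lborel)" for x
  proof -
    note b = ball_facts[OF r, of x]
    let ?i = "\<lambda>y. indicator (ball x r) y :: real"
    have ii: "integrable lborel ?i" using b by (simp add: integrable_indicator_iff)
    have iu: "sq_integrable lborel (\<lambda>y. ?i y * (u x - u y))"
    proof -
      have "sq_integrable lborel (\<lambda>y. ?i y * u x - ?i y * u y)"
        by (intro sq_integrable_diff sq_integrable_indicator_mult(1)[OF us b(1,2)])
           (use sq_integrable_indicator(1)[of "ball x r" lborel "u x"] b in auto)
      then show ?thesis by (simp add: right_diff_distrib)
    qed
    have "(LINT y|lborel. ?i y * (u x - u y)) = v * u x - (LINT y|lborel. ?i y * u y)"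
      using ii sq_integrable_indicator_mult(2)[OF us b(1,2)] by (simp add: right_diff_distrib vb)
    then have e: "u x - ball_avg r u x = (LINT y|lborel. ?i y * (u x - u y)) / v"
      using v by (simp add: ball_avg_def vb diff_divide_distrib)
    have ie: "integrable lborel (\<lambda>y. ?i y * (u x - u y)^2)"
    proof -
      have "(?i y * (u x - u y))^2 = ?i y * (u x - u y)^2" for y by (auto simp: indicator_def)
      then show ?thesis using iu by (simp add: sq_integrable_real)
    qed
    have "(u x - ball_avg r u x)^2 \<le> (1 / v) * (LINT y|lborel. ?i y * (u x - u y)^2)"
      using indicator_Cauchy_Schwarz[OF b(1,2) iu] v unfolding e vb
      by (simp add: power_divide divide_le_eq power2_eq_square mult_ac)
    then have "ennreal ((u x - ball_avg r u x)^2) \<le> ennreal (1 / v) * ennreal (LINT y|lborel. ?i y * (u x - u y)^2)"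
      using v by (subst ennreal_mult[symmetric]) (auto intro: ennreal_leI)
    also have "ennreal (LINT y|lborel. ?i y * (u x - u y)^2) = (\<integral>\<^sup>+y. ennreal (?i y * (u x - u y)^2) \<partial>lborel)"
      by (rule nn_integral_eq_integral[symmetric, OF ie]) simp
    also have "\<dots> = (\<integral>\<^sup>+y. ennreal (indicator E (x, y) * (pdiff u (x, y))^2) \<partial>lborel)"
      by (intro nn_integral_cong) (auto simp: E_def indicator_def pdiff_def)
    finally show ?thesis .
  qed
  have "(\<integral>\<^sup>+x. ennreal ((u x - ball_avg r u x)^2) \<partial>lborel) \<le> (\<integral>\<^sup>+x. ennreal (1 / v) * (\<integral>\<^sup>+y. ennreal (indicator E (x, y) * (pdiff u (x, y))^2) \<partial>lborel) \<partial>lborel)"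
    by (rule nn_integral_mono) (rule pt)
  also have "\<dots> = ennreal (1 / v) * (\<integral>\<^sup>+x. \<integral>\<^sup>+y. ennreal (indicator E (x, y) * (pdiff u (x, y))^2) \<partial>lborel \<partial>lborel)"
  proof (rule nn_integral_cmult)
    have "(\<lambda>z. ennreal (indicator E z * (pdiff u z)^2)) \<in> borel_measurable (lborel \<Otimes>\<^sub>M lborel)"
      unfolding lborel_prod by measurable
    then show "(\<lambda>x. \<integral>\<^sup>+y. ennreal (indicator E (x, y) * (pdiff u (x, y))^2) \<partial>lborel) \<in> borel_measurable lborel"
      by (rule lborel.borel_measurable_nn_integral_fst)
  qed
  also have "(\<integral>\<^sup>+x. \<integral>\<^sup>+y. ennreal (indicator E (x, y) * (pdiff u (x, y))^2) \<partial>lborel \<partial>lborel) = (\<integral>\<^sup>+z. ennreal (indicator E z * (pdiff u z)^2) \<partial>(lborel \<Otimes>\<^sub>M lborel))"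
    by (rule lborel.nn_integral_fst) (unfold lborel_prod, measurable)
  also have "\<dots> \<le> ennreal (r powr (real DIM('a) + 2 * s) / c0 * D u)"
    unfolding lborel_prod by (rule near_diagonal(2)[OF u E Er r])
  also have "ennreal (1 / v) * ennreal (r powr (real DIM('a) + 2 * s) / c0 * D u) = ennreal (r powr (2 * s) / (v1 * c0) * D u)"
    using v c0 v1 r by (subst ennreal_mult[symmetric]) (auto simp: v_def powr_add)
  finally have le: "(\<integral>\<^sup>+x. ennreal ((u x - ball_avg r u x)^2) \<partial>lborel) \<le> ennreal (r powr (2 * s) / (v1 * c0) * D u)"
    by (simp add: mult_left_mono)
  show i: "sq_integrable lborel (\<lambda>x. u x - ball_avg r u x)"
    unfolding sq_integrable_real
    by (intro conjI integrableI_nonneg) (measurable, use le in \<open>auto simp: le_less_trans\<close>)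
  show "(LINT x|lborel. (u x - ball_avg r u x)^2) \<le> r powr (2 * s) / (v1 * c0) * D u"
    using le c0 v1 nn_integral_eq_integral[OF i[unfolded sq_integrable_real, THEN conjunct2]] by (simp add: ennreal_le_iff)
qed

text \<open>The difference of the two averages is the mean of \<open>pdiff u\<close> over the
  product of the two balls, a set of pairs at distance of order \<open>r\<close>. The product has
  volume of order 2N in \<open>r\<close>, against N + 2s from \<open>near_diagonal\<close>.\<close>

lemma ball_avg_halving:
  assumes u: "H u" and r: "r > 0"
  shows "(ball_avg r u x - ball_avg (r / 2) u x)^2 \<le> 2 powr (2 * real DIM('a) + 2 * s) / (v1^2 * c0) * (r powr (2 * s - real DIM('a))) * D u"
proof -
  have us: "sq_integrable lborel u" using u by (simp add: H_def)
  have um [measurable]: "u \<in> borel_measurable borel" using H_measurable[OF u] .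
  have r2: "r / 2 > 0" using r by simp
  note b = ball_facts[OF r, of x] and b' = ball_facts[OF r2, of x]
  let ?A = "ball x r" and ?B = "ball x (r / 2)"
  define v where "v = measure lborel ?A"
  define v' where "v' = measure lborel ?B"
  have v: "v > 0" "v' > 0" using b b' by (auto simp: v_def v'_def)
  let ?E = "?A \<times> ?B"
  have E [measurable]: "?E \<in> sets borel" by (intro borel_open open_Times) auto
  \<comment> \<open>A crude bound; only the power of \<open>r\<close> matters.\<close>
  have ER: "norm (fst z - snd z) \<le> 2 * r" if "z \<in> ?E" for z
  proof -
    have "dist (fst z) (snd z) \<le> dist x (fst z) + dist x (snd z)" by (rule dist_triangle3)
    then show ?thesis using that r by (auto simp: dist_norm)
  qed
  have eE: "emeasure lborel ?E = ennreal (v * v')"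
  proof -
    have "emeasure lborel ?E = emeasure (lborel \<Otimes>\<^sub>M lborel) ?E" by (simp add: lborel_prod)
    also have "\<dots> = emeasure lborel ?A * emeasure lborel ?B" by (rule lborel.emeasure_pair_measure_Times) auto
    also have "\<dots> = ennreal v * ennreal v'" using b b' unfolding v_def v'_def
      by (subst (1 2) emeasure_eq_ennreal_measure) auto
    finally show ?thesis using v by (simp add: ennreal_mult)
  qed
  have mE: "measure lborel ?E = v * v'" using eE v by (simp add: measure_def)
  have i2: "integrable lborel (\<lambda>z. indicator ?E z * (pdiff u z)^2)" using near_diagonal(1)[OF u E ER] r by simp
  have sE: "sq_integrable lborel (\<lambda>z. indicator ?E z * pdiff u z)"
  proof -
    have "(indicator ?E z * pdiff u z)^2 = indicator ?E z * (pdiff u z)^2" for z by (auto simp: indicator_def)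
    then show ?thesis unfolding sq_integrable_real using i2 by auto
  qed
  have iA: "integrable lborel (\<lambda>y. indicator ?A y :: real)" "integrable lborel (\<lambda>y. indicator ?B y :: real)"
    using b b' by (auto simp: integrable_indicator_iff)
  note iuA = sq_integrable_indicator_mult(2)[OF us b(1,2)] and iuB = sq_integrable_indicator_mult(2)[OF us b'(1,2)]
  have "indicator ?E z * pdiff u z = (indicator ?A (fst z) * u (fst z)) * indicator ?B (snd z) - indicator ?A (fst z) * (indicator ?B (snd z) * u (snd z))" for z
    by (cases z) (auto simp: indicator_def pdiff_def)
  then have "(LINT z|lborel. indicator ?E z * pdiff u z) = (LINT y|lborel. indicator ?A y * u y) * (LINT y|lborel. indicator ?B y) - (LINT y|lborel. indicator ?A y) * (LINT y|lborel. indicator ?B y * u y)"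
    using lborel_prod_mult_integral[OF iuA iA(2)] lborel_prod_mult_integral[OF iA(1) iuB] by simp
  also have "\<dots> = (v * v') * (ball_avg r u x - ball_avg (r / 2) u x)"
    using v by (simp add: ball_avg_def v_def[symmetric] v'_def[symmetric] right_diff_distrib)
  finally have I: "(LINT z|lborel. indicator ?E z * pdiff u z) = (v * v') * (ball_avg r u x - ball_avg (r / 2) u x)" .
  have "((v * v') * (ball_avg r u x - ball_avg (r / 2) u x))^2 \<le> (v * v') * (LINT z|lborel. indicator ?E z * (pdiff u z)^2)"
    using indicator_Cauchy_Schwarz[OF E _ sE] unfolding I mE eE by simp
  also have "\<dots> \<le> (v * v') * ((2 * r) powr (real DIM('a) + 2 * s) / c0 * D u)"
    using near_diagonal(3)[OF u E ER] r v by (intro mult_left_mono) auto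
  finally have "(v * v') * ((v * v') * (ball_avg r u x - ball_avg (r / 2) u x)^2) \<le> (v * v') * ((2 * r) powr (real DIM('a) + 2 * s) / c0 * D u)"
    by (simp add: power_mult_distrib power2_eq_square mult_ac)
  then have "(v * v') * (ball_avg r u x - ball_avg (r / 2) u x)^2 \<le> (2 * r) powr (real DIM('a) + 2 * s) / c0 * D u"
    using v by (subst (asm) mult_le_cancel_left_pos) auto
  then have "(ball_avg r u x - ball_avg (r / 2) u x)^2 \<le> ((2 * r) powr (real DIM('a) + 2 * s) / c0 * D u) / (v * v')"
    using v by (subst pos_le_divide_eq) (auto simp: mult.commute)
  also have "\<dots> = ((2 * r) powr (real DIM('a) + 2 * s) / (v * v')) / c0 * D u" by simp
  also have "(2 * r) powr (real DIM('a) + 2 * s) / (v * v') = 2 powr (2 * real DIM('a) + 2 * s) / v1^2 * r powr (2 * s - real DIM('a))"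
  proof -
    have 1: "v * v' = v1^2 * (r powr (2 * real DIM('a)) * 2 powr (- real DIM('a)))"
      unfolding v_def v'_def using r by (simp add: measure_ball powr_divide powr_minus_divide powr_add[symmetric] power2_eq_square)
    have 2: "(2 * r) powr (real DIM('a) + 2 * s) = (2 powr (2 * real DIM('a) + 2 * s) * r powr (2 * s - real DIM('a))) * (r powr (2 * real DIM('a)) * 2 powr (- real DIM('a)))"
    proof -
      have p2: "2 powr (2 * real DIM('a) + 2 * s) * 2 powr (- real DIM('a)) = (2::real) powr (real DIM('a) + 2 * s)"
        by (simp only: powr_add[symmetric]) simp
      have pr: "r powr (2 * s - real DIM('a)) * r powr (2 * real DIM('a)) = r powr (real DIM('a) + 2 * s)"
        by (simp only: powr_add[symmetric]) (simp add: add.commute)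
      have "(2 * r) powr (real DIM('a) + 2 * s) = 2 powr (real DIM('a) + 2 * s) * r powr (real DIM('a) + 2 * s)"
        using r by (simp add: powr_mult)
      then show ?thesis unfolding p2[symmetric] pr[symmetric] by (simp only: mult_ac)
    qed
    show ?thesis unfolding 1 2 using r v1 by simp
  qed
  finally show ?thesis by simp
qed

section \<open>Dyadic levels and the subcritical Sobolev inequality\<close>

definition gam :: real where "gam = real DIM('a) / 2 - s"

lemma gam: "gam > 0" using N by (simp add: gam_def)

lemma half_pow_powr: "((1/2)^n) powr a = 2 powr (- (real n * a))"
proof -
  have "(1/2::real)^n = 2 powr (- real n)" by (simp add: powr_minus_divide powr_realpow power_one_over)
  then show ?thesis by (simp add: powr_powr)
qed

text \<open>Telescoping over halved radii: the increments grow geometrically with ratio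
  \<open>2 powr gam > 1\<close>, so their sum is comparable with the last one.
  \<open>gam = N/2 - s\<close> is half the exponent in \<open>ball_avg_halving\<close>, with the
  sign reversed.\<close>

lemma ball_avg_growth:
  "\<exists>K>0. \<forall>u M n x. H u \<longrightarrow> M \<ge> 0 \<longrightarrow> S u + D u \<le> M^2 \<longrightarrow> \<bar>ball_avg ((1/2)^n) u x\<bar> \<le> K * M * 2 powr (real n * gam)"
proof -
  define C where "C = 2 powr (2 * real DIM('a) + 2 * s) / (v1^2 * c0)"
  have C: "C > 0" using v1 c0 by (simp add: C_def)
  have g1: "2 powr gam > (1::real)" using gam by simp
  \<comment> \<open>The first entry covers the unit ball. The second closes the induction: an
    increment is at most \<open>K * (2 powr gam - 1)\<close> times
    \<open>M * 2 powr (real n * gam)\<close>.\<close>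
  define K where "K = max (1 / sqrt v1) (sqrt C / (2 powr gam - 1))"
  have K: "K > 0" "1 / sqrt v1 \<le> K" "sqrt C / (2 powr gam - 1) \<le> K" using v1 by (auto simp: K_def less_max_iff_disj)
  have K': "sqrt C \<le> K * (2 powr gam - 1)" using K(3) g1 by (simp add: divide_le_eq)
  have "\<bar>ball_avg ((1/2)^n) u x\<bar> \<le> K * M * 2 powr (real n * gam)" if u: "H u" and M: "M \<ge> 0" "S u + D u \<le> M^2" for u M n x
  proof (induction n)
    case 0
    have "(ball_avg 1 u x)^2 \<le> S u / v1"
      using ball_avg_bound[of u 1 x] u measure_ball[of 1 x] by (simp add: H_def S_def)
    also have "\<dots> \<le> M^2 / v1" using M(2) v1 by (intro divide_right_mono) (auto intro: order_trans[of _ "S u + D u"])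
    also have "\<dots> = (M / sqrt v1)^2" using v1 by (simp add: power_divide)
    finally have "\<bar>ball_avg 1 u x\<bar> \<le> M * (1 / sqrt v1)" using M(1) v1 by (simp add: abs_le_square_iff[symmetric])
    also have "\<dots> \<le> M * K" using K(2) M(1) by (rule mult_left_mono)
    finally show ?case by (simp add: mult.commute)
  next
    case (Suc n)
    have "(ball_avg ((1/2)^n) u x - ball_avg ((1/2)^n / 2) u x)^2 \<le> C * (((1/2)^n) powr (2 * s - real DIM('a))) * D u"
      unfolding C_def by (rule ball_avg_halving[OF u]) simp
    also have "\<dots> \<le> C * (((1/2)^n) powr (2 * s - real DIM('a))) * M^2"
      using C by (intro mult_left_mono order_trans[OF _ M(2)]) auto
    also have "((1/2::real)^n) powr (2 * s - real DIM('a)) = (2 powr (real n * gam))^2"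
      unfolding half_pow_powr by (simp add: power2_eq_square powr_add[symmetric] gam_def algebra_simps)
    also have "C * (2 powr (real n * gam))^2 * M^2 = (sqrt C * 2 powr (real n * gam) * M)^2"
      using C by (simp add: power_mult_distrib)
    finally have d: "\<bar>ball_avg ((1/2)^n) u x - ball_avg ((1/2)^Suc n) u x\<bar> \<le> sqrt C * 2 powr (real n * gam) * M"
      using M(1) C by (simp add: abs_le_square_iff[symmetric])
    also have "\<dots> \<le> K * (2 powr gam - 1) * 2 powr (real n * gam) * M"
      using K' M(1) by (intro mult_right_mono) auto
    finally have "\<bar>ball_avg ((1/2)^Suc n) u x\<bar> \<le> K * M * 2 powr (real n * gam) + K * (2 powr gam - 1) * 2 powr (real n * gam) * M"
      using Suc.IH by linarith
    also have "\<dots> = K * M * (2 powr (real n * gam) * 2 powr gam)" by (simp add: algebra_simps)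
    also have "2 powr (real n * gam) * 2 powr gam = (2::real) powr (real (Suc n) * gam)"
      by (simp add: powr_add[symmetric] algebra_simps)
    finally show ?case .
  qed
  then show ?thesis using K(1) by blast
qed

text \<open>Where \<open>\<bar>u x\<bar>\<close> lies between twice the bounds of
  \<open>ball_avg_growth\<close> for \<open>k\<close> and \<open>k + 1\<close>, the average at scale
  \<open>(1/2)^k\<close> is at most half of it, so \<open>\<bar>u x\<bar> \<le> 2 * \<bar>u x -
  ball_avg ((1/2)^k) u x\<bar>\<close>. The squared L2 norm of that difference decays like
  \<open>2 powr (- 2 * s * k)\<close>, which outweighs the height to the power
  \<open>p - 2\<close>.\<close>

theorem Sobolev_tail:
  assumes p: "2 \<le> p" "p * (real DIM('a) - 2 * s) < 2 * real DIM('a)"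
  shows "\<exists>K>0. \<exists>A>0. \<exists>\<rho>. 0 < \<rho> \<and> \<rho> < 1 \<and> (\<forall>u M m. H u \<longrightarrow> M > 0 \<longrightarrow> S u + D u \<le> M^2 \<longrightarrow>
    (\<integral>\<^sup>+x. ennreal (\<bar>u x\<bar> powr p) * indicator {x. K * M * 2 powr (real m * gam) < \<bar>u x\<bar>} x \<partial>lborel) \<le> ennreal (A * M powr p * \<rho> ^ m))"
proof -
  obtain K where K: "K > 0" and Kb: "\<And>u M n x. H u \<Longrightarrow> M \<ge> 0 \<Longrightarrow> S u + D u \<le> M^2 \<Longrightarrow> \<bar>ball_avg ((1/2)^n) u x\<bar> \<le> K * M * 2 powr (real n * gam)"
    using ball_avg_growth by blast
  define C where "C = 1 / (v1 * c0)"
  have C: "C > 0" using v1 c0 by (simp add: C_def)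
  \<comment> \<open>Ratio between consecutive levels: the height loses
    \<open>2 powr (gam * (p - 2))\<close>, the approximation gains \<open>2 powr (- 2 * s)\<close>.
    It is below 1 exactly for subcritical \<open>p\<close>.\<close>
  define \<rho> where "\<rho> = 2 powr (gam * (p - 2) - 2 * s)"
  have "gam * (p - 2) - 2 * s = (p * (real DIM('a) - 2 * s) - 2 * real DIM('a)) / 2"
    by (simp add: gam_def field_simps)
  also have "\<dots> < 0" using p(2) by simp
  finally have \<rho>: "0 < \<rho>" "\<rho> < 1" unfolding \<rho>_def by (auto simp: powr_less_one)
  define B where "B = 4 * C * (2 * K) powr (p - 2) * 2 powr (gam * (p - 2))"
  have B: "B > 0" using C K by (simp add: B_def)
  have "(\<integral>\<^sup>+x. ennreal (\<bar>u x\<bar> powr p) * indicator {x. 2 * K * M * 2 powr (real m * gam) < \<bar>u x\<bar>} x \<partial>lborel) \<le> ennreal (B / (1 - \<rho>) * M powr p * \<rho> ^ m)"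
    if u: "H u" and M: "M > 0" "S u + D u \<le> M^2" for u M m
  proof -
    have um [measurable]: "u \<in> borel_measurable borel" using H_measurable[OF u] .
    define l where "l n = K * M * 2 powr (real n * gam)" for n :: nat
    have l: "l n > 0" for n using K M by (simp add: l_def)
    have lav: "\<bar>ball_avg ((1/2)^n) u x\<bar> \<le> l n" for n x unfolding l_def using Kb[OF u _ M(2)] M(1) by simp
    define W where "W n x = (2 * l (Suc n)) powr (p - 2) * (4 * (u x - ball_avg ((1/2)^n) u x)^2)" for n x
    have W0: "W n x \<ge> 0" for n x by (simp add: W_def)
    have [measurable]: "W n \<in> borel_measurable borel" for n unfolding W_def by measurable
    have WI: "(\<integral>\<^sup>+x. ennreal (W n x) \<partial>lborel) \<le> ennreal (B * M powr p * \<rho> ^ n)" for n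
    proof -
      note a = ball_avg_approx[OF u, of "(1/2)^n"]
      have "(\<integral>\<^sup>+x. ennreal (W n x) \<partial>lborel) = ennreal ((2 * l (Suc n)) powr (p - 2) * 4 * (LINT x|lborel. (u x - ball_avg ((1/2)^n) u x)^2))"
        unfolding W_def using a(1) by (subst nn_integral_eq_integral) (auto simp: sq_integrable_real)
      also have "\<dots> \<le> ennreal ((2 * l (Suc n)) powr (p - 2) * 4 * (C * ((1/2)^n) powr (2 * s) * M^2))"
      proof (intro ennreal_leI mult_left_mono)
        have "(LINT x|lborel. (u x - ball_avg ((1/2)^n) u x)^2) \<le> C * ((1/2)^n) powr (2 * s) * D u"
          using a(2) by (simp add: C_def)
        also have "\<dots> \<le> C * ((1/2)^n) powr (2 * s) * M^2"
          using C by (intro mult_left_mono order_trans[OF _ M(2)]) auto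
        finally show "(LINT x|lborel. (u x - ball_avg ((1/2)^n) u x)^2) \<le> C * ((1/2)^n) powr (2 * s) * M^2" .
      qed auto
      also have "(2 * l (Suc n)) powr (p - 2) * 4 * (C * ((1/2)^n) powr (2 * s) * M^2) = B * M powr p * \<rho> ^ n"
      proof -
        have 1: "(2 * l (Suc n)) powr (p - 2) = (2 * K) powr (p - 2) * M powr (p - 2) * (2 powr (gam * (p - 2)) * 2 powr (real n * (gam * (p - 2))))"
        proof -
          have "2 * l (Suc n) = (2 * K) * M * 2 powr (real (Suc n) * gam)" by (simp add: l_def)
          moreover have "(2 powr (real (Suc n) * gam)) powr (p - 2) = 2 powr (gam * (p - 2)) * (2::real) powr (real n * (gam * (p - 2)))"
            by (simp only: powr_powr powr_add[symmetric]) (simp add: algebra_simps)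
          ultimately show ?thesis using K M by (simp only:) (simp add: powr_mult)
        qed
        have 2: "\<rho> ^ n = 2 powr (real n * (gam * (p - 2))) * ((1/2)^n) powr (2 * s)"
          unfolding half_pow_powr \<rho>_def by (simp add: powr_realpow[symmetric] powr_powr powr_add[symmetric] algebra_simps)
        have 3: "M powr p = M powr (p - 2) * M^2"
          using M powr_add[of M "p - 2" 2] by (simp add: powr_numeral)
        show ?thesis unfolding 1 2 3 B_def by (simp only: mult_ac)
      qed
      finally show ?thesis .
    qed
    have pt: "ennreal (\<bar>u x\<bar> powr p) * indicator {x. 2 * K * M * 2 powr (real m * gam) < \<bar>u x\<bar>} x \<le> (\<Sum>n. ennreal (W (n + m) x))" for x
    proof (cases "2 * l m < \<bar>u x\<bar>")
      case True
      have "\<exists>k. \<bar>u x\<bar> \<le> 2 * l (Suc k + m)"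
      proof -
        obtain k :: nat where k: "\<bar>u x\<bar> / (2 * K * M) \<le> (2 powr gam) ^ k"
          using real_arch_pow[of "2 powr gam" "\<bar>u x\<bar> / (2 * K * M)"] gam by (auto intro: less_imp_le)
        have "(2 powr gam) ^ k = 2 powr (real k * gam)" by (simp add: powr_realpow[symmetric] powr_powr mult.commute)
        also have "\<dots> \<le> 2 powr (real (Suc k + m) * gam)" using gam by (intro powr_mono mult_right_mono) auto
        finally have "\<bar>u x\<bar> / (2 * K * M) \<le> 2 powr (real (Suc k + m) * gam)" using k by linarith
        then show ?thesis using K M by (auto simp: l_def divide_le_eq mult_ac intro!: exI[of _ k])
      qed
      \<comment> \<open>The least index puts \<open>\<bar>u x\<bar>\<close> strictly above level
        \<open>k + m\<close>, where the average is controlled, and at most at the next level, which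
        bounds the height.\<close>
      define k where "k = (LEAST k. \<bar>u x\<bar> \<le> 2 * l (Suc k + m))"
      have k1: "\<bar>u x\<bar> \<le> 2 * l (Suc k + m)" unfolding k_def by (rule LeastI_ex) fact
      have k2: "2 * l (k + m) < \<bar>u x\<bar>"
      proof (cases k)
        case 0 then show ?thesis using True by simp
      next
        case (Suc j)
        have "\<not> \<bar>u x\<bar> \<le> 2 * l (Suc j + m)" using not_less_Least[of j "\<lambda>k. \<bar>u x\<bar> \<le> 2 * l (Suc k + m)"] Suc by (simp add: k_def)
        then show ?thesis using Suc by simp
      qed
      have "\<bar>u x\<bar> \<le> 2 * \<bar>u x - ball_avg ((1/2)^(k + m)) u x\<bar>"
      proof -
        have "\<bar>a\<bar> \<le> 2 * \<bar>a - b\<bar>" if "2 * c < \<bar>a\<bar>" "\<bar>b\<bar> \<le> c" for a b c :: real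
          using that by (auto simp: abs_if split: if_splits)
        then show ?thesis using k2 lav[of "k + m" x] by blast
      qed
      then have sq: "(u x)^2 \<le> 4 * (u x - ball_avg ((1/2)^(k + m)) u x)^2"
        using power_mono[of "\<bar>u x\<bar>" "2 * \<bar>u x - ball_avg ((1/2)^(k + m)) u x\<bar>" 2] by (simp add: power_mult_distrib)
      have ux: "\<bar>u x\<bar> > 0" using True l[of m] by linarith
      have "\<bar>u x\<bar> powr p = \<bar>u x\<bar> powr (p - 2) * (u x)^2"
        using ux powr_add[of "\<bar>u x\<bar>" "p - 2" 2] by (simp add: powr_numeral)
      also have "\<dots> \<le> (2 * l (Suc (k + m))) powr (p - 2) * (4 * (u x - ball_avg ((1/2)^(k + m)) u x)^2)"
        using k1 sq p(1) by (intro mult_mono powr_mono2) auto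
      finally have "ennreal (\<bar>u x\<bar> powr p) \<le> ennreal (W (k + m) x)" unfolding W_def by (rule ennreal_leI)
      also have "\<dots> \<le> (\<Sum>n. ennreal (W (n + m) x))"
        using sum_le_suminf[of "\<lambda>n. ennreal (W (n + m) x)" "{k}"] by simp
      finally show ?thesis by (auto simp: indicator_def)
    next
      case False
      then show ?thesis by (simp add: l_def indicator_def mult.assoc)
    qed
    have "(\<integral>\<^sup>+x. ennreal (\<bar>u x\<bar> powr p) * indicator {x. 2 * K * M * 2 powr (real m * gam) < \<bar>u x\<bar>} x \<partial>lborel) \<le> (\<integral>\<^sup>+x. (\<Sum>n. ennreal (W (n + m) x)) \<partial>lborel)"
      by (rule nn_integral_mono) (rule pt)
    also have "\<dots> = (\<Sum>n. \<integral>\<^sup>+x. ennreal (W (n + m) x) \<partial>lborel)"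
      by (rule nn_integral_suminf) measurable
    also have "\<dots> \<le> (\<Sum>n. ennreal (B * M powr p * \<rho> ^ (n + m)))"
      by (intro suminf_le WI) auto
    also have "\<dots> = ennreal (\<Sum>n. (B * M powr p * \<rho> ^ m) * \<rho> ^ n)"
      using B \<rho> by (subst suminf_ennreal2) (auto simp: power_add mult_ac intro!: summable_mult summable_mult2 summable_geometric)
    also have "(\<Sum>n. (B * M powr p * \<rho> ^ m) * \<rho> ^ n) = B / (1 - \<rho>) * M powr p * \<rho> ^ m"
      using \<rho> by (subst suminf_mult) (auto simp: suminf_geometric summable_geometric)
    finally show ?thesis .
  qed
  then have "\<forall>u M m. H u \<longrightarrow> M > 0 \<longrightarrow> S u + D u \<le> M^2 \<longrightarrow> (\<integral>\<^sup>+x. ennreal (\<bar>u x\<bar> powr p) * indicator {x. (2 * K) * M * 2 powr (real m * gam) < \<bar>u x\<bar>} x \<partial>lborel) \<le> ennreal (B / (1 - \<rho>) * M powr p * \<rho> ^ m)"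
    by simp
  moreover have "2 * K > 0" "B / (1 - \<rho>) > 0" using K B \<rho> by auto
  ultimately show ?thesis using \<rho> by blast
qed

lemma powr_split_le:
  fixes y :: real
  assumes "p \<ge> 2" "L > 0"
  shows "\<bar>y\<bar> powr p \<le> L powr (p - 2) * y^2 + (if L < \<bar>y\<bar> then \<bar>y\<bar> powr p else 0)"
proof (cases "L < \<bar>y\<bar> \<or> y = 0")
  case True then show ?thesis using assms by auto
next
  case False
  have "\<bar>y\<bar> powr p = \<bar>y\<bar> powr (p - 2) * y^2"
    using False powr_add[of "\<bar>y\<bar>" "p - 2" 2] by (simp add: powr_numeral)
  also have "\<dots> \<le> L powr (p - 2) * y^2" using False assms by (intro mult_right_mono powr_mono2) auto
  finally show ?thesis using False by simp
qed

text \<open>Below a level, \<open>\<bar>u x\<bar> powr p\<close> is at most a constant times the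
  square; above it the tail bound applies. The index \<open>m\<close> of the level stays free: 0
  gives the Sobolev inequality, a large \<open>m\<close> makes the tail negligible.\<close>

theorem Sobolev_split:
  assumes p: "2 \<le> p" "p * (real DIM('a) - 2 * s) < 2 * real DIM('a)"
  shows "\<exists>K>0. \<exists>A>0. \<exists>\<rho>. 0 < \<rho> \<and> \<rho> < 1 \<and> (\<forall>u M m. H u \<longrightarrow> M > 0 \<longrightarrow> S u + D u \<le> M^2 \<longrightarrow>
    integrable lborel (\<lambda>x. \<bar>u x\<bar> powr p) \<and>
    (LINT x|lborel. \<bar>u x\<bar> powr p) \<le> (K * M * 2 powr (real m * gam)) powr (p - 2) * S u + A * M powr p * \<rho> ^ m)"
proof -
  obtain K A \<rho> where K: "K > 0" "A > 0" "0 < \<rho>" "\<rho> < 1"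
    and T: "\<And>u M m. H u \<Longrightarrow> M > 0 \<Longrightarrow> S u + D u \<le> M^2 \<Longrightarrow>
    (\<integral>\<^sup>+x. ennreal (\<bar>u x\<bar> powr p) * indicator {x. K * M * 2 powr (real m * gam) < \<bar>u x\<bar>} x \<partial>lborel) \<le> ennreal (A * M powr p * \<rho> ^ m)"
    using Sobolev_tail[OF p] by blast
  have "integrable lborel (\<lambda>x. \<bar>u x\<bar> powr p) \<and>
    (LINT x|lborel. \<bar>u x\<bar> powr p) \<le> (K * M * 2 powr (real m * gam)) powr (p - 2) * S u + A * M powr p * \<rho> ^ m"
    if u: "H u" and M: "M > 0" "S u + D u \<le> M^2" for u M m
  proof -
    have [measurable]: "u \<in> borel_measurable borel" using H_measurable[OF u] .
    define L where "L = K * M * 2 powr (real m * gam)"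
    have L: "L > 0" using K M by (simp add: L_def)
    have "(\<integral>\<^sup>+x. ennreal (\<bar>u x\<bar> powr p) \<partial>lborel) \<le> (\<integral>\<^sup>+x. ennreal (L powr (p - 2) * (u x)^2) + ennreal (\<bar>u x\<bar> powr p) * indicator {x. L < \<bar>u x\<bar>} x \<partial>lborel)"
    proof (rule nn_integral_mono)
      fix x
      have "ennreal (\<bar>u x\<bar> powr p) \<le> ennreal (L powr (p - 2) * (u x)^2 + (if L < \<bar>u x\<bar> then \<bar>u x\<bar> powr p else 0))"
        by (rule ennreal_leI[OF powr_split_le[OF p(1) L]])
      also have "\<dots> = ennreal (L powr (p - 2) * (u x)^2) + ennreal (\<bar>u x\<bar> powr p) * indicator {x. L < \<bar>u x\<bar>} x"
        by (subst ennreal_plus) (auto simp: indicator_def)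
      finally show "ennreal (\<bar>u x\<bar> powr p) \<le> ennreal (L powr (p - 2) * (u x)^2) + ennreal (\<bar>u x\<bar> powr p) * indicator {x. L < \<bar>u x\<bar>} x" .
    qed
    also have "\<dots> = (\<integral>\<^sup>+x. ennreal (L powr (p - 2) * (u x)^2) \<partial>lborel) + (\<integral>\<^sup>+x. ennreal (\<bar>u x\<bar> powr p) * indicator {x. L < \<bar>u x\<bar>} x \<partial>lborel)"
      by (rule nn_integral_add) measurable
    also have "(\<integral>\<^sup>+x. ennreal (L powr (p - 2) * (u x)^2) \<partial>lborel) = ennreal (L powr (p - 2) * S u)"
      unfolding S_def using u by (subst nn_integral_eq_integral) (auto simp: H_def sq_integrable_real)
    also have "(\<integral>\<^sup>+x. ennreal (\<bar>u x\<bar> powr p) * indicator {x. L < \<bar>u x\<bar>} x \<partial>lborel) \<le> ennreal (A * M powr p * \<rho> ^ m)"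
      unfolding L_def by (rule T[OF u M])
    finally have le: "(\<integral>\<^sup>+x. ennreal (\<bar>u x\<bar> powr p) \<partial>lborel) \<le> ennreal (L powr (p - 2) * S u + A * M powr p * \<rho> ^ m)"
      using K by (simp add: ennreal_plus[symmetric] add_left_mono del: ennreal_plus)
    have i: "integrable lborel (\<lambda>x. \<bar>u x\<bar> powr p)"
      by (rule integrableI_nonneg) (measurable, use le in \<open>auto simp: le_less_trans\<close>)
    have nn: "0 \<le> L powr (p - 2) * S u + A * M powr p * \<rho> ^ m" using K by simp
    have "(LINT x|lborel. \<bar>u x\<bar> powr p) \<le> L powr (p - 2) * S u + A * M powr p * \<rho> ^ m"
      using le nn_integral_eq_integral[OF i] ennreal_le_iff[OF nn] by simp
    then show ?thesis using i by (simp add: L_def)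
  qed
  then show ?thesis using K by blast
qed

corollary Sobolev_integrable:
  assumes p: "2 \<le> p" "p * (real DIM('a) - 2 * s) < 2 * real DIM('a)" and u: "H u"
  shows "integrable lborel (\<lambda>x. \<bar>u x\<bar> powr p)"
proof -
  have "0 \<le> S u + D u" by simp
  then have "S u + D u \<le> (sqrt (S u + D u) + 1)^2" "sqrt (S u + D u) + 1 > 0"
    using real_sqrt_ge_zero[of "S u + D u"] by (auto simp: power2_sum intro: add_nonneg_pos)
  then show ?thesis using Sobolev_split[OF p] u by blast
qed

corollary Sobolev_ineq:
  assumes p: "2 \<le> p" "p * (real DIM('a) - 2 * s) < 2 * real DIM('a)"
  shows "\<exists>C>0. \<forall>u. H u \<longrightarrow> S u + D u > 0 \<longrightarrow> (LINT x|lborel. \<bar>u x\<bar> powr p) \<le> C * (S u + D u) powr (p / 2)"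
proof -
  obtain K A \<rho> where K: "K > 0" "A > 0" "0 < \<rho>" "\<rho> < 1"
    and T: "\<And>u M m. H u \<Longrightarrow> M > 0 \<Longrightarrow> S u + D u \<le> M^2 \<Longrightarrow>
    (LINT x|lborel. \<bar>u x\<bar> powr p) \<le> (K * M * 2 powr (real m * gam)) powr (p - 2) * S u + A * M powr p * \<rho> ^ m"
    using Sobolev_split[OF p] by blast
  have "(LINT x|lborel. \<bar>u x\<bar> powr p) \<le> (K powr (p - 2) + A) * (S u + D u) powr (p / 2)" if u: "H u" and pos: "S u + D u > 0" for u
  proof -
    define M where "M = sqrt (S u + D u)"
    have M: "M > 0" "S u + D u = M^2" using pos by (auto simp: M_def)
    \<comment> \<open>With \<open>m = 0\<close> and \<open>M\<close> equal to the norm, both terms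
      are bounded by multiples of \<open>M powr p\<close>.\<close>
    have "(LINT x|lborel. \<bar>u x\<bar> powr p) \<le> (K * M * 2 powr (real 0 * gam)) powr (p - 2) * S u + A * M powr p * \<rho> ^ 0"
      by (rule T[OF u M(1)]) (simp add: M(2))
    also have "\<dots> \<le> (K * M) powr (p - 2) * M^2 + A * M powr p"
      unfolding M(2)[symmetric] by (simp add: mult_left_mono)
    also have "(K * M) powr (p - 2) * M^2 = K powr (p - 2) * M powr p"
      using K M powr_add[of M "p - 2" 2] by (simp add: powr_mult powr_numeral)
    also have "M powr p = (S u + D u) powr (p / 2)"
      using M powr_powr[of M 2 "p / 2"] by (simp add: powr_numeral)
    finally show ?thesis by (simp add: distrib_right)
  qed
  moreover have "K powr (p - 2) + A > 0" using K by (simp add: add_nonneg_pos)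
  ultimately show ?thesis by blast
qed

text \<open>On bounded sets a small L2 mass forces a small Lp norm. This later turns a lower bound
  for the energy into a lower bound for the mass.\<close>

corollary Sobolev_interpolation:
  assumes p: "2 \<le> p" "p * (real DIM('a) - 2 * s) < 2 * real DIM('a)" and M: "M > 0" and \<eta>: "\<eta> > 0"
  shows "\<exists>C>0. \<forall>u. H u \<longrightarrow> S u + D u \<le> M^2 \<longrightarrow> (LINT x|lborel. \<bar>u x\<bar> powr p) \<le> C * S u + \<eta>"
proof -
  obtain K A \<rho> where K: "K > 0" "A > 0" "0 < \<rho>" "\<rho> < 1"
    and T: "\<And>u M m. H u \<Longrightarrow> M > 0 \<Longrightarrow> S u + D u \<le> M^2 \<Longrightarrow>
    (LINT x|lborel. \<bar>u x\<bar> powr p) \<le> (K * M * 2 powr (real m * gam)) powr (p - 2) * S u + A * M powr p * \<rho> ^ m"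
    using Sobolev_split[OF p] by blast
  obtain m where m: "\<rho> ^ m < \<eta> / (A * M powr p)"
    using real_arch_pow_inv[of "\<eta> / (A * M powr p)" \<rho>] K M \<eta> by auto
  then have "A * M powr p * \<rho> ^ m \<le> \<eta>" using K M by (simp add: less_divide_eq mult_ac)
  moreover have "(K * M * 2 powr (real m * gam)) powr (p - 2) > 0" using K M by simp
  ultimately show ?thesis using T[OF _ M, of _ m] by (meson add_left_mono order_trans)
qed

end

section \<open>Local compactness of bounded sequences\<close>

lemma bounded_family_convergent_subseq:
  fixes g :: "nat \<Rightarrow> nat \<Rightarrow> real"
  assumes "\<And>i. \<exists>B. \<forall>n. \<bar>g i n\<bar> \<le> B"
  obtains r where "strict_mono r" "\<And>i. convergent (\<lambda>n. g i (r n))"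
proof -
  interpret subseqs "\<lambda>i s. convergent (\<lambda>n. g i (s n))"
  proof
    fix n :: nat and s :: "nat \<Rightarrow> nat"
    obtain B where "\<And>m. \<bar>g n m\<bar> \<le> B" using assms[of n] by blast
    then have "bounded (range (\<lambda>k. g n (s k)))" by (auto intro!: boundedI[of _ B])
    then obtain l r where "strict_mono r" "((\<lambda>k. g n (s k)) \<circ> r) \<longlonglongrightarrow> l"
      using bounded_imp_convergent_subsequence by blast
    then show "\<exists>r'. strict_mono r' \<and> convergent (\<lambda>na. g n ((s \<circ> r') na))"
      by (auto simp: convergent_def o_def)
  qed
  have "convergent (\<lambda>n. g i (diagseq n))" for i
  proof -
    have "convergent (\<lambda>n. g i ((diagseq \<circ> ((+) (Suc i))) n))"
    proof (rule diagseq_holds)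
      fix r s :: "nat \<Rightarrow> nat" and n assume "strict_mono r" "convergent (\<lambda>na. g n (s na))"
      then show "convergent (\<lambda>na. g n ((s \<circ> r) na))"
        using convergent_subseq_convergent[of "\<lambda>na. g n (s na)" r] by (simp add: o_def)
    qed
    then have "convergent (\<lambda>n. g i (diagseq (n + Suc i)))" by (simp add: add.commute)
    then show ?thesis by (rule convergent_ignore_initial_segment[THEN iffD1])
  qed
  with subseq_diagseq show thesis by (rule that)
qed

context frac
begin

text \<open>By Cauchy-Schwarz the modulus of continuity of an average depends on \<open>u\<close>
  only through its mass. Hence the averages of a bounded sequence at one scale are
  equicontinuous.\<close>

lemma ball_avg_modulus:
  assumes u: "sq_integrable lborel u" and r: "r > 0"
  shows "(ball_avg r u x - ball_avg r u (y::'a))^2 \<le> shift_dist (indicator (ball (0::'a) r) :: 'a \<Rightarrow> real) (y - x) * S u / (measure lborel (ball (0::'a) r))^2"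
proof -
  let ?i = "indicator (ball (0::'a) r) :: 'a \<Rightarrow> real"
  let ?v = "measure lborel (ball (0::'a) r)"
  have um [measurable]: "u \<in> borel_measurable borel" using u by (simp add: sq_integrable_def)
  have v: "?v > 0" using r by (rule content_ball_pos)
  have ii: "sq_integrable lborel ?i" using sq_integrable_indicator(1)[of "ball 0 r" lborel "1::real"] ball_facts[OF r, of "0::'a"] by simp
  have it: "sq_integrable lborel (\<lambda>z. ?i (- x + z))" for x by (rule sq_integrable_translate[OF ii])
  have vb: "measure lborel (ball x r) = ?v" for x :: 'a using r by (simp add: measure_ball)
  have ib: "indicator (ball x r) z = ?i (- x + z)" for x z by (auto simp: indicator_def dist_norm norm_minus_commute)
  have "ball_avg r u x - ball_avg r u y = (LINT z|lborel. (?i (- x + z) - ?i (- y + z)) * u z) / ?v"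
  proof -
    have "ball_avg r u x = (LINT z|lborel. ?i (- x + z) * u z) / ?v" for x
      unfolding ball_avg_def by (simp only: vb[of x] ib[of x])
    then show ?thesis using sq_integrable_prod[OF it u] by (simp add: left_diff_distrib diff_divide_distrib)
  qed
  then have "(ball_avg r u x - ball_avg r u y)^2 = (LINT z|lborel. (?i (- x + z) - ?i (- y + z)) * u z)^2 / ?v^2"
    by (simp add: power_divide)
  also have "\<dots> \<le> (LINT z|lborel. (?i (- x + z) - ?i (- y + z))^2) * S u / ?v^2"
    using sq_integrable_Cauchy_Schwarz[OF sq_integrable_diff[OF it it] u, of x y] by (intro divide_right_mono) (auto simp: S_def)
  also have "(LINT z|lborel. (?i (- x + z) - ?i (- y + z))^2) = (LINT z|lborel. (?i ((y - x) + z) - ?i z)^2)"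
  proof -
    have [measurable]: "ball (0::'a) r \<in> sets borel" by simp
    have "(\<lambda>z. (?i (- x + z) - ?i (- y + z))^2) \<in> borel_measurable borel" by measurable
    from integral_translate[OF this, of y] show ?thesis by (simp add: algebra_simps)
  qed
  also have "\<dots> = shift_dist ?i (y - x)" by (simp add: shift_dist_def)
  finally show ?thesis .
qed

text \<open>At a fixed scale the averages are bounded and equicontinuous, so convergence on a
  countable dense set spreads to all points. The distance from \<open>u n\<close> to its averages is
  small uniformly in \<open>n\<close> by \<open>ball_avg_approx\<close>. Together the sequence is
  Cauchy in a weighted L2 space.\<close>

theorem Rellich:
  fixes u :: "nat \<Rightarrow> 'a \<Rightarrow> real"
  assumes u: "\<And>n. H (u n)" and M: "M > 0" "\<And>n. S (u n) + D (u n) \<le> M^2"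
  obtains r u0 where "strict_mono r" "u0 \<in> borel_measurable borel" "AE x in lborel. (\<lambda>n. u (r n) x) \<longlonglongrightarrow> u0 x"
    "\<And>R. (\<lambda>n. LINT x|lborel. indicator (ball 0 R) x * (u (r n) x - u0 x)^2) \<longlonglongrightarrow> 0"
proof -
  have us: "sq_integrable lborel (u n)" for n using u by (simp add: H_def)
  have um [measurable]: "u n \<in> borel_measurable borel" for n using H_measurable[OF u] .
  have SM: "S (u n) \<le> M^2" and DM: "D (u n) \<le> M^2" for n
    using M(2)[of n] by (auto intro: order_trans[rotated])
  obtain K where K: "K > 0" and Kb: "\<And>u M n x. H u \<Longrightarrow> M \<ge> 0 \<Longrightarrow> S u + D u \<le> M^2 \<Longrightarrow> \<bar>ball_avg ((1/2)^n) u x\<bar> \<le> K * M * 2 powr (real n * gam)"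
    using ball_avg_growth by blast
  define A where "A k n x = ball_avg ((1/2)^k) (u n) x" for k n x
  have Am [measurable]: "A k n \<in> borel_measurable borel" for k n unfolding A_def by measurable
  have Ab: "\<bar>A k n x\<bar> \<le> K * M * 2 powr (real k * gam)" for k n x
    unfolding A_def using Kb[OF u _ M(2)] M(1) by simp
  obtain Q :: "'a set" where Q: "countable Q" "\<And>X. open X \<Longrightarrow> X \<noteq> {} \<Longrightarrow> \<exists>d\<in>Q. d \<in> X"
    by (rule countable_dense_setE) blast
  have Qne: "Q \<noteq> {}" using Q(2)[of UNIV] by auto
  define q where "q = from_nat_into Q"
  \<comment> \<open>One index runs through all pairs of a dyadic scale and a dense point, since the
    diagonal argument takes a single countable family.\<close>
  define g where "g i n = A (fst (prod_decode i)) n (q (snd (prod_decode i)))" for i n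
  have gb: "\<exists>B. \<forall>n. \<bar>g i n\<bar> \<le> B" for i unfolding g_def using Ab by blast
  obtain r where r: "strict_mono r" and rc: "\<And>i. convergent (\<lambda>n. g i (r n))"
    using bounded_family_convergent_subseq[of g] gb by blast
  have cq: "convergent (\<lambda>n. A k (r n) d)" if dQ: "d \<in> Q" for k d
  proof -
    obtain j where "q j = d" using from_nat_into_surj[OF Q(1) dQ] unfolding q_def by blast
    then show ?thesis using rc[of "prod_encode (k, j)"] by (simp add: g_def)
  qed
  have ca: "convergent (\<lambda>n. A k (r n) x)" for k x
  proof -
    let ?i = "indicator (ball (0::'a) ((1/2)^k)) :: 'a \<Rightarrow> real"
    define v where "v = (measure lborel (ball (0::'a) ((1/2)^k)))^2"
    have hk: "(1/2::real)^k > 0" by simp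
    have v: "v > 0" using content_ball_pos[OF hk, of "0::'a"] unfolding v_def by (rule zero_less_power)
    have "\<forall>n. \<exists>d\<in>Q. d \<in> ball x (1 / Suc n)" using Q(2)[of "ball x (1 / Suc _)"] by simp
    then obtain d where d: "\<And>n. d n \<in> Q" "\<And>n. d n \<in> ball x (1 / Suc n)" by metis
    have "(\<lambda>n. d n - x) \<longlonglongrightarrow> 0"
    proof (rule Lim_null_comparison[OF always_eventually LIMSEQ_Suc[OF lim_inverse_n']], rule allI)
      show "norm (d n - x) \<le> 1 / real (Suc n)" for n using d(2)[of n] by (simp add: dist_norm norm_minus_commute)
    qed
    moreover have "shift_cont ?i"
    proof (rule shift_cont)
      show "sq_integrable lborel ?i"
        using sq_integrable_indicator(1)[OF _ ball_facts(2)[OF hk, of "0::'a"], where c="1::real"] by simp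
    qed
    ultimately have "(\<lambda>n. shift_dist ?i (d n - x)) \<longlonglongrightarrow> 0"
      unfolding shift_cont_def by blast
    then have "(\<lambda>n. shift_dist ?i (d n - x) * (M^2 / v)) \<longlonglongrightarrow> 0 * (M^2 / v)" by (intro tendsto_intros)
    then have lim: "(\<lambda>n. shift_dist ?i (d n - x) * (M^2 / v)) \<longlonglongrightarrow> 0" by simp
    have "Cauchy (\<lambda>n. A k (r n) x)"
    proof (rule metric_CauchyI)
      fix e :: real assume e: "e > 0"
      have "(e/3)^2 > 0" using e by simp
      from order_tendstoD(2)[OF lim this] obtain j where j: "shift_dist ?i (d j - x) * (M^2 / v) < (e/3)^2"
        using eventually_happens' sequentially_bot by blast
      have close: "\<bar>A k n x - A k n (d j)\<bar> < e / 3" for n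
      proof -
        have "(A k n x - A k n (d j))^2 \<le> shift_dist ?i (d j - x) * S (u n) / v"
          unfolding A_def v_def by (rule ball_avg_modulus[OF us]) simp
        also have "\<dots> \<le> shift_dist ?i (d j - x) * M^2 / v"
          using SM[of n] v by (intro divide_right_mono mult_left_mono) auto
        also have "\<dots> < (e/3)^2" using j by simp
        finally have "\<bar>A k n x - A k n (d j)\<bar>\<^sup>2 < (e/3)^2" by simp
        then show ?thesis by (rule power_less_imp_less_base) (use e in simp)
      qed
      have "Cauchy (\<lambda>n. A k (r n) (d j))" using cq[OF d(1)] by (simp add: Cauchy_convergent_iff)
      moreover have "e / 3 > 0" using e by simp
      ultimately have "\<exists>N. \<forall>m\<ge>N. \<forall>n\<ge>N. dist (A k (r m) (d j)) (A k (r n) (d j)) < e / 3"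
        by (rule metric_CauchyD)
      then obtain N where N: "\<And>m n. m \<ge> N \<Longrightarrow> n \<ge> N \<Longrightarrow> \<bar>A k (r m) (d j) - A k (r n) (d j)\<bar> < e / 3"
        unfolding dist_real_def by blast
      have "dist (A k (r m) x) (A k (r n) x) < e" if "m \<ge> N" "n \<ge> N" for m n
      proof -
        have gen: "\<bar>a - b\<bar> < e" if "\<bar>a - a'\<bar> < e/3" "\<bar>b - b'\<bar> < e/3" "\<bar>a' - b'\<bar> < e/3" for a b a' b' :: real
          using that by (auto simp: abs_if field_simps split: if_splits)
        show ?thesis unfolding dist_real_def by (rule gen[OF close close N[OF that]])
      qed
      then show "\<exists>N. \<forall>m\<ge>N. \<forall>n\<ge>N. dist (A k (r m) x) (A k (r n) x) < e" by blast
    qed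
    then show ?thesis by (simp add: Cauchy_convergent_iff)
  qed
  \<comment> \<open>Bounded averages need not be square integrable over the whole space. The
    Gaussian weight repairs this and is bounded below on every ball.\<close>
  define w where "w x = exp (- 1 * (norm x)^2 / 2)" for x :: 'a
  have w: "w x > 0" "w x \<le> 1" for x by (auto simp: w_def)
  have wm [measurable]: "w \<in> borel_measurable borel" unfolding w_def by measurable
  have w2: "integrable lborel (\<lambda>x. (w x)^2)"
  proof -
    have "integrable lborel (\<lambda>x::'a. exp (- 2 * (norm x)^2 / 2))"
      using integrable_Re[OF fourier_L1_gauss(1)[of 2 "0::'a"]] by simp
    moreover have "(w x)^2 = exp (- 2 * (norm x)^2 / 2)" for x by (simp add: w_def exp_double[symmetric])
    ultimately show ?thesis by simp
  qed
  define f where "f n x = w x * u (r n) x" for n x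
  have fm [measurable]: "f n \<in> borel_measurable borel" for n unfolding f_def by measurable
  have wle: "(w x * y)^2 \<le> y^2" for x y
    using w[of x] power_le_one[of "w x" 2] by (simp add: power_mult_distrib mult_left_le_one_le)
  have fs: "sq_integrable lborel (f n)" for n unfolding f_def
    by (rule sq_integrable_bound[OF sq_integrableD(2)[OF us[of "r n"]]]) (measurable, use wle in auto)
  define C where "C = 1 / (v1 * c0)"
  have C: "C > 0" using v1 c0 by (simp add: C_def)
  have Cauchy: "\<exists>N. \<forall>m\<ge>N. \<forall>n\<ge>N. (LINT x|lborel. (norm (f m x - f n x))^2) < e" if e: "e > 0" for e
  proof -
    \<comment> \<open>Each of the four terms in \<open>pt\<close> carries the factor 4. The two
      approximation errors thus take \<open>8\<close> times this bound, at most
      \<open>e / 2\<close>, and the two differences of averages, each below \<open>e / 16\<close>,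
      take the other half.\<close>
    obtain k where k: "8 * (C * ((1/2)^k) powr (2 * s) * M^2) < e / 2"
    proof -
      have q1: "2 powr (- (2 * s)) < (1::real)" using s by (simp add: powr_less_one)
      obtain k where "(2 powr (- (2 * s))) ^ k < e / (16 * C * M^2)"
        using real_arch_pow_inv[OF _ q1, of "e / (16 * C * M^2)"] e C M(1) by auto
      moreover have "(2 powr (- (2 * s))) ^ k = ((1/2)^k) powr (2 * s)"
        unfolding half_pow_powr by (simp add: powr_realpow[symmetric] powr_powr mult_ac)
      ultimately show thesis using that[of k] C M(1) by (simp add: less_divide_eq mult_ac)
    qed
    define B where "B = K * M * 2 powr (real k * gam)"
    define a where "a x = lim (\<lambda>n. A k (r n) x)" for x
    have al: "(\<lambda>n. A k (r n) x) \<longlonglongrightarrow> a x" for x using ca[of k x] by (simp add: a_def convergent_LIMSEQ_iff)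
    have am [measurable]: "a \<in> borel_measurable borel" by (rule borel_measurable_LIMSEQ_real[OF al]) auto
    have aB: "\<bar>a x\<bar> \<le> B" for x
      using Lim_bounded[OF tendsto_rabs[OF al[of x]], of 0 B] Ab[of k _ x] by (auto simp: B_def)
    have db: "(A k n x - a x)^2 \<le> 4 * B^2" for n x
    proof -
      have "\<bar>A k n x - a x\<bar> \<le> 2 * B" using Ab[of k n x] aB[of x] by (auto simp: B_def abs_le_iff)
      then have "\<bar>A k n x - a x\<bar>\<^sup>2 \<le> (2 * B)^2" by (rule power_mono) simp
      then show ?thesis by (simp add: power_mult_distrib)
    qed
    have ai: "integrable lborel (\<lambda>x. (w x)^2 * (A k n x - a x)^2)" for n
    proof (rule Bochner_Integration.integrable_bound)
      show "integrable lborel (\<lambda>x. (w x)^2 * (4 * B^2))" using w2 by simp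
    qed (measurable, use db[of n] in \<open>auto intro!: mult_left_mono AE_I2\<close>)
    have "(\<lambda>n. LINT x|lborel. (w x)^2 * (A k (r n) x - a x)^2) \<longlonglongrightarrow> (LINT x|(lborel::'a measure). (0::real))"
    proof (rule integral_dominated_convergence)
      show "integrable lborel (\<lambda>x. (w x)^2 * (4 * B^2))" using w2 by simp
      show "AE x in lborel. (\<lambda>n. (w x)^2 * (A k (r n) x - a x)^2) \<longlonglongrightarrow> 0"
      proof (rule AE_I2)
        fix x
        have "(\<lambda>n. (w x)^2 * (A k (r n) x - a x)^2) \<longlonglongrightarrow> (w x)^2 * (a x - a x)^2" by (intro tendsto_intros al)
        then show "(\<lambda>n. (w x)^2 * (A k (r n) x - a x)^2) \<longlonglongrightarrow> 0" by simp
      qed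
      show "AE x in lborel. norm ((w x)^2 * (A k (r n) x - a x)^2) \<le> (w x)^2 * (4 * B^2)" for n
        using db by (intro AE_I2) (auto intro!: mult_left_mono)
    qed measurable
    then have "\<forall>\<^sub>F n in sequentially. (LINT x|lborel. (w x)^2 * (A k (r n) x - a x)^2) < e / 16"
      using e by (intro order_tendstoD(2)) auto
    then obtain N where N: "\<And>n. n \<ge> N \<Longrightarrow> (LINT x|lborel. (w x)^2 * (A k (r n) x - a x)^2) < e / 16"
      by (auto simp: eventually_sequentially)
    have "(LINT x|lborel. (norm (f m x - f n x))^2) < e" if mn: "m \<ge> N" "n \<ge> N" for m n
    proof -
      have app: "sq_integrable lborel (\<lambda>x. u n x - A k n x)" "(LINT x|lborel. (u n x - A k n x)^2) \<le> C * ((1/2)^k) powr (2 * s) * M^2" for n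
      proof -
        note b = ball_avg_approx[OF u[of n], of "(1/2)^k"]
        show "sq_integrable lborel (\<lambda>x. u n x - A k n x)" using b(1) by (simp add: A_def)
        have "(LINT x|lborel. (u n x - A k n x)^2) \<le> C * ((1/2)^k) powr (2 * s) * D (u n)" using b(2) by (simp add: A_def C_def)
        also have "\<dots> \<le> C * ((1/2)^k) powr (2 * s) * M^2" using DM[of n] C by (intro mult_left_mono) auto
        finally show "(LINT x|lborel. (u n x - A k n x)^2) \<le> C * ((1/2)^k) powr (2 * s) * M^2" .
      qed
      let ?P = "\<lambda>n x. (w x)^2 * (A k (r n) x - a x)^2" and ?Q = "\<lambda>n x. (u (r n) x - A k (r n) x)^2"
      have pt: "(norm (f m x - f n x))^2 \<le> 4 * ?P m x + 4 * ?P n x + (4 * ?Q m x + 4 * ?Q n x)" for x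
      proof -
        have four: "(y1 + y2 + (y3 + y4))^2 \<le> 4 * y1^2 + 4 * y2^2 + (4 * y3^2 + 4 * y4^2)" for y1 y2 y3 y4 :: real
          using norm_add_sq_le[of "y1 + y2" "y3 + y4"] norm_add_sq_le[of y1 y2] norm_add_sq_le[of y3 y4] by simp
        have "f m x - f n x = w x * (A k (r m) x - a x) + w x * (a x - A k (r n) x) + (w x * (u (r m) x - A k (r m) x) + w x * (A k (r n) x - u (r n) x))"
          by (simp add: f_def algebra_simps)
        then have "(norm (f m x - f n x))^2 \<le> 4 * (w x * (A k (r m) x - a x))^2 + 4 * (w x * (a x - A k (r n) x))^2 + (4 * (w x * (u (r m) x - A k (r m) x))^2 + 4 * (w x * (A k (r n) x - u (r n) x))^2)"
          using four by simp
        also have "\<dots> \<le> 4 * ?P m x + 4 * ?P n x + (4 * ?Q m x + 4 * ?Q n x)"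
          using wle[of x "u (r m) x - A k (r m) x"] wle[of x "A k (r n) x - u (r n) x"]
          by (intro add_mono mult_left_mono) (auto simp: power_mult_distrib power2_commute)
        finally show ?thesis .
      qed
      have "(LINT x|lborel. (norm (f m x - f n x))^2) \<le> (LINT x|lborel. 4 * ?P m x + 4 * ?P n x + (4 * ?Q m x + 4 * ?Q n x))"
      proof (rule integral_mono)
        show "integrable lborel (\<lambda>x. (norm (f m x - f n x))^2)"
          using sq_integrable_diff[OF fs fs, of m n] by (simp add: sq_integrable_def)
        show "integrable lborel (\<lambda>x. 4 * ?P m x + 4 * ?P n x + (4 * ?Q m x + 4 * ?Q n x))"
          using ai[of "r m"] ai[of "r n"] app(1)[of "r m"] app(1)[of "r n"] by (simp add: sq_integrable_real)
      qed (rule pt)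
      also have "\<dots> = 4 * (LINT x|lborel. ?P m x) + 4 * (LINT x|lborel. ?P n x) + (4 * (LINT x|lborel. ?Q m x) + 4 * (LINT x|lborel. ?Q n x))"
        using ai[of "r m"] ai[of "r n"] app(1)[of "r m"] app(1)[of "r n"] by (simp add: sq_integrable_real)
      also have "\<dots> < e" using N[OF mn(1)] N[OF mn(2)] app(2)[of "r m"] app(2)[of "r n"] k by linarith
      finally show ?thesis .
    qed
    then show ?thesis by blast
  qed
  obtain r' g0 where r': "strict_mono r'" and g0: "g0 \<in> borel_measurable lborel" and ae: "AE x in lborel. (\<lambda>n. f (r' n) x) \<longlonglongrightarrow> g0 x"
    using sq_integrable_Cauchy_AE_subseq[OF fs Cauchy] by blast
  have g0m [measurable]: "g0 \<in> borel_measurable borel" using g0 by simp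
  have rn: "r' n \<ge> n" for n using r' by (rule strict_mono_imp_increasing)
  define u0 where "u0 x = g0 x / w x" for x
  have u0m [measurable]: "u0 \<in> borel_measurable borel" unfolding u0_def by measurable
  have wu0: "g0 x = w x * u0 x" for x using w(1)[of x] by (simp add: u0_def)
  have L2: "\<exists>N. \<forall>n\<ge>N. sq_integrable lborel (\<lambda>x. g0 x - f (r' n) x) \<and> (LINT x|lborel. (norm (g0 x - f (r' n) x))^2) \<le> e" if e: "e > 0" for e
  proof -
    obtain N where N: "\<And>m n. m \<ge> N \<Longrightarrow> n \<ge> N \<Longrightarrow> (LINT x|lborel. (norm (f m x - f n x))^2) < e" using Cauchy[OF e] by blast
    have "sq_integrable lborel (\<lambda>x. g0 x - f (r' n) x) \<and> (LINT x|lborel. (norm (g0 x - f (r' n) x))^2) \<le> e" if n: "n \<ge> N" for n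
    proof -
      have a: "AE x in lborel. (\<lambda>k. f (r' k) x - f (r' n) x) \<longlonglongrightarrow> g0 x - f (r' n) x"
        using ae by eventually_elim (intro tendsto_intros)
      have b: "(LINT x|lborel. (norm (f (r' k) x - f (r' n) x))^2) \<le> e" if "k \<ge> N" for k
        by (rule less_imp_le, rule N) (use rn[of k] rn[of n] n that in auto)
      have m: "(\<lambda>x. g0 x - f (r' n) x) \<in> borel_measurable lborel" by measurable
      show ?thesis
        using sq_integrable_liminf[OF sq_integrable_diff[OF fs fs] m a b] by blast
    qed
    then show ?thesis by blast
  qed
  show thesis
  proof (rule that[of "r \<circ> r'" u0])
    show "strict_mono (r \<circ> r')" using r r' by (rule strict_mono_o)
    show "u0 \<in> borel_measurable borel" by (rule u0m)
    show "AE x in lborel. (\<lambda>n. u ((r \<circ> r') n) x) \<longlonglongrightarrow> u0 x" using ae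
    proof eventually_elim
      case (elim x)
      have "(\<lambda>n. f (r' n) x / w x) \<longlonglongrightarrow> g0 x / w x" using w(1)[of x] by (intro tendsto_intros elim) auto
      then show ?case using w(1)[of x] by (simp add: f_def u0_def)
    qed
    fix R :: real
    show "(\<lambda>n. LINT x|lborel. indicator (ball 0 R) x * (u ((r \<circ> r') n) x - u0 x)^2) \<longlonglongrightarrow> 0"
    proof (rule LIMSEQ_I)
      fix e :: real assume e: "e > 0"
      \<comment> \<open>Since \<open>(w x)^2 = exp (- (norm x)^2)\<close>, this gives
        \<open>c * (w x)^2 \<ge> 1\<close> on the ball.\<close>
      define c where "c = exp (R^2)"
      have c: "c > 0" by (simp add: c_def)
      obtain N where N: "\<And>n. n \<ge> N \<Longrightarrow> sq_integrable lborel (\<lambda>x. g0 x - f (r' n) x) \<and> (LINT x|lborel. (norm (g0 x - f (r' n) x))^2) \<le> e / (2 * c)"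
        using L2[of "e / (2 * c)"] e c by auto
      have "norm ((LINT x|lborel. indicator (ball 0 R) x * (u ((r \<circ> r') n) x - u0 x)^2) - 0) < e" if n: "n \<ge> N" for n
      proof -
        have "(LINT x|lborel. indicator (ball 0 R) x * (u ((r \<circ> r') n) x - u0 x)^2) \<le> (LINT x|lborel. c * (norm (g0 x - f (r' n) x))^2)"
        proof (rule integral_mono')
          show "integrable lborel (\<lambda>x. c * (norm (g0 x - f (r' n) x))^2)" using N[OF n] by (simp add: sq_integrable_def)
          fix x :: 'a
          show "indicator (ball 0 R) x * (u ((r \<circ> r') n) x - u0 x)^2 \<le> c * (norm (g0 x - f (r' n) x))^2"
          proof (cases "norm x < R")
            case True
            have "g0 x - f (r' n) x = w x * (u0 x - u (r (r' n)) x)" by (simp add: wu0 f_def right_diff_distrib)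
            then have 1: "c * (norm (g0 x - f (r' n) x))^2 = (c * (w x)^2) * (u ((r \<circ> r') n) x - u0 x)^2"
              by (simp add: power_mult_distrib power2_commute)
            have "(norm x)^2 \<le> R^2" using True by (intro power_mono) auto
            then have "1 \<le> c * (w x)^2" by (simp add: c_def w_def exp_double[symmetric] exp_add[symmetric])
            then have "1 * (u ((r \<circ> r') n) x - u0 x)^2 \<le> c * (w x)^2 * (u ((r \<circ> r') n) x - u0 x)^2"
              by (intro mult_right_mono) auto
            then show ?thesis unfolding 1 using True by simp
          next
            case False
            then show ?thesis using c by simp
          qed
          show "0 \<le> c * (norm (g0 x - f (r' n) x))^2" using c by simp
        qed
        also have "\<dots> = c * (LINT x|lborel. (norm (g0 x - f (r' n) x))^2)" by simp
        also have "\<dots> \<le> c * (e / (2 * c))" using N[OF n] c by (intro mult_left_mono) auto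
        also have "\<dots> < e" using c e by simp
        finally have "(LINT x|lborel. indicator (ball 0 R) x * (u ((r \<circ> r') n) x - u0 x)^2) < e" .
        moreover have "0 \<le> (LINT x|lborel. indicator (ball 0 R) x * (u ((r \<circ> r') n) x - u0 x)^2)" by simp
        ultimately show ?thesis by simp
      qed
      then show "\<exists>N. \<forall>n\<ge>N. norm ((LINT x|lborel. indicator (ball 0 R) x * (u ((r \<circ> r') n) x - u0 x)^2) - 0) < e" by blast
    qed
  qed
qed

end

section \<open>Lipschitz functions of bounded support have finite energy\<close>

lemma heat_gauss_integral:
  assumes t: "t > 0"
  shows "(\<integral>\<^sup>+h. ennreal (heat t (h::'a::euclidean_space) * (1 - exp (- (norm h)\<^sup>2))) \<partial>lborel)
    = ennreal (1 - (1 + 2 * t) powr (- real DIM('a) / 2))"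
proof -
  \<comment> \<open>The variance of the product of the two Gaussians:
    \<open>1 / (2 * t) + 1 = 1 / (2 * t')\<close>.\<close>
  define t' where "t' = t / (1 + 2 * t)"
  have t': "t' > 0" using t by (simp add: t'_def add_pos_pos)
  have t2: "1 + 2 * t > 0" using t by simp
  have e: "heat t h * exp (- (norm h)\<^sup>2) = (1 + 2 * t) powr (- real DIM('a) / 2) * heat t' h" for h :: 'a
  proof -
    have 1: "- (norm h)\<^sup>2 / (2 * t) + - (norm h)\<^sup>2 = - (norm h)\<^sup>2 / (2 * t')"
      using t t2 by (simp add: t'_def field_simps)
    have "2 * pi * t = (1 + 2 * t) * (2 * pi * t')" using t2 by (simp add: t'_def)
    then have 2: "(2 * pi * t) powr (- real DIM('a) / 2) = (1 + 2 * t) powr (- real DIM('a) / 2) * (2 * pi * t') powr (- real DIM('a) / 2)"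
      using t2 t' by (simp only:) (simp add: powr_mult)
    have "exp (- (norm h)\<^sup>2 / (2 * t)) * exp (- (norm h)\<^sup>2) = exp (- (norm h)\<^sup>2 / (2 * t'))"
      by (simp only: exp_add[symmetric] 1)
    then show ?thesis unfolding heat_def 2 by (simp only: mult.assoc)
  qed
  have "heat t h * (1 - exp (- (norm h)\<^sup>2)) = heat t h - (1 + 2 * t) powr (- real DIM('a) / 2) * heat t' h" for h :: 'a
    using e[of h] by (simp add: right_diff_distrib)
  then have "(\<integral>\<^sup>+h. ennreal (heat t (h::'a) * (1 - exp (- (norm h)\<^sup>2))) \<partial>lborel) = (\<integral>\<^sup>+h. ennreal (heat t (h::'a) - (1 + 2 * t) powr (- real DIM('a) / 2) * heat t' h) \<partial>lborel)"
    by simp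
  also have "\<dots> = ennreal (LINT h|lborel. heat t (h::'a) - (1 + 2 * t) powr (- real DIM('a) / 2) * heat t' h)"
  proof (rule nn_integral_eq_integral)
    show "integrable lborel (\<lambda>h::'a. heat t h - (1 + 2 * t) powr (- real DIM('a) / 2) * heat t' h)"
      using heat_integral(1)[OF t, where 'a='a] heat_integral(1)[OF t', where 'a='a] by simp
    have "0 \<le> heat t h - (1 + 2 * t) powr (- real DIM('a) / 2) * heat t' h" for h :: 'a
      unfolding e[symmetric] by (simp add: mult_left_le)
    then show "AE h::'a in lborel. 0 \<le> heat t h - (1 + 2 * t) powr (- real DIM('a) / 2) * heat t' h" by simp
  qed
  also have "(LINT h|lborel. heat t (h::'a) - (1 + 2 * t) powr (- real DIM('a) / 2) * heat t' h) = 1 - (1 + 2 * t) powr (- real DIM('a) / 2)"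
    using heat_integral[OF t, where 'a='a] heat_integral[OF t', where 'a='a] by simp
  finally show ?thesis .
qed

text \<open>Lets the weight \<open>1 - exp (- r^2)\<close>, which integrates explicitly against heat
  kernels, stand for the usual \<open>min 1 (r^2)\<close>.\<close>

lemma min_sq_le: "min 1 (r^2) \<le> 2 * (1 - exp (- r\<^sup>2))" for r :: real
proof (cases "r^2 \<le> 1")
  case True
  have "exp (- r\<^sup>2) = 1 / exp (r^2)" by (simp add: exp_minus inverse_eq_divide)
  also have "\<dots> \<le> 1 / (1 + r^2)" using exp_ge_add_one_self[of "r^2"] by (intro divide_left_mono mult_pos_pos) (auto intro: add_pos_nonneg)
  also have "\<dots> \<le> 1 - r^2 / 2"
  proof -
    have "r^2 * r^2 \<le> r^2" using mult_left_le[OF True, of "r^2"] by simp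
    then have "1 \<le> (1 - r^2 / 2) * (1 + r^2)" by (simp add: algebra_simps)
    then show ?thesis by (subst pos_divide_le_eq) (auto intro: add_pos_nonneg)
  qed
  finally show ?thesis by simp
next
  case False
  then have "exp (- r\<^sup>2) \<le> exp (- 1)" by simp
  also have "exp (- 1) \<le> (1/2::real)" using exp_ge_add_one_self[of "1::real"] by (simp add: exp_minus field_simps)
  finally show ?thesis by simp
qed

context frac
begin

text \<open>Subordination once more: against each heat kernel the weight has the explicit integral
  of \<open>heat_gauss_integral\<close>, which is at most N times \<open>t\<close> and at most 1.
  The remaining \<open>t\<close>-integral converges at both ends because 0 < s < 1.\<close>

lemma ker_integrable:
  "(\<integral>\<^sup>+h. ennreal (gag_ker s (h::'a) * (1 - exp (- (norm h)\<^sup>2))) \<partial>lborel) < \<infinity>"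
proof -
  have hm [measurable]: "(\<lambda>(t, h). heat t (h::'a)) \<in> borel_measurable (borel \<Otimes>\<^sub>M borel)" unfolding heat_def by measurable
  have Np: "real DIM('a) > 0" by simp
  let ?m = "\<lambda>h::'a. 1 - exp (- (norm h)\<^sup>2)"
  have m0: "0 \<le> ?m h" for h by simp
  let ?X = "\<integral>\<^sup>+h. ennreal (norm (h::'a) powr (- (real DIM('a) + 2 * s))) * ennreal (?m h) \<partial>lborel"
  have "frac_ker_const s (real DIM('a)) * ?X = (\<integral>\<^sup>+h. frac_ker_const s (real DIM('a)) * (ennreal (norm (h::'a) powr (- (real DIM('a) + 2 * s))) * ennreal (?m h)) \<partial>lborel)"
    by (rule nn_integral_cmult[symmetric]) measurable
  also have "\<dots> = (\<integral>\<^sup>+h. (\<integral>\<^sup>+t\<in>{0<..}. ennreal (t powr (-1 - s) * heat t h) \<partial>lborel) * ennreal (?m h) \<partial>lborel)"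
  proof (rule nn_integral_cong)
    fix h :: 'a
    show "frac_ker_const s (real DIM('a)) * (ennreal (norm h powr (- (real DIM('a) + 2 * s))) * ennreal (?m h)) = (\<integral>\<^sup>+t\<in>{0<..}. ennreal (t powr (-1 - s) * heat t h) \<partial>lborel) * ennreal (?m h)"
    proof (cases "h = 0")
      case False
      show ?thesis unfolding frac_ker_integral[OF False] by (simp only: mult.assoc)
    qed simp
  qed
  also have "\<dots> = (\<integral>\<^sup>+h. \<integral>\<^sup>+t. ennreal (t powr (-1 - s) * heat t h) * indicator {0<..} t * ennreal (?m h) \<partial>lborel \<partial>lborel)"
    by (intro nn_integral_cong nn_integral_multc[symmetric]) measurable
  also have "\<dots> = (\<integral>\<^sup>+t. \<integral>\<^sup>+h. ennreal (t powr (-1 - s) * heat t h) * indicator {0<..} t * ennreal (?m h) \<partial>lborel \<partial>lborel)"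
    by (rule lborel_pair.Fubini') measurable
  also have "\<dots> = (\<integral>\<^sup>+t\<in>{0<..}. ennreal (t powr (-1 - s) * (1 - (1 + 2 * t) powr (- real DIM('a) / 2))) \<partial>lborel)"
  proof (rule nn_integral_cong)
    fix t :: real
    show "(\<integral>\<^sup>+h. ennreal (t powr (-1 - s) * heat t h) * indicator {0<..} t * ennreal (?m h) \<partial>lborel)
      = ennreal (t powr (-1 - s) * (1 - (1 + 2 * t) powr (- real DIM('a) / 2))) * indicator {0<..} t"
    proof (cases "t > 0")
      case True
      have "(\<integral>\<^sup>+h. ennreal (t powr (-1 - s) * heat t h) * indicator {0<..} t * ennreal (?m h) \<partial>lborel) = (\<integral>\<^sup>+h. ennreal (t powr (-1 - s)) * ennreal (heat t (h::'a) * ?m h) \<partial>lborel)"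
        using True m0 by (intro nn_integral_cong) (simp add: ennreal_mult mult_ac)
      also have "\<dots> = ennreal (t powr (-1 - s)) * ennreal (1 - (1 + 2 * t) powr (- real DIM('a) / 2))"
        unfolding heat_gauss_integral[OF True, where 'a='a, symmetric] by (rule nn_integral_cmult) measurable
      also have "\<dots> = ennreal (t powr (-1 - s) * (1 - (1 + 2 * t) powr (- real DIM('a) / 2)))"
      proof (rule ennreal_mult[symmetric])
        show "0 \<le> 1 - (1 + 2 * t) powr (- real DIM('a) / 2)" using True powr_mono[of "- real DIM('a) / 2" 0 "1 + 2 * t"] by simp
      qed simp
      finally show ?thesis using True by simp
    qed simp
  qed
  also have "\<dots> < \<infinity>"
  proof (rule nn_integral_pos_finite[where a="-s" and b="-1-s" and C="real DIM('a)"])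
    fix t :: real assume t: "0 < t" "t \<le> 1"
    have "1 - (1 + 2 * t) powr (- real DIM('a) / 2) \<le> real DIM('a) * t"
    proof -
      have "ln (1 + 2 * t) \<le> 2 * t" using ln_add_one_self_le_self[of "2 * t"] t by simp
      then have "real DIM('a) / 2 * ln (1 + 2 * t) \<le> real DIM('a) / 2 * (2 * t)" by (intro mult_left_mono) auto
      then have "- (real DIM('a) * t) \<le> - real DIM('a) / 2 * ln (1 + 2 * t)" by simp
      then have "1 + - (real DIM('a) * t) \<le> exp (- real DIM('a) / 2 * ln (1 + 2 * t))"
        using exp_ge_add_one_self[of "- real DIM('a) / 2 * ln (1 + 2 * t)"] by (auto intro: order_trans[rotated])
      then show ?thesis using t by (simp add: powr_def)
    qed
    then have "t powr (-1 - s) * (1 - (1 + 2 * t) powr (- real DIM('a) / 2)) \<le> t powr (-1 - s) * (real DIM('a) * t powr 1)"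
      using t by (intro mult_left_mono) auto
    also have "\<dots> = real DIM('a) * (t powr (-1 - s) * t powr 1)" by (simp only: mult.left_commute)
    also have "t powr (-1 - s) * t powr 1 = t powr (- s)" by (simp only: powr_add[symmetric]) simp
    finally show "ennreal (t powr (-1 - s) * (1 - (1 + 2 * t) powr (- real DIM('a) / 2))) \<le> ennreal (real DIM('a) * t powr (- s))"
      by (rule ennreal_leI)
  next
    fix t :: real assume t: "t \<ge> 1"
    have "t powr (-1 - s) * (1 - (1 + 2 * t) powr (- real DIM('a) / 2)) \<le> real DIM('a) * t powr (-1 - s)"
    proof -
      have "1 - (1 + 2 * t) powr (- real DIM('a) / 2) \<le> 1" by simp
      also have "1 \<le> real DIM('a)" using DIM_positive[where 'a='a] by simp
      finally have "t powr (-1 - s) * (1 - (1 + 2 * t) powr (- real DIM('a) / 2)) \<le> t powr (-1 - s) * real DIM('a)"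
        by (rule mult_left_mono) simp
      then show ?thesis by (simp only: mult.commute)
    qed
    then show "ennreal (t powr (-1 - s) * (1 - (1 + 2 * t) powr (- real DIM('a) / 2))) \<le> ennreal (real DIM('a) * t powr (-1 - s))"
      by (rule ennreal_leI)
  qed (use s in auto)
  finally have "frac_ker_const s (real DIM('a)) * ?X < \<infinity>" .
  then have X: "?X < \<infinity>" using frac_ker_const_finite(2)[OF s Np] by (auto simp: ennreal_mult_less_top)
  have "(\<integral>\<^sup>+h. ennreal (gag_ker s (h::'a) * ?m h) \<partial>lborel) = (\<integral>\<^sup>+h. ennreal c0 * (ennreal (norm (h::'a) powr (- (real DIM('a) + 2 * s))) * ennreal (?m h)) \<partial>lborel)"
    using c0 m0 by (intro nn_integral_cong) (simp add: gag_ker_def c0_def ennreal_mult[symmetric] mult.assoc)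
  also have "\<dots> = ennreal c0 * ?X" by (rule nn_integral_cmult) measurable
  also have "\<dots> < \<infinity>" using X by (simp add: ennreal_mult_less_top)
  finally show ?thesis .
qed

lemma gag_ker_minus: "gag_ker s (x - y) = gag_ker s (y - x)" by (simp add: gag_ker_def norm_minus_commute)

definition gm :: "'a \<times> 'a \<Rightarrow> real" where "gm z = 1 - exp (- (norm (fst z - snd z))\<^sup>2)"

lemma gm_nonneg: "gm z \<ge> 0" by (simp add: gm_def)
lemma gm_measurable [measurable]: "gm \<in> borel_measurable borel" unfolding gm_def by measurable
lemma min_gm: "min 1 ((norm (x - y))^2) \<le> 2 * gm (x, y)" unfolding gm_def using min_sq_le by simp

text \<open>Integrating the free point first leaves the mass of \<open>w\<close> times the finite
  integral of \<open>ker_integrable\<close>. This is the integrable majorant for cutoffs and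
  bumps.\<close>

lemma gag_weight_integrable:
  fixes w :: "'a \<Rightarrow> real"
  assumes w: "sq_integrable lborel w"
  shows "integrable (gag s) (\<lambda>z. (w (fst z))^2 * gm z)" "integrable (gag s) (\<lambda>z. (w (snd z))^2 * gm z)"
proof -
  have [measurable]: "w \<in> borel_measurable borel" using w by (simp add: sq_integrable_def)
  let ?k = "\<lambda>h::'a. gag_ker s h * (1 - exp (- (norm h)\<^sup>2))"
  let ?X = "\<integral>\<^sup>+h. ennreal (?k h) \<partial>lborel"
  have k0: "gag_ker s h \<ge> 0" for h :: 'a using c0 by (simp add: gag_ker_def c0_def[symmetric])
  have e: "ennreal (gag_ker s (x - y)) * ennreal (a^2 * gm (x, y)) = ennreal (a^2) * ennreal (?k (y - x))" for x y a
    using k0 gm_nonneg by (simp add: gm_def ennreal_mult[symmetric] gag_ker_minus[of x y] norm_minus_commute mult_ac)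
  have inner: "(\<integral>\<^sup>+y. ennreal (a^2) * ennreal (?k (y - x)) \<partial>lborel) = ennreal (a^2) * ?X" for a x
  proof -
    have "(\<integral>\<^sup>+y. ennreal (a^2) * ennreal (?k (y - x)) \<partial>lborel) = ennreal (a^2) * (\<integral>\<^sup>+y. ennreal (?k (y - x)) \<partial>lborel)"
      by (rule nn_integral_cmult) measurable
    also have "(\<integral>\<^sup>+y. ennreal (?k (y - x)) \<partial>lborel) = ?X"
      using nn_integral_translate[of "\<lambda>y. ennreal (?k y)" "- x"] by simp
    finally show ?thesis .
  qed
  have tot: "(\<integral>\<^sup>+x. ennreal ((w x)^2) * ?X \<partial>lborel) < \<infinity>"
  proof -
    have "(\<integral>\<^sup>+x. ennreal ((w x)^2) * ?X \<partial>lborel) = (\<integral>\<^sup>+x. ennreal ((w x)^2) \<partial>lborel) * ?X" by (rule nn_integral_multc) measurable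
    moreover have "(\<integral>\<^sup>+x. ennreal ((w x)^2) \<partial>lborel) < \<infinity>" using w by (simp add: sq_integrable_real integrable_iff_bounded)
    ultimately show ?thesis using ker_integrable by (simp add: ennreal_mult_less_top)
  qed
  have "(\<integral>\<^sup>+z. ennreal ((w (fst z))^2 * gm z) \<partial>gag s) = (\<integral>\<^sup>+x. \<integral>\<^sup>+y. ennreal ((w x)^2) * ennreal (?k (y - x)) \<partial>lborel \<partial>lborel)"
    by (subst nn_integral_gag) (measurable, simp add: e)
  also have "\<dots> = (\<integral>\<^sup>+x. ennreal ((w x)^2) * ?X \<partial>lborel)" by (simp only: inner)
  finally have 1: "(\<integral>\<^sup>+z. ennreal ((w (fst z))^2 * gm z) \<partial>gag s) < \<infinity>" using tot by simp
  show "integrable (gag s) (\<lambda>z. (w (fst z))^2 * gm z)"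
    by (rule integrableI_nonneg) (measurable, use gm_nonneg 1 in auto)
  have e2: "ennreal (gag_ker s (x - y)) * ennreal (a^2 * gm (x, y)) = ennreal (a^2) * ennreal (?k (x - y))" for x y a
    using k0 gm_nonneg by (simp add: gm_def ennreal_mult[symmetric] mult_ac)
  have "(\<integral>\<^sup>+z. ennreal ((w (snd z))^2 * gm z) \<partial>gag s) = (\<integral>\<^sup>+x. \<integral>\<^sup>+y. ennreal ((w y)^2) * ennreal (?k (x - y)) \<partial>lborel \<partial>lborel)"
    by (subst nn_integral_gag) (measurable, simp add: e2)
  also have "\<dots> = (\<integral>\<^sup>+y. \<integral>\<^sup>+x. ennreal ((w y)^2) * ennreal (?k (x - y)) \<partial>lborel \<partial>lborel)"
    by (rule lborel_pair.Fubini'[symmetric]) measurable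
  also have "\<dots> = (\<integral>\<^sup>+y. ennreal ((w y)^2) * ?X \<partial>lborel)" by (simp only: inner)
  finally have 2: "(\<integral>\<^sup>+z. ennreal ((w (snd z))^2 * gm z) \<partial>gag s) < \<infinity>" using tot by simp
  show "integrable (gag s) (\<lambda>z. (w (snd z))^2 * gm z)"
    by (rule integrableI_nonneg) (measurable, use gm_nonneg 2 in auto)
qed

lemma sq_le_gm:
  assumes "\<bar>a\<bar> \<le> L * norm (x - y)" "\<bar>a\<bar> \<le> L" "L \<ge> 0"
  shows "a^2 \<le> 2 * L^2 * gm (x, y)"
proof -
  have "a^2 \<le> L^2" "a^2 \<le> L^2 * (norm (x - y))^2"
    using power_mono[OF assms(2), of 2] power_mono[OF assms(1), of 2] by (auto simp: power_mult_distrib)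
  then have "a^2 \<le> L^2 * min 1 ((norm (x - y))^2)" by (simp add: min_def)
  also have "\<dots> \<le> L^2 * (2 * gm (x, y))" by (intro mult_left_mono min_gm) auto
  finally show ?thesis by simp
qed

text \<open>\<open>pdiff \<phi>\<close> vanishes unless one of the two points lies in the ball.
  Lipschitz continuity at short distance and boundedness at long distance make its square at most a
  multiple of \<open>gm\<close>. One constant \<open>L\<close> serves for both bounds.\<close>

lemma Lipschitz_bump_H:
  assumes m: "\<phi> \<in> borel_measurable borel" and L: "\<And>x y. \<bar>\<phi> x - \<phi> y\<bar> \<le> L * norm (x - y)" "\<And>x. \<bar>\<phi> x\<bar> \<le> L"
    and R: "\<And>x. norm x \<ge> R \<Longrightarrow> \<phi> x = 0"
  shows "H \<phi>"
proof -
  have L0: "L \<ge> 0" using order_trans[OF abs_ge_zero L(2)] .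
  note [measurable] = m
  let ?B = "ball (0::'a) R"
  have [measurable]: "?B \<in> sets borel" by simp
  have B: "?B \<in> sets lborel" "emeasure lborel ?B < \<infinity>" using emeasure_lborel_ball_finite by auto
  define w where "w x = indicator ?B x * (1::real)" for x
  have ws: "sq_integrable lborel w" unfolding w_def using sq_integrable_indicator(1)[OF B, of "1::real"] by simp
  have "\<phi> = (\<lambda>x. indicator ?B x * \<phi> x)"
  proof
    show "\<phi> x = indicator ?B x * \<phi> x" for x by (cases "norm x < R") (use R[of x] in auto)
  qed
  moreover have "sq_integrable lborel (\<lambda>x. indicator ?B x * \<phi> x)"
  proof (rule sq_integrable_bound)
    show "integrable lborel (\<lambda>x. L^2 * indicator ?B x)" using B by (simp add: integrable_indicator_iff)
    show "(\<lambda>x. indicator ?B x * \<phi> x) \<in> borel_measurable lborel" by measurable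
    show "AE x in lborel. (norm (indicator ?B x * \<phi> x))^2 \<le> L^2 * indicator ?B x"
      using power_mono[OF L(2), of _ 2] by (intro AE_I2) (auto simp: indicator_def)
  qed
  ultimately have s1: "sq_integrable lborel \<phi>" by simp
  have "sq_integrable (gag s) (pdiff \<phi>)"
  proof (rule sq_integrable_bound)
    show "integrable (gag s) (\<lambda>z. 8 * L^2 * ((w (fst z))^2 * gm z) + 8 * L^2 * ((w (snd z))^2 * gm z))"
      using gag_weight_integrable[OF ws] by simp
    show "pdiff \<phi> \<in> borel_measurable (gag s)" by measurable
    have "(pdiff \<phi> z)^2 \<le> 8 * L^2 * ((w (fst z))^2 * gm z) + 8 * L^2 * ((w (snd z))^2 * gm z)" for z
    proof (cases "fst z \<in> ?B \<or> snd z \<in> ?B")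
      case True
      have "(pdiff \<phi> z)^2 \<le> 2 * (2 * L)^2 * gm (fst z, snd z)"
      proof (rule sq_le_gm)
        have "\<bar>pdiff \<phi> z\<bar> \<le> L * norm (fst z - snd z)" unfolding pdiff_def by (rule L)
        also have "\<dots> \<le> 2 * L * norm (fst z - snd z)" using L0 by (intro mult_right_mono) auto
        finally show "\<bar>pdiff \<phi> z\<bar> \<le> 2 * L * norm (fst z - snd z)" .
        have "\<bar>pdiff \<phi> z\<bar> \<le> \<bar>\<phi> (fst z)\<bar> + \<bar>\<phi> (snd z)\<bar>" unfolding pdiff_def by (rule abs_triangle_ineq4)
        also have "\<dots> \<le> L + L" by (intro add_mono L)
        finally show "\<bar>pdiff \<phi> z\<bar> \<le> 2 * L" by simp
      qed (use L0 in auto)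
      also have "\<dots> = 8 * L^2 * gm z" by (simp add: power_mult_distrib)
      also have "\<dots> \<le> 8 * L^2 * ((w (fst z))^2 * gm z) + 8 * L^2 * ((w (snd z))^2 * gm z)"
        using True gm_nonneg[of z] by (auto simp: w_def indicator_def)
      finally show ?thesis .
    next
      case False
      then have "pdiff \<phi> z = 0" using R by (simp add: pdiff_def)
      then show ?thesis using gm_nonneg[of z] by simp
    qed
    then show "AE z in gag s. (norm (pdiff \<phi> z))^2 \<le> 8 * L^2 * ((w (fst z))^2 * gm z) + 8 * L^2 * ((w (snd z))^2 * gm z)"
      by (intro AE_I2) simp
  qed
  then show ?thesis using s1 by (simp add: H_def)
qed

end

section \<open>The nonlinearity\<close>

text \<open>\<open>p\<close> is \<open>q + 1\<close> for the exponent \<open>q\<close> of (f3), the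
  growth exponent of the primitive; hence \<open>3 < p\<close>, and the power \<open>p - 2\<close>
  in the condition on the derivative.\<close>

locale nonlinearity =
  fixes f :: "real \<Rightarrow> real" and p \<theta> :: real
  assumes f_diff: "\<And>u. f differentiable (at u)"
    and f_C1: "continuous_on UNIV (deriv f)"
    and f_neg: "\<And>u. u \<le> 0 \<Longrightarrow> f u = 0"
    and f_lim0: "(deriv f \<longlongrightarrow> 0) (at 0)"
    and p3: "3 < p"
    and f_lim_top: "((\<lambda>u. deriv f u / u powr (p - 2)) \<longlongrightarrow> 0) at_top"
    and \<theta>: "2 < \<theta>"
    and AR: "\<And>u. u > 0 \<Longrightarrow> 0 < \<theta> * prim f u \<and> \<theta> * prim f u \<le> u * f u"
    and f_mono: "strict_mono_on {0<..} (\<lambda>u. f u / u)"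
begin

abbreviation "F \<equiv> prim f"
definition g :: "real \<Rightarrow> real" where "g u = f u * u"
definition h :: "real \<Rightarrow> real" where "h u = g u / 2 - F u"
text \<open>Common growth majorant of \<open>g\<close>, \<open>h\<close> and \<open>F\<close>, and
  the weight in which their Brezis-Lieb splitting is measured.\<close>

definition \<Phi> :: "real \<Rightarrow> real" where "\<Phi> u = u^2 + \<bar>u\<bar> powr p"

lemma f_deriv: "(f has_real_derivative deriv f u) (at u)"
  using f_diff[of u] DERIV_deriv_iff_real_differentiable by blast

lemma f_cont: "continuous_on A f"
  using f_deriv by (meson DERIV_isCont continuous_at_imp_continuous_on)

lemma f_isCont: "isCont f u" using f_deriv by (rule DERIV_isCont)

lemma f_measurable [measurable]: "f \<in> borel_measurable borel"
  by (intro borel_measurable_continuous_onI f_cont)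

lemma deriv_f_0: "deriv f 0 = 0"
proof -
  have "isCont (deriv f) 0" using f_C1 by (simp add: continuous_on_eq_continuous_at)
  then show ?thesis using LIM_unique[OF f_lim0] by (simp add: isCont_def)
qed

lemma f_0 [simp]: "f 0 = 0" by (rule f_neg) simp

text \<open>For \<open>t < 0\<close> the interval \<open>{0..t}\<close> is empty and
  \<open>F t = 0\<close>, in agreement with \<open>f\<close> vanishing there. Moving the base point
  to the left of both \<open>u\<close> and 0 gives one formula on both sides of 0.\<close>

lemma F_deriv: "(F has_real_derivative f u) (at u)"
proof -
  define a where "a = min u 0 - 1"
  define b where "b = max u 0 + 1"
  have ab: "a < u" "u < b" "a < 0" "0 < b" by (auto simp: a_def b_def)
  have e: "F t = integral {a..t} f" if "t \<in> {a..b}" for t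
  proof (cases "t \<ge> 0")
    case True
    have "integral {a..0} f = integral {a..0} (\<lambda>_. 0)" by (rule integral_cong) (simp add: f_neg)
    moreover have "integral {a..0} f + integral {0..t} f = integral {a..t} f"
      by (rule Henstock_Kurzweil_Integration.integral_combine) (use ab True in \<open>auto intro!: integrable_continuous_real f_cont\<close>)
    ultimately show ?thesis by (simp add: prim_def)
  next
    case False
    have "integral {a..t} f = integral {a..t} (\<lambda>_. 0)" by (rule integral_cong) (use False in \<open>simp add: f_neg\<close>)
    then show ?thesis using False by (simp add: prim_def)
  qed
  have "((\<lambda>t. integral {a..t} f) has_real_derivative f u) (at u within {a..b})"
    by (rule integral_has_real_derivative[OF f_cont]) (use ab in auto)
  then have "((\<lambda>t. integral {a..t} f) has_real_derivative f u) (at u)"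
    using at_within_Icc_at[OF ab(1,2)] by simp
  then show ?thesis
  proof (rule DERIV_cong_ev[THEN iffD1, rotated -1])
    show "\<forall>\<^sub>F x in nhds u. integral {a..x} f = F x"
    proof (rule eventually_mono[OF eventually_nhds_in_open[of "{a<..<b}"]])
      show "u \<in> {a<..<b}" using ab by simp
      show "integral {a..x} f = F x" if "x \<in> {a<..<b}" for x using e[of x] that by simp
    qed auto
  qed auto
qed

lemma F_neg: "u \<le> 0 \<Longrightarrow> F u = 0"
  by (cases "u = 0") (auto simp: prim_def)

lemma F_0 [simp]: "F 0 = 0" by (simp add: F_neg)

lemma g_deriv: "(g has_real_derivative (f u + u * deriv f u)) (at u)"
  unfolding g_def[abs_def] by (rule derivative_eq_intros f_deriv refl | simp)+

lemma h_deriv: "(h has_real_derivative ((u * deriv f u - f u) / 2)) (at u)"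
  unfolding h_def[abs_def] by (rule derivative_eq_intros g_deriv F_deriv refl | simp add: field_simps)+

lemma cont_ghF: "continuous_on UNIV g" "continuous_on UNIV h" "continuous_on UNIV F"
  using g_deriv h_deriv F_deriv by (meson DERIV_isCont continuous_at_imp_continuous_on)+

lemma ghF_measurable [measurable]: "g \<in> borel_measurable borel" "h \<in> borel_measurable borel" "F \<in> borel_measurable borel"
  using cont_ghF by (auto intro: borel_measurable_continuous_onI)

lemma g_neg: "u \<le> 0 \<Longrightarrow> g u = 0" by (simp add: g_def f_neg)
lemma h_neg: "u \<le> 0 \<Longrightarrow> h u = 0" by (simp add: h_def g_neg F_neg)

lemma \<Phi>_measurable [measurable]: "\<Phi> \<in> borel_measurable borel" unfolding \<Phi>_def by measurable
lemma \<Phi>_nonneg: "\<Phi> u \<ge> 0" by (simp add: \<Phi>_def)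

section \<open>Growth bounds and splitting of the nonlinearity\<close>

lemma deriv_f_bound: "\<exists>C>0. \<forall>u. \<bar>deriv f u\<bar> \<le> C * (1 + \<bar>u\<bar> powr (p - 2))"
proof -
  have "\<forall>\<^sub>F u in at_top. \<bar>deriv f u / u powr (p - 2)\<bar> < 1"
    using tendstoD[OF f_lim_top, of 1] by (simp add: dist_real_def)
  then obtain R where R: "\<And>u. u \<ge> R \<Longrightarrow> \<bar>deriv f u / u powr (p - 2)\<bar> < 1"
    unfolding eventually_at_top_linorder by blast
  define R' where "R' = max R 1"
  have "compact (deriv f ` {-1..R'})"
    by (intro compact_continuous_image continuous_on_subset[OF f_C1]) auto
  then obtain B where B: "\<And>u. u \<in> {-1..R'} \<Longrightarrow> \<bar>deriv f u\<bar> \<le> B"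
    using compact_imp_bounded bounded_iff by (metis (no_types, lifting) image_eqI real_norm_def)
  have "\<bar>deriv f u\<bar> \<le> (\<bar>B\<bar> + 1) * (1 + \<bar>u\<bar> powr (p - 2))" for u
  proof -
    have 1: "1 \<le> 1 + \<bar>u\<bar> powr (p - 2)" by simp
    consider "u < -1" | "u \<in> {-1..R'}" | "u > R'" by fastforce
    then show ?thesis
    proof cases
      case 1
      have "(f has_real_derivative 0) (at u)"
      proof (rule DERIV_cong_ev[THEN iffD1, rotated -1])
        show "((\<lambda>_. 0) has_real_derivative 0) (at u)" by simp
        show "\<forall>\<^sub>F x in nhds u. (0::real) = f x"
          by (rule eventually_mono[OF eventually_nhds_in_open[of "{..<0}"]]) (use 1 f_neg in auto)
      qed auto
      then have "deriv f u = 0" by (rule DERIV_imp_deriv)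
      then show ?thesis by simp
    next
      case 2
      have "\<bar>deriv f u\<bar> \<le> (\<bar>B\<bar> + 1) * 1" using B[OF 2] abs_ge_self[of B] by simp
      also have "\<dots> \<le> (\<bar>B\<bar> + 1) * (1 + \<bar>u\<bar> powr (p - 2))" by (intro mult_left_mono) auto
      finally show ?thesis .
    next
      case 3
      then have u: "u \<ge> R" "u > 0" by (auto simp: R'_def)
      have "\<bar>deriv f u\<bar> \<le> u powr (p - 2)"
        using R[OF u(1)] u(2) by (simp add: abs_divide divide_less_eq)
      also have "\<dots> \<le> (\<bar>B\<bar> + 1) * (1 + \<bar>u\<bar> powr (p - 2))"
        using u mult_mono[of 1 "\<bar>B\<bar> + 1" "u powr (p - 2)" "1 + \<bar>u\<bar> powr (p - 2)"] by simp
      finally show ?thesis .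
    qed
  qed
  then show ?thesis by (intro exI[of _ "\<bar>B\<bar> + 1"]) auto
qed

lemma MVT_abs_bound:
  fixes j j' :: "real \<Rightarrow> real"
  assumes d: "\<And>x. (j has_real_derivative j' x) (at x)" and b: "\<And>x. \<bar>x\<bar> \<le> \<bar>a\<bar> + \<bar>b\<bar> \<Longrightarrow> \<bar>j' x\<bar> \<le> B"
  shows "\<bar>j (a + b) - j a\<bar> \<le> B * \<bar>b\<bar>"
proof -
  have cs: "convex (closed_segment a (a + b))" by (rule convex_closed_segment)
  have "norm (j (a + b) - j a) \<le> B * norm (a + b - a)"
  proof (rule field_differentiable_bound[OF cs])
    fix x assume x: "x \<in> closed_segment a (a + b)"
    show "(j has_field_derivative j' x) (at x within closed_segment a (a + b))"
      using d by (rule has_field_derivative_at_within)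
    obtain t where t: "0 \<le> t" "t \<le> 1" "x = (1 - t) *\<^sub>R a + t *\<^sub>R (a + b)" using x unfolding closed_segment_def by blast
    then have "x = a + t * b" by (simp add: algebra_simps)
    then have "\<bar>x\<bar> \<le> \<bar>a\<bar> + \<bar>t * b\<bar>" using abs_triangle_ineq by blast
    also have "\<bar>t * b\<bar> \<le> \<bar>b\<bar>" using t by (simp add: abs_mult mult_left_le_one_le)
    finally show "norm (j' x) \<le> B" using b by simp
  qed auto
  then show ?thesis by simp
qed

lemma f_bound_crude: "\<exists>C>0. \<forall>u. \<bar>f u\<bar> \<le> C * (\<bar>u\<bar> + \<bar>u\<bar> powr (p - 1))"
proof -
  obtain C where C: "C > 0" "\<And>u. \<bar>deriv f u\<bar> \<le> C * (1 + \<bar>u\<bar> powr (p - 2))" using deriv_f_bound by blast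
  have "\<bar>f u\<bar> \<le> C * (\<bar>u\<bar> + \<bar>u\<bar> powr (p - 1))" for u
  proof -
    have "\<bar>f (0 + u) - f 0\<bar> \<le> (C * (1 + \<bar>u\<bar> powr (p - 2))) * \<bar>u\<bar>"
    proof (rule MVT_abs_bound[OF f_deriv])
      fix x :: real assume "\<bar>x\<bar> \<le> \<bar>0\<bar> + \<bar>u\<bar>"
      then have "\<bar>x\<bar> powr (p - 2) \<le> \<bar>u\<bar> powr (p - 2)" using p3 by (intro powr_mono2) auto
      then show "\<bar>deriv f x\<bar> \<le> C * (1 + \<bar>u\<bar> powr (p - 2))"
        using C(2)[of x] C(1) by (meson add_left_mono mult_left_mono less_imp_le order_trans)
    qed
    moreover have "\<bar>u\<bar> powr (p - 2) * \<bar>u\<bar> = \<bar>u\<bar> powr (p - 1)"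
      using powr_add[of "\<bar>u\<bar>" "p - 2" 1] by (cases "u = 0") auto
    ultimately show ?thesis by (simp add: algebra_simps)
  qed
  then show ?thesis using C(1) by blast
qed

text \<open>The linear coefficient can be arbitrarily small because the derivative of
  \<open>f\<close> vanishes at 0. This is what allows the quadratic part of \<open>g\<close> to be
  absorbed by the potential.\<close>

lemma f_bound:
  assumes \<delta>: "\<delta> > 0"
  shows "\<exists>C>0. \<forall>u. \<bar>f u\<bar> \<le> \<delta> * \<bar>u\<bar> + C * \<bar>u\<bar> powr (p - 1)"
proof -
  obtain C where C: "C > 0" "\<And>u. \<bar>f u\<bar> \<le> C * (\<bar>u\<bar> + \<bar>u\<bar> powr (p - 1))" using f_bound_crude by blast
  have "isCont (deriv f) 0" using f_C1 by (simp add: continuous_on_eq_continuous_at)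
  then obtain \<eta> where \<eta>: "\<eta> > 0" "\<And>x. \<bar>x\<bar> < \<eta> \<Longrightarrow> \<bar>deriv f x\<bar> < \<delta>"
    unfolding continuous_at_eps_delta using \<delta> by (auto simp: deriv_f_0 dist_real_def)
  \<comment> \<open>Beyond \<open>\<eta>\<close> the linear term is absorbed by the power:
    \<open>\<bar>u\<bar> \<le> \<eta> powr (2 - p) * \<bar>u\<bar> powr (p - 1)\<close>.\<close>
  define C' where "C' = C * (\<eta> powr (2 - p) + 1)"
  have C': "C' > 0" using C by (simp add: C'_def add_nonneg_pos)
  have "\<bar>f u\<bar> \<le> \<delta> * \<bar>u\<bar> + C' * \<bar>u\<bar> powr (p - 1)" for u
  proof (cases "\<bar>u\<bar> < \<eta>")
    case True
    have "\<bar>f (0 + u) - f 0\<bar> \<le> \<delta> * \<bar>u\<bar>"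
      by (rule MVT_abs_bound[OF f_deriv]) (use True \<eta>(2) in \<open>auto intro: less_imp_le\<close>)
    moreover have "0 \<le> C' * \<bar>u\<bar> powr (p - 1)" using C' by simp
    ultimately show ?thesis by simp
  next
    case False
    then have u: "\<bar>u\<bar> > 0" "\<eta> \<le> \<bar>u\<bar>" using \<eta>(1) by auto
    have "\<bar>u\<bar> = \<bar>u\<bar> powr (2 - p) * \<bar>u\<bar> powr (p - 1)" using u by (simp add: powr_add[symmetric])
    also have "\<dots> \<le> \<eta> powr (2 - p) * \<bar>u\<bar> powr (p - 1)"
      using u \<eta>(1) p3 by (intro mult_right_mono powr_mono2') auto
    finally have "C * (\<bar>u\<bar> + \<bar>u\<bar> powr (p - 1)) \<le> C * (\<eta> powr (2 - p) * \<bar>u\<bar> powr (p - 1) + \<bar>u\<bar> powr (p - 1))"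
      using C(1) by (intro mult_left_mono) auto
    also have "\<dots> = C' * \<bar>u\<bar> powr (p - 1)" by (simp add: C'_def algebra_simps)
    finally have "\<bar>f u\<bar> \<le> C' * \<bar>u\<bar> powr (p - 1)" using C(2)[of u] by linarith
    then show ?thesis using \<delta> by (simp add: add_increasing)
  qed
  then show ?thesis using C' by blast
qed

lemma powr_p_mult: "\<bar>u\<bar> powr (p - 1) * \<bar>u\<bar> = \<bar>u\<bar> powr p" for u :: real
  using powr_add[of "\<bar>u\<bar>" "p - 1" 1] by (cases "u = 0") auto

lemma g_bound:
  assumes \<delta>: "\<delta> > 0"
  shows "\<exists>C>0. \<forall>u. \<bar>g u\<bar> \<le> \<delta> * u^2 + C * \<bar>u\<bar> powr p"
proof -
  obtain C where C: "C > 0" "\<And>u. \<bar>f u\<bar> \<le> \<delta> * \<bar>u\<bar> + C * \<bar>u\<bar> powr (p - 1)" using f_bound[OF \<delta>] by blast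
  have "\<bar>g u\<bar> \<le> \<delta> * u^2 + C * \<bar>u\<bar> powr p" for u
  proof -
    have "\<bar>g u\<bar> \<le> (\<delta> * \<bar>u\<bar> + C * \<bar>u\<bar> powr (p - 1)) * \<bar>u\<bar>"
      unfolding g_def abs_mult by (rule mult_right_mono[OF C(2)]) simp
    also have "\<dots> = \<delta> * (\<bar>u\<bar> * \<bar>u\<bar>) + C * (\<bar>u\<bar> powr (p - 1) * \<bar>u\<bar>)" by (simp add: algebra_simps)
    finally show ?thesis unfolding powr_p_mult by (simp add: power2_eq_square)
  qed
  then show ?thesis using C(1) by blast
qed

text \<open>If \<open>b\<close> is small relative to \<open>a\<close>, the mean value theorem yields
  a small factor \<open>\<eta>\<close>; otherwise both arguments are controlled by \<open>b\<close>.
  Only the growth of the derivative is used, so one proof serves \<open>g\<close>, \<open>h\<close>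
  and \<open>F\<close>.\<close>

lemma growth_split:
  fixes j j' :: "real \<Rightarrow> real"
  assumes d: "\<And>x. (j has_real_derivative j' x) (at x)" and j0: "j 0 = 0"
    and C: "C > 0" "\<And>x. \<bar>j' x\<bar> \<le> C * (\<bar>x\<bar> + \<bar>x\<bar> powr (p - 1))"
  shows "\<bar>j x\<bar> \<le> C * \<Phi> x"
    and "\<delta> > 0 \<Longrightarrow> \<exists>K. \<forall>a b. \<bar>j (a + b) - j a - j b\<bar> \<le> \<delta> * \<Phi> a + K * \<Phi> b"
proof -
  have mono: "C * (\<bar>x\<bar> + \<bar>x\<bar> powr (p - 1)) \<le> C * (r + r powr (p - 1))" if "\<bar>x\<bar> \<le> r" for x r
    using that C(1) p3 by (intro mult_left_mono add_mono powr_mono2) auto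
  have diff: "\<bar>j (a + b) - j a\<bar> \<le> C * (r + r powr (p - 1)) * \<bar>b\<bar>" if "\<bar>a\<bar> + \<bar>b\<bar> \<le> r" for a b r
    by (rule MVT_abs_bound[OF d]) (use that mono C(2) in \<open>meson order_trans\<close>)
  have bd: "\<bar>j x\<bar> \<le> C * \<Phi> x" for x
  proof -
    have "\<bar>j (0 + x) - j 0\<bar> \<le> C * (\<bar>x\<bar> + \<bar>x\<bar> powr (p - 1)) * \<bar>x\<bar>" by (rule diff) simp
    also have "\<dots> = C * (\<bar>x\<bar> * \<bar>x\<bar> + \<bar>x\<bar> powr (p - 1) * \<bar>x\<bar>)" by (simp add: algebra_simps)
    finally show ?thesis unfolding powr_p_mult by (simp add: j0 \<Phi>_def power2_eq_square)
  qed
  then show "\<bar>j x\<bar> \<le> C * \<Phi> x" .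
  assume \<delta>: "\<delta> > 0"
  \<comment> \<open>\<open>E\<close> and \<open>K\<close> are the constants of \<open>scale\<close>
    for \<open>k = 2\<close> and \<open>k = 1 / \<eta> + 1\<close>, which bound
    \<open>\<bar>a\<bar> + \<bar>b\<bar>\<close> by \<open>\<bar>a\<bar>\<close> and by
    \<open>\<bar>b\<bar>\<close> in the two cases.\<close>
  define E where "E = C * (2 + 2 powr (p - 1))"
  have E: "E > 0" using C(1) by (simp add: E_def add_pos_nonneg)
  define \<eta> where "\<eta> = min 1 (\<delta> / E)"
  have \<eta>: "0 < \<eta>" "\<eta> \<le> 1" "E * \<eta> \<le> \<delta>" using \<delta> E by (auto simp: \<eta>_def min_def field_simps)
  define K where "K = C * ((1 / \<eta> + 1) + (1 / \<eta> + 1) powr (p - 1))"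
  have K: "K > 0" using C(1) \<eta>(1) by (simp add: K_def add_pos_nonneg)
  have scale: "C * (k * y + (k * y) powr (p - 1)) * y \<le> C * (k + k powr (p - 1)) * \<Phi> y" if "k > 0" "y \<ge> 0" for k y
  proof -
    have "C * (k * y + (k * y) powr (p - 1)) * y = C * (k * y^2 + k powr (p - 1) * (\<bar>y\<bar> powr (p - 1) * \<bar>y\<bar>))"
      using that by (simp add: powr_mult power2_eq_square algebra_simps)
    also have "\<dots> \<le> C * (k * \<Phi> y + k powr (p - 1) * \<Phi> y)"
      unfolding powr_p_mult using that C(1) by (intro mult_left_mono add_mono) (auto simp: \<Phi>_def)
    finally show ?thesis by (simp add: algebra_simps)
  qed
  have \<Phi>abs: "\<Phi> \<bar>y\<bar> = \<Phi> y" for y by (simp add: \<Phi>_def)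
  have "\<bar>j (a + b) - j a - j b\<bar> \<le> \<delta> * \<Phi> a + (K + C) * \<Phi> b" for a b
  proof -
    have "\<bar>j (a + b) - j a\<bar> \<le> \<delta> * \<Phi> a + K * \<Phi> b"
    proof (cases "\<bar>b\<bar> \<le> \<eta> * \<bar>a\<bar>")
      case True
      have "\<bar>b\<bar> \<le> 1 * \<bar>a\<bar>" using order_trans[OF True mult_right_mono[OF \<eta>(2)]] by simp
      then have "\<bar>j (a + b) - j a\<bar> \<le> C * (2 * \<bar>a\<bar> + (2 * \<bar>a\<bar>) powr (p - 1)) * \<bar>b\<bar>" by (intro diff) simp
      also have "\<dots> \<le> C * (2 * \<bar>a\<bar> + (2 * \<bar>a\<bar>) powr (p - 1)) * (\<eta> * \<bar>a\<bar>)"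
        using True C(1) by (intro mult_left_mono) auto
      also have "\<dots> = \<eta> * (C * (2 * \<bar>a\<bar> + (2 * \<bar>a\<bar>) powr (p - 1)) * \<bar>a\<bar>)" by simp
      also have "\<dots> \<le> \<eta> * (E * \<Phi> a)" using scale[of 2 "\<bar>a\<bar>"] \<eta>(1) by (intro mult_left_mono) (auto simp: E_def \<Phi>abs)
      also have "\<dots> = (E * \<eta>) * \<Phi> a" by simp
      also have "\<dots> \<le> \<delta> * \<Phi> a" using \<eta>(3) \<Phi>_nonneg by (rule mult_right_mono)
      also have "\<dots> \<le> \<delta> * \<Phi> a + K * \<Phi> b" using K \<Phi>_nonneg[of b] by simp
      finally show ?thesis .
    next
      case False
      then have "\<bar>a\<bar> + \<bar>b\<bar> \<le> (1 / \<eta> + 1) * \<bar>b\<bar>" using \<eta>(1) by (simp add: field_simps)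
      then have "\<bar>j (a + b) - j a\<bar> \<le> C * ((1 / \<eta> + 1) * \<bar>b\<bar> + ((1 / \<eta> + 1) * \<bar>b\<bar>) powr (p - 1)) * \<bar>b\<bar>" by (rule diff)
      also have "\<dots> \<le> K * \<Phi> b" using scale[of "1 / \<eta> + 1" "\<bar>b\<bar>"] \<eta>(1) by (simp add: K_def \<Phi>abs add_pos_pos)
      also have "\<dots> \<le> \<delta> * \<Phi> a + K * \<Phi> b" using \<delta> \<Phi>_nonneg[of a] by simp
      finally show ?thesis .
    qed
    moreover have "\<bar>j (a + b) - j a - j b\<bar> \<le> \<bar>j (a + b) - j a\<bar> + \<bar>j b\<bar>" by (rule abs_triangle_ineq4)
    ultimately show ?thesis using bd[of b] by (simp add: distrib_right)
  qed
  then show "\<exists>K. \<forall>a b. \<bar>j (a + b) - j a - j b\<bar> \<le> \<delta> * \<Phi> a + K * \<Phi> b" by blast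
qed

lemma deriv_growth: "\<exists>C>0. \<forall>x. \<bar>f x\<bar> + \<bar>x * deriv f x\<bar> \<le> C * (\<bar>x\<bar> + \<bar>x\<bar> powr (p - 1))"
proof -
  obtain C1 where C1: "C1 > 0" "\<And>u. \<bar>f u\<bar> \<le> C1 * (\<bar>u\<bar> + \<bar>u\<bar> powr (p - 1))" using f_bound_crude by blast
  obtain C2 where C2: "C2 > 0" "\<And>u. \<bar>deriv f u\<bar> \<le> C2 * (1 + \<bar>u\<bar> powr (p - 2))" using deriv_f_bound by blast
  have "\<bar>f x\<bar> + \<bar>x * deriv f x\<bar> \<le> (C1 + C2) * (\<bar>x\<bar> + \<bar>x\<bar> powr (p - 1))" for x
  proof -
    have "\<bar>x * deriv f x\<bar> \<le> \<bar>x\<bar> * (C2 * (1 + \<bar>x\<bar> powr (p - 2)))"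
      unfolding abs_mult by (rule mult_left_mono[OF C2(2)]) simp
    also have "\<dots> = C2 * (\<bar>x\<bar> + \<bar>x\<bar> powr (p - 1))"
      using powr_add[of "\<bar>x\<bar>" "p - 2" 1] by (cases "x = 0") (auto simp: algebra_simps)
    finally show ?thesis using C1(2)[of x] by (simp add: distrib_right)
  qed
  then show ?thesis using C1 C2 by (intro exI[of _ "C1 + C2"]) auto
qed

lemma ghF_growth:
  "\<exists>C>0. \<forall>x. \<bar>g x\<bar> \<le> C * \<Phi> x \<and> \<bar>h x\<bar> \<le> C * \<Phi> x \<and> \<bar>F x\<bar> \<le> C * \<Phi> x"
  "\<delta> > 0 \<Longrightarrow> \<exists>K. \<forall>a b. \<bar>g (a + b) - g a - g b\<bar> \<le> \<delta> * \<Phi> a + K * \<Phi> b"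
  "\<delta> > 0 \<Longrightarrow> \<exists>K. \<forall>a b. \<bar>h (a + b) - h a - h b\<bar> \<le> \<delta> * \<Phi> a + K * \<Phi> b"
proof -
  obtain C where C: "C > 0" "\<And>x. \<bar>f x\<bar> + \<bar>x * deriv f x\<bar> \<le> C * (\<bar>x\<bar> + \<bar>x\<bar> powr (p - 1))" using deriv_growth by blast
  have 1: "\<bar>f x + x * deriv f x\<bar> \<le> C * (\<bar>x\<bar> + \<bar>x\<bar> powr (p - 1))"
    and 2: "\<bar>(x * deriv f x - f x) / 2\<bar> \<le> C * (\<bar>x\<bar> + \<bar>x\<bar> powr (p - 1))"
    and 3: "\<bar>f x\<bar> \<le> C * (\<bar>x\<bar> + \<bar>x\<bar> powr (p - 1))" for x
  proof -
    show "\<bar>f x + x * deriv f x\<bar> \<le> C * (\<bar>x\<bar> + \<bar>x\<bar> powr (p - 1))"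
      by (rule order_trans[OF abs_triangle_ineq C(2)])
    have "\<bar>(x * deriv f x - f x) / 2\<bar> \<le> \<bar>x * deriv f x - f x\<bar>" by simp
    also have "\<dots> \<le> \<bar>f x\<bar> + \<bar>x * deriv f x\<bar>"
      using abs_triangle_ineq4[of "x * deriv f x" "f x"] by (simp add: add.commute)
    finally show "\<bar>(x * deriv f x - f x) / 2\<bar> \<le> C * (\<bar>x\<bar> + \<bar>x\<bar> powr (p - 1))" using C(2) by (rule order_trans)
    show "\<bar>f x\<bar> \<le> C * (\<bar>x\<bar> + \<bar>x\<bar> powr (p - 1))"
      by (rule order_trans[OF _ C(2)]) simp
  qed
  note G = growth_split[OF g_deriv _ C(1) 1] and HH = growth_split[OF h_deriv _ C(1) 2] and FF = growth_split[OF F_deriv _ C(1) 3]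
  show "\<exists>C>0. \<forall>x. \<bar>g x\<bar> \<le> C * \<Phi> x \<and> \<bar>h x\<bar> \<le> C * \<Phi> x \<and> \<bar>F x\<bar> \<le> C * \<Phi> x"
    using G(1) HH(1) FF(1) C(1) by (intro exI[of _ C]) (simp add: g_neg h_neg)
  show "\<delta> > 0 \<Longrightarrow> \<exists>K. \<forall>a b. \<bar>g (a + b) - g a - g b\<bar> \<le> \<delta> * \<Phi> a + K * \<Phi> b"
    by (rule G(2)) (simp_all add: g_neg)
  show "\<delta> > 0 \<Longrightarrow> \<exists>K. \<forall>a b. \<bar>h (a + b) - h a - h b\<bar> \<le> \<delta> * \<Phi> a + K * \<Phi> b"
    by (rule HH(2)) (simp_all add: h_neg)
qed

section \<open>Consequences of the monotonicity of f(u)/u and of the Ambrosetti-Rabinowitz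
  condition\<close>

lemma f_quot_mono: "0 < a \<Longrightarrow> a \<le> b \<Longrightarrow> f a / a \<le> f b / b"
  using strict_mono_onD[OF f_mono, of a b] by (cases "a = b") (auto intro: less_imp_le)

lemma F_pos: "u > 0 \<Longrightarrow> F u > 0" and f_pos: "u > 0 \<Longrightarrow> f u > 0" and g_AR: "\<theta> * F u \<le> g u"
proof -
  show "u > 0 \<Longrightarrow> F u > 0" using AR[of u] \<theta> by (auto simp: zero_less_mult_iff)
  show "u > 0 \<Longrightarrow> f u > 0" using AR[of u] by (smt (verit) zero_less_mult_pos)
  show "\<theta> * F u \<le> g u" using AR[of u] by (cases "u > 0") (auto simp: g_def F_neg f_neg mult.commute)
qed

lemma g_nonneg: "g u \<ge> 0" using f_pos[of u] by (cases "u > 0") (auto simp: g_def f_neg)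
lemma f_nonneg: "f u \<ge> 0" using f_pos[of u] by (cases "u > 0") (auto simp: f_neg)
text \<open>The monotonicity of \<open>f u / u\<close> says that \<open>F\<close> is a convex function of \<open>u^2\<close>.\<close>

lemma F_tangent:
  assumes b: "b > 0" and a: "a \<ge> 0"
  shows "F b - F a \<le> f b / b * (b^2 - a^2) / 2"
proof -
  \<comment> \<open>On the nonnegative half-line \<open>K\<close> increases up to \<open>b\<close>
    and decreases beyond it, its derivative being \<open>t * (f b / b - f t / t)\<close>. The claim
    is \<open>K a \<le> K b\<close>.\<close>
  define K where "K t = f b / b * t^2 / 2 - F t" for t
  have d: "(K has_real_derivative (f b / b * t - f t)) (at t)" for t
    unfolding K_def[abs_def] by (rule derivative_eq_intros F_deriv refl | simp)+
  have s: "f b / b * t - f t = t * (f b / b - f t / t)" if "t > 0" for t using that by (simp add: right_diff_distrib)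
  have "K a \<le> K b"
  proof (cases "a \<le> b")
    case True
    show ?thesis
    proof (rule DERIV_nonneg_imp_nondecreasing[OF True])
      fix t assume t: "a \<le> t" "t \<le> b"
      have "0 \<le> f b / b * t - f t"
      proof (cases "t = 0")
        case False
        then have "t > 0" using t a by simp
        then show ?thesis unfolding s[OF \<open>t > 0\<close>] using f_quot_mono[of t b] t by simp
      qed simp
      then show "\<exists>y. (K has_real_derivative y) (at t) \<and> 0 \<le> y" using d by blast
    qed
  next
    case False
    then have ba: "b \<le> a" by simp
    show ?thesis
    proof (rule DERIV_nonpos_imp_nonincreasing[OF ba])
      fix t assume t: "b \<le> t" "t \<le> a"
      have "t > 0" using b t by simp
      then have "f b / b * t - f t \<le> 0" unfolding s[OF \<open>t > 0\<close>]
        using f_quot_mono[of b t] t b by (simp add: mult_le_0_iff)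
      then show "\<exists>y. (K has_real_derivative y) (at t) \<and> y \<le> 0" using d by blast
    qed
  qed
  then show ?thesis by (simp add: K_def algebra_simps diff_divide_distrib)
qed

lemma g_quot: "u > 0 \<Longrightarrow> g u = f u / u * u^2"
  by (simp add: g_def power2_eq_square)

lemma h_AR: "(1/2 - 1/\<theta>) * g u \<le> h u"
  using g_AR[of u] \<theta> by (simp add: h_def field_simps)

lemma h_pos: "u > 0 \<Longrightarrow> h u > 0"
proof -
  assume u: "u > 0"
  have "0 < (1/2 - 1/\<theta>) * g u" using \<theta> f_pos[OF u] u by (intro mult_pos_pos) (auto simp: g_def field_simps)
  then show ?thesis using h_AR[of u] by linarith
qed

text \<open>The tangent inequality at \<open>b\<close>, with the slope lowered from
  \<open>f b / b\<close> to \<open>f a / a\<close>, rearranges to the claim.\<close>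

lemma h_mono: "a \<le> b \<Longrightarrow> h a \<le> h b"
proof -
  assume ab: "a \<le> b"
  show ?thesis
  proof (cases "a > 0")
    case True
    then have b: "b > 0" using ab by simp
    have "F b - F a \<le> f b / b * (b^2 - a^2) / 2" using F_tangent[OF b, of a] True by simp
    also have "\<dots> = g b / 2 - (f b / b) * a^2 / 2" using b by (simp add: g_quot algebra_simps diff_divide_distrib)
    also have "\<dots> \<le> g b / 2 - (f a / a) * a^2 / 2"
      by (intro diff_left_mono divide_right_mono mult_right_mono f_quot_mono[OF True ab]) auto
    finally show ?thesis using g_quot[OF True] by (simp add: h_def)
  next
    case False
    then show ?thesis using h_pos[of b] by (cases "b > 0") (auto simp: h_neg)
  qed
qed

lemma h_nonneg: "h u \<ge> 0" using h_pos[of u] by (cases "u > 0") (auto simp: h_neg)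

text \<open>The tangent inequality on the ray of \<open>u\<close>. Integrated over an element of the
  Nehari set, it says that the energy along its ray is largest at \<open>t = 1\<close>.\<close>

lemma F_ray:
  assumes t: "t \<ge> 0"
  shows "F u - F (t * u) \<le> (1 - t^2) / 2 * g u"
proof (cases "u > 0")
  case True
  have "F u - F (t * u) \<le> f u / u * (u^2 - (t * u)^2) / 2" using F_tangent[OF True, of "t * u"] True t by simp
  also have "\<dots> = (1 - t^2) / 2 * (f u / u * u^2)" by (simp add: algebra_simps power_mult_distrib diff_divide_distrib)
  finally show ?thesis unfolding g_quot[OF True] .
next
  case False
  then have "t * u \<le> 0" using t by (simp add: mult_nonneg_nonpos)
  then show ?thesis using False by (simp add: F_neg g_neg)
qed

text \<open>For \<open>u > 0\<close> the quotient \<open>g (t * u) / t^2\<close> increases strictly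
  in \<open>t\<close>. The strict forms determine the sign of \<open>G\<close> on either side of the
  Nehari set, the others serve where \<open>u\<close> is not positive.\<close>

lemma g_ray:
  "0 < t \<Longrightarrow> t < 1 \<Longrightarrow> g (t * u) \<le> t^2 * g u" "1 < t \<Longrightarrow> t^2 * g u \<le> g (t * u)"
  "0 < t \<Longrightarrow> t < 1 \<Longrightarrow> u > 0 \<Longrightarrow> g (t * u) < t^2 * g u" "1 < t \<Longrightarrow> u > 0 \<Longrightarrow> t^2 * g u < g (t * u)"
proof -
  have e: "g (t * u) = f (t * u) / (t * u) * (t^2 * u^2)" if "t > 0" "u > 0" for t u
    using that g_quot[of "t * u"] by (simp add: power_mult_distrib)
  have e': "t^2 * g u = f u / u * (t^2 * u^2)" if "u > 0" for t u using g_quot[OF that] by simp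
  have A: "g (t * u) < t^2 * g u" if "0 < t" "t < 1" "u > 0" for t u
    unfolding e[OF that(1,3)] e'[OF that(3)]
    using that strict_mono_onD[OF f_mono, of "t * u" u] by (intro mult_strict_right_mono) auto
  have B: "t^2 * g u < g (t * u)" if "1 < t" "u > 0" for t u
  proof -
    have t: "t > 0" using that by simp
    show ?thesis unfolding e[OF t that(2)] e'[OF that(2)]
      using that t strict_mono_onD[OF f_mono, of u "t * u"] by (intro mult_strict_right_mono) auto
  qed
  show "0 < t \<Longrightarrow> t < 1 \<Longrightarrow> u > 0 \<Longrightarrow> g (t * u) < t^2 * g u" by (rule A)
  show "1 < t \<Longrightarrow> u > 0 \<Longrightarrow> t^2 * g u < g (t * u)" by (rule B)
  show "0 < t \<Longrightarrow> t < 1 \<Longrightarrow> g (t * u) \<le> t^2 * g u"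
    using A[of t u] by (cases "u > 0") (auto simp: g_neg mult_nonneg_nonpos)
  show "1 < t \<Longrightarrow> t^2 * g u \<le> g (t * u)"
    using B[of t u] by (cases "u > 0") (auto simp: g_neg mult_nonneg_nonpos)
qed

text \<open>The Ambrosetti-Rabinowitz condition is the statement that
  \<open>F x * x powr (- \<theta>)\<close> has nonnegative derivative.\<close>

lemma F_superquadratic:
  assumes "t \<ge> 1"
  shows "F 1 * t powr \<theta> \<le> F t"
proof -
  have "F 1 * 1 powr (- \<theta>) \<le> F t * t powr (- \<theta>)"
  proof (rule DERIV_nonneg_imp_nondecreasing[OF assms])
    fix x :: real assume x: "1 \<le> x" "x \<le> t"
    have "((\<lambda>x. F x * x powr (- \<theta>)) has_real_derivative (f x * x powr (- \<theta>) + F x * (- \<theta> * x powr (- \<theta> - 1)))) (at x)"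
      using x by (auto intro!: derivative_eq_intros F_deriv)
    moreover have "f x * x powr (- \<theta>) + F x * (- \<theta> * x powr (- \<theta> - 1)) = x powr (- \<theta> - 1) * (g x - \<theta> * F x)"
    proof -
      have "x powr (- \<theta>) = x powr (- \<theta> - 1) * x" using x powr_add[of x "- \<theta> - 1" 1] by simp
      then show ?thesis by (simp add: g_def algebra_simps)
    qed
    ultimately show "\<exists>y. ((\<lambda>x. F x * x powr (- \<theta>)) has_real_derivative y) (at x) \<and> 0 \<le> y"
      using g_AR[of x] by (intro exI[of _ "x powr (- \<theta> - 1) * (g x - \<theta> * F x)"]) simp
  qed
  then have "F 1 * t powr \<theta> \<le> F t * t powr (- \<theta>) * t powr \<theta>" by (intro mult_right_mono) auto
  also have "\<dots> = F t" using assms by (simp add: mult.assoc powr_add[symmetric])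
  finally show ?thesis .
qed

end

section \<open>The Nehari manifold\<close>

text \<open>\<open>gag s\<close> has a density with respect to Lebesgue measure on pairs, where a
  product with a null factor is null. So a.e. convergence of functions passes to their differences
  \<open>pdiff\<close>.\<close>

lemma AE_gag:
  fixes P :: "'a::euclidean_space \<Rightarrow> bool"
  assumes "AE x in lborel. P x"
  shows "AE z in gag s. P (fst z) \<and> P (snd z)"
proof -
  obtain N where N: "{x \<in> space lborel. \<not> P x} \<subseteq> N" "emeasure lborel N = 0" "N \<in> sets lborel"
    using assms by (rule AE_E)
  have [measurable]: "N \<in> sets borel" using N(3) by simp
  have "N \<times> UNIV \<in> null_sets (lborel \<Otimes>\<^sub>M (lborel :: 'a measure))" "UNIV \<times> N \<in> null_sets ((lborel :: 'a measure) \<Otimes>\<^sub>M lborel)"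
    using N(2) by (auto simp: null_sets_def lborel.emeasure_pair_measure_Times)
  then have "AE z in lborel. z \<notin> N \<times> (UNIV :: 'a set)" "AE z in lborel. z \<notin> (UNIV :: 'a set) \<times> N"
    unfolding lborel_prod by (auto intro: AE_not_in)
  then have "AE z in lborel. P (fst z) \<and> P (snd z)"
    by eventually_elim (use N(1) in \<open>auto simp: mem_Times_iff\<close>)
  then show ?thesis unfolding gag_def
    by (subst AE_density) (auto elim: eventually_mono)
qed

locale var = frac s T + nonlinearity f p \<theta>
  for s :: real and T :: "'a::euclidean_space itself" and f :: "real \<Rightarrow> real" and p \<theta> :: real +
  assumes pN: "p * (real DIM('a) - 2 * s) < 2 * real DIM('a)"
begin

text \<open>The positive lower bound makes \<open>Q V\<close> control the full norm, and it is
  shared by constant and rescaled potentials. Continuity is added separately where functions of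
  bounded support have to lie in \<open>W V\<close>.\<close>

definition pot :: "('a \<Rightarrow> real) \<Rightarrow> bool" where
  "pot V \<longleftrightarrow> V \<in> borel_measurable borel \<and> (\<exists>v>0. \<forall>z. v \<le> V z)"

text \<open>Written with \<open>sqrt (V z) * u z\<close>, the potential energy becomes an L2 norm
  and the general facts on \<open>sq_integrable\<close> apply to it.\<close>

definition W :: "('a \<Rightarrow> real) \<Rightarrow> ('a \<Rightarrow> real) \<Rightarrow> bool" where
  "W V u \<longleftrightarrow> H u \<and> sq_integrable lborel (\<lambda>z. sqrt (V z) * u z)"

definition P :: "('a \<Rightarrow> real) \<Rightarrow> ('a \<Rightarrow> real) \<Rightarrow> real" where
  "P V u = (LINT z|lborel. (sqrt (V z) * u z)^2)"

definition Q :: "('a \<Rightarrow> real) \<Rightarrow> ('a \<Rightarrow> real) \<Rightarrow> real" where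
  "Q V u = D u + P V u"

definition Gi :: "('a \<Rightarrow> real) \<Rightarrow> real" where "Gi u = (LINT z|lborel. g (u z))"
definition J :: "('a \<Rightarrow> real) \<Rightarrow> real" where "J u = (LINT z|lborel. h (u z))"
definition G :: "('a \<Rightarrow> real) \<Rightarrow> ('a \<Rightarrow> real) \<Rightarrow> real" where "G V u = Q V u - Gi u"

definition null :: "('a \<Rightarrow> real) \<Rightarrow> bool" where "null u \<longleftrightarrow> (AE z in lborel. u z = 0)"

definition Neh :: "('a \<Rightarrow> real) \<Rightarrow> ('a \<Rightarrow> real) \<Rightarrow> bool" where
  "Neh V u \<longleftrightarrow> W V u \<and> \<not> null u \<and> G V u = 0"

lemma potD: "pot V \<Longrightarrow> V \<in> borel_measurable borel" "pot V \<Longrightarrow> V z > 0" "pot V \<Longrightarrow> V z \<ge> 0"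
  unfolding pot_def by (auto intro: less_le_trans less_imp_le order_trans)

lemma pot_const: "a > 0 \<Longrightarrow> pot (\<lambda>_. a)" by (auto simp: pot_def)

lemma W_H: "W V u \<Longrightarrow> H u" by (simp add: W_def)
lemma W_measurable: "W V u \<Longrightarrow> u \<in> borel_measurable borel" using W_H H_measurable by blast
lemma P_nonneg [simp]: "P V u \<ge> 0" by (simp add: P_def)
lemma Q_nonneg [simp]: "Q V u \<ge> 0" by (simp add: Q_def)

lemma H_add: "H u \<Longrightarrow> H v \<Longrightarrow> H (\<lambda>x. u x + v x)"
proof -
  assume "H u" "H v"
  moreover have "pdiff (\<lambda>x. u x + v x) = (\<lambda>z. pdiff u z + pdiff v z)" by (auto simp: pdiff_def)
  ultimately show ?thesis by (simp add: H_def sq_integrable_add)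
qed

lemma pdiff_mult: "pdiff (\<lambda>x. t * u x) = (\<lambda>z. t * pdiff u z)" by (auto simp: pdiff_def right_diff_distrib)

lemma H_mult: "H u \<Longrightarrow> H (\<lambda>x. t * u x)"
  by (simp add: H_def sq_integrable_mult pdiff_mult)

lemma H_diff: "H u \<Longrightarrow> H v \<Longrightarrow> H (\<lambda>x. u x - v x)"
  using H_add[OF _ H_mult[of v "-1"]] by simp

lemma W_mult: "W V u \<Longrightarrow> W V (\<lambda>x. t * u x)"
  using sq_integrable_mult[of lborel "\<lambda>z. sqrt (V z) * u z" t] by (simp add: W_def H_mult mult.left_commute)

lemma W_add: "W V u \<Longrightarrow> W V v \<Longrightarrow> W V (\<lambda>x. u x + v x)"
  using sq_integrable_add[of lborel "\<lambda>z. sqrt (V z) * u z" "\<lambda>z. sqrt (V z) * v z"] by (simp add: W_def H_add distrib_left)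

lemma W_diff: "W V u \<Longrightarrow> W V v \<Longrightarrow> W V (\<lambda>x. u x - v x)"
  using W_add[OF _ W_mult[of V v "-1"]] by simp

lemma Q_mult: "Q V (\<lambda>x. t * u x) = t^2 * Q V u"
proof -
  have "(sqrt (V z) * (t * u z))^2 = t^2 * (sqrt (V z) * u z)^2" for z by (simp add: power_mult_distrib)
  then have "P V (\<lambda>x. t * u x) = t^2 * P V u" unfolding P_def by (simp only: integral_mult_right_zero)
  moreover have "D (\<lambda>x. t * u x) = t^2 * D u" unfolding D_def pdiff_mult power_mult_distrib by (rule integral_mult_right_zero)
  ultimately show ?thesis by (simp add: Q_def distrib_left)
qed

text \<open>The Gagliardo form decreases pointwise under normal contractions; this covers the
  positive part and the modulus, for which the Fourier side gives no direct bound.\<close>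

lemma W_contraction:
  assumes u: "W V u" and V: "pot V" and v: "v \<in> borel_measurable borel" "\<And>x. \<bar>v x\<bar> \<le> \<bar>u x\<bar>" "\<And>x y. \<bar>v x - v y\<bar> \<le> \<bar>u x - u y\<bar>"
  shows "W V v" "Q V v \<le> Q V u"
proof -
  note [measurable] = v(1) potD(1)[OF V]
  have 0: "(v x)^2 \<le> (u x)^2" for x using v(2)[of x] by (rule abs_le_square_iff[THEN iffD1])
  have 1: "(pdiff v z)^2 \<le> (pdiff u z)^2" for z unfolding pdiff_def using v(3) by (rule abs_le_square_iff[THEN iffD1])
  have 2: "(sqrt (V x) * v x)^2 \<le> (sqrt (V x) * u x)^2" for x
    using 0[of x] by (simp add: power_mult_distrib mult_left_mono)
  have s: "sq_integrable lborel v" "sq_integrable (gag s) (pdiff v)" "sq_integrable lborel (\<lambda>z. sqrt (V z) * v z)"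
  proof -
    show "sq_integrable lborel v"
      by (rule sq_integrable_bound[of _ "\<lambda>x. (u x)^2"]) (use u 0 v(1) in \<open>auto simp: W_def H_def sq_integrable_real\<close>)
    show "sq_integrable (gag s) (pdiff v)"
      by (rule sq_integrable_bound[of _ "\<lambda>x. (pdiff u x)^2"]) (use u 1 v(1) in \<open>auto simp: W_def H_def sq_integrable_real\<close>)
    show "sq_integrable lborel (\<lambda>z. sqrt (V z) * v z)"
      by (rule sq_integrable_bound[of _ "\<lambda>z. (sqrt (V z) * u z)^2"]) (use u 2 v(1) in \<open>auto simp: W_def sq_integrable_real\<close>)
  qed
  then show "W V v" by (simp add: W_def H_def)
  have "D v \<le> D u" unfolding D_def by (rule integral_mono) (use s(2) u 1 in \<open>auto simp: W_def H_def sq_integrable_real\<close>)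
  moreover have "P V v \<le> P V u" unfolding P_def by (rule integral_mono) (use s(3) u 2 in \<open>auto simp: W_def H_def sq_integrable_real\<close>)
  ultimately show "Q V v \<le> Q V u" by (simp add: Q_def)
qed

lemma p2: "2 \<le> p" using p3 by simp

lemma \<Phi>_integrable: "H u \<Longrightarrow> integrable lborel (\<lambda>x. \<Phi> (u x))"
  using Sobolev_integrable[OF p2 pN] by (auto simp: \<Phi>_def H_def sq_integrable_real)

lemma \<Phi>_dominated:
  assumes k: "integrable lborel k" and j: "j \<in> borel_measurable borel" "\<And>x. \<bar>j x\<bar> \<le> C * \<Phi> x" and C: "C > 0"
    and u: "u \<in> borel_measurable borel" "\<And>x. \<Phi> (u x) \<le> k x"
  shows "integrable lborel (\<lambda>x. j (u x :: real))"
proof (rule Bochner_Integration.integrable_bound)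
  show "integrable lborel (\<lambda>x. C * k x)" using k by simp
  show "(\<lambda>x. j (u x)) \<in> borel_measurable lborel" using j(1) u(1) by measurable
  have "\<bar>j (u x)\<bar> \<le> C * k x" for x
    by (rule order_trans[OF j(2) mult_left_mono[OF u(2) less_imp_le[OF C]]])
  then show "AE x in lborel. norm (j (u x)) \<le> norm (C * k x)"
    by (intro AE_I2) (auto intro: order_trans[OF _ abs_ge_self])
qed

lemma ghF_integrable:
  assumes "H u"
  shows "integrable lborel (\<lambda>x. g (u x))" "integrable lborel (\<lambda>x. h (u x))" "integrable lborel (\<lambda>x. F (u x))"
proof -
  obtain C where C: "C > 0" "\<And>x. \<bar>g x\<bar> \<le> C * \<Phi> x" "\<And>x. \<bar>h x\<bar> \<le> C * \<Phi> x" "\<And>x. \<bar>F x\<bar> \<le> C * \<Phi> x"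
    using ghF_growth(1) by blast
  note U = H_measurable[OF assms] order_refl
  show "integrable lborel (\<lambda>x. g (u x))" by (rule \<Phi>_dominated[OF \<Phi>_integrable[OF assms] _ C(2) C(1) U]) simp
  show "integrable lborel (\<lambda>x. h (u x))" by (rule \<Phi>_dominated[OF \<Phi>_integrable[OF assms] _ C(3) C(1) U]) simp
  show "integrable lborel (\<lambda>x. F (u x))" by (rule \<Phi>_dominated[OF \<Phi>_integrable[OF assms] _ C(4) C(1) U]) simp
qed

lemma \<Phi>_mono: "\<bar>a\<bar> \<le> \<bar>b\<bar> \<Longrightarrow> \<Phi> a \<le> \<Phi> b"
  using p3 abs_le_square_iff[of a b] by (auto simp: \<Phi>_def intro!: add_mono powr_mono2)

lemma \<Phi>_tendsto:
  fixes j :: "real \<Rightarrow> real"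
  assumes j: "continuous_on UNIV j" "\<And>x. \<bar>j x\<bar> \<le> C * \<Phi> x" and C: "C > 0"
    and k: "H k" and w: "\<And>n. w n \<in> borel_measurable borel" "\<And>n x. \<bar>w n x\<bar> \<le> \<bar>k x\<bar>"
    and l: "w0 \<in> borel_measurable borel" "\<And>x. (\<lambda>n. w n x) \<longlonglongrightarrow> w0 x"
  shows "(\<lambda>n. LINT x|lborel. j (w n x)) \<longlonglongrightarrow> (LINT x|lborel. j (w0 x))"
proof (rule integral_dominated_convergence)
  have [measurable]: "j \<in> borel_measurable borel" using j(1) by (rule borel_measurable_continuous_onI)
  note [measurable] = w(1) l(1)
  show "integrable lborel (\<lambda>x. C * \<Phi> (k x))" using \<Phi>_integrable[OF k] by simp
  show "(\<lambda>x. j (w0 x)) \<in> borel_measurable lborel" "(\<lambda>x. j (w n x)) \<in> borel_measurable lborel" for n by measurable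
  have c: "isCont j y" for y using j(1) by (simp add: continuous_on_eq_continuous_at)
  show "AE x in lborel. (\<lambda>n. j (w n x)) \<longlonglongrightarrow> j (w0 x)"
    by (intro AE_I2 isCont_tendsto_compose[OF c] l)
  show "AE x in lborel. norm (j (w n x)) \<le> C * \<Phi> (k x)" for n
  proof (rule AE_I2)
    fix x
    show "norm (j (w n x)) \<le> C * \<Phi> (k x)"
      unfolding real_norm_def by (rule order_trans[OF j(2) mult_left_mono[OF \<Phi>_mono[OF w(2)] less_imp_le[OF C]]])
  qed
qed

lemma Gi_tendsto:
  assumes k: "H k" and w: "\<And>n. w n \<in> borel_measurable borel" "\<And>n x. \<bar>w n x\<bar> \<le> \<bar>k x\<bar>"
    and l: "w0 \<in> borel_measurable borel" "\<And>x. (\<lambda>n. w n x) \<longlonglongrightarrow> w0 x"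
  shows "(\<lambda>n. Gi (w n)) \<longlonglongrightarrow> Gi w0"
proof -
  obtain C where C: "C > 0" "\<And>x. \<bar>g x\<bar> \<le> C * \<Phi> x" using ghF_growth(1) by blast
  show ?thesis unfolding Gi_def by (rule \<Phi>_tendsto[OF cont_ghF(1) C(2) C(1) k w l])
qed

lemma S_pos: "H u \<Longrightarrow> \<not> null u \<Longrightarrow> S u > 0"
proof (rule ccontr)
  assume u: "H u" "\<not> null u" "\<not> 0 < S u"
  then have "S u = 0" using S_nonneg[of u] by linarith
  then have "AE z in lborel. (u z)^2 = 0"
    unfolding S_def using u(1) by (subst (asm) integral_nonneg_eq_0_iff_AE) (auto simp: H_def sq_integrable_real)
  then show False using u(2) by (simp add: null_def)
qed

lemma potE:
  assumes "pot V"
  obtains v where "v > 0" "\<And>z. v \<le> V z" "\<And>u. W V u \<Longrightarrow> v * S u \<le> P V u"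
proof -
  obtain v where v: "v > 0" "\<And>z. v \<le> V z" using assms by (auto simp: pot_def)
  have "v * S u \<le> P V u" if u: "W V u" for u
  proof -
    have "v * (u z)^2 \<le> (sqrt (V z) * u z)^2" for z
      using v(2)[of z] potD(3)[OF assms, of z] by (simp add: power_mult_distrib mult_right_mono)
    then have "(LINT z|lborel. v * (u z)^2) \<le> P V u"
      unfolding P_def using u by (intro integral_mono) (auto simp: W_def H_def sq_integrable_real)
    then show ?thesis by (simp add: S_def)
  qed
  with v show thesis by (rule that)
qed

lemma W_norm_le:
  assumes "pot V"
  shows "\<exists>K>0. \<forall>u. W V u \<longrightarrow> S u + D u \<le> K * Q V u"
proof -
  obtain v where v: "v > 0" "\<And>u. W V u \<Longrightarrow> v * S u \<le> P V u" using potE[OF assms] by metis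
  have "S u + D u \<le> (1 / v + 1) * Q V u" if u: "W V u" for u
  proof -
    have "S u \<le> (1 / v) * P V u" using v(2)[OF u] v(1) by (simp add: field_simps)
    also have "\<dots> \<le> (1 / v) * Q V u" using v(1) by (intro mult_left_mono) (auto simp: Q_def)
    finally have "S u \<le> (1 / v) * Q V u" .
    moreover have "D u \<le> Q V u" by (simp add: Q_def)
    ultimately show ?thesis by (simp add: distrib_right)
  qed
  moreover have "1 / v + 1 > 0" using v(1) by (simp add: add_pos_pos)
  ultimately show ?thesis by blast
qed

lemma Q_pos: "pot V \<Longrightarrow> W V u \<Longrightarrow> \<not> null u \<Longrightarrow> Q V u > 0"
proof -
  assume V: "pot V" and u: "W V u" "\<not> null u"
  obtain v where v: "v > 0" "v * S u \<le> P V u" using potE[OF V] u(1) by metis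
  have "v * S u > 0" using v(1) S_pos[OF W_H[OF u(1)] u(2)] by simp
  then show ?thesis using v(2) D_nonneg[of u] unfolding Q_def by linarith
qed

text \<open>With \<open>\<delta> = v / 2\<close>, where \<open>v\<close> bounds the potential from
  below, the quadratic part of \<open>g\<close> costs at most half of \<open>Q V u\<close>; only the
  Lp norm remains on the right.\<close>

lemma half_Q_le:
  assumes V: "pot V"
  shows "\<exists>C>0. \<forall>u. W V u \<longrightarrow> G V u \<le> 0 \<longrightarrow> Q V u \<le> C * (LINT x|lborel. \<bar>u x\<bar> powr p)"
proof -
  obtain v where v: "v > 0" "\<And>u. W V u \<Longrightarrow> v * S u \<le> P V u" using potE[OF V] by metis
  obtain C where C: "C > 0" "\<And>u. \<bar>g u\<bar> \<le> (v/2) * u^2 + C * \<bar>u\<bar> powr p" using g_bound[of "v/2"] v(1) by auto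
  have "Q V u \<le> (2 * C) * (LINT x|lborel. \<bar>u x\<bar> powr p)" if u: "W V u" "G V u \<le> 0" for u
  proof -
    have Hu: "H u" using u(1) by (rule W_H)
    have i: "integrable lborel (\<lambda>x. (v/2) * (u x)^2)" "integrable lborel (\<lambda>x. C * \<bar>u x\<bar> powr p)"
      using Hu Sobolev_integrable[OF p2 pN Hu] by (auto simp: H_def sq_integrable_real)
    have "Gi u \<le> (LINT x|lborel. (v/2) * (u x)^2 + C * \<bar>u x\<bar> powr p)"
      unfolding Gi_def
      by (rule integral_mono[OF ghF_integrable(1)[OF Hu] Bochner_Integration.integrable_add[OF i] order_trans[OF abs_ge_self C(2)]])
    also have "\<dots> = (v/2) * S u + C * (LINT x|lborel. \<bar>u x\<bar> powr p)" using i by (simp add: S_def)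
    also have "(v/2) * S u \<le> Q V u / 2"
    proof -
      have "v * S u \<le> Q V u" using order_trans[OF v(2)[OF u(1)], of "Q V u"] by (simp add: Q_def)
      then show ?thesis by simp
    qed
    finally show ?thesis using u(2) unfolding G_def by simp
  qed
  then show ?thesis using C(1) by (intro exI[of _ "2 * C"]) auto
qed

text \<open>With the Sobolev inequality \<open>half_Q_le\<close> reads
  \<open>Q \<le> A * Q powr (p / 2)\<close>, and \<open>p / 2 > 1\<close> keeps \<open>Q\<close>
  away from 0. The range \<open>G V u \<le> 0\<close> is included because it is the starting point
  of projections.\<close>

lemma Nehari_Q_lower:
  assumes V: "pot V"
  shows "\<exists>\<rho>>0. \<forall>u. W V u \<longrightarrow> \<not> null u \<longrightarrow> G V u \<le> 0 \<longrightarrow> \<rho> \<le> Q V u"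
proof -
  obtain C where C: "C > 0" "\<And>u. W V u \<Longrightarrow> G V u \<le> 0 \<Longrightarrow> Q V u \<le> C * (LINT x|lborel. \<bar>u x\<bar> powr p)" using half_Q_le[OF V] by blast
  obtain K where K: "K > 0" "\<And>u. W V u \<Longrightarrow> S u + D u \<le> K * Q V u" using W_norm_le[OF V] by blast
  obtain B where B: "B > 0" "\<And>u. H u \<Longrightarrow> S u + D u > 0 \<Longrightarrow> (LINT x|lborel. \<bar>u x\<bar> powr p) \<le> B * (S u + D u) powr (p / 2)"
    using Sobolev_ineq[OF p2 pN] by blast
  define A where "A = C * B * K powr (p / 2)"
  have A: "A > 0" using C B K by (simp add: A_def)
  define \<rho> where "\<rho> = (1 / A) powr (1 / (p / 2 - 1))"
  have "\<rho> \<le> Q V u" if u: "W V u" "\<not> null u" "G V u \<le> 0" for u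
  proof -
    have q: "Q V u > 0" by (rule Q_pos[OF V u(1,2)])
    have sd: "S u + D u > 0" using S_pos[OF W_H[OF u(1)] u(2)] D_nonneg[of u] by linarith
    have "Q V u \<le> C * (LINT x|lborel. \<bar>u x\<bar> powr p)" by (rule C(2)[OF u(1,3)])
    also have "\<dots> \<le> C * (B * (S u + D u) powr (p / 2))"
      using B(2)[OF W_H[OF u(1)] sd] C(1) by (intro mult_left_mono) auto
    also have "\<dots> \<le> C * (B * (K * Q V u) powr (p / 2))"
      using K(2)[OF u(1)] sd C B p3 by (intro mult_left_mono powr_mono2) auto
    also have "\<dots> = A * (Q V u powr (p / 2 - 1) * Q V u)"
      using K q powr_add[of "Q V u" "p / 2 - 1" 1] by (simp add: A_def powr_mult)
    finally have "1 * Q V u \<le> (A * Q V u powr (p / 2 - 1)) * Q V u" by simp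
    then have "1 \<le> A * Q V u powr (p / 2 - 1)" using q by (rule mult_right_le_imp_le)
    then have "1 / A \<le> Q V u powr (p / 2 - 1)" using A by (simp add: divide_le_eq mult.commute)
    then have "(1 / A) powr (1 / (p / 2 - 1)) \<le> (Q V u powr (p / 2 - 1)) powr (1 / (p / 2 - 1))"
      using A p3 by (intro powr_mono2) auto
    also have "\<dots> = Q V u" using p3 q by (simp add: powr_powr)
    finally show ?thesis by (simp add: \<rho>_def)
  qed
  moreover have "\<rho> > 0" using A by (simp add: \<rho>_def)
  ultimately show ?thesis by blast
qed

text \<open>Interpolation bounds the Lp norm by the mass plus a small number, so the lower bound for
  \<open>Q\<close> passes to the mass \<open>S\<close>. This is what forbids a bounded sequence on
  the Nehari set to spread out in L2 norm to nothing.\<close>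

lemma Nehari_mass_lower:
  assumes V: "pot V" and M: "M > 0"
  shows "\<exists>\<kappa>>0. \<forall>u. W V u \<longrightarrow> \<not> null u \<longrightarrow> G V u \<le> 0 \<longrightarrow> Q V u \<le> M \<longrightarrow> \<kappa> \<le> S u"
proof -
  obtain C where C: "C > 0" "\<And>u. W V u \<Longrightarrow> G V u \<le> 0 \<Longrightarrow> Q V u \<le> C * (LINT x|lborel. \<bar>u x\<bar> powr p)" using half_Q_le[OF V] by blast
  obtain K where K: "K > 0" "\<And>u. W V u \<Longrightarrow> S u + D u \<le> K * Q V u" using W_norm_le[OF V] by blast
  obtain \<rho> where \<rho>: "\<rho> > 0" "\<And>u. W V u \<Longrightarrow> \<not> null u \<Longrightarrow> G V u \<le> 0 \<Longrightarrow> \<rho> \<le> Q V u" using Nehari_Q_lower[OF V] by blast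
  have KM: "sqrt (K * M) > 0" "(sqrt (K * M))^2 = K * M" using K M by auto
  \<comment> \<open>After multiplication by \<open>C\<close> this error is half of the lower bound
    \<open>\<rho>\<close>.\<close>
  have "\<rho> / (2 * C) > 0" using \<rho> C by simp
  then obtain B where B: "B > 0" "\<And>u. H u \<Longrightarrow> S u + D u \<le> (sqrt (K * M))^2 \<Longrightarrow> (LINT x|lborel. \<bar>u x\<bar> powr p) \<le> B * S u + \<rho> / (2 * C)"
    using Sobolev_interpolation[OF p2 pN KM(1)] by blast
  have "\<rho> / (2 * C * B) \<le> S u" if u: "W V u" "\<not> null u" "G V u \<le> 0" "Q V u \<le> M" for u
  proof -
    have "S u + D u \<le> (sqrt (K * M))^2"
      unfolding KM(2) by (rule order_trans[OF K(2)[OF u(1)] mult_left_mono[OF u(4) less_imp_le[OF K(1)]]])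
    then have "(LINT x|lborel. \<bar>u x\<bar> powr p) \<le> B * S u + \<rho> / (2 * C)" by (rule B(2)[OF W_H[OF u(1)]])
    then have "C * (LINT x|lborel. \<bar>u x\<bar> powr p) \<le> C * (B * S u + \<rho> / (2 * C))" using C(1) by (intro mult_left_mono) auto
    then have "\<rho> \<le> C * (B * S u + \<rho> / (2 * C))" using \<rho>(2)[OF u(1,2,3)] C(2)[OF u(1,3)] by linarith
    also have "\<dots> = C * B * S u + \<rho> / 2" using C(1) by (simp add: distrib_left)
    finally have "\<rho> / 2 \<le> C * B * S u" by simp
    then show ?thesis using C(1) B(1) by (simp add: divide_le_eq mult_ac)
  qed
  moreover have "\<rho> / (2 * C * B) > 0" using \<rho> C B by simp
  ultimately show ?thesis by blast
qed

lemma null_mult: "t \<noteq> 0 \<Longrightarrow> null (\<lambda>x. t * u x) \<longleftrightarrow> null u" by (simp add: null_def)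

text \<open>Close to 0 on the ray \<open>G\<close> is positive, since \<open>Q\<close> has dropped
  below the lower bound \<open>\<rho>\<close>; at \<open>t = 1\<close> it is nonpositive. Continuity
  in \<open>t\<close> yields a zero in between.\<close>

lemma Nehari_projection:
  assumes V: "pot V" and w: "W V w" "\<not> null w" "G V w \<le> 0"
  obtains t where "0 < t" "t \<le> 1" "Neh V (\<lambda>x. t * w x)"
proof -
  obtain \<rho> where \<rho>: "\<rho> > 0" "\<And>u. W V u \<Longrightarrow> \<not> null u \<Longrightarrow> G V u \<le> 0 \<Longrightarrow> \<rho> \<le> Q V u" using Nehari_Q_lower[OF V] by blast
  have q: "Q V w > 0" by (rule Q_pos[OF V w(1,2)])
  have [measurable]: "w \<in> borel_measurable borel" by (rule W_measurable[OF w(1)])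
  \<comment> \<open>Gives \<open>a^2 * Q V w \<le> \<rho> / 2 < \<rho>\<close>.\<close>
  define a where "a = min 1 (sqrt (\<rho> / (2 * Q V w)))"
  have a: "0 < a" "a \<le> 1" using \<rho> q by (auto simp: a_def)
  have "a^2 \<le> (sqrt (\<rho> / (2 * Q V w)))^2" using a by (intro power_mono) (auto simp: a_def)
  also have "\<dots> = \<rho> / (2 * Q V w)" using \<rho> q by simp
  finally have "a^2 * Q V w \<le> \<rho> / (2 * Q V w) * Q V w" using q by (intro mult_right_mono) auto
  also have "\<dots> < \<rho>" using \<rho> q by simp
  finally have "Q V (\<lambda>x. a * w x) < \<rho>" by (simp add: Q_mult)
  then have Ga: "G V (\<lambda>x. a * w x) > 0"
    using \<rho>(2)[OF W_mult[OF w(1), of a]] a w(2) by (fastforce simp: null_mult)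
  have c: "continuous_on {a..1} (\<lambda>t. G V (\<lambda>x. t * w x))"
    unfolding G_def Q_mult
  proof (intro continuous_intros)
    show "continuous_on {a..1} (\<lambda>t. Gi (\<lambda>x. t * w x))"
    proof (rule continuous_on_sequentiallyI)
      fix t :: "nat \<Rightarrow> real" and t0 assume t: "\<forall>n. t n \<in> {a..1}" "t0 \<in> {a..1}" "t \<longlonglongrightarrow> t0"
      show "(\<lambda>n. Gi (\<lambda>x. t n * w x)) \<longlonglongrightarrow> Gi (\<lambda>x. t0 * w x)"
      proof (rule Gi_tendsto[OF W_H[OF w(1)]])
        show "\<bar>t n * w x\<bar> \<le> \<bar>w x\<bar>" for n x
        proof -
          have "0 \<le> t n" "t n \<le> 1" using t(1) a by (auto intro: order_trans[of 0 a])
          then show ?thesis by (simp add: abs_mult mult_left_le_one_le)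
        qed
        show "(\<lambda>n. t n * w x) \<longlonglongrightarrow> t0 * w x" for x by (intro tendsto_intros t)
      qed measurable
    qed
  qed
  obtain t where t: "a \<le> t" "t \<le> 1" "G V (\<lambda>x. t * w x) = 0"
    using IVT2'[OF _ _ a(2) c, of 0] Ga w(3) by auto
  then have "Neh V (\<lambda>x. t * w x)" using a w W_mult[OF w(1), of t] by (simp add: Neh_def null_mult)
  then show thesis using that[of t] t a by auto
qed

lemma J_nonneg [simp]: "J u \<ge> 0" unfolding J_def by (simp add: h_nonneg)
lemma J_ray:
  assumes "H u" "0 \<le> t" "t \<le> 1"
  shows "J (\<lambda>x. t * u x) \<le> J u"
  unfolding J_def
proof (rule integral_mono[OF ghF_integrable(2)[OF H_mult[OF assms(1)]] ghF_integrable(2)[OF assms(1)]])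
  fix x
  show "h (t * u x) \<le> h (u x)"
  proof (cases "u x > 0")
    case True
    then show ?thesis using assms by (intro h_mono) (simp add: mult_left_le_one_le)
  next
    case False
    then have "t * u x \<le> 0" using assms(2) by (simp add: mult_nonneg_nonpos)
    then show ?thesis using False by (simp add: h_neg)
  qed
qed

lemma J_ge_Gi: "H u \<Longrightarrow> (1/2 - 1/\<theta>) * Gi u \<le> J u"
proof -
  assume u: "H u"
  have "(LINT x|lborel. (1/2 - 1/\<theta>) * g (u x)) \<le> J u"
    unfolding J_def using ghF_integrable[OF u] h_AR by (intro integral_mono) auto
  then show ?thesis by (simp add: Gi_def)
qed

lemma Nehari_Q_le: "Neh V u \<Longrightarrow> (1/2 - 1/\<theta>) * Q V u \<le> J u"
  using J_ge_Gi[OF W_H, of V u] by (auto simp: Neh_def G_def)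

lemma Nehari_energy: "Neh V u \<Longrightarrow> Q V u / 2 - (LINT x|lborel. F (u x)) = J u"
proof -
  assume u: "Neh V u"
  then have Hu: "H u" and q: "Q V u = Gi u" by (auto simp: Neh_def G_def dest: W_H)
  show ?thesis unfolding q J_def Gi_def h_def using ghF_integrable[OF Hu] by simp
qed

lemma J_pos:
  assumes u: "H u" "\<not> null u" "\<And>x. 0 \<le> u x"
  shows "J u > 0"
proof (rule ccontr)
  assume "\<not> 0 < J u"
  then have "J u = 0" using J_nonneg[of u] by linarith
  then have "AE x in lborel. h (u x) = 0"
    unfolding J_def using ghF_integrable(2)[OF u(1)] h_nonneg by (subst (asm) integral_nonneg_eq_0_iff_AE) auto
  then have "AE x in lborel. u x = 0"
  proof eventually_elim
    case (elim x)
    then show ?case using h_pos[of "u x"] u(3)[of x] by fastforce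
  qed
  then show False using u(2) by (simp add: null_def)
qed

definition lev :: "('a \<Rightarrow> real) \<Rightarrow> real" where "lev V = (INF u\<in>{u. Neh V u}. J u)"

lemma lev_le: "Neh V u \<Longrightarrow> lev V \<le> J u"
  unfolding lev_def by (rule cINF_lower) (auto intro!: bdd_belowI2[of _ 0])

text \<open>Relaxes the constraint \<open>G V w = 0\<close> to an inequality, which is easy to
  verify for remainders, for competitors and after a change of the potential.\<close>

lemma lev_le_G: "pot V \<Longrightarrow> W V w \<Longrightarrow> \<not> null w \<Longrightarrow> G V w \<le> 0 \<Longrightarrow> lev V \<le> J w"
  using Nehari_projection lev_le J_ray W_H by (metis less_imp_le order_trans)

text \<open>\<open>g\<close> and \<open>h\<close> vanish on negative arguments, so passing to the
  positive part keeps \<open>Gi\<close> and \<open>J\<close> and lowers \<open>Q\<close>. The result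
  has \<open>G \<le> 0\<close> and is projected back with a factor at most 1.\<close>

lemma Nehari_nonneg:
  assumes V: "pot V" and u: "Neh V u"
  obtains u' where "Neh V u'" "\<And>x. 0 \<le> u' x" "J u' \<le> J u"
proof -
  have um [measurable]: "u \<in> borel_measurable borel" using u by (auto simp: Neh_def intro: W_measurable)
  define v where "v x = max (u x) 0" for x
  have vm: "v \<in> borel_measurable borel" unfolding v_def by measurable
  have w: "W V v" "Q V v \<le> Q V u"
    using W_contraction[of V u v] u V vm by (auto simp: Neh_def v_def max_def)
  have gv: "Gi v = Gi u" "J v = J u"
    unfolding Gi_def J_def v_def by (auto intro!: Bochner_Integration.integral_cong simp: max_def g_neg h_neg)
  have nv: "\<not> null v"
  proof
    assume "null v"
    then have "AE x in lborel. g (u x) = 0" unfolding null_def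
      by eventually_elim (auto simp: v_def max_def g_neg split: if_splits)
    then have "Gi u = (LINT x|(lborel::'a measure). 0)" unfolding Gi_def by (intro integral_cong_AE) auto
    then have "Q V u = 0" using u by (simp add: Neh_def G_def)
    moreover have "Q V u > 0" using u by (intro Q_pos[OF V]) (auto simp: Neh_def)
    ultimately show False by simp
  qed
  have "G V v \<le> 0" using w(2) gv u by (simp add: Neh_def G_def)
  then obtain t where t: "0 < t" "t \<le> 1" "Neh V (\<lambda>x. t * v x)" using Nehari_projection[OF V w(1) nv] by blast
  have "J (\<lambda>x. t * v x) \<le> J u" using J_ray[OF W_H[OF w(1)], of t] t gv by simp
  then show thesis using that[of "\<lambda>x. t * v x"] t by (auto simp: v_def)
qed

section \<open>Existence of minimisers\<close>

lemma Nehari_Q_bounded: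
  assumes "\<And>n. Neh V (u n)" "\<And>n. J (u n) \<le> B" shows "Q V (u n) \<le> B / (1/2 - 1/\<theta>)"
proof -
  have "1/2 - 1/\<theta> > 0" using \<theta> by (simp add: field_simps)
  then show ?thesis using order_trans[OF Nehari_Q_le[OF assms(1)] assms(2), of n] by (simp add: le_divide_eq mult.commute)
qed

text \<open>Boundedness and a.e. convergence suffice: \<open>Sobolev_split\<close> bounds the
  integrals of \<open>\<Phi> (v n)\<close>, and \<open>ghF_growth\<close> provides the splitting of
  the integrands.\<close>

lemma J_split:
  assumes v: "\<And>n. H (v n)" and u: "H u" and lim: "AE x in lborel. (\<lambda>n. v n x) \<longlonglongrightarrow> 0"
    and B: "\<And>n. S (v n) + D (v n) \<le> M^2" "M > 0"
  shows "(\<lambda>n. Gi (\<lambda>x. v n x + u x) - Gi (v n)) \<longlonglongrightarrow> Gi u"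
    and "(\<lambda>n. J (\<lambda>x. v n x + u x) - J (v n)) \<longlonglongrightarrow> J u"
proof -
  obtain K A \<rho> where K: "\<And>u m. H u \<Longrightarrow> S u + D u \<le> M^2 \<Longrightarrow>
    (LINT x|lborel. \<bar>u x\<bar> powr p) \<le> (K * M * 2 powr (real m * gam)) powr (p - 2) * S u + A * M powr p * \<rho> ^ m"
    using Sobolev_split[OF p2 pN] B(2) by metis
  \<comment> \<open>The level index \<open>m = 0\<close> is enough, since only some bound uniform in
    \<open>n\<close> is wanted.\<close>
  define L where "L = (K * M * 2 powr (real 0 * gam)) powr (p - 2)"
  have pB: "(LINT x|lborel. \<Phi> (v n x)) \<le> (1 + L) * M^2 + A * M powr p" for n
  proof -
    have "(LINT x|lborel. \<Phi> (v n x)) = S (v n) + (LINT x|lborel. \<bar>v n x\<bar> powr p)"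
      unfolding \<Phi>_def S_def using v[of n] Sobolev_integrable[OF p2 pN v[of n]] by (simp add: H_def sq_integrable_real)
    also have "\<dots> \<le> S (v n) + (L * S (v n) + A * M powr p)"
      using K[OF v[of n] B(1), of 0] by (simp add: L_def)
    also have "\<dots> = (1 + L) * S (v n) + A * M powr p" by (simp add: distrib_right)
    also have "(1 + L) * S (v n) \<le> (1 + L) * M^2"
    proof (rule mult_left_mono)
      show "S (v n) \<le> M^2" using B(1)[of n] D_nonneg[of "v n"] by linarith
      show "0 \<le> 1 + L" by (simp add: L_def)
    qed
    finally show ?thesis by simp
  qed
  have vm: "v n \<in> borel_measurable lborel" for n using H_measurable[OF v] by simp
  have um: "u \<in> borel_measurable lborel" using H_measurable[OF u] by simp
  have a: "H (\<lambda>x. v n x + u x)" for n by (rule H_add[OF v u])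
  show "(\<lambda>n. Gi (\<lambda>x. v n x + u x) - Gi (v n)) \<longlonglongrightarrow> Gi u"
    unfolding Gi_def
    by (rule Brezis_Lieb[where \<Phi>=\<Phi>, OF cont_ghF(1) _ \<Phi>_measurable \<Phi>_nonneg ghF_growth(2) vm um lim
          \<Phi>_integrable[OF u] \<Phi>_integrable[OF v] pB ghF_integrable(1)[OF u] ghF_integrable(1)[OF v] ghF_integrable(1)[OF a]])
       (simp_all add: g_neg)
  show "(\<lambda>n. J (\<lambda>x. v n x + u x) - J (v n)) \<longlonglongrightarrow> J u"
    unfolding J_def
    by (rule Brezis_Lieb[where \<Phi>=\<Phi>, OF cont_ghF(2) _ \<Phi>_measurable \<Phi>_nonneg ghF_growth(3) vm um lim
          \<Phi>_integrable[OF u] \<Phi>_integrable[OF v] pB ghF_integrable(2)[OF u] ghF_integrable(2)[OF v] ghF_integrable(2)[OF a]])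
       (simp_all add: h_neg)
qed

text \<open>Fatou's lemma for each of the three L2 norms, the one on pairs by means of
  \<open>AE_gag\<close>.\<close>

lemma W_limit:
  assumes V: "pot V" and u: "\<And>n. W V (u n)" and q: "\<And>n. Q V (u n) \<le> B" and SB: "\<And>n. S (u n) \<le> B'"
    and u0: "u0 \<in> borel_measurable borel" and ae: "AE x in lborel. (\<lambda>n. u n x) \<longlonglongrightarrow> u0 x"
  shows "W V u0"
proof -
  note [measurable] = u0 potD(1)[OF V] W_measurable[OF u]
  have s: "sq_integrable lborel (u n)" "sq_integrable (gag s) (pdiff (u n))" "sq_integrable lborel (\<lambda>z. sqrt (V z) * u n z)" for n
    using u[of n] by (auto simp: W_def H_def)
  have b: "(LINT x|lborel. (norm (u n x))^2) \<le> B'" "(LINT z|gag s. (norm (pdiff (u n) z))^2) \<le> B" "(LINT x|lborel. (norm (sqrt (V x) * u n x))^2) \<le> B" for n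
  proof -
    have "D (u n) \<le> B" "P V (u n) \<le> B" by (rule order_trans[OF _ q[of n]], simp add: Q_def)+
    then show "(LINT x|lborel. (norm (u n x))^2) \<le> B'" "(LINT z|gag s. (norm (pdiff (u n) z))^2) \<le> B" "(LINT x|lborel. (norm (sqrt (V x) * u n x))^2) \<le> B"
      using SB[of n] by (simp_all add: S_def D_def P_def)
  qed
  have "sq_integrable lborel u0" by (rule sq_integrable_liminf(1)[OF s(1) _ ae b(1)]) (use u0 in simp)
  moreover have "sq_integrable (gag s) (pdiff u0)"
  proof (rule sq_integrable_liminf(1)[OF s(2) _ _ b(2)])
    show "AE z in gag s. (\<lambda>n. pdiff (u n) z) \<longlonglongrightarrow> pdiff u0 z"
      using AE_gag[OF ae] by eventually_elim (auto simp: pdiff_def intro: tendsto_diff)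
    show "pdiff u0 \<in> borel_measurable (gag s)" by measurable
  qed
  moreover have "sq_integrable lborel (\<lambda>z. sqrt (V z) * u0 z)"
  proof (rule sq_integrable_liminf(1)[OF s(3) _ _ b(3)])
    show "AE z in lborel. (\<lambda>n. sqrt (V z) * u n z) \<longlonglongrightarrow> sqrt (V z) * u0 z"
      using ae by eventually_elim (intro tendsto_intros)
    show "(\<lambda>z. sqrt (V z) * u0 z) \<in> borel_measurable lborel" by measurable
  qed
  ultimately show ?thesis by (simp add: W_def H_def)
qed

text \<open>Brezis-Lieb for squares, on pairs and on points, takes the place of the weak convergence
  that would make the cross terms vanish.\<close>

lemma Q_split:
  assumes v: "\<And>n. W V (v n)" and u: "W V u" and lim: "AE x in lborel. (\<lambda>n. v n x) \<longlonglongrightarrow> 0" and B: "\<And>n. Q V (v n) \<le> B"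
  shows "(\<lambda>n. Q V (\<lambda>x. v n x + u x) - Q V (v n)) \<longlonglongrightarrow> Q V u"
proof -
  have "(\<lambda>n. (LINT z|gag s. (pdiff (v n) z + pdiff u z)^2) - (LINT z|gag s. (pdiff (v n) z)^2)) \<longlonglongrightarrow> (LINT z|gag s. (pdiff u z)^2)"
  proof (rule Brezis_Lieb_sq[where B=B])
    show "AE z in gag s. (\<lambda>n. pdiff (v n) z) \<longlonglongrightarrow> 0"
      using AE_gag[OF lim]
    proof eventually_elim
      case (elim z)
      then have "(\<lambda>n. pdiff (v n) z) \<longlonglongrightarrow> 0 - 0" unfolding pdiff_def by (intro tendsto_intros) auto
      then show ?case by simp
    qed
    show "(LINT z|gag s. (pdiff (v n) z)^2) \<le> B" for n
      using B[of n] P_nonneg[of V "v n"] unfolding Q_def D_def by linarith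
  qed (use v u in \<open>auto simp: W_def H_def\<close>)
  moreover have "(\<lambda>n. (LINT z|lborel. (sqrt (V z) * v n z + sqrt (V z) * u z)^2) - (LINT z|lborel. (sqrt (V z) * v n z)^2)) \<longlonglongrightarrow> (LINT z|lborel. (sqrt (V z) * u z)^2)"
  proof (rule Brezis_Lieb_sq[where B=B])
    show "AE z in lborel. (\<lambda>n. sqrt (V z) * v n z) \<longlonglongrightarrow> 0"
      using lim by eventually_elim (rule tendsto_mult_right_zero)
    show "(LINT z|lborel. (sqrt (V z) * v n z)^2) \<le> B" for n
      using B[of n] D_nonneg[of "v n"] unfolding Q_def P_def by linarith
  qed (use v u in \<open>auto simp: W_def H_def\<close>)
  ultimately have "(\<lambda>n. ((LINT z|gag s. (pdiff (v n) z + pdiff u z)^2) - (LINT z|gag s. (pdiff (v n) z)^2))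
     + ((LINT z|lborel. (sqrt (V z) * v n z + sqrt (V z) * u z)^2) - (LINT z|lborel. (sqrt (V z) * v n z)^2))) \<longlonglongrightarrow> Q V u"
    unfolding Q_def D_def P_def by (rule tendsto_add)
  moreover have "pdiff (\<lambda>x. v n x + u x) = (\<lambda>z. pdiff (v n) z + pdiff u z)" for n by (auto simp: pdiff_def)
  ultimately show ?thesis by (simp add: Q_def D_def P_def distrib_left algebra_simps)
qed

lemma S_diff_le: "H u \<Longrightarrow> H v \<Longrightarrow> S (\<lambda>x. u x - v x) + D (\<lambda>x. u x - v x) \<le> 2 * (S u + D u) + 2 * (S v + D v)"
proof -
  assume uv: "H u" "H v"
  have "S (\<lambda>x. u x - v x) \<le> (LINT x|lborel. 2 * (u x)^2 + 2 * (v x)^2)" unfolding S_def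
    by (rule integral_mono) (use uv H_diff[OF uv] norm_diff_sq_le[of "u _" "v _"] in \<open>auto simp: H_def sq_integrable_real\<close>)
  moreover have "\<dots> = 2 * S u + 2 * S v" using uv by (simp add: S_def H_def sq_integrable_real)
  moreover have "D (\<lambda>x. u x - v x) \<le> (LINT z|gag s. 2 * (pdiff u z)^2 + 2 * (pdiff v z)^2)" unfolding D_def
  proof (rule integral_mono)
    show "(pdiff (\<lambda>x. u x - v x) z)^2 \<le> 2 * (pdiff u z)^2 + 2 * (pdiff v z)^2" for z
      using norm_diff_sq_le[of "pdiff u z" "pdiff v z"] by (simp add: pdiff_def algebra_simps)
  qed (use uv H_diff[OF uv] in \<open>auto simp: H_def sq_integrable_real\<close>)
  moreover have "(LINT z|gag s. 2 * (pdiff u z)^2 + 2 * (pdiff v z)^2) = 2 * D u + 2 * D v" using uv by (simp add: D_def H_def sq_integrable_real)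
  ultimately show ?thesis by simp
qed

text \<open>A minimising sequence on the Nehari set can only fail to produce a minimiser by
  converging to zero locally; \<open>tight V\<close> excludes this.\<close>

definition tight :: "('a \<Rightarrow> real) \<Rightarrow> bool" where
  "tight V \<longleftrightarrow> (\<forall>u B. (\<forall>n. Neh V (u n)) \<longrightarrow> (\<forall>n::nat. Q V (u n) \<le> B) \<longrightarrow> (\<lambda>n. J (u n)) \<longlonglongrightarrow> lev V \<longrightarrow>
     (\<forall>R. (\<lambda>n. LINT x|lborel. indicator (ball 0 R) x * (u n x)^2) \<longlonglongrightarrow> 0) \<longrightarrow> False)"

text \<open>Each approximate minimiser is replaced by a nonnegative one of no larger
  \<open>J\<close>. The uniform bound \<open>lev V + 1\<close> is recorded because
  \<open>Nehari_Q_bounded\<close> turns it into a bound for \<open>Q\<close>.\<close>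

lemma minimising_sequence:
  assumes V: "pot V" and ne: "Neh V w"
  obtains u where "\<And>n::nat. Neh V (u n)" "\<And>n x. 0 \<le> u n x" "(\<lambda>n. J (u n)) \<longlonglongrightarrow> lev V" "\<And>n. J (u n) \<le> lev V + 1"
proof -
  have "\<exists>u. Neh V u \<and> (\<forall>x. 0 \<le> u x) \<and> J u < lev V + 1 / Suc n" for n
  proof -
    have "Inf (J ` {u. Neh V u}) < lev V + 1 / Suc n" by (simp add: lev_def)
    then obtain u where u: "Neh V u" "J u < lev V + 1 / Suc n"
      using cInf_lessD[of "J ` {u. Neh V u}"] ne by auto
    obtain u' where u': "Neh V u'" "\<And>x. 0 \<le> u' x" "J u' \<le> J u" using Nehari_nonneg[OF V u(1)] by blast
    have "J u' < lev V + 1 / Suc n" using u'(3) u(2) by (rule le_less_trans)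
    then show ?thesis using u'(1,2) by blast
  qed
  then obtain u where u: "\<And>n. Neh V (u n)" "\<And>n x. 0 \<le> u n x" "\<And>n. J (u n) < lev V + 1 / Suc n" by metis
  have L: "(\<lambda>n. J (u n)) \<longlonglongrightarrow> lev V"
  proof (rule tendsto_sandwich)
    show "\<forall>\<^sub>F n in sequentially. lev V \<le> J (u n)" using lev_le[OF u(1)] by simp
    show "\<forall>\<^sub>F n in sequentially. J (u n) \<le> lev V + 1 / Suc n" using u(3) by (simp add: less_imp_le)
    have "(\<lambda>n. lev V + 1 / real (Suc n)) \<longlonglongrightarrow> lev V + 0" by (intro tendsto_intros LIMSEQ_Suc[OF lim_inverse_n'])
    then show "(\<lambda>n. lev V + 1 / real (Suc n)) \<longlonglongrightarrow> lev V" by simp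
  qed simp
  have "J (u n) \<le> lev V + 1" for n
  proof -
    have "1 / real (Suc n) \<le> 1" by simp
    then show ?thesis using u(3)[of n] by linarith
  qed
  then show thesis using that[of u] u(1,2) L by blast
qed

theorem minimiser_exists:
  assumes V: "pot V" and ne: "Neh V w" and ti: "tight V"
  obtains u where "Neh V u" "\<And>x. 0 \<le> u x" "J u = lev V"
proof -
  obtain u1 where u1: "\<And>n::nat. Neh V (u1 n)" "\<And>n x. 0 \<le> u1 n x" "(\<lambda>n. J (u1 n)) \<longlonglongrightarrow> lev V" "\<And>n. J (u1 n) \<le> lev V + 1"
    using minimising_sequence[OF V ne] by blast
  define B where "B = (lev V + 1) / (1/2 - 1/\<theta>)"
  have Q1: "Q V (u1 n) \<le> B" for n unfolding B_def by (rule Nehari_Q_bounded[OF u1(1,4)])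
  obtain K where K: "K > 0" "\<And>u. W V u \<Longrightarrow> S u + D u \<le> K * Q V u" using W_norm_le[OF V] by blast
  have B0: "B \<ge> 0" using Q1[of 0] Q_nonneg by (rule order_trans[rotated])
  \<comment> \<open>The summand 1 keeps \<open>M\<close> positive when \<open>B = 0\<close>, as the
    compactness theorem requires.\<close>
  define M where "M = sqrt (K * B) + 1"
  have M: "M > 0" "K * B \<le> M^2" using K B0 by (auto simp: M_def power2_sum intro: add_nonneg_pos)
  have W1: "W V (u1 n)" for n using u1(1) by (simp add: Neh_def)
  have SD1: "S (u1 n) + D (u1 n) \<le> M^2" for n
    by (rule order_trans[OF K(2)[OF W1] order_trans[OF mult_left_mono[OF Q1 less_imp_le[OF K(1)]] M(2)]])
  obtain r u0 where r: "strict_mono r" and u0m: "u0 \<in> borel_measurable borel"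
    and ae0: "AE x in lborel. (\<lambda>n. u1 (r n) x) \<longlonglongrightarrow> u0 x"
    and loc0: "\<And>R. (\<lambda>n. LINT x|lborel. indicator (ball 0 R) x * (u1 (r n) x - u0 x)^2) \<longlonglongrightarrow> 0"
    by (rule Rellich[where u=u1 and M=M, OF W_H[OF W1] M(1) SD1]) (rule that)
  define U where "U n = u1 (r n)" for n
  have U: "Neh V (U n)" "W V (U n)" "0 \<le> U n x" "Q V (U n) \<le> B" "S (U n) + D (U n) \<le> M^2" for n x
    unfolding U_def using u1 W1 Q1 SD1 by auto
  have JU: "(\<lambda>n. J (U n)) \<longlonglongrightarrow> lev V"
    unfolding U_def using LIMSEQ_subseq_LIMSEQ[OF u1(3) r] by (simp add: o_def)
  \<comment> \<open>A limit of nonnegative functions is nonnegative only almost everywhere; the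
    positive part changes it on a null set and makes this hold everywhere.\<close>
  define u where "u x = max (u0 x) 0" for x
  have um [measurable]: "u \<in> borel_measurable borel" unfolding u_def using u0m by measurable
  have u0: "0 \<le> u x" for x by (simp add: u_def)
  have uu0: "AE x in lborel. u x = u0 x" using ae0
  proof eventually_elim
    case (elim x)
    have "0 \<le> u0 x" by (rule LIMSEQ_le_const[OF elim]) (use u1(2) in auto)
    then show ?case by (simp add: u_def)
  qed
  have ae: "AE x in lborel. (\<lambda>n. U n x) \<longlonglongrightarrow> u x"
    using ae0 uu0 by eventually_elim (simp add: U_def)
  have SU: "S (U n) \<le> M^2" for n using U(5)[of n] D_nonneg[of "U n"] by linarith
  have Wu: "W V u" by (rule W_limit[OF V U(2,4) SU um ae])
  have nz: "\<not> null u"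
  proof
    assume "null u"
    then have z: "AE x in lborel. u0 x = 0" using uu0 unfolding null_def by eventually_elim simp
    have "(LINT x|lborel. indicator (ball 0 R) x * (u1 (r n) x - u0 x)^2) = (LINT x|lborel. indicator (ball 0 R) x * (U n x)^2)" for R n
    proof (rule integral_cong_AE)
      show "AE x in lborel. indicator (ball 0 R) x * (u1 (r n) x - u0 x)^2 = indicator (ball 0 R) x * (U n x)^2"
        using z by eventually_elim (simp add: U_def)
      note [measurable] = u0m W_measurable[OF U(2)] W_measurable[OF W1]
      have [measurable]: "ball (0::'a) R \<in> sets borel" by simp
      show "(\<lambda>x. indicator (ball 0 R) x * (u1 (r n) x - u0 x)^2) \<in> borel_measurable lborel"
        "(\<lambda>x. indicator (ball 0 R) x * (U n x)^2) \<in> borel_measurable lborel" by measurable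
    qed
    then have "(\<lambda>n. LINT x|lborel. indicator (ball 0 R) x * (U n x)^2) \<longlonglongrightarrow> 0" for R using loc0[of R] by simp
    then show False using ti U(1,4) JU unfolding tight_def by blast
  qed
  define v where "v n x = U n x - u x" for n x
  have Wv: "W V (v n)" for n unfolding v_def by (rule W_diff[OF U(2) Wu])
  have Hv: "H (v n)" for n by (rule W_H[OF Wv])
  have v0: "AE x in lborel. (\<lambda>n. v n x) \<longlonglongrightarrow> 0" using ae
  proof eventually_elim
    case (elim x)
    have "(\<lambda>n. U n x - u x) \<longlonglongrightarrow> u x - u x" by (intro tendsto_intros elim)
    then show ?case by (simp add: v_def)
  qed
  define M' where "M' = sqrt (2 * M^2 + 2 * (S u + D u)) + 1"
  have M': "M' > 0" "2 * M^2 + 2 * (S u + D u) \<le> M'\<^sup>2" by (auto simp: M'_def power2_sum intro: add_nonneg_pos)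
  have SDv: "S (v n) + D (v n) \<le> M'\<^sup>2" for n
  proof -
    have "S (v n) + D (v n) \<le> 2 * (S (U n) + D (U n)) + 2 * (S u + D u)"
      unfolding v_def by (rule S_diff_le[OF W_H[OF U(2)] W_H[OF Wu]])
    also have "\<dots> \<le> 2 * M^2 + 2 * (S u + D u)" by (rule add_right_mono[OF mult_left_mono[OF U(5)]]) simp
    also note M'(2)
    finally show ?thesis .
  qed
  have Qv: "Q V (v n) \<le> 2 * B + 2 * Q V u" for n
  proof -
    have "P V (v n) \<le> (LINT z|lborel. 2 * (sqrt (V z) * U n z)^2 + 2 * (sqrt (V z) * u z)^2)" unfolding P_def
    proof (rule integral_mono)
      show "(sqrt (V z) * v n z)^2 \<le> 2 * (sqrt (V z) * U n z)^2 + 2 * (sqrt (V z) * u z)^2" for z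
        using norm_diff_sq_le[of "sqrt (V z) * U n z" "sqrt (V z) * u z"] by (simp add: v_def right_diff_distrib)
    qed (use Wv[of n] U(2)[of n] Wu in \<open>auto simp: W_def sq_integrable_real\<close>)
    also have "\<dots> = 2 * P V (U n) + 2 * P V u" using U(2)[of n] Wu by (simp add: P_def W_def sq_integrable_real)
    finally have 1: "P V (v n) \<le> 2 * P V (U n) + 2 * P V u" .
    have "D (v n) \<le> (LINT z|gag s. 2 * (pdiff (U n) z)^2 + 2 * (pdiff u z)^2)" unfolding D_def
    proof (rule integral_mono)
      show "(pdiff (v n) z)^2 \<le> 2 * (pdiff (U n) z)^2 + 2 * (pdiff u z)^2" for z
        using norm_diff_sq_le[of "pdiff (U n) z" "pdiff u z"] by (simp add: pdiff_def v_def algebra_simps)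
    qed (use Wv[of n] U(2)[of n] Wu in \<open>auto simp: W_def H_def sq_integrable_real\<close>)
    also have "\<dots> = 2 * D (U n) + 2 * D u" using U(2)[of n] Wu by (simp add: D_def W_def H_def sq_integrable_real)
    finally have "Q V (v n) \<le> (2 * D (U n) + 2 * D u) + (2 * P V (U n) + 2 * P V u)"
      unfolding Q_def using 1 by (rule add_mono)
    also have "\<dots> = 2 * Q V (U n) + 2 * Q V u" by (simp add: Q_def)
    also have "\<dots> \<le> 2 * B + 2 * Q V u" by (rule add_right_mono[OF mult_left_mono[OF U(4)]]) simp
    finally show ?thesis .
  qed
  have vu: "(\<lambda>x. v n x + u x) = U n" for n by (auto simp: v_def)
  note JS = J_split[OF Hv W_H[OF Wu] v0 SDv M'(1), unfolded vu]
  note QS = Q_split[OF Wv Wu v0 Qv, unfolded vu]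
  \<comment> \<open>\<open>U n\<close> lies on the Nehari set, so \<open>G V (v n)\<close> is the
    difference of the two splittings: \<open>G\<close> asymptotically divides the value 0 between
    \<open>u\<close> and the remainders.\<close>
  have GS: "(\<lambda>n. G V (v n)) \<longlonglongrightarrow> - G V u"
  proof -
    have "(\<lambda>n. (Gi (U n) - Gi (v n)) - (Q V (U n) - Q V (v n))) \<longlonglongrightarrow> Gi u - Q V u" by (intro tendsto_diff JS(1) QS)
    moreover have "(Gi (U n) - Gi (v n)) - (Q V (U n) - Q V (v n)) = G V (v n)" for n
      using U(1)[of n] by (simp add: Neh_def G_def)
    ultimately show ?thesis by (simp add: G_def)
  qed
  have Jv: "(\<lambda>n. J (v n)) \<longlonglongrightarrow> lev V - J u"
    using tendsto_diff[OF JU JS(2)] by simp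
  show thesis
  proof (cases "G V u \<le> 0")
    case True
    \<comment> \<open>Since \<open>J (v n) \<ge> 0\<close>, the limit satisfies
      \<open>J u \<le> lev V\<close>, and its projection does not raise \<open>J\<close>.\<close>
    obtain t where t: "0 < t" "t \<le> 1" "Neh V (\<lambda>x. t * u x)" using Nehari_projection[OF V Wu nz True] by blast
    have "0 \<le> lev V - J u" by (rule LIMSEQ_le_const[OF Jv]) auto
    then have "J (\<lambda>x. t * u x) \<le> lev V" using J_ray[OF W_H[OF Wu], of t] t by simp
    then have "J (\<lambda>x. t * u x) = lev V" using lev_le[OF t(3)] by simp
    then show thesis using that[OF t(3)] u0 t by simp
  next
    case False
    \<comment> \<open>The remainders now lie where \<open>G\<close> is negative and \<open>J\<close>
      is at least the level; but their energies tend to \<open>lev V - J u\<close> with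
      \<open>J u > 0\<close>.\<close>
    then have "- G V u < 0" by simp
    from order_tendstoD(2)[OF GS this] have "\<forall>\<^sub>F n in sequentially. lev V \<le> J (v n)"
    proof eventually_elim
      case (elim n)
      have "\<not> null (v n)"
      proof
        assume n: "null (v n)"
        have "Gi (v n) = (LINT x|(lborel::'a measure). 0)" unfolding Gi_def
          by (rule integral_cong_AE) (use n W_measurable[OF Wv] in \<open>auto simp: null_def g_neg elim: eventually_mono\<close>)
        then have "G V (v n) \<ge> 0" by (simp add: G_def)
        then show False using elim by simp
      qed
      then show ?case using lev_le_G[OF V Wv] elim by simp
    qed
    then have "lev V \<le> lev V - J u" by (rule tendsto_lowerbound[OF Jv]) simp
    then show thesis using J_pos[OF W_H[OF Wu] nz u0] by simp
  qed
qed

text \<open>Outside a large ball the mass is at most the bounded potential energy divided by a large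
  lower bound of \<open>V\<close>, inside it tends to 0. This contradicts the lower bound
  \<open>\<kappa>\<close> for the mass.\<close>

lemma coercive_tight:
  assumes V: "pot V" and co: "\<And>A. \<exists>R. \<forall>z. norm z \<ge> R \<longrightarrow> A \<le> V z"
  shows "tight V"
  unfolding tight_def
proof (intro allI impI)
  fix u :: "nat \<Rightarrow> 'a \<Rightarrow> real" and B
  assume u: "\<forall>n. Neh V (u n)" and q: "\<forall>n. Q V (u n) \<le> B"
    and loc: "\<forall>R. (\<lambda>n. LINT x|lborel. indicator (ball 0 R) x * (u n x)^2) \<longlonglongrightarrow> 0"
  have B: "\<bar>B\<bar> + 1 > 0" by simp
  obtain \<kappa> where \<kappa>: "\<kappa> > 0" "\<And>u. W V u \<Longrightarrow> \<not> null u \<Longrightarrow> G V u \<le> 0 \<Longrightarrow> Q V u \<le> \<bar>B\<bar> + 1 \<Longrightarrow> \<kappa> \<le> S u"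
    using Nehari_mass_lower[OF V B] by blast
  \<comment> \<open>With \<open>P V (u n) \<le> \<bar>B\<bar> + 1\<close> the outer mass is at most
    \<open>\<kappa> / 2\<close>, the other half being kept for the ball.\<close>
  define A where "A = 2 * (\<bar>B\<bar> + 1) / \<kappa>"
  have A: "A > 0" using \<kappa> B by (simp add: A_def)
  obtain R where R: "\<And>z. norm z \<ge> R \<Longrightarrow> A \<le> V z" using co by blast
  have "\<kappa> / 2 > 0" using \<kappa> by simp
  from order_tendstoD(2)[OF loc[rule_format, of R] this] obtain n where n: "(LINT x|lborel. indicator (ball 0 R) x * (u n x)^2) < \<kappa> / 2"
    using eventually_happens' sequentially_bot by blast
  have Wn: "W V (u n)" "\<not> null (u n)" "G V (u n) \<le> 0" using u by (auto simp: Neh_def)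
  have Bn: "Q V (u n) \<le> \<bar>B\<bar> + 1" using q[rule_format, of n] abs_ge_self[of B] by simp
  have k: "\<kappa> \<le> S (u n)" by (rule \<kappa>(2)[OF Wn Bn])
  have us: "sq_integrable lborel (u n)" using W_H[OF Wn(1)] by (simp add: H_def)
  have um [measurable]: "u n \<in> borel_measurable borel" by (rule W_measurable[OF Wn(1)])
  have bi: "integrable lborel (\<lambda>x. indicator (ball 0 R) x * (u n x)^2)"
    by (rule Bochner_Integration.integrable_bound[OF sq_integrableD(2)[OF us]]) (auto simp: indicator_def)
  have vi: "integrable lborel (\<lambda>x. (sqrt (V x) * u n x)^2)" using Wn(1) by (simp add: W_def sq_integrable_real)
  have "S (u n) \<le> (LINT x|lborel. indicator (ball 0 R) x * (u n x)^2 + (1 / A) * (sqrt (V x) * u n x)^2)"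
    unfolding S_def
  proof (rule integral_mono)
    show "integrable lborel (\<lambda>x. (u n x)^2)" using us by (simp add: sq_integrable_real)
    show "integrable lborel (\<lambda>x. indicator (ball 0 R) x * (u n x)^2 + (1 / A) * (sqrt (V x) * u n x)^2)" using bi vi by simp
    fix x
    show "(u n x)^2 \<le> indicator (ball 0 R) x * (u n x)^2 + (1 / A) * (sqrt (V x) * u n x)^2"
    proof (cases "norm x < R")
      case True then show ?thesis using A by simp
    next
      case False
      then have "1 \<le> (1 / A) * V x" using R[of x] A by (simp add: le_divide_eq)
      then have "1 * (u n x)^2 \<le> (1 / A) * V x * (u n x)^2" by (intro mult_right_mono) auto
      also have "\<dots> = (1 / A) * (sqrt (V x) * u n x)^2" using potD(3)[OF V, of x] by (simp add: power_mult_distrib)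
      finally show ?thesis using False by simp
    qed
  qed
  also have "\<dots> = (LINT x|lborel. indicator (ball 0 R) x * (u n x)^2) + (1 / A) * P V (u n)" using bi vi by (simp add: P_def)
  also have "(1 / A) * P V (u n) \<le> (1 / A) * (\<bar>B\<bar> + 1)"
  proof (rule mult_left_mono)
    show "P V (u n) \<le> \<bar>B\<bar> + 1" by (rule order_trans[OF _ Bn]) (simp add: Q_def)
    show "0 \<le> 1 / A" using A by simp
  qed
  also have "(1 / A) * (\<bar>B\<bar> + 1) = \<kappa> / 2"
  proof -
    have "(1 / (2 * b / \<kappa>)) * b = \<kappa> / 2" if "b > 0" for b using that by simp
    from this[OF B] show ?thesis by (simp only: A_def)
  qed
  finally show False using n k by simp
qed

text \<open>If the mass in the ball tends to 0, the potential energy is eventually at least that of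
  the constant \<open>A'\<close>, so \<open>G\<close> for \<open>A'\<close> is nonpositive along the
  sequence. Then \<open>J (u n)\<close>, which tends to \<open>lev V\<close>, is at least the larger
  level of \<open>A'\<close>.\<close>

lemma level_tight:
  assumes V: "pot V" and A: "0 < A'" "A' < A" and R: "\<And>z. norm z \<ge> R \<Longrightarrow> A \<le> V z"
    and lt: "lev V < lev (\<lambda>_. A')"
  shows "tight V"
  unfolding tight_def
proof (intro allI impI)
  fix u :: "nat \<Rightarrow> 'a \<Rightarrow> real" and B
  assume u: "\<forall>n. Neh V (u n)" and q: "\<forall>n. Q V (u n) \<le> B" and Jl: "(\<lambda>n. J (u n)) \<longlonglongrightarrow> lev V"
    and loc: "\<forall>R. (\<lambda>n. LINT x|lborel. indicator (ball 0 R) x * (u n x)^2) \<longlonglongrightarrow> 0"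
  have B: "\<bar>B\<bar> + 1 > 0" by simp
  obtain \<kappa> where \<kappa>: "\<kappa> > 0" "\<And>u. W V u \<Longrightarrow> \<not> null u \<Longrightarrow> G V u \<le> 0 \<Longrightarrow> Q V u \<le> \<bar>B\<bar> + 1 \<Longrightarrow> \<kappa> \<le> S u"
    using Nehari_mass_lower[OF V B] by blast
  \<comment> \<open>The gap \<open>A - A'\<close>, multiplied by a mass of at least
    \<open>\<kappa>\<close>, pays for the mass inside the ball, where \<open>A\<close> need not
    bound \<open>V\<close> from below.\<close>
  have "(A - A') * \<kappa> / A > 0" using A \<kappa> by simp
  from order_tendstoD(2)[OF loc[rule_format, of R] this]
  have "\<forall>\<^sub>F n in sequentially. lev (\<lambda>_. A') \<le> J (u n)"
  proof eventually_elim
    case (elim n)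
    have Wn: "W V (u n)" "\<not> null (u n)" "G V (u n) \<le> 0" using u by (auto simp: Neh_def)
    have Bn: "Q V (u n) \<le> \<bar>B\<bar> + 1" using q[rule_format, of n] abs_ge_self[of B] by simp
    have k: "\<kappa> \<le> S (u n)" by (rule \<kappa>(2)[OF Wn Bn])
    have us: "sq_integrable lborel (u n)" using W_H[OF Wn(1)] by (simp add: H_def)
    have um [measurable]: "u n \<in> borel_measurable borel" by (rule W_measurable[OF Wn(1)])
    have bi: "integrable lborel (\<lambda>x. indicator (ball 0 R) x * (u n x)^2)"
      by (rule Bochner_Integration.integrable_bound[OF sq_integrableD(2)[OF us]]) (auto simp: indicator_def)
    have vi: "integrable lborel (\<lambda>x. (sqrt (V x) * u n x)^2)" using Wn(1) by (simp add: W_def sq_integrable_real)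
    have si: "integrable lborel (\<lambda>x. (u n x)^2)" using us by (simp add: sq_integrable_real)
    have W': "W (\<lambda>_. A') (u n)" using W_H[OF Wn(1)] sq_integrable_mult[OF us, of "sqrt A'"] by (simp add: W_def)
    have P': "P (\<lambda>_. A') (u n) = A' * S (u n)" using A by (simp add: P_def S_def power_mult_distrib)
    have "(LINT x|lborel. A * (u n x)^2) \<le> (LINT x|lborel. (sqrt (V x) * u n x)^2 + A * (indicator (ball 0 R) x * (u n x)^2))"
    proof (rule integral_mono)
      fix x
      show "A * (u n x)^2 \<le> (sqrt (V x) * u n x)^2 + A * (indicator (ball 0 R) x * (u n x)^2)"
      proof (cases "norm x < R")
        case True then show ?thesis by simp
      next
        case False
        then show ?thesis using R[of x] potD(3)[OF V, of x] by (simp add: power_mult_distrib mult_right_mono)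
      qed
    qed (use bi vi si in auto)
    then have "A * S (u n) \<le> P V (u n) + A * (LINT x|lborel. indicator (ball 0 R) x * (u n x)^2)"
      using bi vi by (simp add: S_def P_def)
    moreover have "A * (LINT x|lborel. indicator (ball 0 R) x * (u n x)^2) \<le> (A - A') * \<kappa>"
      using elim A by (simp add: less_divide_eq mult.commute less_imp_le)
    moreover have "(A - A') * \<kappa> \<le> (A - A') * S (u n)" using k A by (intro mult_left_mono) auto
    ultimately have "A' * S (u n) \<le> P V (u n)" by (simp add: left_diff_distrib)
    then have "G (\<lambda>_. A') (u n) \<le> 0" using Wn(3) by (simp add: G_def Q_def P')
    then show ?case using lev_le_G[OF pot_const[OF A(1)] W' Wn(2)] by simp
  qed
  then have "lev (\<lambda>_. A') \<le> lev V" by (rule tendsto_lowerbound[OF Jl]) simp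
  then show False using lt by simp
qed

section \<open>Minimisers are positive critical points\<close>

text \<open>The bilinear form of \<open>Q V\<close> in Gagliardo terms; it is matched with
  \<open>frac_form\<close> by polarisation at the very end.\<close>

definition Bf :: "('a \<Rightarrow> real) \<Rightarrow> ('a \<Rightarrow> real) \<Rightarrow> ('a \<Rightarrow> real) \<Rightarrow> real" where
  "Bf V u v = (LINT z|gag s. pdiff u z * pdiff v z) + (LINT z|lborel. (sqrt (V z) * u z) * (sqrt (V z) * v z))"

lemma integral_sq_add:
  fixes a b :: "'x \<Rightarrow> real"
  assumes "sq_integrable M a" "sq_integrable M b"
  shows "(LINT x|M. (a x + c * b x)^2) = (LINT x|M. (a x)^2) + 2 * c * (LINT x|M. a x * b x) + c^2 * (LINT x|M. (b x)^2)"
proof -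
  have "(a x + c * b x)^2 = (a x)^2 + 2 * c * (a x * b x) + c^2 * (b x)^2" for x
    by (simp add: power2_sum power_mult_distrib)
  then show ?thesis using assms sq_integrable_prod[OF assms] by (simp add: sq_integrable_real)
qed

lemma Q_add:
  assumes u: "W V u" and v: "W V v"
  shows "Q V (\<lambda>x. u x + c * v x) = Q V u + 2 * c * Bf V u v + c^2 * Q V v"
proof -
  have 1: "D (\<lambda>x. u x + c * v x) = D u + 2 * c * (LINT z|gag s. pdiff u z * pdiff v z) + c^2 * D v"
  proof -
    have "pdiff (\<lambda>x. u x + c * v x) = (\<lambda>z. pdiff u z + c * pdiff v z)" by (auto simp: pdiff_def algebra_simps)
    then show ?thesis unfolding D_def using integral_sq_add[of "gag s" "pdiff u" "pdiff v" c] u v by (simp add: W_def H_def)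
  qed
  have 2: "P V (\<lambda>x. u x + c * v x) = P V u + 2 * c * (LINT z|lborel. (sqrt (V z) * u z) * (sqrt (V z) * v z)) + c^2 * P V v"
  proof -
    have "sqrt (V z) * (u z + c * v z) = sqrt (V z) * u z + c * (sqrt (V z) * v z)" for z by (simp add: algebra_simps)
    then show ?thesis unfolding P_def
      using integral_sq_add[of lborel "\<lambda>z. sqrt (V z) * u z" "\<lambda>z. sqrt (V z) * v z" c] u v by (simp add: W_def)
  qed
  show ?thesis unfolding Q_def Bf_def 1 2 by (simp add: algebra_simps)
qed

text \<open>\<open>G V (\<lambda>x. t * u x)\<close> is the integral of
  \<open>t^2 * g (u x) - g (t * u x)\<close>, whose sign is constant and strict where
  \<open>u\<close> is positive, and that set has positive measure.\<close>

lemma strict_ray: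
  assumes u: "Neh V u" "\<And>x. 0 \<le> u x"
  shows "0 < t \<Longrightarrow> t < 1 \<Longrightarrow> G V (\<lambda>x. t * u x) > 0" "1 < t \<Longrightarrow> G V (\<lambda>x. t * u x) < 0"
proof -
  have W: "W V u" and nz: "\<not> null u" and q: "Q V u = Gi u" using u(1) by (auto simp: Neh_def G_def)
  note i = ghF_integrable(1)[OF W_H[OF W]] ghF_integrable(1)[OF W_H[OF W_mult[OF W]]]
  have e: "G V (\<lambda>x. t * u x) = (LINT x|lborel. t^2 * g (u x) - g (t * u x))" for t
    using i(1) i(2)[of t] by (simp add: G_def Q_mult q Gi_def)
  have ne: "(LINT x|lborel. k x) \<noteq> 0" if k: "integrable lborel k" "\<And>x. 0 \<le> k x" "\<And>x. u x > 0 \<Longrightarrow> k x > 0" for k :: "'a \<Rightarrow> real"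
  proof
    assume "(LINT x|lborel. k x) = 0"
    then have "AE x in lborel. k x = 0" using integral_nonneg_eq_0_iff_AE[OF k(1)] k(2) by simp
    then have "AE x in lborel. u x = 0"
    proof eventually_elim
      case (elim x)
      then show ?case using k(3)[of x] u(2)[of x] by fastforce
    qed
    then show False using nz by (simp add: null_def)
  qed
  show "G V (\<lambda>x. t * u x) > 0" if "0 < t" "t < 1"
  proof -
    let ?k = "\<lambda>x. t^2 * g (u x) - g (t * u x)"
    have k0: "0 \<le> ?k x" for x using g_ray(1)[OF that, of "u x"] by simp
    have k1: "u x > 0 \<Longrightarrow> ?k x > 0" for x using g_ray(3)[OF that, of "u x"] by simp
    have ki: "integrable lborel ?k" using i(1) i(2)[of t] by simp
    have "(LINT x|lborel. ?k x) \<noteq> 0" by (rule ne[OF ki k0 k1])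
    moreover have "(LINT x|lborel. ?k x) \<ge> 0" by (rule Bochner_Integration.integral_nonneg) (rule k0)
    ultimately show ?thesis unfolding e by linarith
  qed
  show "G V (\<lambda>x. t * u x) < 0" if "1 < t"
  proof -
    let ?k = "\<lambda>x. g (t * u x) - t^2 * g (u x)"
    have k0: "0 \<le> ?k x" for x using g_ray(2)[OF that, of "u x"] by simp
    have k1: "u x > 0 \<Longrightarrow> ?k x > 0" for x using g_ray(4)[OF that, of "u x"] by simp
    have ki: "integrable lborel ?k" using i(1) i(2)[of t] by simp
    have "(LINT x|lborel. ?k x) \<noteq> 0" by (rule ne[OF ki k0 k1])
    moreover have "(LINT x|lborel. ?k x) \<ge> 0" by (rule Bochner_Integration.integral_nonneg) (rule k0)
    moreover have "G V (\<lambda>x. t * u x) = - (LINT x|lborel. ?k x)" unfolding e using i(1) i(2)[of t] by simp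
    ultimately show ?thesis by simp
  qed
qed

lemma W_abs: "pot V \<Longrightarrow> W V u \<Longrightarrow> W V (\<lambda>x. \<bar>u x\<bar>)"
  by (rule W_contraction(1)[of V u]) (use W_measurable in auto)

text \<open>\<open>G\<close> changes sign strictly at \<open>t = 1\<close> on the ray of
  \<open>u\<close>. For small \<open>\<tau>\<close> the signs at \<open>1 - \<kappa>\<close> and
  \<open>1 + \<kappa>\<close> survive the perturbation by \<open>\<tau> * v\<close>, and the
  intermediate value theorem replaces the implicit function theorem.\<close>

lemma nearby_Nehari:
  assumes V: "pot V" and u: "Neh V u" "\<And>x. 0 \<le> u x" and v: "W V v" and \<kappa>: "0 < \<kappa>" "\<kappa> < 1"
  shows "\<exists>\<tau> t. 0 < \<tau> \<and> \<tau> < \<kappa> \<and> 1 - \<kappa> \<le> t \<and> t \<le> 1 + \<kappa> \<and> Neh V (\<lambda>x. t * (u x + \<tau> * v x))"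
proof -
  have W: "W V u" using u(1) by (simp add: Neh_def)
  note [measurable] = W_measurable[OF W] W_measurable[OF v]
  \<comment> \<open>Dominates all \<open>t * (u x + \<tau> n * v x)\<close> at once, since
    \<open>t < 2\<close> and \<open>\<tau> n \<le> 1\<close>.\<close>
  define k where "k x = 2 * (\<bar>u x\<bar> + \<bar>v x\<bar>)" for x
  have k: "H k" unfolding k_def by (rule W_H[of V], intro W_mult W_add W_abs V W v)
  define \<tau> where "\<tau> n = 1 / real (Suc n)" for n :: nat
  have \<tau>: "0 < \<tau> n" "\<tau> n \<le> 1" for n by (auto simp: \<tau>_def)
  have \<tau>0: "\<tau> \<longlonglongrightarrow> 0" unfolding \<tau>_def by (rule LIMSEQ_Suc[OF lim_inverse_n'])
  have lim: "(\<lambda>n. G V (\<lambda>x. t * (u x + \<tau> n * v x))) \<longlonglongrightarrow> G V (\<lambda>x. t * u x)" if t: "0 < t" "t < 2" for t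
    unfolding G_def
  proof (intro tendsto_diff)
    have "(\<lambda>n. t^2 * (Q V u + 2 * \<tau> n * Bf V u v + (\<tau> n)^2 * Q V v)) \<longlonglongrightarrow> t^2 * (Q V u + 2 * 0 * Bf V u v + 0^2 * Q V v)"
      by (intro tendsto_intros \<tau>0)
    then show "(\<lambda>n. Q V (\<lambda>x. t * (u x + \<tau> n * v x))) \<longlonglongrightarrow> Q V (\<lambda>x. t * u x)"
      by (simp add: Q_mult Q_add[OF W v])
    show "(\<lambda>n. Gi (\<lambda>x. t * (u x + \<tau> n * v x))) \<longlonglongrightarrow> Gi (\<lambda>x. t * u x)"
    proof (rule Gi_tendsto[OF k])
      fix n x
      have "\<bar>t * (u x + \<tau> n * v x)\<bar> = t * \<bar>u x + \<tau> n * v x\<bar>" using t by (simp add: abs_mult)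
      also have "\<dots> \<le> 2 * (\<bar>u x\<bar> + \<bar>v x\<bar>)"
      proof (rule mult_mono)
        have "\<bar>u x + \<tau> n * v x\<bar> \<le> \<bar>u x\<bar> + \<bar>\<tau> n * v x\<bar>" by (rule abs_triangle_ineq)
        also have "\<bar>\<tau> n * v x\<bar> \<le> \<bar>v x\<bar>" using \<tau>[of n] by (simp add: abs_mult mult_left_le_one_le)
        finally show "\<bar>u x + \<tau> n * v x\<bar> \<le> \<bar>u x\<bar> + \<bar>v x\<bar>" by simp
      qed (use t in auto)
      finally show "\<bar>t * (u x + \<tau> n * v x)\<bar> \<le> \<bar>k x\<bar>" by (simp add: k_def)
    next
      fix x
      have "(\<lambda>n. t * (u x + \<tau> n * v x)) \<longlonglongrightarrow> t * (u x + 0 * v x)" by (intro tendsto_intros \<tau>0)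
      then show "(\<lambda>n. t * (u x + \<tau> n * v x)) \<longlonglongrightarrow> t * u x" by simp
    qed measurable
  qed
  have p: "0 < 1 - \<kappa>" "1 - \<kappa> < 2" "0 < 1 + \<kappa>" "1 + \<kappa> < 2" using \<kappa> by auto
  have "\<forall>\<^sub>F n in sequentially. G V (\<lambda>x. (1 - \<kappa>) * (u x + \<tau> n * v x)) > 0"
    by (rule order_tendstoD(1)[OF lim[OF p(1,2)]]) (use strict_ray(1)[OF u] \<kappa> in auto)
  moreover have "\<forall>\<^sub>F n in sequentially. G V (\<lambda>x. (1 + \<kappa>) * (u x + \<tau> n * v x)) < 0"
    by (rule order_tendstoD(2)[OF lim[OF p(3,4)]]) (use strict_ray(2)[OF u] \<kappa> in auto)
  moreover have "\<forall>\<^sub>F n in sequentially. \<tau> n < \<kappa>" by (rule order_tendstoD(2)[OF \<tau>0 \<kappa>(1)])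
  ultimately have "\<forall>\<^sub>F n in sequentially. G V (\<lambda>x. (1 - \<kappa>) * (u x + \<tau> n * v x)) > 0 \<and> G V (\<lambda>x. (1 + \<kappa>) * (u x + \<tau> n * v x)) < 0 \<and> \<tau> n < \<kappa>"
    by eventually_elim auto
  then obtain n where n: "G V (\<lambda>x. (1 - \<kappa>) * (u x + \<tau> n * v x)) > 0" "G V (\<lambda>x. (1 + \<kappa>) * (u x + \<tau> n * v x)) < 0" "\<tau> n < \<kappa>"
    using eventually_happens' sequentially_bot by blast
  define w where "w x = u x + \<tau> n * v x" for x
  have Ww: "W V w" unfolding w_def by (intro W_add W_mult W v)
  note [measurable] = W_measurable[OF Ww]
  have wn: "\<not> null w"
  proof
    assume "null w"
    then have z: "AE x in lborel. w x = 0" by (simp add: null_def)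
    have "Gi (\<lambda>x. (1 + \<kappa>) * w x) = (LINT x|(lborel::'a measure). 0)" unfolding Gi_def
      by (rule integral_cong_AE) (use z in \<open>auto simp: g_neg elim: eventually_mono\<close>)
    then have "G V (\<lambda>x. (1 + \<kappa>) * w x) \<ge> 0" by (simp add: G_def)
    then show False using n(2) by (simp add: w_def)
  qed
  have c: "continuous_on {1 - \<kappa>..1 + \<kappa>} (\<lambda>t. G V (\<lambda>x. t * w x))"
    unfolding G_def Q_mult
  proof (intro continuous_intros)
    show "continuous_on {1 - \<kappa>..1 + \<kappa>} (\<lambda>t. Gi (\<lambda>x. t * w x))"
    proof (rule continuous_on_sequentiallyI)
      fix t :: "nat \<Rightarrow> real" and t0 assume t: "\<forall>n. t n \<in> {1 - \<kappa>..1 + \<kappa>}" "t0 \<in> {1 - \<kappa>..1 + \<kappa>}" "t \<longlonglongrightarrow> t0"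
      show "(\<lambda>n. Gi (\<lambda>x. t n * w x)) \<longlonglongrightarrow> Gi (\<lambda>x. t0 * w x)"
      proof (rule Gi_tendsto[OF H_mult[OF W_H[OF Ww], of 2]])
        show "\<bar>t n * w x\<bar> \<le> \<bar>2 * w x\<bar>" for n x
        proof -
          have "1 - \<kappa> \<le> t n" "t n \<le> 1 + \<kappa>" using t(1) by auto
          then have "\<bar>t n\<bar> \<le> 2" using \<kappa> by (simp add: abs_le_iff)
          then show ?thesis by (simp add: abs_mult mult_right_mono)
        qed
        show "(\<lambda>n. t n * w x) \<longlonglongrightarrow> t0 * w x" for x by (intro tendsto_intros t)
      qed measurable
    qed
  qed
  have "\<exists>t\<ge>1 - \<kappa>. t \<le> 1 + \<kappa> \<and> G V (\<lambda>x. t * w x) = 0"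
    by (rule IVT2'[OF _ _ _ c]) (use n(1,2) \<kappa> in \<open>auto simp: w_def\<close>)
  then obtain t where t: "1 - \<kappa> \<le> t" "t \<le> 1 + \<kappa>" "G V (\<lambda>x. t * w x) = 0" by blast
  have "Neh V (\<lambda>x. t * w x)" using t \<kappa> wn W_mult[OF Ww, of t] by (simp add: Neh_def null_mult)
  then show ?thesis using t n(3) \<tau>(1)[of n] unfolding w_def by blast
qed

lemma F_increment: "\<exists>\<xi>. \<bar>\<xi> - a\<bar> \<le> \<bar>b\<bar> \<and> F (a + b) - F a = b * f \<xi>"
proof -
  consider "b = 0" | "b > 0" | "b < 0" by linarith
  then show ?thesis
  proof cases
    case 2
    then have "a < a + b" by simp
    from MVT2[OF this F_deriv] obtain z where "a < z" "z < a + b" "F (a + b) - F a = (a + b - a) * f z" by blast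
    then show ?thesis using 2 by (intro exI[of _ z]) auto
  next
    case 3
    then have "a + b < a" by simp
    from MVT2[OF this F_deriv] obtain z where "a + b < z" "z < a" "F a - F (a + b) = (a - (a + b)) * f z" by blast
    then show ?thesis using 3 by (intro exI[of _ z]) (auto simp: algebra_simps)
  qed auto
qed

text \<open>With \<open>I\<close> the energy,
  \<open>I (t u) \<le> J u \<le> I (t (u + \<tau> v))\<close>: the first by maximality along the
  ray, the second by minimality. What remains is a difference quotient in \<open>\<tau>\<close>
  alone, so \<open>t\<close> only has to tend to 1, at no particular rate. As \<open>\<tau>\<close>
  is positive a single inequality results; \<open>-v\<close> supplies the other.\<close>

lemma critical_ge:
  assumes V: "pot V" and u: "Neh V u" "\<And>x. 0 \<le> u x" and min: "\<And>w. Neh V w \<Longrightarrow> J u \<le> J w" and v: "W V v"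
  shows "(LINT x|lborel. f (u x) * v x) \<le> Bf V u v"
proof -
  have W: "W V u" and q: "Q V u = Gi u" using u(1) by (auto simp: Neh_def G_def)
  note [measurable] = W_measurable[OF W] W_measurable[OF v]
  \<comment> \<open>The second \<open>Suc\<close> makes \<open>\<kappa> 0 < 1\<close>.\<close>
  define \<kappa> where "\<kappa> n = 1 / real (Suc (Suc n))" for n :: nat
  have \<kappa>: "0 < \<kappa> n" "\<kappa> n < 1" for n by (auto simp: \<kappa>_def)
  have \<kappa>0: "\<kappa> \<longlonglongrightarrow> 0" unfolding \<kappa>_def by (intro LIMSEQ_Suc lim_inverse_n')
  have "\<forall>n. \<exists>\<tau> t. 0 < \<tau> \<and> \<tau> < \<kappa> n \<and> 1 - \<kappa> n \<le> t \<and> t \<le> 1 + \<kappa> n \<and> Neh V (\<lambda>x. t * (u x + \<tau> * v x))"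
    using nearby_Nehari[OF V u v \<kappa>] by blast
  then obtain \<tau> t where \<tau>t: "\<And>n. 0 < \<tau> n" "\<And>n. \<tau> n < \<kappa> n" "\<And>n. 1 - \<kappa> n \<le> t n" "\<And>n. t n \<le> 1 + \<kappa> n" "\<And>n. Neh V (\<lambda>x. t n * (u x + \<tau> n * v x))"
    by metis
  have \<tau>0: "\<tau> \<longlonglongrightarrow> 0"
    by (rule tendsto_sandwich[OF _ _ tendsto_const \<kappa>0]) (auto intro!: always_eventually less_imp_le \<tau>t)
  have t1: "t \<longlonglongrightarrow> 1"
  proof (rule tendsto_sandwich)
    have "(\<lambda>n. 1 - \<kappa> n) \<longlonglongrightarrow> 1 - 0" "(\<lambda>n. 1 + \<kappa> n) \<longlonglongrightarrow> 1 + 0" by (intro tendsto_intros \<kappa>0)+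
    then show "(\<lambda>n. 1 - \<kappa> n) \<longlonglongrightarrow> 1" "(\<lambda>n. 1 + \<kappa> n) \<longlonglongrightarrow> 1" by simp_all
  qed (use \<tau>t in auto)
  have t2: "0 < t n" "t n \<le> 2" "\<tau> n \<le> 1" for n
    using \<tau>t(2,3,4)[of n] \<kappa>[of n] by auto
  define I where "I w = Q V w / 2 - (LINT x|lborel. F (w x))" for w
  define q' where "q' n x = (F (t n * u x + t n * (\<tau> n * v x)) - F (t n * u x)) / \<tau> n" for n x
  have Wn: "W V (\<lambda>x. t n * (u x + \<tau> n * v x))" "W V (\<lambda>x. t n * u x)" for n by (intro W_mult W_add W v)+
  have step: "0 \<le> (t n)^2 * (Bf V u v + \<tau> n * Q V v / 2) - (LINT x|lborel. q' n x)" for n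
  proof -
    have "I (\<lambda>x. t n * u x) \<le> J u"
    proof -
      have "(LINT x|lborel. F (u x) - F (t n * u x)) \<le> (LINT x|lborel. (1 - (t n)^2) / 2 * g (u x))"
        by (rule integral_mono) (use ghF_integrable[OF W_H[OF W]] ghF_integrable[OF W_H[OF Wn(2)]] F_ray t2(1)[of n] in \<open>auto simp: less_imp_le\<close>)
      then have "(LINT x|lborel. F (u x)) - (LINT x|lborel. F (t n * u x)) \<le> (1 - (t n)^2) / 2 * Q V u"
        using ghF_integrable[OF W_H[OF W]] ghF_integrable[OF W_H[OF Wn(2)]] by (simp add: q Gi_def)
      then have "(t n)^2 * Q V u / 2 - (LINT x|lborel. F (t n * u x)) \<le> Q V u / 2 - (LINT x|lborel. F (u x))"
        by (simp add: field_simps)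
      then show ?thesis unfolding I_def Q_mult Nehari_energy[OF u(1)] .
    qed
    also have "J u \<le> J (\<lambda>x. t n * (u x + \<tau> n * v x))" by (rule min[OF \<tau>t(5)])
    also have "\<dots> = I (\<lambda>x. t n * (u x + \<tau> n * v x))" unfolding I_def by (rule Nehari_energy[OF \<tau>t(5), symmetric])
    finally have "0 \<le> I (\<lambda>x. t n * (u x + \<tau> n * v x)) - I (\<lambda>x. t n * u x)" by simp
    also have "\<dots> = \<tau> n * ((t n)^2 * (Bf V u v + \<tau> n * Q V v / 2) - (LINT x|lborel. q' n x))"
    proof -
      have "(LINT x|lborel. q' n x) = ((LINT x|lborel. F (t n * (u x + \<tau> n * v x))) - (LINT x|lborel. F (t n * u x))) / \<tau> n"
        unfolding q'_def using ghF_integrable(3)[OF W_H[OF Wn(1)], of n] ghF_integrable(3)[OF W_H[OF Wn(2)], of n]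
        by (simp add: distrib_left)
      then have "\<tau> n * (LINT x|lborel. q' n x) = (LINT x|lborel. F (t n * (u x + \<tau> n * v x))) - (LINT x|lborel. F (t n * u x))"
        using \<tau>t(1)[of n] by simp
      moreover have "T * (A + 2 * c * B + c^2 * E) / 2 - X - (T * A / 2 - Y) = c * (T * (B + c * E / 2) - Z)"
        if "c * Z = X - Y" for T A B E X Y Z c :: real
        unfolding right_diff_distrib that by (simp add: power2_eq_square algebra_simps add_divide_distrib)
      ultimately show ?thesis unfolding I_def Q_mult Q_add[OF W v] by blast
    qed
    finally show ?thesis using \<tau>t(1)[of n] by (simp add: zero_le_mult_iff)
  qed
  have lq: "(\<lambda>n. LINT x|lborel. q' n x) \<longlonglongrightarrow> (LINT x|lborel. f (u x) * v x)"
  proof -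
    obtain C where C: "C > 0" "\<And>y. \<bar>f y\<bar> \<le> C * (\<bar>y\<bar> + \<bar>y\<bar> powr (p - 1))" using f_bound_crude by blast
    define k where "k x = 2 * (\<bar>u x\<bar> + \<bar>v x\<bar>)" for x
    have k: "H k" unfolding k_def by (rule W_H[of V], intro W_mult W_add W_abs V W v)
    \<comment> \<open>These mean value points need not depend measurably on \<open>x\<close>. They
      only serve pointwise bounds and limits; measurability of \<open>q' n\<close> comes from its
      definition by \<open>F\<close>.\<close>
    define \<xi> where "\<xi> n x = (SOME \<xi>. \<bar>\<xi> - t n * u x\<bar> \<le> \<bar>t n * (\<tau> n * v x)\<bar> \<and> F (t n * u x + t n * (\<tau> n * v x)) - F (t n * u x) = t n * (\<tau> n * v x) * f \<xi>)" for n x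
    have \<xi>: "\<bar>\<xi> n x - t n * u x\<bar> \<le> \<bar>t n * (\<tau> n * v x)\<bar>"
      "F (t n * u x + t n * (\<tau> n * v x)) - F (t n * u x) = t n * (\<tau> n * v x) * f (\<xi> n x)" for n x
      unfolding \<xi>_def using someI_ex[OF F_increment[where a="t n * u x" and b="t n * (\<tau> n * v x)"]] by auto
    have q'e: "q' n x = t n * v x * f (\<xi> n x)" for n x
      unfolding q'_def \<xi>(2) using \<tau>t(1)[of n] by simp
    show ?thesis
    proof (rule integral_dominated_convergence)
      show "integrable lborel (\<lambda>x. C * \<Phi> (k x))" using \<Phi>_integrable[OF k] by simp
      show "(\<lambda>x. f (u x) * v x) \<in> borel_measurable lborel" by measurable
      show "q' n \<in> borel_measurable lborel" for n
        unfolding q'_def using borel_measurable_continuous_onI[OF cont_ghF(3)] by measurable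
      show "AE x in lborel. (\<lambda>n. q' n x) \<longlonglongrightarrow> f (u x) * v x"
      proof (rule AE_I2)
        fix x
        have "(\<lambda>n. \<bar>t n * (\<tau> n * v x)\<bar>) \<longlonglongrightarrow> \<bar>1 * (0 * v x)\<bar>" by (intro tendsto_intros t1 \<tau>0)
        then have z: "(\<lambda>n. \<bar>t n * (\<tau> n * v x)\<bar>) \<longlonglongrightarrow> 0" by simp
        have "(\<lambda>n. \<xi> n x - t n * u x) \<longlonglongrightarrow> 0"
          by (rule Lim_null_comparison[OF _ z]) (use \<xi>(1) in \<open>intro always_eventually allI, simp\<close>)
        from tendsto_add[OF this tendsto_mult[OF t1 tendsto_const[of "u x"]]] have "(\<lambda>n. \<xi> n x) \<longlonglongrightarrow> u x" by simp
        then have "(\<lambda>n. f (\<xi> n x)) \<longlonglongrightarrow> f (u x)" by (rule isCont_tendsto_compose[OF f_isCont])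
        then have "(\<lambda>n. t n * v x * f (\<xi> n x)) \<longlonglongrightarrow> 1 * v x * f (u x)" by (intro tendsto_intros t1)
        then show "(\<lambda>n. q' n x) \<longlonglongrightarrow> f (u x) * v x" unfolding q'e by (simp add: mult.commute)
      qed
      show "AE x in lborel. norm (q' n x) \<le> C * \<Phi> (k x)" for n
      proof (rule AE_I2)
        fix x
        have tv: "\<bar>t n * v x\<bar> \<le> k x"
          using t2[of n] mult_mono[of "t n" 2 "\<bar>v x\<bar>" "\<bar>u x\<bar> + \<bar>v x\<bar>"] by (simp add: k_def abs_mult)
        have "\<bar>\<xi> n x\<bar> \<le> \<bar>\<xi> n x - t n * u x\<bar> + \<bar>t n * u x\<bar>" using abs_triangle_ineq[of "\<xi> n x - t n * u x" "t n * u x"] by simp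
        also have "\<dots> \<le> \<bar>t n * (\<tau> n * v x)\<bar> + \<bar>t n * u x\<bar>" using \<xi>(1) by (rule add_right_mono)
        also have "\<dots> = t n * (\<tau> n * \<bar>v x\<bar> + \<bar>u x\<bar>)" using t2(1)[of n] \<tau>t(1)[of n] by (simp add: abs_mult distrib_left)
        also have "\<dots> \<le> 2 * (1 * \<bar>v x\<bar> + \<bar>u x\<bar>)"
          using t2[of n] \<tau>t(1)[of n] by (intro mult_mono add_mono mult_right_mono) (auto intro!: add_nonneg_nonneg mult_nonneg_nonneg less_imp_le)
        finally have \<xi>k: "\<bar>\<xi> n x\<bar> \<le> k x" by (simp add: k_def add.commute)
        have k0: "0 \<le> k x" by (simp add: k_def)
        have "\<bar>f (\<xi> n x)\<bar> \<le> C * (k x + k x powr (p - 1))"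
          by (rule order_trans[OF C(2)]) (use \<xi>k C(1) p3 in \<open>intro mult_left_mono add_mono powr_mono2, auto\<close>)
        then have "\<bar>t n * v x\<bar> * \<bar>f (\<xi> n x)\<bar> \<le> k x * (C * (k x + k x powr (p - 1)))"
          using tv k0 by (intro mult_mono) auto
        also have "\<dots> = C * (k x * k x + \<bar>k x\<bar> powr (p - 1) * \<bar>k x\<bar>)" using k0 by (simp add: algebra_simps)
        also have "\<dots> = C * \<Phi> (k x)" unfolding powr_p_mult by (simp add: \<Phi>_def power2_eq_square)
        finally show "norm (q' n x) \<le> C * \<Phi> (k x)" unfolding q'e by (simp add: abs_mult)
      qed
    qed
  qed
  have "(\<lambda>n. (t n)^2 * (Bf V u v + \<tau> n * Q V v / 2) - (LINT x|lborel. q' n x)) \<longlonglongrightarrow> 1^2 * (Bf V u v + 0 * Q V v / 2) - (LINT x|lborel. f (u x) * v x)"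
    by (intro tendsto_intros t1 \<tau>0 lq) auto
  then have "(\<lambda>n. (t n)^2 * (Bf V u v + \<tau> n * Q V v / 2) - (LINT x|lborel. q' n x)) \<longlonglongrightarrow> Bf V u v - (LINT x|lborel. f (u x) * v x)" by simp
  then have "0 \<le> Bf V u v - (LINT x|lborel. f (u x) * v x)" by (rule LIMSEQ_le_const) (use step in auto)
  then show ?thesis by simp
qed

theorem critical_point:
  assumes V: "pot V" and u: "Neh V u" "\<And>x. 0 \<le> u x" and min: "\<And>w. Neh V w \<Longrightarrow> J u \<le> J w" and v: "W V v"
  shows "Bf V u v = (LINT x|lborel. f (u x) * v x)"
proof (rule antisym)
  have "(LINT x|lborel. f (u x) * (-1 * v x)) \<le> Bf V u (\<lambda>x. -1 * v x)"
    by (rule critical_ge[OF V u min W_mult[OF v]])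
  moreover have "Bf V u (\<lambda>x. -1 * v x) = - Bf V u v" unfolding Bf_def pdiff_mult by simp
  ultimately show "Bf V u v \<le> (LINT x|lborel. f (u x) * v x)" by simp
qed (rule critical_ge[OF V u min v])

section \<open>Positivity of minimisers\<close>

definition tent :: "real \<Rightarrow> 'a \<Rightarrow> real" where "tent R x = max 0 (R - norm x)"

lemma tent_props:
  shows "0 \<le> tent R x" "norm x < R \<Longrightarrow> tent R x > 0" "norm x \<ge> R \<Longrightarrow> tent R x = 0"
    "\<bar>tent R x - tent R y\<bar> \<le> norm (x - y)" "R \<ge> 0 \<Longrightarrow> tent R x \<le> R"
    "tent R \<in> borel_measurable borel"
proof -
  have "\<bar>norm x - norm y\<bar> \<le> norm (x - y)" by (rule norm_triangle_ineq3)
  then show "\<bar>tent R x - tent R y\<bar> \<le> norm (x - y)" by (auto simp: tent_def max_def abs_le_iff)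
  show "tent R \<in> borel_measurable borel" unfolding tent_def by measurable
qed (auto simp: tent_def)

lemma bounded_support_W:
  assumes V: "pot V" "continuous_on UNIV V" and u: "H u" and R: "\<And>x. norm x \<ge> R \<Longrightarrow> u x = 0"
  shows "W V u"
proof -
  have "compact (V ` cball 0 R)" by (intro compact_continuous_image continuous_on_subset[OF V(2)]) auto
  then have "bounded (V ` cball 0 R)" by (rule compact_imp_bounded)
  then obtain B where B0: "\<And>y. y \<in> V ` cball 0 R \<Longrightarrow> norm y \<le> B" unfolding bounded_iff by blast
  have B: "\<bar>V x\<bar> \<le> B" if "norm x \<le> R" for x using B0[of "V x"] that by simp
  note [measurable] = H_measurable[OF u] potD(1)[OF V(1)]
  have "(sqrt (V x) * u x)^2 \<le> \<bar>B\<bar> * (u x)^2" for x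
  proof (cases "norm x \<le> R")
    case True
    have "V x \<le> \<bar>B\<bar>" using B[OF True] abs_ge_self[of "V x"] abs_ge_self[of B] by simp
    then show ?thesis using potD(3)[OF V(1), of x] by (simp add: power_mult_distrib mult_right_mono)
  qed (use R[of x] in simp)
  then have "sq_integrable lborel (\<lambda>z. sqrt (V z) * u z)"
    by (intro sq_integrable_bound[of lborel "\<lambda>x. \<bar>B\<bar> * (u x)^2"]) (use u in \<open>auto simp: H_def sq_integrable_real\<close>)
  then show ?thesis using u by (simp add: W_def)
qed

text \<open>A discrete Picone identity: the expression equals
  \<open>(a * B - b * A)^2 / (A * B)\<close>. It is meant for \<open>A\<close>, \<open>B\<close> the
  values of \<open>u + \<delta>\<close> and \<open>a\<close>, \<open>b\<close> those of a cutoff at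
  two points.\<close>

lemma quotient_test_inequality:
  fixes a b A B :: real
  assumes "A > 0" "B > 0"
  shows "(a - b)^2 - (A - B) * (a^2 / A - b^2 / B) = a^2 * B / A + b^2 * A / B - 2 * a * b"
    and "0 \<le> a^2 * B / A + b^2 * A / B - 2 * a * b"
proof -
  show "(a - b)^2 - (A - B) * (a^2 / A - b^2 / B) = a^2 * B / A + b^2 * A / B - 2 * a * b"
  proof -
    have "(A - B) * (a^2 / A - b^2 / B) = a^2 * (A / A) - b^2 * A / B - a^2 * B / A + b^2 * (B / B)"
      by (simp add: algebra_simps diff_divide_distrib)
    then show ?thesis using assms by (simp add: power2_diff)
  qed
  have "0 \<le> (a * B - b * A)^2 / (A * B)" using assms by simp
  also have "(a * B - b * A)^2 = a^2 * B * B + b^2 * A * A - 2 * a * b * (A * B)"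
    by (simp add: power2_eq_square algebra_simps)
  also have "\<dots> / (A * B) = a^2 * B / A + b^2 * A / B - 2 * a * b"
    using assms by (simp add: add_divide_distrib diff_divide_distrib)
  finally show "0 \<le> a^2 * B / A + b^2 * A / B - 2 * a * b" .
qed

text \<open>Testing with \<open>\<phi>\<^sup>2 / (u + \<delta>)\<close>, the logarithmic test function of De Giorgi--Moser theory, and
  letting \<open>\<delta>\<close> tend to zero.\<close>

lemma zero_set_interaction:
  assumes V: "pot V" "continuous_on UNIV V" and u: "W V u" "\<And>x. 0 \<le> u x"
    and crit: "\<And>v. W V v \<Longrightarrow> Bf V u v = (LINT x|lborel. f (u x) * v x)" and R: "R \<ge> 1"
  shows "(\<integral>\<^sup>+z. ennreal (if u (fst z) = 0 then (tent R (fst z))^2 * u (snd z) else 0) \<partial>gag s) = 0"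
proof -
  define \<phi> where "\<phi> = tent R"
  note tp = tent_props[where R=R, folded \<phi>_def]
  have R0: "R \<ge> 0" using R by simp
  note [measurable] = W_measurable[OF u(1)] tp(6) potD(1)[OF V(1)]
  have \<phi>R: "\<bar>\<phi> x\<bar> \<le> R" for x using tp(1,5)[of x] R0 by simp
  have H\<phi>: "H \<phi>"
  proof (rule Lipschitz_bump_H[where L=R and R=R])
    show "\<bar>\<phi> x - \<phi> y\<bar> \<le> R * norm (x - y)" for x y
      by (rule order_trans[OF tp(4)]) (use R in \<open>simp add: mult_le_cancel_right1\<close>)
  qed (use \<phi>R tp in auto)
  have W\<phi>: "W V \<phi>" by (rule bounded_support_W[OF V H\<phi> tp(3)])
  \<comment> \<open>The total energy of the cutoff, which will bound the Picone remainders
    \<open>r n\<close> independently of \<open>n\<close>.\<close>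
  define K where "K = D \<phi> + P V \<phi>"
  define \<delta> where "\<delta> n = 1 / real (Suc n)" for n :: nat
  have \<delta>: "\<delta> n > 0" for n by (simp add: \<delta>_def)
  have \<delta>0: "\<delta> \<longlonglongrightarrow> 0" unfolding \<delta>_def by (rule LIMSEQ_Suc[OF lim_inverse_n'])
  define r where "r n z = (\<phi> (fst z))^2 * (u (snd z) + \<delta> n) / (u (fst z) + \<delta> n)
     + (\<phi> (snd z))^2 * (u (fst z) + \<delta> n) / (u (snd z) + \<delta> n) - 2 * \<phi> (fst z) * \<phi> (snd z)" for n z
  have r0: "r n z \<ge> 0" for n z
    unfolding r_def by (rule quotient_test_inequality(2)) (use u(2) \<delta> in \<open>auto intro: add_nonneg_pos\<close>)
  have rm [measurable]: "r n \<in> borel_measurable borel" for n unfolding r_def by measurable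
  have rI: "(\<integral>\<^sup>+z. ennreal (r n z) \<partial>gag s) \<le> ennreal K" for n
  proof -
    define v where "v x = (\<phi> x)^2 / (u x + \<delta> n)" for x
    have ud: "u x + \<delta> n \<ge> \<delta> n" "u x + \<delta> n > 0" for x using u(2)[of x] \<delta>[of n] by auto
    have vm [measurable]: "v \<in> borel_measurable borel" unfolding v_def by measurable
    have \<phi>2: "(\<phi> x)^2 \<le> R^2" for x using power_mono[OF \<phi>R, of x 2] by simp
    \<comment> \<open>The quotient is Lipschitz in the pair of values of \<open>\<phi>\<close> and
      \<open>u\<close> as long as \<open>\<delta> n\<close> is fixed; hence it has finite energy and
      is an admissible test function.\<close>
    have dv: "\<bar>v x - v y\<bar> \<le> (2 * R / \<delta> n) * \<bar>\<phi> x - \<phi> y\<bar> + (R^2 / (\<delta> n)^2) * \<bar>u x - u y\<bar>" for x y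
    proof -
      have e: "v x - v y = (\<phi> x + \<phi> y) * (\<phi> x - \<phi> y) / (u x + \<delta> n) + (\<phi> y)^2 * (u y - u x) / ((u x + \<delta> n) * (u y + \<delta> n))"
      proof -
        have "X^2 / A - Y^2 / B = (X + Y) * (X - Y) / A + Y^2 * (B - A) / (A * B)" if "A > 0" "B > 0" for X Y A B :: real
          using that by (simp add: power2_eq_square divide_simps, simp add: algebra_simps)
        from this[OF ud(2) ud(2)] show ?thesis by (simp add: v_def)
      qed
      have "\<bar>(\<phi> x + \<phi> y) * (\<phi> x - \<phi> y) / (u x + \<delta> n)\<bar> \<le> (2 * R / \<delta> n) * \<bar>\<phi> x - \<phi> y\<bar>"
      proof -
        have "\<bar>(\<phi> x + \<phi> y) * (\<phi> x - \<phi> y) / (u x + \<delta> n)\<bar> = (\<bar>\<phi> x + \<phi> y\<bar> * \<bar>\<phi> x - \<phi> y\<bar>) / (u x + \<delta> n)"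
          using ud(2)[of x] by (simp add: abs_mult abs_divide)
        also have "\<dots> \<le> (2 * R * \<bar>\<phi> x - \<phi> y\<bar>) / \<delta> n"
        proof (rule frac_le)
          have "\<bar>\<phi> x + \<phi> y\<bar> \<le> \<bar>\<phi> x\<bar> + \<bar>\<phi> y\<bar>" by (rule abs_triangle_ineq)
          also have "\<dots> \<le> 2 * R" using \<phi>R[of x] \<phi>R[of y] by simp
          finally show "\<bar>\<phi> x + \<phi> y\<bar> * \<bar>\<phi> x - \<phi> y\<bar> \<le> 2 * R * \<bar>\<phi> x - \<phi> y\<bar>" by (rule mult_right_mono) simp
        qed (use ud \<delta> R0 in auto)
        finally show ?thesis by simp
      qed
      moreover have "\<bar>(\<phi> y)^2 * (u y - u x) / ((u x + \<delta> n) * (u y + \<delta> n))\<bar> \<le> (R^2 / (\<delta> n)^2) * \<bar>u x - u y\<bar>"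
      proof -
        have "\<bar>(\<phi> y)^2 * (u y - u x) / ((u x + \<delta> n) * (u y + \<delta> n))\<bar> = ((\<phi> y)^2 * \<bar>u x - u y\<bar>) / ((u x + \<delta> n) * (u y + \<delta> n))"
          using ud(2)[of x] ud(2)[of y] by (simp add: abs_mult abs_divide abs_minus_commute)
        also have "\<dots> \<le> (R^2 * \<bar>u x - u y\<bar>) / (\<delta> n * \<delta> n)"
          using \<phi>2[of y] ud(1)[of x] ud(1)[of y] \<delta>[of n] by (intro frac_le mult_right_mono mult_mono) auto
        finally show ?thesis by (simp add: power2_eq_square)
      qed
      ultimately show ?thesis unfolding e by (intro order_trans[OF abs_triangle_ineq] add_mono)
    qed
    have Hv: "H v"
    proof -
      have "sq_integrable lborel v"
      proof (rule sq_integrable_bound)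
        show "integrable lborel (\<lambda>x. (R / \<delta> n)^2 * (\<phi> x)^2)" using H\<phi> by (simp add: H_def sq_integrable_real)
        show "AE x in lborel. (norm (v x))^2 \<le> (R / \<delta> n)^2 * (\<phi> x)^2"
        proof (rule AE_I2)
          fix x
          have "\<bar>v x\<bar> = (\<bar>\<phi> x\<bar> * \<bar>\<phi> x\<bar>) / (u x + \<delta> n)" using ud(2)[of x] by (simp add: v_def power2_eq_square)
          also have "\<dots> \<le> (R * \<bar>\<phi> x\<bar>) / \<delta> n" using \<phi>R ud \<delta> R0 by (intro frac_le mult_right_mono) auto
          finally have "\<bar>v x\<bar> \<le> (R / \<delta> n) * \<bar>\<phi> x\<bar>" by simp
          from power_mono[OF this, of 2] show "(norm (v x))^2 \<le> (R / \<delta> n)^2 * (\<phi> x)^2" by (simp add: power_mult_distrib power_divide)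
        qed
      qed simp
      moreover have "sq_integrable (gag s) (pdiff v)"
      proof (rule sq_integrable_bound)
        show "integrable (gag s) (\<lambda>z. 2 * (2 * R / \<delta> n)^2 * (pdiff \<phi> z)^2 + 2 * (R^2 / (\<delta> n)^2)^2 * (pdiff u z)^2)"
          using H\<phi> W_H[OF u(1)] by (simp add: H_def sq_integrable_real)
        show "AE z in gag s. (norm (pdiff v z))^2 \<le> 2 * (2 * R / \<delta> n)^2 * (pdiff \<phi> z)^2 + 2 * (R^2 / (\<delta> n)^2)^2 * (pdiff u z)^2"
        proof (rule AE_I2)
          fix z :: "'a \<times> 'a"
          have "\<bar>pdiff v z\<bar> \<le> (2 * R / \<delta> n) * \<bar>pdiff \<phi> z\<bar> + (R^2 / (\<delta> n)^2) * \<bar>pdiff u z\<bar>" unfolding pdiff_def by (rule dv)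
          then have "\<bar>pdiff v z\<bar>\<^sup>2 \<le> ((2 * R / \<delta> n) * \<bar>pdiff \<phi> z\<bar> + (R^2 / (\<delta> n)^2) * \<bar>pdiff u z\<bar>)^2" by (rule power_mono) simp
          also have "\<dots> \<le> 2 * ((2 * R / \<delta> n) * \<bar>pdiff \<phi> z\<bar>)^2 + 2 * ((R^2 / (\<delta> n)^2) * \<bar>pdiff u z\<bar>)^2"
          proof -
            have "(a + b)^2 \<le> 2 * a^2 + 2 * b^2" for a b :: real using norm_add_sq_le[of a b] by simp
            then show ?thesis .
          qed
          finally show "(norm (pdiff v z))^2 \<le> 2 * (2 * R / \<delta> n)^2 * (pdiff \<phi> z)^2 + 2 * (R^2 / (\<delta> n)^2)^2 * (pdiff u z)^2"
            unfolding power_mult_distrib[of "2 * R / \<delta> n"] power_mult_distrib[of "R^2 / (\<delta> n)^2"] by simp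
        qed
      qed measurable
      ultimately show ?thesis by (simp add: H_def)
    qed
    have Wv: "W V v"
      by (rule bounded_support_W[OF V Hv, of R]) (simp add: v_def tp(3))
    have pI: "integrable (gag s) (\<lambda>z. pdiff u z * pdiff v z)"
      using sq_integrable_prod[of "gag s" "pdiff u" "pdiff v"] Hv W_H[OF u(1)] by (simp add: H_def)
    have \<phi>I: "integrable (gag s) (\<lambda>z. (pdiff \<phi> z)^2)" using H\<phi> by (simp add: H_def sq_integrable_real)
    have re: "r n z = (pdiff \<phi> z)^2 - pdiff u z * pdiff v z" for z
    proof -
      have "pdiff u z * pdiff v z = ((u (fst z) + \<delta> n) - (u (snd z) + \<delta> n)) * ((\<phi> (fst z))^2 / (u (fst z) + \<delta> n) - (\<phi> (snd z))^2 / (u (snd z) + \<delta> n))"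
        by (simp add: pdiff_def v_def)
      then show ?thesis unfolding r_def pdiff_def[of \<phi>]
        using quotient_test_inequality(1)[OF ud(2) ud(2), of "\<phi> (fst z)" "\<phi> (snd z)" "fst z" "snd z"] by simp
    qed
    have "(\<integral>\<^sup>+z. ennreal (r n z) \<partial>gag s) = ennreal (LINT z|gag s. (pdiff \<phi> z)^2 - pdiff u z * pdiff v z)"
    proof -
      have rn: "r n = (\<lambda>z. (pdiff \<phi> z)^2 - pdiff u z * pdiff v z)" by (rule ext) (rule re)
      have "integrable (gag s) (r n)" unfolding rn by (intro Bochner_Integration.integrable_diff pI \<phi>I)
      from nn_integral_eq_integral[OF this] show ?thesis using r0[of n] unfolding rn[symmetric] by simp
    qed
    also have "(LINT z|gag s. (pdiff \<phi> z)^2 - pdiff u z * pdiff v z) = D \<phi> - (LINT z|gag s. pdiff u z * pdiff v z)"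
      using pI \<phi>I by (simp add: D_def)
    \<comment> \<open>By the equation the energy product equals a nonnegative integral of
      \<open>f (u x) * v x\<close> minus the potential term, and \<open>u * v \<le> \<phi>^2\<close>
      bounds the latter by \<open>P V \<phi>\<close>, whatever \<open>\<delta> n\<close> is.\<close>
    also have "\<dots> \<le> K"
    proof -
      have v0: "v x \<ge> 0" for x using ud(2)[of x] by (simp add: v_def)
      have "0 \<le> (LINT x|lborel. f (u x) * v x)" using f_nonneg v0 by simp
      moreover have "(LINT z|lborel. (sqrt (V z) * u z) * (sqrt (V z) * v z)) \<le> P V \<phi>" unfolding P_def
      proof (rule integral_mono)
        show "integrable lborel (\<lambda>z. (sqrt (V z) * u z) * (sqrt (V z) * v z))"
          using sq_integrable_prod[of lborel "\<lambda>z. sqrt (V z) * u z" "\<lambda>z. sqrt (V z) * v z"] Wv u(1) by (simp add: W_def)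
        show "integrable lborel (\<lambda>z. (sqrt (V z) * \<phi> z)^2)" using W\<phi> by (simp add: W_def sq_integrable_real)
        fix z
        have "u z * v z = (\<phi> z)^2 * (u z / (u z + \<delta> n))" by (simp add: v_def)
        also have "\<dots> \<le> (\<phi> z)^2 * 1" using ud[of z] u(2)[of z] \<delta>[of n] by (intro mult_left_mono) auto
        finally have "V z * (u z * v z) \<le> V z * (\<phi> z)^2" using potD(3)[OF V(1), of z] by (intro mult_left_mono) auto
        moreover have "(sqrt (V z) * u z) * (sqrt (V z) * v z) = (sqrt (V z))^2 * (u z * v z)" by (simp only: power2_eq_square mult_ac)
        moreover have "(sqrt (V z))^2 = V z" using potD(3)[OF V(1), of z] by simp
        ultimately show "(sqrt (V z) * u z) * (sqrt (V z) * v z) \<le> (sqrt (V z) * \<phi> z)^2"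
          by (simp only: power_mult_distrib)
      qed
      ultimately show ?thesis using crit[OF Wv] unfolding Bf_def K_def by linarith
    qed
    finally show ?thesis by (simp add: ennreal_leI)
  qed
  have K0: "K \<ge> 0" by (simp add: K_def)
  \<comment> \<open>Multiplication by \<open>\<delta> n\<close> isolates the singular term: where
    \<open>u (fst z) = 0\<close> it tends to \<open>(\<phi> (fst z))^2 * u (snd z)\<close>, while
    the integral of \<open>\<delta> n * r n\<close> is at most
    \<open>\<delta> n * K\<close>.\<close>
  have lim: "ennreal (if u (fst z) = 0 then (\<phi> (fst z))^2 * u (snd z) else 0) \<le> liminf (\<lambda>n. ennreal (\<delta> n * r n z))" for z
  proof (cases "u (fst z) = 0")
    case True
    define a b y where "a = \<phi> (fst z)" and "b = \<phi> (snd z)" and "y = u (snd z)"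
    have y0: "y \<ge> 0" by (simp add: y_def u(2))
    have dr: "\<delta> n * r n z = a^2 * (y + \<delta> n) + b^2 * (\<delta> n * (\<delta> n / (y + \<delta> n))) - 2 * a * b * \<delta> n" for n
      using \<delta>[of n] True unfolding r_def a_def[symmetric] b_def[symmetric] y_def[symmetric] by (simp add: algebra_simps, simp add: add_divide_distrib)
    \<comment> \<open>The quotient is at most 1 also when \<open>y = 0\<close>, so one factor
      \<open>\<delta> n\<close> suffices in all cases.\<close>
    have sm: "(\<lambda>n. \<delta> n * (\<delta> n / (y + \<delta> n))) \<longlonglongrightarrow> 0"
    proof (rule tendsto_sandwich[OF _ _ tendsto_const \<delta>0])
      show "\<forall>\<^sub>F n in sequentially. 0 \<le> \<delta> n * (\<delta> n / (y + \<delta> n))" using \<delta> y0 by (auto intro!: always_eventually less_imp_le[OF \<delta>] mult_nonneg_nonneg divide_nonneg_nonneg add_nonneg_nonneg simp: less_imp_le)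
      have "\<delta> n / (y + \<delta> n) \<le> 1" for n using \<delta>[of n] y0 by simp
      then show "\<forall>\<^sub>F n in sequentially. \<delta> n * (\<delta> n / (y + \<delta> n)) \<le> \<delta> n"
        using \<delta> by (intro always_eventually allI mult_left_le) (auto intro: less_imp_le)
    qed
    have "(\<lambda>n. a^2 * (y + \<delta> n) + b^2 * (\<delta> n * (\<delta> n / (y + \<delta> n))) - 2 * a * b * \<delta> n) \<longlonglongrightarrow> a^2 * (y + 0) + b^2 * 0 - 2 * a * b * 0"
      by (intro tendsto_intros \<delta>0 sm)
    then have "(\<lambda>n. ennreal (\<delta> n * r n z)) \<longlonglongrightarrow> ennreal (a^2 * y)" unfolding dr by (intro tendsto_ennrealI) simp
    from lim_imp_Liminf[OF _ this] show ?thesis using True by (simp add: a_def y_def)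
  qed simp
  have "(\<integral>\<^sup>+z. ennreal (if u (fst z) = 0 then (\<phi> (fst z))^2 * u (snd z) else 0) \<partial>gag s) \<le> (\<integral>\<^sup>+z. liminf (\<lambda>n. ennreal (\<delta> n * r n z)) \<partial>gag s)"
    by (rule nn_integral_mono) (rule lim)
  also have "\<dots> \<le> liminf (\<lambda>n. \<integral>\<^sup>+z. ennreal (\<delta> n * r n z) \<partial>gag s)"
    by (rule nn_integral_liminf) measurable
  also have "\<dots> \<le> liminf (\<lambda>n. ennreal (\<delta> n * K))"
  proof (rule Liminf_mono, intro always_eventually allI)
    fix n
    have "(\<integral>\<^sup>+z. ennreal (\<delta> n * r n z) \<partial>gag s) = (\<integral>\<^sup>+z. ennreal (\<delta> n) * ennreal (r n z) \<partial>gag s)"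
      using \<delta>[of n] r0[of n] by (simp add: ennreal_mult)
    also have "\<dots> = ennreal (\<delta> n) * (\<integral>\<^sup>+z. ennreal (r n z) \<partial>gag s)" by (rule nn_integral_cmult) measurable
    also have "\<dots> \<le> ennreal (\<delta> n) * ennreal K" by (rule mult_left_mono[OF rI]) simp
    also have "\<dots> = ennreal (\<delta> n * K)" using \<delta>[of n] K0 by (simp add: ennreal_mult)
    finally show "(\<integral>\<^sup>+z. ennreal (\<delta> n * r n z) \<partial>gag s) \<le> ennreal (\<delta> n * K)" .
  qed
  also have "\<dots> = 0"
  proof -
    have "(\<lambda>n. ennreal (\<delta> n * K)) \<longlonglongrightarrow> ennreal (0 * K)" by (intro tendsto_ennrealI tendsto_intros \<delta>0)
    from lim_imp_Liminf[OF _ this] show ?thesis by simp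
  qed
  finally show ?thesis unfolding \<phi>_def le_zero_eq .
qed

text \<open>A nonlocal strong maximum principle. For almost every zero \<open>x\<close> of
  \<open>u\<close> inside the cutoff, the vanishing interaction integral and the strict positivity
  of the kernel force \<open>u y = 0\<close> for almost every \<open>y\<close>, against
  \<open>\<not> null u\<close>.\<close>

theorem solution_positive:
  assumes V: "pot V" "continuous_on UNIV V" and u: "W V u" "\<And>x. 0 \<le> u x" "\<not> null u"
    and crit: "\<And>v. W V v \<Longrightarrow> Bf V u v = (LINT x|lborel. f (u x) * v x)"
  shows "AE x in lborel. 0 < u x"
proof -
  note [measurable] = W_measurable[OF u(1)] tent_props(6)
  have kp: "gag_ker s (x - y) > 0" if "x \<noteq> y" for x y :: 'a
    using that c0 by (simp add: gag_ker_def c0_def[symmetric])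
  have "AE x in lborel. \<not> (u x = 0 \<and> norm x < real (Suc n))" for n
  proof -
    let ?k = "\<lambda>x y. ennreal (gag_ker s (x - y)) * ennreal (if u x = 0 then (tent (Suc n) x)^2 * u y else 0)"
    have km: "(\<lambda>z. ?k (fst z) (snd z)) \<in> borel_measurable (lborel \<Otimes>\<^sub>M lborel)" unfolding lborel_prod by measurable
    have "(\<integral>\<^sup>+x. \<integral>\<^sup>+y. ?k x y \<partial>lborel \<partial>lborel) = 0"
    proof -
      have "(\<integral>\<^sup>+z. ennreal (if u (fst z) = 0 then (tent (Suc n) (fst z))^2 * u (snd z) else 0) \<partial>gag s) = 0"
        by (rule zero_set_interaction[OF V u(1,2)]) (use crit in auto)
      then show ?thesis by (subst (asm) nn_integral_gag) (measurable, simp cong: if_cong)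
    qed
    moreover have "(\<lambda>x. \<integral>\<^sup>+y. ?k x y \<partial>lborel) \<in> borel_measurable lborel"
      using lborel.borel_measurable_nn_integral_fst[OF km] by simp
    ultimately have "AE x in lborel. (\<integral>\<^sup>+y. ?k x y \<partial>lborel) = 0"
      by (simp add: nn_integral_0_iff_AE)
    then show ?thesis
    proof eventually_elim
      case (elim x)
      show ?case
      proof
        assume x: "u x = 0 \<and> norm x < real (Suc n)"
        have "AE y in lborel. ?k x y = 0" using elim by (subst (asm) nn_integral_0_iff_AE) auto
        moreover have "AE y in lborel. y \<noteq> x" by (rule AE_lborel_singleton)
        ultimately have "AE y in lborel. u y = 0"
        proof eventually_elim
          case (elim y)
          have t: "tent (real (Suc n)) x > 0" using x tent_props(2) by blast
          have k: "ennreal (gag_ker s (x - y)) \<noteq> 0" using kp[of x y] elim(2) by (simp add: ennreal_eq_0_iff not_le)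
          have "ennreal ((tent (real (Suc n)) x)^2 * u y) = 0"
            using elim(1) k unfolding mult_eq_0_iff by (simp only: x[THEN conjunct1] simp_thms if_True)
          then have "(tent (real (Suc n)) x)^2 * u y \<le> 0" unfolding ennreal_eq_0_iff .
          moreover have "0 < (tent (real (Suc n)) x)^2 * u y" if "0 < u y" using t that by (intro mult_pos_pos zero_less_power)
          ultimately show ?case using u(2)[of y] by (metis less_le not_le)
        qed
        then show False using u(3) by (simp add: null_def)
      qed
    qed
  qed
  then have "AE x in lborel. \<forall>n. \<not> (u x = 0 \<and> norm x < real (Suc n))" unfolding AE_all_countable by blast
  then show ?thesis
  proof eventually_elim
    case (elim x)
    obtain n :: nat where "norm x < n" using reals_Archimedean2 by blast
    then have "norm x < real (Suc n)" by simp
    then show ?case using elim u(2)[of x] by (metis less_le)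
  qed
qed

section \<open>Comparison of levels\<close>

text \<open>On a ball where the tent is at least \<open>1/2\<close>, the growth
  \<open>t powr \<theta>\<close> of \<open>F\<close> with \<open>\<theta> > 2\<close> outweighs
  \<open>t^2 * Q V \<phi>\<close>. So some multiple of the tent has \<open>G \<le> 0\<close> and can
  be projected.\<close>

lemma Nehari_nonempty:
  assumes V: "pot V" "continuous_on UNIV V"
  shows "\<exists>w. Neh V w"
proof -
  define \<phi> :: "'a \<Rightarrow> real" where "\<phi> = tent 1"
  note tp = tent_props[where R=1, folded \<phi>_def]
  note [measurable] = tp(6)
  have H\<phi>: "H \<phi>"
    by (rule Lipschitz_bump_H[where L=1 and R=1]) (use tp in auto)
  have W\<phi>: "W V \<phi>" by (rule bounded_support_W[OF V H\<phi> tp(3)])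
  let ?B = "ball (0::'a) (1/2)"
  have Bb: "?B \<in> sets lborel" "emeasure lborel ?B < \<infinity>" using emeasure_lborel_ball_finite by auto
  define b where "b = measure lborel ?B"
  have b: "b > 0" unfolding b_def by (rule content_ball_pos) simp
  have \<phi>B: "1/2 \<le> \<phi> x" if "x \<in> ?B" for x using that by (auto simp: \<phi>_def tent_def)
  have nz: "\<not> null \<phi>"
  proof
    assume "null \<phi>"
    then have "AE x in lborel. x \<notin> ?B" unfolding null_def
      by eventually_elim (use \<phi>B in fastforce)
    then have "emeasure lborel ?B = 0" using Bb by (subst (asm) AE_iff_measurable[of ?B]) auto
    then show False using b by (simp add: b_def measure_def)
  qed
  have F1: "F 1 > 0" by (rule F_pos) simp
  have low: "\<theta> * (F 1 * (t / 2) powr \<theta>) * b \<le> Gi (\<lambda>x. t * \<phi> x)" if t: "t \<ge> 2" for t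
  proof -
    have "(LINT x|lborel. \<theta> * (F 1 * (t / 2) powr \<theta>) * indicator ?B x) \<le> Gi (\<lambda>x. t * \<phi> x)"
      unfolding Gi_def
    proof (rule integral_mono)
      show "integrable lborel (\<lambda>x. \<theta> * (F 1 * (t / 2) powr \<theta>) * indicator ?B x)" using Bb by (simp add: integrable_indicator_iff)
      show "integrable lborel (\<lambda>x. g (t * \<phi> x))" by (rule ghF_integrable(1)[OF H_mult[OF H\<phi>]])
      fix x
      show "\<theta> * (F 1 * (t / 2) powr \<theta>) * indicator ?B x \<le> g (t * \<phi> x)"
      proof (cases "x \<in> ?B")
        case True
        have 1: "t / 2 \<le> t * \<phi> x" using mult_left_mono[OF \<phi>B[OF True], of t] t by simp
        have "F 1 * (t / 2) powr \<theta> \<le> F 1 * (t * \<phi> x) powr \<theta>"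
          using 1 t F1 \<theta> by (intro mult_left_mono powr_mono2) auto
        also have "\<dots> \<le> F (t * \<phi> x)" using order_trans[OF _ 1, of 1] t by (intro F_superquadratic) simp
        finally have "\<theta> * (F 1 * (t / 2) powr \<theta>) \<le> \<theta> * F (t * \<phi> x)" using \<theta> by (intro mult_left_mono) auto
        also have "\<dots> \<le> g (t * \<phi> x)" by (rule g_AR)
        finally show ?thesis using True by simp
      next
        case False then show ?thesis using g_nonneg by simp
      qed
    qed
    then show ?thesis using Bb by (simp add: b_def)
  qed
  define A where "A = \<theta> * F 1 * b * (1/2) powr \<theta>"
  have A: "A > 0" using \<theta> F1 b by (simp add: A_def)
  \<comment> \<open>The second entry gives
    \<open>Q V \<phi> \<le> A * t powr (\<theta> - 2)\<close>. The entry 2 ensures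
    \<open>t * \<phi> x \<ge> 1\<close> on the ball, where \<open>F_superquadratic\<close>
    applies.\<close>
  define t where "t = max 2 ((Q V \<phi> / A) powr (1 / (\<theta> - 2)))"
  have t: "t \<ge> 2" "(Q V \<phi> / A) powr (1 / (\<theta> - 2)) \<le> t" by (auto simp: t_def)
  have q: "Q V \<phi> > 0" by (rule Q_pos[OF V(1) W\<phi> nz])
  have "Q V \<phi> / A = ((Q V \<phi> / A) powr (1 / (\<theta> - 2))) powr (\<theta> - 2)" using q A \<theta> by (simp add: powr_powr)
  also have "\<dots> \<le> t powr (\<theta> - 2)" using t \<theta> by (intro powr_mono2) auto
  finally have "Q V \<phi> \<le> A * t powr (\<theta> - 2)" using A by (simp add: divide_le_eq mult.commute)
  then have "t^2 * Q V \<phi> \<le> t^2 * (A * t powr (\<theta> - 2))" by (rule mult_left_mono) simp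
  also have "\<dots> = A * t powr \<theta>" using t powr_add[of t "\<theta> - 2" 2] by (simp add: powr_numeral)
  also have "\<dots> = \<theta> * (F 1 * (t / 2) powr \<theta>) * b" using t by (simp add: A_def powr_divide)
  also have "\<dots> \<le> Gi (\<lambda>x. t * \<phi> x)" by (rule low[OF t(1)])
  finally have "G V (\<lambda>x. t * \<phi> x) \<le> 0" by (simp add: G_def Q_mult)
  moreover have "\<not> null (\<lambda>x. t * \<phi> x)" using nz t null_mult[of t \<phi>] by simp
  ultimately show ?thesis using Nehari_projection[OF V(1) W_mult[OF W\<phi>, of t]] by metis
qed

section \<open>Cutoffs and compactly supported competitors\<close>

lemma P_const: "A \<ge> 0 \<Longrightarrow> P (\<lambda>_. A) u = A * S u"
  by (simp add: P_def S_def power_mult_distrib)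

lemma W_const: "H u \<Longrightarrow> W (\<lambda>_. A) u"
  using sq_integrable_mult[of lborel u "sqrt A"] by (simp add: W_def H_def)

definition cut :: "nat \<Rightarrow> 'a \<Rightarrow> real" where "cut n x = min 1 (tent (real n + 2) x)"

lemma cut_props:
  "0 \<le> cut n x" "cut n x \<le> 1" "\<bar>cut n x - cut n y\<bar> \<le> norm (x - y)" "norm x \<ge> real n + 2 \<Longrightarrow> cut n x = 0"
  "norm x \<le> real n + 1 \<Longrightarrow> cut n x = 1" "cut n \<in> borel_measurable borel"
proof -
  have "\<bar>min 1 a - min 1 b\<bar> \<le> \<bar>a - b\<bar>" for a b :: real by (auto simp: min_def)
  then show "\<bar>cut n x - cut n y\<bar> \<le> norm (x - y)" unfolding cut_def using tent_props(4) by (rule order_trans)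
  show "cut n \<in> borel_measurable borel" unfolding cut_def using tent_props(6) by measurable
qed (auto simp: cut_def tent_def)

lemma cut_tendsto: "(\<lambda>n. cut n x) \<longlonglongrightarrow> 1"
proof -
  obtain m :: nat where m: "norm x < m" using reals_Archimedean2 by blast
  have "\<forall>\<^sub>F n in sequentially. cut n x = 1"
    by (rule eventually_sequentiallyI[of m]) (use m in \<open>auto intro!: cut_props(5)\<close>)
  then show ?thesis by (rule tendsto_eventually)
qed

text \<open>By the product rule the difference of \<open>cut n x * w x\<close> splits into a cut-off
  difference of \<open>w\<close> and a term with the difference of \<open>cut n\<close>. The cutoffs
  share the Lipschitz constant 1 and the bound 1, so \<open>gm\<close> gives a majorant independent
  of \<open>n\<close>.\<close>

lemma cutoff:
  assumes w: "H w" and A: "A > 0"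
  shows "H (\<lambda>x. cut n x * w x)" "(\<lambda>n. G (\<lambda>_. A) (\<lambda>x. cut n x * w x)) \<longlonglongrightarrow> G (\<lambda>_. A) w"
proof -
  note [measurable] = H_measurable[OF w] cut_props(6)
  have ws: "sq_integrable lborel w" and wg: "sq_integrable (gag s) (pdiff w)" using w by (auto simp: H_def)
  \<comment> \<open>The factor 4 is the 2 of the squared sum times the 2 of \<open>sq_le_gm\<close>
    with \<open>L = 1\<close>.\<close>
  define k where "k z = 2 * (pdiff w z)^2 + 4 * ((w (snd z))^2 * gm z)" for z
  have ki: "integrable (gag s) k"
    unfolding k_def using wg gag_weight_integrable(2)[OF ws] by (simp add: sq_integrable_real)
  have kb: "(pdiff (\<lambda>x. cut n x * w x) z)^2 \<le> k z" for n z
  proof -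
    have e: "pdiff (\<lambda>x. cut n x * w x) z = cut n (fst z) * pdiff w z + w (snd z) * (cut n (fst z) - cut n (snd z))"
      by (simp add: pdiff_def algebra_simps)
    have "(pdiff (\<lambda>x. cut n x * w x) z)^2 \<le> 2 * (cut n (fst z) * pdiff w z)^2 + 2 * (w (snd z) * (cut n (fst z) - cut n (snd z)))^2"
      unfolding e using norm_add_sq_le[of "cut n (fst z) * pdiff w z" "w (snd z) * (cut n (fst z) - cut n (snd z))"] by simp
    also have "\<dots> \<le> k z" unfolding k_def
    proof (rule add_mono)
      have "(cut n (fst z))^2 * (pdiff w z)^2 \<le> 1 * (pdiff w z)^2"
        by (rule mult_right_mono) (use cut_props(1,2)[of n "fst z"] in \<open>auto intro: power_le_one\<close>)
      then show "2 * (cut n (fst z) * pdiff w z)^2 \<le> 2 * (pdiff w z)^2" by (simp add: power_mult_distrib)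
      have "(cut n (fst z) - cut n (snd z))^2 \<le> 2 * 1^2 * gm (fst z, snd z)"
      proof (rule sq_le_gm)
        show "\<bar>cut n (fst z) - cut n (snd z)\<bar> \<le> 1" using cut_props(1,2)[of n "fst z"] cut_props(1,2)[of n "snd z"] by (simp add: abs_le_iff)
      qed (use cut_props(3) in auto)
      then have "(w (snd z))^2 * (cut n (fst z) - cut n (snd z))^2 \<le> (w (snd z))^2 * (2 * gm z)"
        by (intro mult_left_mono) auto
      then show "2 * (w (snd z) * (cut n (fst z) - cut n (snd z)))^2 \<le> 4 * ((w (snd z))^2 * gm z)" by (simp add: power_mult_distrib mult_ac)
    qed
    finally show ?thesis .
  qed
  have cb: "\<bar>cut n x * w x\<bar> \<le> \<bar>w x\<bar>" for n x
    using cut_props(1,2)[of n x] by (simp add: abs_mult mult_left_le_one_le)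
  have cb2: "(cut n x * w x)^2 \<le> (w x)^2" for n x using cb by (rule abs_le_square_iff[THEN iffD1])
  show H: "H (\<lambda>x. cut n x * w x)" for n
    unfolding H_def
  proof
    show "sq_integrable lborel (\<lambda>x. cut n x * w x)"
      by (rule sq_integrable_bound[OF sq_integrableD(2)[OF ws]]) (use cb2 in auto)
    show "sq_integrable (gag s) (pdiff (\<lambda>x. cut n x * w x))"
      by (rule sq_integrable_bound[OF ki]) (use kb in auto)
  qed
  have Dl: "(\<lambda>n. D (\<lambda>x. cut n x * w x)) \<longlonglongrightarrow> D w" unfolding D_def
  proof (rule integral_dominated_convergence[OF _ _ ki])
    show "AE z in gag s. (\<lambda>n. (pdiff (\<lambda>x. cut n x * w x) z)^2) \<longlonglongrightarrow> (pdiff w z)^2"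
    proof (rule AE_I2)
      fix z :: "'a \<times> 'a"
      have "(\<lambda>n. (cut n (fst z) * w (fst z) - cut n (snd z) * w (snd z))^2) \<longlonglongrightarrow> (1 * w (fst z) - 1 * w (snd z))^2"
        by (intro tendsto_intros cut_tendsto)
      then show "(\<lambda>n. (pdiff (\<lambda>x. cut n x * w x) z)^2) \<longlonglongrightarrow> (pdiff w z)^2" by (simp add: pdiff_def)
    qed
    show "AE z in gag s. norm ((pdiff (\<lambda>x. cut n x * w x) z)^2) \<le> k z" for n using kb by simp
    show "(\<lambda>z. (pdiff w z)^2) \<in> borel_measurable (gag s)" "(\<lambda>z. (pdiff (\<lambda>x. cut n x * w x) z)^2) \<in> borel_measurable (gag s)" for n
      by measurable
  qed
  have Sl: "(\<lambda>n. S (\<lambda>x. cut n x * w x)) \<longlonglongrightarrow> S w" unfolding S_def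
  proof (rule integral_dominated_convergence)
    show "integrable lborel (\<lambda>x. (w x)^2)" using ws by (simp add: sq_integrable_real)
    show "AE x in lborel. (\<lambda>n. (cut n x * w x)^2) \<longlonglongrightarrow> (w x)^2"
    proof (rule AE_I2)
      fix x
      have "(\<lambda>n. (cut n x * w x)^2) \<longlonglongrightarrow> (1 * w x)^2" by (intro tendsto_intros cut_tendsto)
      then show "(\<lambda>n. (cut n x * w x)^2) \<longlonglongrightarrow> (w x)^2" by simp
    qed
    show "AE x in lborel. norm ((cut n x * w x)^2) \<le> (w x)^2" for n using cb2 by simp
    show "(\<lambda>x. (w x)^2) \<in> borel_measurable lborel" "(\<lambda>x. (cut n x * w x)^2) \<in> borel_measurable lborel" for n by measurable
  qed
  have Gl: "(\<lambda>n. Gi (\<lambda>x. cut n x * w x)) \<longlonglongrightarrow> Gi w"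
  proof (rule Gi_tendsto[OF w])
    show "(\<lambda>n. cut n x * w x) \<longlonglongrightarrow> w x" for x using tendsto_mult[OF cut_tendsto tendsto_const, of x "w x"] by simp
  qed (use cb in measurable)
  have "(\<lambda>n. D (\<lambda>x. cut n x * w x) + A * S (\<lambda>x. cut n x * w x) - Gi (\<lambda>x. cut n x * w x)) \<longlonglongrightarrow> D w + A * S w - Gi w"
    by (intro tendsto_intros Dl Sl Gl)
  then show "(\<lambda>n. G (\<lambda>_. A) (\<lambda>x. cut n x * w x)) \<longlonglongrightarrow> G (\<lambda>_. A) w"
    using A by (simp add: G_def Q_def P_const)
qed

text \<open>A nearly minimal element for the larger constant, rescaled to the Nehari set of the smaller one and cut
  off, has energy below the larger level by a definite amount.\<close>

lemma compact_competitor: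
  assumes B: "0 < B'" "B' < B" "B < A"
  obtains w R where "H w" "\<not> null w" "\<And>x. norm x \<ge> R \<Longrightarrow> w x = 0" "G (\<lambda>_. B') w < 0" "J w < lev (\<lambda>_. A)"
proof -
  have pos: "0 < B" "0 < A" using B by auto
  have pA: "pot (\<lambda>_. A)" and pB: "pot (\<lambda>_. B)" using pos by (auto intro: pot_const)
  obtain w1 where "Neh (\<lambda>_. A) w1" using Nehari_nonempty[OF pA] by auto
  then obtain u where u: "\<And>n::nat. Neh (\<lambda>_. A) (u n)" "\<And>n x. 0 \<le> u n x" "(\<lambda>n. J (u n)) \<longlonglongrightarrow> lev (\<lambda>_. A)" "\<And>n. J (u n) \<le> lev (\<lambda>_. A) + 1"
    using minimising_sequence[OF pA] by blast
  define M where "M = (lev (\<lambda>_. A) + 1) / (1/2 - 1/\<theta>) + 1"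
  have Hu: "H (u n)" and nu: "\<not> null (u n)" and Gu: "G (\<lambda>_. A) (u n) = 0" for n using u(1)[of n] by (auto simp: Neh_def dest: W_H)
  have Qu0: "Q (\<lambda>_. A) (u n) \<le> (lev (\<lambda>_. A) + 1) / (1/2 - 1/\<theta>)" for n
    by (rule Nehari_Q_bounded[where u=u, OF u(1) u(4)])
  have Qu: "Q (\<lambda>_. A) (u n) \<le> M" for n using Qu0[of n] by (simp add: M_def)
  have M: "M > 0"
  proof -
    have "(lev (\<lambda>_. A) + 1) / (1/2 - 1/\<theta>) \<ge> 0"
      by (rule order_trans[OF Q_nonneg Qu0])
    then show ?thesis by (simp add: M_def)
  qed
  obtain \<kappa> where \<kappa>: "\<kappa> > 0" "\<And>u. W (\<lambda>_. B) u \<Longrightarrow> \<not> null u \<Longrightarrow> G (\<lambda>_. B) u \<le> 0 \<Longrightarrow> Q (\<lambda>_. B) u \<le> M \<Longrightarrow> \<kappa> \<le> S u"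
    using Nehari_mass_lower[OF pB M] by blast
  \<comment> \<open>Lowering the constant from \<open>A\<close> to \<open>B\<close> saves at least
    this much energy on a function of mass \<open>\<kappa>\<close>, so an element within
    \<open>e\<close> of the level of \<open>A\<close> ends up strictly below it.\<close>
  define e where "e = (A - B) / 2 * \<kappa>"
  have e: "e > 0" using B \<kappa> by (simp add: e_def)
  have "lev (\<lambda>_. A) < lev (\<lambda>_. A) + e" using e by simp
  from order_tendstoD(2)[OF u(3) this] obtain n where n: "J (u n) < lev (\<lambda>_. A) + e"
    using eventually_happens' sequentially_bot by blast
  have Su: "S (u n) > 0" by (rule S_pos[OF Hu nu])
  have QAB: "Q (\<lambda>_. B) v = Q (\<lambda>_. A) v - (A - B) * S v" for v using pos by (simp add: Q_def P_const left_diff_distrib)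
  have GB: "G (\<lambda>_. B) (u n) \<le> 0"
    using Gu[of n] Su B unfolding G_def QAB by (simp add: mult_nonneg_nonneg less_imp_le)
  obtain t where t: "0 < t" "t \<le> 1" "Neh (\<lambda>_. B) (\<lambda>x. t * u n x)"
    using Nehari_projection[OF pB W_const[OF Hu] nu GB] by blast
  define w0 where "w0 x = t * u n x" for x
  have w0: "Neh (\<lambda>_. B) w0" "H w0" "\<not> null w0" "G (\<lambda>_. B) w0 = 0" "\<And>x. 0 \<le> w0 x"
    using t u(2) unfolding w0_def by (auto simp: Neh_def dest: W_H)
  have QBw: "Q (\<lambda>_. B) w0 \<le> M"
  proof -
    have "Q (\<lambda>_. B) w0 = t^2 * Q (\<lambda>_. B) (u n)" unfolding w0_def by (rule Q_mult)
    also have "\<dots> \<le> 1 * Q (\<lambda>_. B) (u n)" using t by (intro mult_right_mono power_le_one) auto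
    also have "\<dots> \<le> Q (\<lambda>_. A) (u n)" using B by (simp add: QAB)
    finally show ?thesis using Qu[of n] by simp
  qed
  have Sw: "\<kappa> \<le> S w0" by (rule \<kappa>(2)[OF W_const[OF w0(2)] w0(3) _ QBw]) (simp add: w0(4))
  have Jw: "J w0 < lev (\<lambda>_. A)"
  proof -
    have "J w0 = Q (\<lambda>_. B) w0 / 2 - (LINT x|lborel. F (w0 x))" using Nehari_energy[OF w0(1)] by simp
    also have "\<dots> = Q (\<lambda>_. A) w0 / 2 - (LINT x|lborel. F (w0 x)) - (A - B) / 2 * S w0" by (simp add: QAB diff_divide_distrib)
    also have "\<dots> \<le> Q (\<lambda>_. A) w0 / 2 - (LINT x|lborel. F (w0 x)) - e"
      unfolding e_def using Sw B by (intro diff_left_mono mult_left_mono) auto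
    \<comment> \<open>\<open>u n\<close> lies on the Nehari set of \<open>A\<close>, where by
      \<open>F_ray\<close> its own energy is the largest along its ray, to which \<open>w0\<close>
      belongs.\<close>
    also have "Q (\<lambda>_. A) w0 / 2 - (LINT x|lborel. F (w0 x)) \<le> J (u n)"
    proof -
      have "(LINT x|lborel. F (u n x) - F (t * u n x)) \<le> (LINT x|lborel. (1 - t^2) / 2 * g (u n x))"
        by (rule integral_mono) (use ghF_integrable[OF Hu] ghF_integrable[OF H_mult[OF Hu]] F_ray t in auto)
      then have "(LINT x|lborel. F (u n x)) - (LINT x|lborel. F (t * u n x)) \<le> (1 - t^2) / 2 * Gi (u n)"
        using ghF_integrable(3)[OF Hu] ghF_integrable(3)[OF H_mult[OF Hu]] by (simp add: Gi_def)
      moreover have "Gi (u n) = Q (\<lambda>_. A) (u n)" using Gu[of n] by (simp add: G_def)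
      ultimately have "t^2 * Q (\<lambda>_. A) (u n) / 2 - (LINT x|lborel. F (t * u n x)) \<le> Q (\<lambda>_. A) (u n) / 2 - (LINT x|lborel. F (u n x))"
        by (simp add: field_simps)
      then show ?thesis unfolding w0_def Q_mult Nehari_energy[OF u(1)] .
    qed
    finally show ?thesis using n by simp
  qed
  \<comment> \<open>The further step from \<open>B\<close> to \<open>B'\<close> makes the inequality
    strict, and a strict inequality survives the cutoff.\<close>
  have Gw: "G (\<lambda>_. B') w0 < 0"
  proof -
    have "G (\<lambda>_. B') w0 = G (\<lambda>_. B) w0 - (B - B') * S w0" using B by (simp add: G_def Q_def P_const left_diff_distrib)
    then show ?thesis using w0(4) S_pos[OF w0(2,3)] B by simp
  qed
  from order_tendstoD(2)[OF cutoff(2)[OF w0(2) B(1)] Gw]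
  obtain m where m: "G (\<lambda>_. B') (\<lambda>x. cut m x * w0 x) < 0" using eventually_happens' sequentially_bot by blast
  define w where "w x = cut m x * w0 x" for x
  have Hw: "H w" unfolding w_def by (rule cutoff(1)[OF w0(2) B(1)])
  note [measurable] = H_measurable[OF Hw]
  have nw: "\<not> null w"
  proof
    assume z: "null w"
    have "Gi w = (LINT x|(lborel::'a measure). 0)" unfolding Gi_def
      by (rule integral_cong_AE) (use z in \<open>auto simp: null_def g_neg elim: eventually_mono\<close>)
    then have "G (\<lambda>_. B') w \<ge> 0" by (simp add: G_def)
    then show False using m by (simp add: w_def[abs_def])
  qed
  have "J w \<le> J w0" unfolding J_def
  proof (rule integral_mono[OF ghF_integrable(2)[OF Hw] ghF_integrable(2)[OF w0(2)]])
    show "h (w x) \<le> h (w0 x)" for x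
      by (rule h_mono) (use cut_props(1,2)[of m x] w0(5)[of x] in \<open>simp add: w_def mult_left_le_one_le\<close>)
  qed
  then have "J w < lev (\<lambda>_. A)" using Jw by simp
  moreover have "G (\<lambda>_. B') w < 0" using m by (simp add: w_def[abs_def])
  moreover have "w x = 0" if "norm x \<ge> real m + 2" for x using cut_props(4)[OF that] by (simp add: w_def)
  ultimately show thesis using that[of w "real m + 2"] Hw nw by blast
qed

section \<open>Minimisers for the rescaled problem\<close>

theorem ground_state_coercive:
  assumes V: "pot V" "continuous_on UNIV V" and co: "\<And>A. \<exists>R. \<forall>z. norm z \<ge> R \<longrightarrow> A \<le> V z"
  shows "\<exists>u. Neh V u \<and> (\<forall>x. 0 \<le> u x) \<and> (\<forall>w. Neh V w \<longrightarrow> J u \<le> J w)"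
proof -
  obtain w where "Neh V w" using Nehari_nonempty[OF V] by blast
  then obtain u where "Neh V u" "\<And>x. 0 \<le> u x" "J u = lev V"
    using minimiser_exists[OF V(1) _ coercive_tight[OF V(1) co]] by metis
  then show ?thesis using lev_le by metis
qed

text \<open>Blowing up around \<open>z0\<close> places the support of one fixed competitor in a
  region where the rescaled potential is close to \<open>V z0\<close>, for all small
  \<open>\<epsilon>\<close> simultaneously; that is why a single \<open>\<epsilon>0\<close>
  works.\<close>

theorem ground_state_semiclassical:
  assumes V: "pot V" "continuous_on UNIV V" and A: "V z0 < A" "\<And>z. norm z \<ge> R0 \<Longrightarrow> A \<le> V z"
  shows "\<exists>\<epsilon>0>0. \<forall>\<epsilon>. 0 < \<epsilon> \<and> \<epsilon> \<le> \<epsilon>0 \<longrightarrow>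
    (\<exists>u. Neh (\<lambda>x. V (z0 + \<epsilon> *\<^sub>R x)) u \<and> (\<forall>x. 0 \<le> u x) \<and> (\<forall>w. Neh (\<lambda>x. V (z0 + \<epsilon> *\<^sub>R x)) w \<longrightarrow> J u \<le> J w))"
proof -
  define d where "d = A - V z0"
  have d: "d > 0" and A_eq: "A = V z0 + d" using A by (simp_all add: d_def)
  \<comment> \<open>\<open>B'\<close> bounds the rescaled potential on the support of the
    competitor, \<open>B\<close> is the constant on whose Nehari set the competitor lies before the
    cutoff, \<open>A'\<close> is the constant whose level it beats, and the gap between
    \<open>A'\<close> and \<open>A\<close> absorbs mass lost in balls.\<close>
  define B' B A' where "B' = V z0 + d / 4" and "B = V z0 + d / 2" and "A' = V z0 + 3 * d / 4"
  have V0: "V z0 > 0" using potD(2)[OF V(1)] .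
  have ord: "V z0 < B'" "0 < B'" "B' < B" "B < A'" "0 < A'" "A' < A"
    using d V0 A_eq unfolding B'_def B_def A'_def by auto
  obtain w R where w: "H w" "\<not> null w" "\<And>x. norm x \<ge> R \<Longrightarrow> w x = 0" "G (\<lambda>_. B') w < 0" "J w < lev (\<lambda>_. A')"
    using compact_competitor[OF ord(2,3,4)] by blast
  have "isCont V z0" using V(2) by (simp add: continuous_on_eq_continuous_at)
  then obtain \<eta> where \<eta>: "\<eta> > 0" "\<And>z. dist z z0 < \<eta> \<Longrightarrow> dist (V z) (V z0) < B' - V z0"
    unfolding continuous_at_eps_delta using ord(1) by (metis diff_gt_0_iff_gt)
  \<comment> \<open>Keeps \<open>\<epsilon> * norm x\<close> below \<open>\<eta>\<close> on the
    support of \<open>w\<close>; the form \<open>\<bar>R\<bar> + 1\<close> allows any sign of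
    \<open>R\<close>.\<close>
  define \<epsilon>0 where "\<epsilon>0 = \<eta> / (\<bar>R\<bar> + 1)"
  have \<epsilon>0: "\<epsilon>0 > 0" using \<eta>(1) by (simp add: \<epsilon>0_def add_nonneg_pos)
  have "\<exists>u. Neh (\<lambda>x. V (z0 + \<epsilon> *\<^sub>R x)) u \<and> (\<forall>x. 0 \<le> u x) \<and> (\<forall>w. Neh (\<lambda>x. V (z0 + \<epsilon> *\<^sub>R x)) w \<longrightarrow> J u \<le> J w)"
    if \<epsilon>: "0 < \<epsilon>" "\<epsilon> \<le> \<epsilon>0" for \<epsilon>
  proof -
    define U where "U x = V (z0 + \<epsilon> *\<^sub>R x)" for x
    have Uc: "continuous_on UNIV U" unfolding U_def
      by (rule continuous_on_compose2[OF V(2)]) (auto intro!: continuous_intros)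
    have Up: "pot U"
      unfolding pot_def using V(1) borel_measurable_continuous_onI[OF Uc] by (auto simp: pot_def U_def)
    have near: "U x \<le> B'" if x: "norm x < R" for x
    proof -
      have "dist (z0 + \<epsilon> *\<^sub>R x) z0 = \<epsilon> * norm x" using \<epsilon> by (simp add: dist_norm)
      also have "\<dots> \<le> \<epsilon>0 * \<bar>R\<bar>" using \<epsilon> x \<epsilon>0 by (intro mult_mono) auto
      also have "\<dots> < \<epsilon>0 * (\<bar>R\<bar> + 1)" using \<epsilon>0 by (intro mult_strict_left_mono) auto
      also have "\<dots> = \<eta>" by (simp add: \<epsilon>0_def add_nonneg_pos order_less_imp_not_eq2)
      finally have "dist (V (z0 + \<epsilon> *\<^sub>R x)) (V z0) < B' - V z0" by (rule \<eta>(2))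
      then show ?thesis by (simp add: U_def dist_real_def abs_less_iff)
    qed
    have WU: "W U w" by (rule bounded_support_W[OF Up Uc w(1,3)])
    have "P U w \<le> P (\<lambda>_. B') w" unfolding P_def
    proof (rule integral_mono)
      show "integrable lborel (\<lambda>z. (sqrt (U z) * w z)^2)" using WU by (simp add: W_def sq_integrable_real)
      show "integrable lborel (\<lambda>z. (sqrt B' * w z)^2)" using W_const[OF w(1), of B'] by (simp add: W_def sq_integrable_real)
      show "(sqrt (U z) * w z)^2 \<le> (sqrt B' * w z)^2" for z
        using near[of z] w(3)[of z] potD(3)[OF Up, of z] ord(2)
        by (cases "norm z < R") (auto simp: power_mult_distrib intro!: mult_right_mono)
    qed
    then have GU: "G U w \<le> 0" using w(4) by (simp add: G_def Q_def)
    have "lev U \<le> J w" by (rule lev_le_G[OF Up WU w(2) GU])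
    then have lt: "lev U < lev (\<lambda>_. A')" using w(5) by simp
    \<comment> \<open>The radius depends on \<open>\<epsilon>\<close>, which is harmless: tightness
      is a statement about each fixed potential.\<close>
    have far: "A \<le> U z" if "norm z \<ge> (\<bar>R0\<bar> + norm z0) / \<epsilon>" for z
    proof -
      have "\<bar>R0\<bar> + norm z0 \<le> norm (\<epsilon> *\<^sub>R z)" using that \<epsilon>(1) by (simp add: divide_le_eq mult.commute)
      moreover have "norm (\<epsilon> *\<^sub>R z) \<le> norm (z0 + \<epsilon> *\<^sub>R z) + norm z0"
        using norm_triangle_ineq4[of "z0 + \<epsilon> *\<^sub>R z" z0] by simp
      ultimately have "R0 \<le> norm (z0 + \<epsilon> *\<^sub>R z)" using abs_ge_self[of R0] by linarith
      then show ?thesis unfolding U_def by (rule A(2))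
    qed
    obtain w1 where "Neh U w1" using Nehari_nonempty[OF Up Uc] by blast
    then obtain u where "Neh U u" "\<And>x. 0 \<le> u x" "J u = lev U"
      using minimiser_exists[OF Up _ level_tight[OF Up ord(5,6) far lt]] by metis
    then show ?thesis using lev_le unfolding U_def by metis
  qed
  then show ?thesis using \<epsilon>0 by blast
qed

end

section \<open>Rescaling\<close>

lemma nn_integral_affine:
  fixes f :: "'a::euclidean_space \<Rightarrow> ennreal"
  assumes c: "c > 0" and f [measurable]: "f \<in> borel_measurable borel"
  shows "(\<integral>\<^sup>+x. f x \<partial>lborel) = ennreal (c ^ DIM('a)) * (\<integral>\<^sup>+x. f (z0 + c *\<^sub>R x) \<partial>lborel)"
  using nn_integral_translate[OF f, of z0] nn_integral_scale[OF c, of "\<lambda>x. f (z0 + x)"] by simp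

lemma integral_affine:
  fixes f :: "'a::euclidean_space \<Rightarrow> real"
  assumes c: "c > 0" and f [measurable]: "f \<in> borel_measurable borel"
  shows "(LINT x|lborel. f x) = c ^ DIM('a) * (LINT x|lborel. f (z0 + c *\<^sub>R x))"
  using integral_translate[OF f, of z0] integral_scale[OF c, of "\<lambda>x. f (z0 + x)"] by simp

lemma sq_integrable_affine:
  fixes f :: "'a::euclidean_space \<Rightarrow> real"
  assumes c: "c > 0" and f [measurable]: "f \<in> borel_measurable borel"
  shows "sq_integrable lborel (\<lambda>x. f (z0 + c *\<^sub>R x)) \<longleftrightarrow> sq_integrable lborel f"
  using nn_integral_affine[OF c, of "\<lambda>x. ennreal ((f x)^2)" z0] c
  by (auto simp: sq_integrable_real integrable_iff_bounded ennreal_mult_less_top)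

lemma AE_affine:
  fixes Z :: "'a::euclidean_space set"
  assumes c: "c > 0" and Z [measurable]: "Z \<in> sets borel"
  shows "(AE x in lborel. z0 + c *\<^sub>R x \<notin> Z) \<longleftrightarrow> (AE x in lborel. x \<notin> Z)"
proof -
  have m: "(\<lambda>x. indicator Z (z0 + c *\<^sub>R x) :: ennreal) \<in> borel_measurable borel" by measurable
  have "(AE x in lborel. x \<notin> Z) \<longleftrightarrow> (\<integral>\<^sup>+x. indicator Z x \<partial>lborel) = 0"
    by (subst nn_integral_0_iff_AE) (auto simp: indicator_eq_0_iff)
  also have "\<dots> \<longleftrightarrow> (\<integral>\<^sup>+x. indicator Z (z0 + c *\<^sub>R x) \<partial>lborel) = 0"
    using c nn_integral_affine[OF c, of "indicator Z" z0] by simp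
  also have "\<dots> \<longleftrightarrow> (AE x in lborel. z0 + c *\<^sub>R x \<notin> Z)"
    using m by (subst nn_integral_0_iff_AE) (auto simp: indicator_eq_0_iff)
  finally show ?thesis by blast
qed

text \<open>Two Jacobians of degree N meet the homogeneity -(N + 2s) of the kernel. With
  \<open>c powr (2 * s)\<close> on the left the remaining factor is \<open>c ^ DIM('a)\<close>, the
  same as for the integrals over points; this matches the coefficient
  \<open>\<epsilon> powr (2 * s)\<close> of the equation.\<close>

lemma nn_integral_gag_affine:
  fixes f :: "'a::euclidean_space \<times> 'a \<Rightarrow> ennreal"
  assumes c: "c > 0" and f [measurable]: "f \<in> borel_measurable borel"
  shows "ennreal (c powr (2 * s)) * (\<integral>\<^sup>+z. f z \<partial>gag s) = ennreal (c ^ DIM('a)) * (\<integral>\<^sup>+z. f (z0 + c *\<^sub>R fst z, z0 + c *\<^sub>R snd z) \<partial>gag s)"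
proof -
  let ?N = "c ^ DIM('a)" and ?a = "\<lambda>x. z0 + c *\<^sub>R x"
  have k: "gag_ker s (?a x - ?a y) = c powr (- (real DIM('a) + 2 * s)) * gag_ker s (x - y)" for x y :: 'a
  proof -
    have "norm (?a x - ?a y) = c * norm (x - y)" using c by (simp add: scaleR_diff_right[symmetric])
    then show ?thesis using c by (simp add: gag_ker_def powr_mult mult_ac)
  qed
  define I where "I x = (\<integral>\<^sup>+y. ennreal (gag_ker s (x - y)) * f (?a x, ?a y) \<partial>lborel)" for x
  have Im: "I \<in> borel_measurable lborel" unfolding I_def by measurable
  have cc: "c powr (2 * s) * (?N * (?N * c powr (- (real DIM('a) + 2 * s)))) = ?N"
    using c by (simp add: powr_realpow[symmetric] powr_add[symmetric])
  have "(\<integral>\<^sup>+z. f z \<partial>gag s) = (\<integral>\<^sup>+x. \<integral>\<^sup>+y. ennreal (gag_ker s (x - y)) * f (x, y) \<partial>lborel \<partial>lborel)"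
    by (rule nn_integral_gag[OF f])
  also have "\<dots> = (\<integral>\<^sup>+x. ennreal ?N * (\<integral>\<^sup>+y. ennreal (gag_ker s (x - ?a y)) * f (x, ?a y) \<partial>lborel) \<partial>lborel)"
    by (intro nn_integral_cong nn_integral_affine[OF c]) measurable
  also have "\<dots> = ennreal ?N * (\<integral>\<^sup>+x. ennreal ?N * (\<integral>\<^sup>+y. ennreal (gag_ker s (?a x - ?a y)) * f (?a x, ?a y) \<partial>lborel) \<partial>lborel)"
    by (rule nn_integral_affine[OF c]) measurable
  also have "\<dots> = ennreal ?N * (\<integral>\<^sup>+x. ennreal ?N * (ennreal (c powr (- (real DIM('a) + 2 * s))) * I x) \<partial>lborel)"
    unfolding k I_def by (subst nn_integral_cmult[symmetric]) (auto simp: ennreal_mult' mult.assoc)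
  also have "\<dots> = ennreal ?N * (\<integral>\<^sup>+x. ennreal (?N * c powr (- (real DIM('a) + 2 * s))) * I x \<partial>lborel)"
    using c by (simp add: I_def ennreal_mult mult.assoc)
  also have "\<dots> = ennreal ?N * (ennreal (?N * c powr (- (real DIM('a) + 2 * s))) * (\<integral>\<^sup>+x. I x \<partial>lborel))"
    by (subst nn_integral_cmult[OF Im]) (rule refl)
  also have "\<dots> = ennreal (?N * (?N * c powr (- (real DIM('a) + 2 * s)))) * (\<integral>\<^sup>+x. I x \<partial>lborel)"
    using c by (simp add: ennreal_mult mult.assoc)
  also have "(\<integral>\<^sup>+x. I x \<partial>lborel) = (\<integral>\<^sup>+z. f (?a (fst z), ?a (snd z)) \<partial>gag s)"
    unfolding I_def by (subst nn_integral_gag) auto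
  finally have e: "(\<integral>\<^sup>+z. f z \<partial>gag s) = ennreal (?N * (?N * c powr (- (real DIM('a) + 2 * s)))) * (\<integral>\<^sup>+z. f (?a (fst z), ?a (snd z)) \<partial>gag s)" .
  have "ennreal (c powr (2 * s)) * (\<integral>\<^sup>+z. f z \<partial>gag s) = ennreal (c powr (2 * s) * (?N * (?N * c powr (- (real DIM('a) + 2 * s))))) * (\<integral>\<^sup>+z. f (?a (fst z), ?a (snd z)) \<partial>gag s)"
    unfolding e using c by (simp add: ennreal_mult mult.assoc)
  then show ?thesis unfolding cc .
qed

context var
begin

text \<open>Passing through \<open>enn2real\<close> covers functions of infinite energy as well,
  where both sides are 0.\<close>

lemma D_affine:
  assumes c: "c > 0" and u [measurable]: "u \<in> borel_measurable borel"
  shows "c powr (2 * s) * D u = c ^ DIM('a) * D (\<lambda>x. u (z0 + c *\<^sub>R x))"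
proof -
  have e: "ennreal (c powr (2 * s)) * (\<integral>\<^sup>+z. ennreal ((pdiff u z)^2) \<partial>gag s) = ennreal (c ^ DIM('a)) * (\<integral>\<^sup>+z. ennreal ((pdiff (\<lambda>x. u (z0 + c *\<^sub>R x)) z)^2) \<partial>gag s)"
    using nn_integral_gag_affine[OF c, of "\<lambda>z. ennreal ((pdiff u z)^2)" s z0] by (simp add: pdiff_def)
  have "D v = enn2real (\<integral>\<^sup>+z. ennreal ((pdiff v z)^2) \<partial>gag s)" if [measurable]: "v \<in> borel_measurable borel" for v
    unfolding D_def by (rule integral_eq_nn_integral) auto
  from this[OF u] this[of "\<lambda>x. u (z0 + c *\<^sub>R x)"] show ?thesis
    using arg_cong[OF e, of enn2real] c by (simp add: enn2real_mult)
qed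

lemma H_affine:
  assumes c: "c > 0" and u [measurable]: "u \<in> borel_measurable borel"
  shows "H (\<lambda>x. u (z0 + c *\<^sub>R x)) \<longleftrightarrow> H u"
proof -
  have e: "ennreal (c powr (2 * s)) * (\<integral>\<^sup>+z. ennreal ((pdiff u z)^2) \<partial>gag s) = ennreal (c ^ DIM('a)) * (\<integral>\<^sup>+z. ennreal ((pdiff (\<lambda>x. u (z0 + c *\<^sub>R x)) z)^2) \<partial>gag s)"
    using nn_integral_gag_affine[OF c, of "\<lambda>z. ennreal ((pdiff u z)^2)" s z0] by (simp add: pdiff_def)
  have "(\<integral>\<^sup>+z. ennreal ((pdiff u z)^2) \<partial>gag s) < \<infinity> \<longleftrightarrow> ennreal (c powr (2 * s)) * (\<integral>\<^sup>+z. ennreal ((pdiff u z)^2) \<partial>gag s) < \<infinity>"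
    using c by (auto simp: ennreal_mult_less_top)
  also have "\<dots> \<longleftrightarrow> (\<integral>\<^sup>+z. ennreal ((pdiff (\<lambda>x. u (z0 + c *\<^sub>R x)) z)^2) \<partial>gag s) < \<infinity>"
    unfolding e using c by (auto simp: ennreal_mult_less_top)
  finally show ?thesis unfolding H_def sq_integrable_affine[OF c u]
    by (auto simp: sq_integrable_real integrable_iff_bounded)
qed

lemma W_affine:
  assumes c: "c > 0" and V: "pot V" and u [measurable]: "u \<in> borel_measurable borel"
  shows "W (\<lambda>x. V (z0 + c *\<^sub>R x)) (\<lambda>x. u (z0 + c *\<^sub>R x)) \<longleftrightarrow> W V u"
proof -
  note [measurable] = potD(1)[OF V]
  show ?thesis unfolding W_def H_affine[OF c u]
    using sq_integrable_affine[OF c, of "\<lambda>x. sqrt (V x) * u x" z0] by simp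
qed

lemma Hs_H: "u \<in> Hs s \<longleftrightarrow> H u" for u :: "'a \<Rightarrow> real"
  unfolding H_def by (rule Hs_iff[OF s])

lemma frac_sq_D: "H u \<Longrightarrow> frac_sq s u = D u"
  unfolding D_def by (rule frac_sq_eq[OF s]) (simp add: H_def)

lemma pot_sqrt: "pot V \<Longrightarrow> sqrt (V z) * x * (sqrt (V z) * y) = V z * x * y"
  using potD(3)[of V z] real_sqrt_mult_self[of "V z"] by (simp add: mult_ac)

lemma pot_sqrt2: "pot V \<Longrightarrow> (sqrt (V z) * x)^2 = V z * x^2"
  using potD(3)[of V z] by (simp add: power_mult_distrib)

lemma Wsp_W:
  assumes V: "pot V" shows "u \<in> Wsp s V \<longleftrightarrow> W V u"
proof (cases "H u")
  case True
  note [measurable] = potD(1)[OF V] H_measurable[OF True]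
  show ?thesis using True by (simp add: Wsp_def W_def Hs_H sq_integrable_real pot_sqrt2[OF V])
qed (simp add: Wsp_def W_def Hs_H)

text \<open>\<open>frac_form\<close> is defined by polarisation, so it is recovered by expanding
  \<open>D\<close> at the sum and at the difference of the rescaled functions.\<close>

lemma frac_form_affine:
  assumes c: "c > 0" and u: "H u" and v: "H v"
  shows "c powr (2 * s) * frac_form s u v = c ^ DIM('a) * (LINT z|gag s. pdiff (\<lambda>x. u (z0 + c *\<^sub>R x)) z * pdiff (\<lambda>x. v (z0 + c *\<^sub>R x)) z)"
proof -
  note [measurable] = H_measurable[OF u] H_measurable[OF v]
  let ?u = "\<lambda>x. u (z0 + c *\<^sub>R x)" and ?v = "\<lambda>x. v (z0 + c *\<^sub>R x)"
  have Hu: "H ?u" and Hv: "H ?v" using u v by (simp_all add: H_affine[OF c])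
  have sq: "sq_integrable (gag s) (pdiff ?u)" "sq_integrable (gag s) (pdiff ?v)" using Hu Hv by (auto simp: H_def)
  have e: "pdiff (\<lambda>x. ?u x + k * ?v x) z = pdiff ?u z + k * pdiff ?v z" for k z by (simp add: pdiff_def algebra_simps)
  have "D (\<lambda>x. ?u x + k * ?v x) = D ?u + 2 * k * (LINT z|gag s. pdiff ?u z * pdiff ?v z) + k^2 * D ?v" for k
    unfolding D_def e by (rule integral_sq_add[OF sq])
  from this[of 1] this[of "-1"]
  have pol: "D (\<lambda>x. ?u x + ?v x) - D (\<lambda>x. ?u x - ?v x) = 4 * (LINT z|gag s. pdiff ?u z * pdiff ?v z)" by simp
  have "c powr (2 * s) * frac_form s u v = (c powr (2 * s) * D (\<lambda>x. u x + v x) - c powr (2 * s) * D (\<lambda>x. u x - v x)) / 4"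
    by (simp add: frac_form_def frac_sq_D H_add H_diff u v right_diff_distrib)
  also have "\<dots> = (c ^ DIM('a) * D (\<lambda>x. ?u x + ?v x) - c ^ DIM('a) * D (\<lambda>x. ?u x - ?v x)) / 4"
    using D_affine[OF c, of "\<lambda>x. u x + v x" z0] D_affine[OF c, of "\<lambda>x. u x - v x" z0] by simp
  also have "\<dots> = c ^ DIM('a) * ((D (\<lambda>x. ?u x + ?v x) - D (\<lambda>x. ?u x - ?v x)) / 4)" by (simp add: right_diff_distrib)
  finally show ?thesis unfolding pol by simp
qed

lemma energy_terms_affine:
  assumes c: "c > 0" and V: "pot V" and u: "W V u"
  shows "c powr (2 * s) * frac_sq s u + (LINT z|lborel. V z * (u z)^2) = c ^ DIM('a) * Q (\<lambda>x. V (z0 + c *\<^sub>R x)) (\<lambda>x. u (z0 + c *\<^sub>R x))"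
    "(LINT z|lborel. f (u z) * u z) = c ^ DIM('a) * Gi (\<lambda>x. u (z0 + c *\<^sub>R x))"
    "(LINT z|lborel. F (u z)) = c ^ DIM('a) * (LINT x|lborel. F (u (z0 + c *\<^sub>R x)))"
    "(AE z in lborel. u z = 0) \<longleftrightarrow> null (\<lambda>x. u (z0 + c *\<^sub>R x))"
proof -
  note [measurable] = W_measurable[OF u] potD(1)[OF V]
  have "(LINT z|lborel. V z * (u z)^2) = c ^ DIM('a) * (LINT x|lborel. V (z0 + c *\<^sub>R x) * (u (z0 + c *\<^sub>R x))^2)"
    by (rule integral_affine[OF c]) measurable
  then show "c powr (2 * s) * frac_sq s u + (LINT z|lborel. V z * (u z)^2) = c ^ DIM('a) * Q (\<lambda>x. V (z0 + c *\<^sub>R x)) (\<lambda>x. u (z0 + c *\<^sub>R x))"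
    using D_affine[OF c W_measurable[OF u], of z0]
    by (simp add: frac_sq_D[OF W_H[OF u]] Q_def P_def pot_sqrt2[OF V] distrib_left)
  show "(LINT z|lborel. f (u z) * u z) = c ^ DIM('a) * Gi (\<lambda>x. u (z0 + c *\<^sub>R x))"
    unfolding Gi_def g_def by (rule integral_affine[OF c]) measurable
  show "(LINT z|lborel. F (u z)) = c ^ DIM('a) * (LINT x|lborel. F (u (z0 + c *\<^sub>R x)))"
    by (rule integral_affine[OF c]) measurable
  show "(AE z in lborel. u z = 0) \<longleftrightarrow> null (\<lambda>x. u (z0 + c *\<^sub>R x))"
    using AE_affine[OF c, of "{z. u z \<noteq> 0}" z0] by (simp add: null_def)
qed

text \<open>All terms of energy, constraint and weak equation acquire the common factor
  \<open>\<epsilon> ^ DIM('a)\<close>, so minimality, criticality and positivity carry over to the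
  original variables for any centre \<open>z0\<close>.\<close>

theorem ground_state_rescale:
  fixes V :: "'a \<Rightarrow> real"
  assumes c: "\<epsilon> > 0" and V: "pot V" "continuous_on UNIV V"
    and u: "Neh (\<lambda>x. V (z0 + \<epsilon> *\<^sub>R x)) u" "\<And>x. 0 \<le> u x" "\<And>w. Neh (\<lambda>x. V (z0 + \<epsilon> *\<^sub>R x)) w \<Longrightarrow> J u \<le> J w"
  shows "ground_state_P s V f \<epsilon> (\<lambda>z. u ((1 / \<epsilon>) *\<^sub>R (z - z0)))"
proof -
  let ?a = "\<lambda>x. z0 + \<epsilon> *\<^sub>R x"
  define V' where "V' = (\<lambda>x. V (?a x))"
  define v where "v z = u ((1 / \<epsilon>) *\<^sub>R (z - z0))" for z
  note u = u[folded V'_def]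
  have va: "v (?a x) = u x" for x using c by (simp add: v_def)
  have Vc: "continuous_on UNIV V'" unfolding V'_def
    by (rule continuous_on_compose2[OF V(2)]) (auto intro!: continuous_intros)
  have V': "pot V'" unfolding pot_def using V(1) borel_measurable_continuous_onI[OF Vc] by (auto simp: pot_def V'_def)
  have Wu: "W V' u" and nu: "\<not> null u" using u(1) by (auto simp: Neh_def)
  note [measurable] = W_measurable[OF Wu] potD(1)[OF V(1)]
  have vm [measurable]: "v \<in> borel_measurable borel" unfolding v_def by measurable
  have Wv: "W V v" using Wu W_affine[OF c V(1) vm, of z0] by (simp add: va V'_def)
  have N: "\<epsilon> ^ DIM('a) > 0" using c by simp
  \<comment> \<open>Needed as an equivalence: the minimiser has to be put into the original Nehari
    set, and every other element of that set has to be pulled back for comparison.\<close>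
  have neh: "w \<in> nehari_P s V f \<epsilon> \<longleftrightarrow> W V w \<and> Neh V' (\<lambda>x. w (?a x))" for w
  proof (cases "W V w")
    case True
    have "W V' (\<lambda>x. w (?a x))" unfolding V'_def using W_affine[OF c V(1) W_measurable[OF True]] True by simp
    then show ?thesis
      unfolding nehari_P_def mem_Collect_eq Wsp_W[OF V(1)] Neh_def G_def V'_def energy_terms_affine[OF c V(1) True, of z0]
      using True N c by auto
  qed (simp add: nehari_P_def Wsp_W[OF V(1)])
  have en: "energy_P s V f \<epsilon> w = \<epsilon> ^ DIM('a) * J (\<lambda>x. w (?a x))" if "w \<in> nehari_P s V f \<epsilon>" for w
  proof -
    have w: "W V w" "Neh V' (\<lambda>x. w (?a x))" using that neh by auto
    have "energy_P s V f \<epsilon> w = (\<epsilon> powr (2 * s) * frac_sq s w + (LINT z|lborel. V z * (w z)^2)) / 2 - (LINT z|lborel. F (w z))"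
      by (simp add: energy_P_def add_divide_distrib)
    also have "\<dots> = \<epsilon> ^ DIM('a) * (Q V' (\<lambda>x. w (?a x)) / 2 - (LINT x|lborel. F (w (?a x))))"
      unfolding V'_def energy_terms_affine[OF c V(1) w(1), of z0] by (simp add: right_diff_distrib)
    finally show ?thesis unfolding Nehari_energy[OF w(2)] .
  qed
  have vN: "v \<in> nehari_P s V f \<epsilon>" unfolding neh using Wv u(1) by (simp add: va)
  have crit: "Bf V' u w = (LINT x|lborel. f (u x) * w x)" if "W V' w" for w
    by (rule critical_point[OF V' u(1,2) _ that]) (rule u(3))
  have "AE x in lborel. 0 < u x"
    by (rule solution_positive[OF V' Vc Wu u(2) nu]) (use crit in auto)
  then have "AE x in lborel. 0 < v (?a x)" by (simp add: va)
  \<comment> \<open>Affine maps preserve null sets, here the set where \<open>v\<close> fails to be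
    positive.\<close>
  then have pos: "AE z in lborel. 0 < v z" using AE_affine[OF c, of "{z. \<not> 0 < v z}" z0] by simp
  have weak: "\<epsilon> powr (2 * s) * frac_form s v w + (LINT z|lborel. V z * v z * w z) = (LINT z|lborel. f (v z) * w z)"
    if w: "w \<in> Wsp s V" for w
  proof -
    have Ww: "W V w" using w by (simp add: Wsp_W[OF V(1)])
    note [measurable] = W_measurable[OF Ww]
    have Ww': "W V' (\<lambda>x. w (?a x))" using Ww W_affine[OF c V(1) W_measurable[OF Ww], of z0] by (simp add: V'_def)
    have "(LINT z|lborel. V z * v z * w z) = \<epsilon> ^ DIM('a) * (LINT x|lborel. V (?a x) * v (?a x) * w (?a x))"
      by (rule integral_affine[OF c]) measurable
    moreover have "(LINT z|lborel. f (v z) * w z) = \<epsilon> ^ DIM('a) * (LINT x|lborel. f (v (?a x)) * w (?a x))"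
      by (rule integral_affine[OF c]) measurable
    ultimately show ?thesis
      using crit[OF Ww'] frac_form_affine[OF c W_H[OF Wv] W_H[OF Ww], of z0]
      by (simp add: Bf_def va pot_sqrt[OF V(1)] V'_def distrib_left[symmetric])
  qed
  have "energy_P s V f \<epsilon> v \<le> energy_P s V f \<epsilon> w" if w: "w \<in> nehari_P s V f \<epsilon>" for w
    unfolding en[OF w] en[OF vN] using u(3)[of "\<lambda>x. w (?a x)"] w N by (intro mult_left_mono) (auto simp: neh va)
  then show ?thesis
    unfolding ground_state_P_def is_solution_P_def using Wv pos weak vN unfolding v_def[symmetric] by (simp add: Wsp_W[OF V(1)])
qed

end

theorem theorem1p1:
  fixes s :: real and V :: "'a::euclidean_space \<Rightarrow> real" and f :: "real \<Rightarrow> real"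
  assumes s: "0 < s" "s < 1"
    and N: "real DIM('a) > 2 * s"
    and V_cont: "continuous_on UNIV V"
    and V_min: "\<exists>z0. (\<forall>z. V z0 \<le> V z) \<and> 0 < V z0 \<and>
                  ereal (V z0) < Liminf at_infinity (\<lambda>z. ereal (V z))"
    and f1: "\<forall>u. f differentiable (at u)" "continuous_on UNIV (deriv f)"
            "\<forall>u \<le> 0. f u = 0"
    and f2: "(deriv f \<longlongrightarrow> 0) (at 0)"
    and f3: "\<exists>q. 2 < q \<and> q < 2 * real DIM('a) / (real DIM('a) - 2 * s) - 1 \<and>
              ((\<lambda>u. deriv f u / u powr (q - 1)) \<longlongrightarrow> 0) at_top"
    and f4: "\<exists>\<theta>>2. \<forall>u>0. 0 < \<theta> * prim f u \<and> \<theta> * prim f u \<le> u * f u"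
    and f5: "strict_mono_on {0<..} (\<lambda>u. f u / u)"
  shows "(Liminf at_infinity (\<lambda>z. ereal (V z)) = \<infinity> \<longrightarrow>
            (\<forall>\<epsilon>>0. \<exists>u. ground_state_P s V f \<epsilon> u))
       \<and> (Liminf at_infinity (\<lambda>z. ereal (V z)) < \<infinity> \<longrightarrow>
            (\<exists>\<epsilon>0>0. \<forall>\<epsilon>. 0 < \<epsilon> \<and> \<epsilon> \<le> \<epsilon>0 \<longrightarrow> (\<exists>u. ground_state_P s V f \<epsilon> u)))"
proof -
  obtain z0 where z0: "\<And>z. V z0 \<le> V z" "0 < V z0" "ereal (V z0) < Liminf at_infinity (\<lambda>z. ereal (V z))"
    using V_min by blast
  obtain q where q: "2 < q" "q < 2 * real DIM('a) / (real DIM('a) - 2 * s) - 1" "((\<lambda>u. deriv f u / u powr (q - 1)) \<longlongrightarrow> 0) at_top"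
    using f3 by blast
  obtain \<theta> where \<theta>: "\<theta> > 2" "\<And>u. u > 0 \<Longrightarrow> 0 < \<theta> * prim f u \<and> \<theta> * prim f u \<le> u * f u" using f4 by blast
  \<comment> \<open>With \<open>p = q + 1\<close>, the bound on \<open>q\<close> says that
    \<open>p\<close> lies below the critical exponent; the form without division is the one used in
    the Sobolev estimates.\<close>
  have qN: "(q + 1) * (real DIM('a) - 2 * s) < 2 * real DIM('a)"
    using q(2) N by (simp add: less_divide_eq algebra_simps)
  interpret var s "TYPE('a)" f "q + 1" \<theta>
    by unfold_locales (use s N f1 f2 f5 q \<theta> qN in auto)
  have V: "pot V" unfolding pot_def using z0(1,2) borel_measurable_continuous_onI[OF V_cont] by blast
  have far: "\<exists>R. \<forall>z. norm z \<ge> R \<longrightarrow> A \<le> V z" if "ereal A < Liminf at_infinity (\<lambda>z. ereal (V z))" for A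
    using less_LiminfD[OF that] by (auto simp: eventually_at_infinity intro: less_imp_le)
  show ?thesis
  proof (intro conjI impI allI)
    fix \<epsilon> :: real
    assume L: "Liminf at_infinity (\<lambda>z. ereal (V z)) = \<infinity>" and \<epsilon>: "\<epsilon> > 0"
    \<comment> \<open>Coercivity is preserved by every rescaling, so here the blow-up may be centred
      at the origin.\<close>
    define V' where "V' = (\<lambda>x. V (0 + \<epsilon> *\<^sub>R x))"
    have Vc: "continuous_on UNIV V'" unfolding V'_def
      by (rule continuous_on_compose2[OF V_cont]) (auto intro!: continuous_intros)
    have V': "pot V'" unfolding pot_def using V borel_measurable_continuous_onI[OF Vc] by (auto simp: pot_def V'_def)
    have "\<exists>R. \<forall>z. norm z \<ge> R \<longrightarrow> A \<le> V' z" for A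
    proof -
      obtain R where R: "\<And>z. norm z \<ge> R \<Longrightarrow> A \<le> V z" using far[of A] L by auto
      have "A \<le> V' z" if "norm z \<ge> R / \<epsilon>" for z
        unfolding V'_def by (rule R) (use that \<epsilon> in \<open>simp add: divide_le_eq mult.commute\<close>)
      then show ?thesis by blast
    qed
    then obtain u where "Neh V' u" "\<And>x. 0 \<le> u x" "\<And>w. Neh V' w \<Longrightarrow> J u \<le> J w"
      using ground_state_coercive[OF V' Vc] by blast
    then show "\<exists>u. ground_state_P s V f \<epsilon> u"
      using ground_state_rescale[OF \<epsilon> V V_cont, of 0 u] unfolding V'_def by blast
  next
    \<comment> \<open>A real number strictly between the minimum and the limit inferior:
      \<open>V\<close> stays above it far out, and the interval down to \<open>V z0\<close> holds
      the chain of constants for the comparison of levels.\<close>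
    obtain A where A: "V z0 < A" "ereal A < Liminf at_infinity (\<lambda>z. ereal (V z))"
      using ereal_dense2[OF z0(3)] by auto
    obtain R where R: "\<And>z. norm z \<ge> R \<Longrightarrow> A \<le> V z" using far[OF A(2)] by blast
    obtain \<epsilon>0 where \<epsilon>0: "\<epsilon>0 > 0" "\<And>\<epsilon>. 0 < \<epsilon> \<Longrightarrow> \<epsilon> \<le> \<epsilon>0 \<Longrightarrow> \<exists>u. Neh (\<lambda>x. V (z0 + \<epsilon> *\<^sub>R x)) u \<and> (\<forall>x. 0 \<le> u x) \<and> (\<forall>w. Neh (\<lambda>x. V (z0 + \<epsilon> *\<^sub>R x)) w \<longrightarrow> J u \<le> J w)"
      using ground_state_semiclassical[OF V V_cont A(1) R] by blast
    have "\<exists>u. ground_state_P s V f \<epsilon> u" if "0 < \<epsilon>" "\<epsilon> \<le> \<epsilon>0" for \<epsilon>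
      using \<epsilon>0(2)[OF that] ground_state_rescale[OF that(1) V V_cont, of z0] by blast
    then show "\<exists>\<epsilon>0>0. \<forall>\<epsilon>. 0 < \<epsilon> \<and> \<epsilon> \<le> \<epsilon>0 \<longrightarrow> (\<exists>u. ground_state_P s V f \<epsilon> u)" using \<epsilon>0(1) by blast
  qed
qed

end
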